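(* Let $\underline{n} = (n_1,\dots,n_d)$ be a $d$-tuple of positive integers and $\underline{u} = (u_1,\dots,u_d) \in (\overline{K}[t])^d$ with $\|u_i\|_\infty < |\theta|_\infty^{n_i q/(q-1)}$ for each $i$. If $\tilde{\pi}, L_{u_1,n_1}(\theta),\dots,L_{u_d,n_d}(\theta)$ are algebraically independent over $\overline{K}$, then $$\operatorname{tr.deg}_{\overline{K}} \overline{K}\big(\tilde{\pi}, L_{\underline{u}_{ij},\underline{n}_{ij}}(\theta) \;\big|\; (i,j) \in I_d\big) = 1 + \# I_d = 1 + \frac{d(d+1)}{2}.$$
   Context: Let $\mathbb{F}_q$ be the finite field with $q$ elements, $K = \mathbb{F}_q(\theta)$, $K_\infty = \mathbb{F}_q((\theta^{-1}))$ with absolute value $|\cdot|_\infty$ ($|\theta|_\infty>1$), $\mathbb{C}_\infty$ the completion of an algebraic closure of $K_\infty$, $\overline{K}$ the algebraic closure of $K$ in $\mathbb{C}_\infty$, and $t$ a variable independent of $\theta$. Fixing a $(q-1)$-st root of $-\theta$, $\tilde{\pi} = (-\theta)^{q/(q-1)} \prod_{i=1}^\infty (1-\theta^{1-q^i})^{-1}$. For $u = \sum_j \alpha_j t^j \in \overline{K}[t]$, $\|u\|_\infty = \max_j |\alpha_j|_\infty$ and $u^{(i)} = \sum_j \alpha_j^{q^i} t^j$. For positive integers $m_1,\dots,m_s$ and $v_1,\dots,v_s \in \overline{K}[t]$ with $\|v_k\|_\infty < |\theta|_\infty^{m_k q/(q-1)}$, set $$L_{(v_1,\dots,v_s),(m_1,\dots,m_s)}(t)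 = \sum_{i_1 > \cdots > i_s \geq 0} \frac{v_1^{(i_1)}\cdots v_s^{(i_s)}}{P_{i_1}(t)^{m_1}\cdots P_{i_s}(t)^{m_s}},\quad P_0=1,\ P_i(t) = (t-\theta^q)(t-\theta^{q^2})\cdots(t-\theta^{q^i}),$$ which converges on $|t|_\infty < |\theta|_\infty^q$; $L_{\cdot,\cdot}(\theta)$ is its value at $t = \theta$. For $s=1$ write $L_{v,m}$. Let $I_d = \{(i,j) \in \mathbb{Z}^2 \mid 1 \leq j < i \leq d+1\}$ and, for $(i,j) \in I_d$, $\underline{n}_{ij} = (n_j, n_{j+1},\dots,n_{i-1})$ and $\underline{u}_{ij} = (u_j,u_{j+1},\dots,u_{i-1})$. *)

theory Defs
  imports "HOL-Computational_Algebra.Polynomial" "HOL-Library.Poly_Mapping"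
begin

definition conv_abs :: "('a::field \<Rightarrow> real) \<Rightarrow> (nat \<Rightarrow> 'a) \<Rightarrow> 'a \<Rightarrow> bool" where
  "conv_abs absv s L \<longleftrightarrow> (\<forall>e>0. \<exists>N. \<forall>n\<ge>N. absv (s n - L) < e)"

definition cauchy_abs :: "('a::field \<Rightarrow> real) \<Rightarrow> (nat \<Rightarrow> 'a) \<Rightarrow> bool" where
  "cauchy_abs absv s \<longleftrightarrow> (\<forall>e>0. \<exists>N. \<forall>m\<ge>N. \<forall>n\<ge>N. absv (s m - s n) < e)"

definition lim_abs :: "('a::field \<Rightarrow> real) \<Rightarrow> (nat \<Rightarrow> 'a) \<Rightarrow> 'a" where
  "lim_abs absv s = (THE L. conv_abs absv s L)"

definition complete_alg_closed_nonarch :: "('a::field \<Rightarrow> real) \<Rightarrow> bool" where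
  "complete_alg_closed_nonarch absv \<longleftrightarrow>
     (\<forall>x. absv x \<ge> 0) \<and> (\<forall>x. absv x = 0 \<longleftrightarrow> x = 0) \<and>
     (\<forall>x y. absv (x * y) = absv x * absv y) \<and>
     (\<forall>x y. absv (x + y) \<le> max (absv x) (absv y)) \<and>
     (\<forall>s. cauchy_abs absv s \<longrightarrow> (\<exists>L. conv_abs absv s L)) \<and>
     (\<forall>p::'a poly. degree p \<ge> 1 \<longrightarrow> (\<exists>x. poly p x = 0))"

definition Fq :: "nat \<Rightarrow> 'a::field set" where
  "Fq q = {x. x ^ q = x}"

definition Kfield :: "nat \<Rightarrow> 'a::field \<Rightarrow> 'a set" where
  "Kfield q \<theta> = {poly f \<theta> / poly g \<theta> | f g. (\<forall>i. coeff f i \<in> Fq q) \<and> (\<forall>i. coeff g i \<in> Fq q)}"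

definition Kbar :: "nat \<Rightarrow> 'a::field \<Rightarrow> 'a set" where
  "Kbar q \<theta> = {x. \<exists>p. p \<noteq> 0 \<and> (\<forall>i. coeff p i \<in> Kfield q \<theta>) \<and> poly p x = 0}"

text \<open>lam is a fixed (q-1)-st root of -theta; pitilde = lam^q * prod_{i>=1} (1 - theta^(1-q^i))^(-1).\<close>
definition pitilde :: "('a::field \<Rightarrow> real) \<Rightarrow> nat \<Rightarrow> 'a \<Rightarrow> 'a \<Rightarrow> 'a" where
  "pitilde absv q \<theta> lam =
     lam ^ q * lim_abs absv (\<lambda>N. \<Prod>i\<in>{1..N}. inverse (1 - inverse (\<theta> ^ (q ^ i - 1))))"

definition twist :: "nat \<Rightarrow> nat \<Rightarrow> 'a::field poly \<Rightarrow> 'a poly" where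
  "twist q i u = map_poly (\<lambda>a. a ^ (q ^ i)) u"

definition Pq :: "nat \<Rightarrow> 'a::field \<Rightarrow> nat \<Rightarrow> 'a \<Rightarrow> 'a" where
  "Pq q \<theta> i t = (\<Prod>k\<in>{1..i}. (t - \<theta> ^ (q ^ k)))"

definition norm_poly :: "('a::field \<Rightarrow> real) \<Rightarrow> 'a poly \<Rightarrow> real" where
  "norm_poly absv u = Max (insert 0 (absv ` set (coeffs u)))"

text \<open>Partial sums over N > i_1 > i_2 > ... > i_s >= 0, for the list of pairs (v_k, m_k).\<close>
fun Lpsum :: "nat \<Rightarrow> 'a::field \<Rightarrow> ('a poly \<times> nat) list \<Rightarrow> 'a \<Rightarrow> nat \<Rightarrow> 'a" where
  "Lpsum q \<theta> [] t N = 1"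
| "Lpsum q \<theta> ((v, m) # rest) t N =
     (\<Sum>i<N. poly (twist q i v) t / (Pq q \<theta> i t) ^ m * Lpsum q \<theta> rest t i)"

definition Lval :: "('a::field \<Rightarrow> real) \<Rightarrow> nat \<Rightarrow> 'a \<Rightarrow> 'a poly list \<Rightarrow> nat list \<Rightarrow> 'a \<Rightarrow> 'a" where
  "Lval absv q \<theta> vs ms t = lim_abs absv (\<lambda>N. Lpsum q \<theta> (zip vs ms) t N)"

definition mpeval :: "('i \<Rightarrow> 'a::field) \<Rightarrow> (('i \<Rightarrow>\<^sub>0 nat) \<Rightarrow>\<^sub>0 'a) \<Rightarrow> 'a" where
  "mpeval x c = (\<Sum>mon\<in>Poly_Mapping.keys c. Poly_Mapping.lookup c mon *
                   (\<Prod>i\<in>Poly_Mapping.keys mon. x i ^ Poly_Mapping.lookup mon i))"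

definition alg_indep :: "'a::field set \<Rightarrow> 'i set \<Rightarrow> ('i \<Rightarrow> 'a) \<Rightarrow> bool" where
  "alg_indep F I x \<longleftrightarrow>
     (\<forall>c. (\<forall>mon. Poly_Mapping.lookup c mon \<in> F) \<and> (\<forall>mon\<in>Poly_Mapping.keys c. Poly_Mapping.keys mon \<subseteq> I) \<and> mpeval x c = 0 \<longrightarrow> c = 0)"

definition is_subfield :: "'a::field set \<Rightarrow> bool" where
  "is_subfield E \<longleftrightarrow> 0 \<in> E \<and> 1 \<in> E \<and> (\<forall>x\<in>E. \<forall>y\<in>E. x + y \<in> E \<and> x * y \<in> E) \<and>
     (\<forall>x\<in>E. - x \<in> E \<and> inverse x \<in> E)"

definition gen_field :: "'a::field set \<Rightarrow> 'a set \<Rightarrow> 'a set" where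
  "gen_field F S = \<Inter>{E. is_subfield E \<and> F \<subseteq> E \<and> S \<subseteq> E}"

definition trdeg :: "'a::field set \<Rightarrow> 'a set \<Rightarrow> nat" where
  "trdeg F E = Sup {card T | T. finite T \<and> T \<subseteq> E \<and> alg_indep F T id}"

definition Iset :: "nat \<Rightarrow> (nat \<times> nat) set" where
  "Iset d = {(i, j). 1 \<le> j \<and> j < i \<and> i \<le> d + 1}"

text \<open>1-indexed sub-tuple (x_j, ..., x_{i-1}).\<close>
definition subtuple :: "'b list \<Rightarrow> nat \<Rightarrow> nat \<Rightarrow> 'b list" where
  "subtuple xs i j = take (i - j) (drop (j - 1) xs)"

end

theory Submission
  imports Defs "HOL-Computational_Algebra.Computational_Algebra"
begin

text \<open>
  Let \<open>\<sigma>\<close> raise the coefficients of a power series to the \<open>q\<close>-th power. The series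
  \<open>\<Omega> = lam^{-q} \<Prod> (1 - t/\<theta>^{q^i})\<close> satisfies \<open>\<Omega> = (t - \<theta>^q) \<sigma>\<Omega>\<close> and \<open>\<Omega>(\<theta>) = 1/\<pi>\<close>, and the
  products \<open>X_{ij} = \<Omega>^{n_j + ... + n_{i-1}} L_{ij}(t)\<close> form a lower unitriangular solution of
  \<open>X_{ij} = \<sigma>X_{ij} + u_{i-1} \<Omega>^{n_{i-1}} \<sigma>X_{i-1,j}\<close>.

  Independence of the values at \<open>\<theta>\<close> in depth one gives independence of the functions \<open>\<Omega>\<close>, \<open>L_{i+1,i}\<close>
  over the rational functions: clear powers of \<open>t - \<theta>\<close> from a relation and specialize. Independence of
  all functions follows by difference algebra, adjoining the entries of \<open>X\<close> column by column. If a new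
  entry were algebraic, then some \<open>p\<close>-polynomial in it, with constant coefficients, would lie in the
  field \<open>M\<close> generated so far; applying to this relation two automorphisms of \<open>M\<close> (adding multiples of
  one column of \<open>X\<close> to another) that commute on \<open>M\<close>, although their commutator moves the new entry,
  forces all coefficients to vanish.

  Finally, the criterion of Anderson, Brownawell and Papanikolas turns independence of the functions
  into independence of their values at \<open>\<theta>\<close>. A linear relation between the values allows one to
  construct (Siegel) a combination \<open>E\<close> of the functions with coefficients of bounded size and many
  zeros \<open>\<theta>^{q^{-v}}\<close>. By the Schwarz lemma its lowest coefficient is tiny, while \<open>E\<close> satisfies a
  \<open>\<sigma>\<close>-difference equation with polynomial coefficients, so that this coefficient is a nonzero root of
  an additive polynomial of bounded height and cannot be tiny (Liouville).
\<close>

text \<open>Twisting by \<open>q\<close>-th powers keeps every map on coefficients a power map; the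
  price is that the value at \<theta> of a \<open>v\<close>-th twist is the \<open>q^v\<close>-th
  power of a value at the \<open>q^v\<close>-th root of \<theta>, which explains the zeros in the
  last step. In characteristic \<open>p\<close> algebraicity of a solution of an additive equation
  yields only a \<open>p\<close>-polynomial relation, not a linear one, so the descent has to treat
  all \<open>p^e\<close>-th powers at once; the commutator does this. The criterion itself concerns
  linear relations. It gives algebraic independence because twisting does not raise the total degree
  in the series \<open>L\<close>, so monomials of bounded degree form a finite system of difference
  equations. The coefficients of \<open>E\<close> are \<open>q^(2N)\<close>-th roots of lattice
  elements of height proportional to \<open>q^(2N)\<close>. Taking the root removes this factor, so
  the lower bound does not depend on \<open>N\<close>, while the bound from the zeros tends to 0.
  The additive polynomial exists because \<open>card J + 1\<close> twists of \<open>E\<close> are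
  combinations of only \<open>card J\<close> series.\<close>

section \<open>Linear algebra over subrings and subfields of an ambient ring\<close>

definition is_subring :: "'a::comm_ring_1 set \<Rightarrow> bool" where
  "is_subring R \<longleftrightarrow> 0 \<in> R \<and> 1 \<in> R \<and> (\<forall>x\<in>R. \<forall>y\<in>R. x + y \<in> R \<and> x * y \<in> R) \<and> (\<forall>x\<in>R. - x \<in> R)"

lemma subringD:
  assumes "is_subring R"
  shows "0 \<in> R" "1 \<in> R" "x \<in> R \<Longrightarrow> y \<in> R \<Longrightarrow> x + y \<in> R" "x \<in> R \<Longrightarrow> y \<in> R \<Longrightarrow> x * y \<in> R"
    "x \<in> R \<Longrightarrow> - x \<in> R" "x \<in> R \<Longrightarrow> y \<in> R \<Longrightarrow> x - y \<in> R"
proof -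
  show "0 \<in> R" "1 \<in> R" "x \<in> R \<Longrightarrow> y \<in> R \<Longrightarrow> x + y \<in> R" "x \<in> R \<Longrightarrow> y \<in> R \<Longrightarrow> x * y \<in> R"
    "x \<in> R \<Longrightarrow> - x \<in> R" using assms unfolding is_subring_def by auto
  show "x - y \<in> R" if "x \<in> R" "y \<in> R"
    using assms that unfolding is_subring_def by (metis add_uminus_conv_diff)
qed

lemma subfield_subring: "is_subfield F \<Longrightarrow> is_subring F"
  unfolding is_subfield_def is_subring_def by auto

lemma subring_sum:
  assumes "is_subring R" "\<And>i. i \<in> A \<Longrightarrow> f i \<in> R" shows "sum f A \<in> R"
  using assms(2) by (induction A rule: infinite_finite_induct) (auto intro: subringD[OF assms(1)])

lemma subring_prod:
  assumes "is_subring R" "\<And>i. i \<in> A \<Longrightarrow> f i \<in> R" shows "prod f A \<in> R"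
  using assms(2) by (induction A rule: infinite_finite_induct) (auto intro: subringD[OF assms(1)])

lemma subring_power:
  assumes "is_subring R" "x \<in> R" shows "x ^ n \<in> R"
  using assms(2) by (induction n) (auto intro: subringD[OF assms(1)])

lemma subfieldD:
  assumes "is_subfield F"
  shows "0 \<in> F" "1 \<in> F" "x \<in> F \<Longrightarrow> y \<in> F \<Longrightarrow> x + y \<in> F" "x \<in> F \<Longrightarrow> y \<in> F \<Longrightarrow> x * y \<in> F"
    "x \<in> F \<Longrightarrow> - x \<in> F" "x \<in> F \<Longrightarrow> y \<in> F \<Longrightarrow> x - y \<in> F" "x \<in> F \<Longrightarrow> inverse x \<in> F"
    "x \<in> F \<Longrightarrow> y \<in> F \<Longrightarrow> x / y \<in> F" "x \<in> F \<Longrightarrow> x ^ n \<in> F"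
proof -
  note S = subringD[OF subfield_subring[OF assms]]
  show "0 \<in> F" "1 \<in> F" "x \<in> F \<Longrightarrow> y \<in> F \<Longrightarrow> x + y \<in> F" "x \<in> F \<Longrightarrow> y \<in> F \<Longrightarrow> x * y \<in> F"
    "x \<in> F \<Longrightarrow> - x \<in> F" "x \<in> F \<Longrightarrow> y \<in> F \<Longrightarrow> x - y \<in> F" using S by auto
  show i: "x \<in> F \<Longrightarrow> inverse x \<in> F" for x using assms unfolding is_subfield_def by auto
  show "x \<in> F \<Longrightarrow> y \<in> F \<Longrightarrow> x / y \<in> F" using i S by (simp add: divide_inverse)
  show "x \<in> F \<Longrightarrow> x ^ n \<in> F" using subring_power[OF subfield_subring[OF assms]] by auto
qed

lemmas subfield_sum = subring_sum[OF subfield_subring]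

text \<open>Gaussian elimination on the rows: a row with a nonzero entry at \<open>c0\<close>
  expresses that unknown through the others and is subtracted from the remaining rows. The point is
  that the solution stays inside the subset \<open>F\<close> of the ambient field.\<close>

lemma homogeneous_system:
  fixes F :: "'a::field set"
  assumes F: "is_subfield F" and "finite R" and "finite C" and "card R < card C"
    and "\<And>r c. r \<in> R \<Longrightarrow> c \<in> C \<Longrightarrow> A r c \<in> F"
  shows "\<exists>x. (\<forall>c\<in>C. x c \<in> F) \<and> (\<exists>c\<in>C. x c \<noteq> 0) \<and> (\<forall>r\<in>R. (\<Sum>c\<in>C. A r c * x c) = 0)"
  using assms(2-)
proof (induction R arbitrary: C A rule: finite_induct)
  case empty
  then have "C \<noteq> {}" by force
  then show ?case by (intro exI[of _ "\<lambda>_. 1"]) (auto simp: subfieldD[OF F])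
next
  case (insert r R)
  show ?case
  proof (cases "\<forall>c\<in>C. A r c = 0")
    case True
    obtain x where "\<forall>c\<in>C. x c \<in> F" "\<exists>c\<in>C. x c \<noteq> 0" "\<forall>r\<in>R. (\<Sum>c\<in>C. A r c * x c) = 0"
      using insert.IH[of C A] insert.prems insert.hyps by auto
    with True show ?thesis by (intro exI[of _ x]) auto
  next
    case False
    then obtain c0 where c0: "c0 \<in> C" "A r c0 \<noteq> 0" by auto
    define C' where "C' = C - {c0}"
    define A' where "A' r' c = A r' c - A r' c0 * A r c / A r c0" for r' c
    have C': "finite C'" "card R < card C'" "C = insert c0 C'" "c0 \<notin> C'"
      using insert.prems insert.hyps c0 by (auto simp: C'_def)
    have "A' r' c \<in> F" if "r' \<in> R" "c \<in> C'" for r' c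
      using that insert.prems(3) c0 unfolding A'_def C'_def
      by (intro subfieldD[OF F]) auto
    then obtain x where x: "\<forall>c\<in>C'. x c \<in> F" "\<exists>c\<in>C'. x c \<noteq> 0"
      "\<forall>r\<in>R. (\<Sum>c\<in>C'. A' r c * x c) = 0"
      using insert.IH[of C' A'] C' by auto
    \<comment> \<open>Row \<open>r\<close> is solved for the eliminated unknown.\<close>
    define x0 where "x0 = - (\<Sum>c\<in>C'. A r c * x c) / A r c0"
    define y where "y = x(c0 := x0)"
    have yC': "(\<Sum>c\<in>C'. B c * y c) = (\<Sum>c\<in>C'. B c * x c)" for B
      using C'(4) by (intro sum.cong) (auto simp: y_def)
    have "x0 \<in> F" unfolding x0_def using insert.prems(3) c0 x(1) C'(3)
      by (intro subfieldD[OF F] subfield_sum[OF F]) auto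
    have r: "(\<Sum>c\<in>C. A r c * y c) = 0"
      unfolding C'(3) using C'(1,4) yC' c0 by (simp add: y_def x0_def)
    have "(\<Sum>c\<in>C. A r' c * y c) = 0" if "r' \<in> R" for r'
    proof -
      have "0 = (\<Sum>c\<in>C'. A' r' c * x c)" using x(3) that by auto
      also have "\<dots> = (\<Sum>c\<in>C'. A r' c * x c - A r' c0 / A r c0 * (A r c * x c))"
        by (intro sum.cong) (auto simp: A'_def algebra_simps)
      also have "\<dots> = (\<Sum>c\<in>C'. A r' c * x c) + A r' c0 * x0"
        by (simp add: sum_subtractf sum_distrib_left x0_def sum_divide_distrib)
      also have "\<dots> = (\<Sum>c\<in>C. A r' c * y c)"
        unfolding C'(3) using C'(1,4) yC' by (simp add: y_def)
      finally show ?thesis by simp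
    qed
    moreover have "\<forall>c\<in>C. y c \<in> F" using x(1) \<open>x0 \<in> F\<close> C'(3) by (auto simp: y_def)
    moreover have "\<exists>c\<in>C. y c \<noteq> 0" using x(2) C'(3,4) by (auto simp: y_def)
    ultimately show ?thesis using r by (intro exI[of _ y]) auto
  qed
qed

text \<open>Sums are built one term at a time, so a closure property of the span has to be checked
  only for sums and single terms (\<open>rspan_closed\<close>), without index sets or coefficient
  families; \<open>rspan_repr\<close> recovers coordinates when they are wanted.\<close>

inductive_set rspan :: "'a::comm_ring_1 set \<Rightarrow> 'a set \<Rightarrow> 'a set" for R M where
  zero: "0 \<in> rspan R M"
| add: "c \<in> R \<Longrightarrow> m \<in> M \<Longrightarrow> z \<in> rspan R M \<Longrightarrow> c * m + z \<in> rspan R M"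

lemma rspan_add: "x \<in> rspan R M \<Longrightarrow> y \<in> rspan R M \<Longrightarrow> x + y \<in> rspan R M"
  by (induction rule: rspan.induct) (auto simp: add.assoc intro: rspan.add)

lemma rspan_sum: "(\<And>i. i \<in> A \<Longrightarrow> f i \<in> rspan R M) \<Longrightarrow> sum f A \<in> rspan R M"
  by (induction A rule: infinite_finite_induct) (auto intro: rspan_add rspan.zero)

lemma rspan_scale:
  assumes "\<And>x y. x \<in> R \<Longrightarrow> y \<in> R \<Longrightarrow> x * y \<in> R" "z \<in> rspan R M" "c \<in> R"
  shows "c * z \<in> rspan R M"
  using assms(2)
proof (induction rule: rspan.induct)
  case (add d m z)
  have "c * (d * m + z) = (c * d) * m + c * z" by (simp add: algebra_simps)
  with add assms show ?case by (auto intro: rspan.add)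
qed (auto intro: rspan.zero)

lemma rspan_scaled_gen: "c \<in> R \<Longrightarrow> m \<in> M \<Longrightarrow> c * m \<in> rspan R M"
  using rspan.add[OF _ _ rspan.zero] by force

lemma rspan_gen: "1 \<in> R \<Longrightarrow> m \<in> M \<Longrightarrow> m \<in> rspan R M"
  using rspan_scaled_gen[of 1] by force

lemma rspan_mono: "z \<in> rspan R M \<Longrightarrow> M \<subseteq> M' \<Longrightarrow> z \<in> rspan R M'"
  by (induction rule: rspan.induct) (auto intro: rspan.intros)

lemma rspan_closed:
  assumes "z \<in> rspan R M" "0 \<in> E" "\<And>x y. x \<in> E \<Longrightarrow> y \<in> E \<Longrightarrow> x + y \<in> E"
    "\<And>c m. c \<in> R \<Longrightarrow> m \<in> M \<Longrightarrow> c * m \<in> E"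
  shows "z \<in> E"
  using assms(1) by (induction rule: rspan.induct) (auto intro: assms)

lemma rspan_trans:
  assumes "\<And>x y. x \<in> R \<Longrightarrow> y \<in> R \<Longrightarrow> x * y \<in> R" "z \<in> rspan R M" "M \<subseteq> rspan R M'"
  shows "z \<in> rspan R M'"
  using assms(2)
  by (rule rspan_closed) (use assms in \<open>auto intro: rspan.zero rspan_add rspan_scale\<close>)

lemma rspan_mult:
  assumes R: "\<And>x y. x \<in> R \<Longrightarrow> y \<in> R \<Longrightarrow> x * y \<in> R"
    and M: "\<And>m m'. m \<in> M \<Longrightarrow> m' \<in> M' \<Longrightarrow> m * m' \<in> rspan R M''"
    and "x \<in> rspan R M" "y \<in> rspan R M'"
  shows "x * y \<in> rspan R M''"
  using assms(3)
proof (rule rspan_closed[where E = "{z. z * y \<in> rspan R M''}", simplified])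
  fix c m assume cm: "c \<in> R" "m \<in> M"
  show "c * m * y \<in> rspan R M''"
  proof -
    have "m * y \<in> rspan R M''" using assms(4)
    proof (rule rspan_closed[where E = "{z. m * z \<in> rspan R M''}", simplified])
      fix c m' assume "c \<in> R" "m' \<in> M'"
      then show "m * (c * m') \<in> rspan R M''"
        using rspan_scale[OF R M[OF cm(2), of m'], of c] by (simp add: mult.left_commute)
    qed (auto simp: distrib_left intro: rspan.zero rspan_add)
    from rspan_scale[OF R this, of c] cm show "c * m * y \<in> rspan R M''" by (simp add: mult.assoc)
  qed
qed (use rspan.zero rspan_add in \<open>auto simp: distrib_right\<close>)

lemma rspan_repr:
  assumes R: "is_subring R" and J: "finite J" and z: "z \<in> rspan R (y ` J)"
  shows "\<exists>c. (\<forall>j\<in>J. c j \<in> R) \<and> z = (\<Sum>j\<in>J. c j * y j)"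
  using z
proof (induction rule: rspan.induct)
  case zero
  then show ?case by (intro exI[of _ "\<lambda>_. 0"]) (auto simp: subringD[OF R])
next
  case (add c m z)
  then obtain d j where d: "\<forall>j\<in>J. d j \<in> R" "z = (\<Sum>j\<in>J. d j * y j)" "j \<in> J" "m = y j" by auto
  have "(\<Sum>i\<in>J. (d(j := d j + c)) i * y i) = (\<Sum>i\<in>J. (if i = j then c * y j else 0) + d i * y i)"
    by (intro sum.cong) (auto simp: algebra_simps)
  also have "\<dots> = c * m + z" using d J by (simp add: sum.distrib)
  finally show ?case using d add by (intro exI[of _ "d(j := d j + c)"]) (auto intro: subringD[OF R])
qed

lemma rspan_sumI:
  assumes "\<And>j. j \<in> J \<Longrightarrow> c j \<in> R" shows "(\<Sum>j\<in>J. c j * y j) \<in> rspan R (y ` J)"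
  by (intro rspan_sum rspan_scaled_gen) (use assms in auto)

lemma lin_dep:
  fixes F :: "'a::field set"
  assumes F: "is_subfield F" and "finite B" "finite C" "card B < card C"
    and v: "\<And>c. c \<in> C \<Longrightarrow> v c \<in> rspan F B"
  shows "\<exists>x. (\<forall>c\<in>C. x c \<in> F) \<and> (\<exists>c\<in>C. x c \<noteq> 0) \<and> (\<Sum>c\<in>C. x c * v c) = 0"
proof -
  have "\<forall>c\<in>C. \<exists>a. (\<forall>b\<in>B. a b \<in> F) \<and> v c = (\<Sum>b\<in>B. a b * b)"
    using rspan_repr[OF subfield_subring[OF F] assms(2), of _ "\<lambda>x. x"] v by simp
  then obtain a where a: "\<And>c b. c \<in> C \<Longrightarrow> b \<in> B \<Longrightarrow> a c b \<in> F"
    "\<And>c. c \<in> C \<Longrightarrow> v c = (\<Sum>b\<in>B. a c b * b)" by metis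
  obtain x where x: "\<forall>c\<in>C. x c \<in> F" "\<exists>c\<in>C. x c \<noteq> 0" "\<forall>b\<in>B. (\<Sum>c\<in>C. a c b * x c) = 0"
    using homogeneous_system[OF F assms(2-4), of "\<lambda>b c. a c b"] a(1) by auto
  have "(\<Sum>c\<in>C. x c * v c) = (\<Sum>c\<in>C. \<Sum>b\<in>B. (a c b * x c) * b)"
    by (intro sum.cong refl) (simp add: a(2) sum_distrib_left mult_ac)
  also have "\<dots> = (\<Sum>b\<in>B. (\<Sum>c\<in>C. a c b * x c) * b)"
    by (subst sum.swap) (simp add: sum_distrib_right)
  also have "\<dots> = 0" using x(3) by simp
  finally show ?thesis using x by auto
qed

subsection \<open>Algebraic elements\<close>

definition alg_over :: "'a::field set \<Rightarrow> 'a \<Rightarrow> bool" where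
  "alg_over F x \<longleftrightarrow> (\<exists>p. p \<noteq> 0 \<and> (\<forall>i. coeff p i \<in> F) \<and> poly p x = 0)"

text \<open>All powers of \<open>z\<close> stay in a space spanned by \<open>card B\<close>
  elements, so the first \<open>card B + 1\<close> of them are linearly dependent. This counting
  replaces the characteristic polynomial of multiplication by \<open>z\<close>.\<close>

lemma alg_over_stable:
  fixes F :: "'a::field set"
  assumes F: "is_subfield F" and B: "finite B" "1 \<in> rspan F B"
    and z: "\<And>b. b \<in> B \<Longrightarrow> z * b \<in> rspan F B"
  shows "alg_over F z"
proof -
  have pw: "z ^ n \<in> rspan F B" for n
  proof (induction n)
    case (Suc n)
    have "z * z ^ n \<in> rspan F B"
      using Suc
    proof (rule rspan_closed[where E = "{w. z * w \<in> rspan F B}", simplified])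
      fix c m assume "c \<in> F" "m \<in> B"
      then show "z * (c * m) \<in> rspan F B"
        using rspan_scale[OF subfieldD(4)[OF F] z[of m], of c] by (simp add: mult.left_commute)
    qed (auto simp: distrib_left intro: rspan.zero rspan_add)
    then show ?case by simp
  qed (use B in simp)
  obtain x where x: "\<forall>i\<in>{..card B}. x i \<in> F" "\<exists>i\<in>{..card B}. x i \<noteq> 0"
    "(\<Sum>i\<in>{..card B}. x i * z ^ i) = 0"
    using lin_dep[OF F B(1), of "{..card B}" "\<lambda>i. z ^ i"] pw by auto
  define p where "p = (\<Sum>i\<le>card B. monom (x i) i)"
  have cp: "coeff p i = (if i \<le> card B then x i else 0)" for i
    unfolding p_def by (simp add: coeff_sum if_distrib cong: if_cong)
  have "p \<noteq> 0" using x(2) cp by (metis atMost_iff coeff_0)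
  moreover have "coeff p i \<in> F" for i using x(1) cp subfieldD[OF F] by auto
  moreover have "poly p z = 0" using x(3) by (simp add: p_def poly_sum poly_monom)
  ultimately show ?thesis unfolding alg_over_def by blast
qed

lemma alg_over_power_span:
  fixes F :: "'a::field set"
  assumes F: "is_subfield F" and "alg_over F z"
  shows "\<exists>n>0. \<forall>m. z ^ m \<in> rspan F ((\<lambda>i. z ^ i) ` {..<n})"
proof -
  obtain p where p: "p \<noteq> 0" "\<forall>i. coeff p i \<in> F" "poly p z = 0"
    using assms unfolding alg_over_def by auto
  define n where "n = degree p"
  define B where "B = (\<lambda>i. z ^ i) ` {..<n}"
  have n: "n > 0" using p unfolding n_def
    by (metis degree_eq_zeroE gr0I mult_zero_right pCons_eq_0_iff poly_0 poly_pCons add.right_neutral)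
  have l: "coeff p n \<noteq> 0" using p by (simp add: n_def)
  have "0 = (\<Sum>i\<le>n. coeff p i * z ^ i)" using p(3) by (simp add: poly_altdef n_def)
  also have "\<dots> = (\<Sum>i<n. coeff p i * z ^ i) + coeff p n * z ^ n"
    by (simp add: lessThan_Suc_atMost[symmetric])
  finally have "z ^ n = (\<Sum>i<n. (- coeff p i / coeff p n) * z ^ i)"
    using l by (simp add: field_simps sum_negf sum_divide_distrib[symmetric] eq_neg_iff_add_eq_0)
  also have "\<dots> \<in> rspan F B" unfolding B_def
    by (intro rspan_sumI) (use p in \<open>auto intro: subfieldD[OF F]\<close>)
  finally have zn: "z ^ n \<in> rspan F B" .
  have st: "z * w \<in> rspan F B" if "w \<in> rspan F B" for w
    using that
  proof (rule rspan_closed[where E = "{w. z * w \<in> rspan F B}", simplified])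
    fix c m assume c: "c \<in> F" "m \<in> B"
    then obtain i where i: "i < n" "m = z ^ i" by (auto simp: B_def)
    have "z * m \<in> rspan F B"
    proof (cases "Suc i = n")
      case True then show ?thesis using zn i by auto
    next
      case False then show ?thesis using i subfieldD(2)[OF F]
        by (intro rspan_gen) (auto simp: B_def intro!: image_eqI[of _ _ "Suc i"])
    qed
    then show "z * (c * m) \<in> rspan F B"
      using rspan_scale[OF subfieldD(4)[OF F] _ c(1)] by (simp add: mult.left_commute)
  qed (auto simp: distrib_left intro: rspan.zero rspan_add)
  have "z ^ m \<in> rspan F B" for m
  proof (induction m)
    case 0
    show ?case using n subfieldD(2)[OF F] by (intro rspan_gen) (auto simp: B_def intro!: image_eqI[of _ _ 0])
  qed (use st in auto)
  then show ?thesis using n B_def by blast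
qed

text \<open>Multiplying the generators by the powers of one more algebraic element preserves closure
  under products. The result is a finite-dimensional algebra containing all of \<open>Z\<close>; it
  serves both for the field structure of the algebraic elements and for the lattices below.\<close>

lemma finite_ext:
  fixes F :: "'a::field set"
  assumes F: "is_subfield F" and "finite Z" "\<And>z. z \<in> Z \<Longrightarrow> alg_over F z"
  shows "\<exists>B. finite B \<and> 1 \<in> rspan F B \<and> Z \<subseteq> rspan F B \<and> (\<forall>b\<in>B. \<forall>b'\<in>B. b * b' \<in> rspan F B)"
  using assms(2-)
proof (induction Z rule: finite_induct)
  case empty
  show ?case using rspan_gen[OF subfieldD(2)[OF F], of 1 "{1}"] by (intro exI[of _ "{1}"]) auto
next
  case (insert z Z)
  then obtain B where B: "finite B" "1 \<in> rspan F B" "Z \<subseteq> rspan F B"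
    "\<forall>b\<in>B. \<forall>b'\<in>B. b * b' \<in> rspan F B" by auto
  obtain n where n: "n > 0" "\<And>m. z ^ m \<in> rspan F ((\<lambda>i. z ^ i) ` {..<n})"
    using alg_over_power_span[OF F, of z] insert by auto
  define P where "P = (\<lambda>i. z ^ i) ` {..<n}"
  define B' where "B' = (\<lambda>(b, w). b * w) ` (B \<times> P)"
  note nn = n(2)[folded P_def]
  have R: "\<And>x y. x \<in> F \<Longrightarrow> y \<in> F \<Longrightarrow> x * y \<in> F" using subfieldD[OF F] by auto
  have mul: "x * y \<in> rspan F B'" if "x \<in> rspan F B" "y \<in> rspan F P" for x y
    using R _ that by (rule rspan_mult) (auto simp: B'_def intro!: rspan_gen subfieldD[OF F])
  have 1: "1 \<in> rspan F P" using nn[of 0] by simp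
  show ?case
  proof (intro exI[of _ B'] conjI ballI)
    show "finite B'" using B by (simp add: B'_def P_def)
    show "1 \<in> rspan F B'" using mul[OF B(2) 1] by simp
    show "insert z Z \<subseteq> rspan F B'" using mul[OF B(2) nn[of 1]] mul[OF _ 1] B(3) by auto
    fix b b' assume "b \<in> B'" "b' \<in> B'"
    then obtain x y i j where "b = x * z ^ i" "b' = y * z ^ j" "x \<in> B" "y \<in> B"
      by (auto simp: B'_def P_def)
    then show "b * b' \<in> rspan F B'" using mul[of "x * y" "z ^ (i + j)"] nn[of "i + j"] B(4)
      by (auto simp: power_add mult_ac)
  qed
qed

text \<open>A spanning subset of least cardinality works: a nontrivial relation would make one of
  its members redundant.\<close>

lemma rspan_independent:
  fixes F :: "'a::field set"
  assumes F: "is_subfield F" and "finite B"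
  shows "\<exists>B'. finite B' \<and> rspan F B' = rspan F B \<and> B' \<subseteq> B \<and>
    (\<forall>c. (\<forall>b\<in>B'. c b \<in> F) \<and> (\<Sum>b\<in>B'. c b * b) = 0 \<longrightarrow> (\<forall>b\<in>B'. c b = 0))"
proof -
  define P where "P n \<longleftrightarrow> (\<exists>B'. B' \<subseteq> B \<and> card B' = n \<and> rspan F B' = rspan F B)" for n
  have "P (card B)" unfolding P_def by auto
  define n where "n = (LEAST n. P n)"
  obtain B' where B': "B' \<subseteq> B" "card B' = n" "rspan F B' = rspan F B"
    using LeastI[of P, OF \<open>P (card B)\<close>, folded n_def] unfolding P_def by blast
  have fB': "finite B'" using B' assms finite_subset by auto
  have "\<forall>b\<in>B'. c b = 0" if c: "\<forall>b\<in>B'. c b \<in> F" "(\<Sum>b\<in>B'. c b * b) = 0" for c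
  proof (rule ccontr)
    assume "\<not> ?thesis"
    then obtain b0 where b0: "b0 \<in> B'" "c b0 \<noteq> 0" by auto
    define B'' where "B'' = B' - {b0}"
    have "0 = c b0 * b0 + (\<Sum>b\<in>B''. c b * b)"
      using c(2) fB' b0 unfolding B''_def by (simp add: sum.remove)
    then have "c b0 * b0 = - (\<Sum>b\<in>B''. c b * b)" by (metis eq_neg_iff_add_eq_0)
    then have "b0 = - (\<Sum>b\<in>B''. c b * b) / c b0" using b0 by (metis nonzero_mult_div_cancel_left)
    then have "b0 = (\<Sum>b\<in>B''. (- c b / c b0) * b)"
      by (simp add: sum_divide_distrib sum_negf)
    also have "\<dots> \<in> rspan F ((\<lambda>x. x) ` B'')"
      by (intro rspan_sumI) (use c b0 in \<open>auto simp: B''_def intro: subfieldD[OF F]\<close>)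
    finally have "b0 \<in> rspan F B''" by simp
    then have "B' \<subseteq> rspan F B''" using rspan_gen[OF subfieldD(2)[OF F], of _ B'']
      unfolding B''_def by blast
    then have "rspan F B'' = rspan F B'"
      using rspan_trans[OF subfieldD(4)[OF F]] rspan_mono[of _ F B'' B'] by (auto simp: B''_def)
    then have "P (card B'')" unfolding P_def using B' by (intro exI[of _ B'']) (auto simp: B''_def)
    then have "n \<le> card B''" unfolding n_def by (rule Least_le)
    moreover have "card B'' < card B'" unfolding B''_def using fB' b0 by (intro card_Diff1_less) auto
    ultimately show False using B' by simp
  qed
  then show ?thesis using fB' B' by blast
qed

lemma subfield_alg_over:
  fixes F :: "'a::field set"
  assumes F: "is_subfield F" shows "is_subfield {x. alg_over F x}"
proof -
  have FF: "alg_over F x" if "x \<in> F" for x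
    unfolding alg_over_def using that subfieldD[OF F]
    by (intro exI[of _ "[:-x, 1:]"]) (auto simp: coeff_pCons split: nat.splits)
  have 2: "alg_over F (x + y) \<and> alg_over F (x * y)" if xy: "alg_over F x" "alg_over F y" for x y
  proof -
    obtain B where B: "finite B" "1 \<in> rspan F B" "{x, y} \<subseteq> rspan F B"
      "\<forall>b\<in>B. \<forall>b'\<in>B. b * b' \<in> rspan F B" using finite_ext[OF F, of "{x, y}"] xy by auto
    have R: "\<And>x y. x \<in> F \<Longrightarrow> y \<in> F \<Longrightarrow> x * y \<in> F" using subfieldD[OF F] by auto
    have m: "u * v \<in> rspan F B" if "u \<in> rspan F B" "v \<in> rspan F B" for u v
      using R _ that by (rule rspan_mult) (use B in auto)
    have "alg_over F z" if "z \<in> rspan F B" for z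
      using F B(1,2) by (rule alg_over_stable) (use m that rspan_gen[OF subfieldD(2)[OF F]] in auto)
    moreover have "x + y \<in> rspan F B" "x * y \<in> rspan F B" using B m rspan_add by auto
    ultimately show ?thesis by auto
  qed
  have inv: "alg_over F (inverse x)" if ax: "alg_over F x" for x
  proof (cases "x = 0")
    case True then show ?thesis using FF subfieldD[OF F] by auto
  next
    case False
    obtain p where p: "p \<noteq> 0" "\<forall>i. coeff p i \<in> F" "poly p x = 0"
      using ax unfolding alg_over_def by auto
    \<comment> \<open>Reversing the coefficients of a polynomial inverts its nonzero roots.\<close>
    have "poly (reflect_poly p) (inverse x) = 0"
      using False p poly_reflect_poly_nz[of "inverse x" p] by simp
    then show ?thesis unfolding alg_over_def using p subfieldD[OF F]
      by (intro exI[of _ "reflect_poly p"]) (auto simp: coeff_reflect_poly)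
  qed
  have m1: "- 1 \<in> F" using subfieldD[OF F] by auto
  have "alg_over F (- x)" if "alg_over F x" for x
    using 2[OF FF[OF m1] that] by simp
  with 2 inv FF subfieldD[OF F] show ?thesis unfolding is_subfield_def by auto
qed

subsection \<open>Generated subfields\<close>

lemma gen_field_subfield: "is_subfield (gen_field F S)"
  unfolding gen_field_def is_subfield_def by blast

lemma gen_field_base: "F \<subseteq> gen_field F S" and gen_field_gens: "S \<subseteq> gen_field F S"
  unfolding gen_field_def by auto

lemma gen_field_least: "is_subfield E \<Longrightarrow> F \<subseteq> E \<Longrightarrow> S \<subseteq> E \<Longrightarrow> gen_field F S \<subseteq> E"
  unfolding gen_field_def by auto

lemma gen_field_mono: "S \<subseteq> S' \<Longrightarrow> gen_field F S \<subseteq> gen_field F S'"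
  using gen_field_least[OF gen_field_subfield gen_field_base] gen_field_gens by blast

lemma quotients_subfield:
  assumes "is_subring P"
  shows "is_subfield {a / b | a b. a \<in> P \<and> b \<in> P \<and> b \<noteq> (0::'a::field)}"
    (is "is_subfield ?Q")
proof -
  note P = subringD[OF assms]
  have QI: "a / b \<in> ?Q" if "a \<in> P" "b \<in> P" "b \<noteq> 0" for a b using that by blast
  have 1: "x + y \<in> ?Q \<and> x * y \<in> ?Q" if xy: "x \<in> ?Q" "y \<in> ?Q" for x y
  proof -
    from xy obtain a b c d where d: "x = a / b" "y = c / d" "a \<in> P" "b \<in> P" "c \<in> P" "d \<in> P"
      "b \<noteq> 0" "d \<noteq> 0" by blast
    then have "x + y = (a * d + c * b) / (b * d)" "x * y = (a * c) / (b * d)"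
      by (auto simp: field_simps)
    moreover have "(a * d + c * b) / (b * d) \<in> ?Q" "(a * c) / (b * d) \<in> ?Q"
      by (rule QI; use d P in simp)+
    ultimately show ?thesis by auto
  qed
  have 2: "- x \<in> ?Q \<and> inverse x \<in> ?Q" if x: "x \<in> ?Q" for x
  proof -
    from x obtain a b where d: "x = a / b" "a \<in> P" "b \<in> P" "b \<noteq> 0" by blast
    then have n: "- x = (- a) / b" by simp
    have "- x \<in> ?Q" unfolding n using d by (intro QI P)
    moreover have "inverse x \<in> ?Q"
    proof (cases "a = 0")
      case True
      then show ?thesis using d QI[of 0 1] P by auto
    next
      case False
      then have "inverse x = b / a" using d by simp
      then show ?thesis using False d QI by auto
    qed
    ultimately show ?thesis ..
  qed
  have 3: "0 \<in> ?Q" "1 \<in> ?Q" using QI[of 0 1] QI[of 1 1] P by auto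
  show ?thesis unfolding is_subfield_def
    by (intro conjI ballI; rule 3 1[THEN conjunct1] 1[THEN conjunct2] 2[THEN conjunct1] 2[THEN conjunct2]; assumption)
qed

lemma gen_field_quotients:
  assumes "is_subring P" "F \<subseteq> P" "S \<subseteq> P"
  shows "gen_field F S \<subseteq> {a / b | a b. a \<in> P \<and> b \<in> P \<and> b \<noteq> 0}"
proof (rule gen_field_least[OF quotients_subfield[OF assms(1)]])
  have "x \<in> {a / b | a b. a \<in> P \<and> b \<in> P \<and> b \<noteq> 0}" if "x \<in> P" for x
    using that subringD(2)[OF assms(1)] by (intro CollectI exI[of _ x] exI[of _ 1]) simp
  then show "F \<subseteq> {a / b | a b. a \<in> P \<and> b \<in> P \<and> b \<noteq> 0}"
    "S \<subseteq> {a / b | a b. a \<in> P \<and> b \<in> P \<and> b \<noteq> 0}" using assms by auto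
qed

definition transc :: "'a::field set \<Rightarrow> 'a \<Rightarrow> bool" where
  "transc M z \<longleftrightarrow> (\<forall>p. (\<forall>k. coeff p k \<in> M) \<and> poly p z = 0 \<longrightarrow> p = 0)"

lemma transc_scale:
  assumes F: "is_subfield M" and t: "transc M (c * z)" and c: "c \<in> M" "c \<noteq> 0"
  shows "transc M z"
  unfolding transc_def
proof (intro allI impI, elim conjE)
  fix p assume p: "\<forall>k. coeff p k \<in> M" "poly p z = 0"
  define r where "r = pcompose p [:0, inverse c:]"
  have cr: "coeff r k = coeff p k * inverse c ^ k" for k
    unfolding r_def by (simp add: coeff_pcompose_linear)
  have cz: "c * z * inverse c = z" using c by simp
  have "poly r (c * z) = poly p (c * z * inverse c)" unfolding r_def poly_pcompose by simp
  then have "poly r (c * z) = 0" unfolding cz using p(2) by simp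
  then have "r = 0" using t cr p(1) subfieldD[OF F] c unfolding transc_def by auto
  then have "coeff p k = 0" for k using cr[of k] c by simp
  then show "p = 0" by (simp add: poly_eq_iff)
qed

lemma not_transc_alg: "\<not> transc M z \<Longrightarrow> alg_over M z"
  unfolding transc_def alg_over_def by blast

subsection \<open>Independence of monomials\<close>

definition monval :: "'i set \<Rightarrow> ('i \<Rightarrow> 'a::comm_ring_1) \<Rightarrow> ('i \<Rightarrow> nat) \<Rightarrow> 'a" where
  "monval I x m = (\<Prod>i\<in>I. x i ^ m i)"

text \<open>A variant of \<open>alg_indep\<close> whose exponent vectors are plain functions. It
  makes sense over rings, hence also for power series with polynomial coefficients; exponents vanish
  outside \<open>I\<close> so that different vectors stand for different monomials.\<close>

definition mindep :: "'a::comm_ring_1 set \<Rightarrow> 'i set \<Rightarrow> ('i \<Rightarrow> 'a) \<Rightarrow> bool" where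
  "mindep F I x \<longleftrightarrow> (\<forall>S a. finite S \<and> (\<forall>m\<in>S. a m \<in> F \<and> (\<forall>i. i \<notin> I \<longrightarrow> m i = 0)) \<and>
     (\<Sum>m\<in>S. a m * monval I x m) = 0 \<longrightarrow> (\<forall>m\<in>S. a m = 0))"

lemma mindepD:
  assumes "mindep F I x" "finite S" "\<And>m. m \<in> S \<Longrightarrow> a m \<in> F"
    "\<And>m i. m \<in> S \<Longrightarrow> i \<notin> I \<Longrightarrow> m i = 0" "(\<Sum>m\<in>S. a m * monval I x m) = 0" "m \<in> S"
  shows "a m = 0"
  using assms unfolding mindep_def by blast

lemma monval_mult: "monval I x m * monval I x m' = monval I x (\<lambda>i. m i + m' i)"
  by (simp add: monval_def power_add prod.distrib)

lemma monval_insert: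
  "finite I \<Longrightarrow> i \<notin> I \<Longrightarrow> monval (insert i I) x m = x i ^ m i * monval I x m"
  by (simp add: monval_def)

lemma monval_cong: "(\<And>i. i \<in> I \<Longrightarrow> m i = m' i) \<Longrightarrow> monval I x m = monval I x m'"
  by (simp add: monval_def)

lemma alg_indep_iff_mindep:
  assumes I: "finite I" and F: "0 \<in> F"
  shows "alg_indep F I x \<longleftrightarrow> mindep F I x"
proof -
  have monokey: "(\<Prod>i\<in>Poly_Mapping.keys mon. x i ^ Poly_Mapping.lookup mon i)
      = monval I x (Poly_Mapping.lookup mon)" if "Poly_Mapping.keys mon \<subseteq> I" for mon
    unfolding monval_def using I that
    by (intro prod.mono_neutral_left) (auto simp: in_keys_iff)
  show ?thesis
  proof
    assume ai: "alg_indep F I x"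
    show "mindep F I x" unfolding mindep_def
    proof (intro allI impI, elim conjE)
      fix S :: "('a \<Rightarrow> nat) set" and a
      assume S: "finite S" "\<forall>m\<in>S. a m \<in> F \<and> (\<forall>i. i \<notin> I \<longrightarrow> m i = 0)"
        "(\<Sum>m\<in>S. a m * monval I x m) = 0"
      define c where "c = Poly_Mapping.Abs_poly_mapping
        (\<lambda>mon. if Poly_Mapping.lookup mon \<in> S then a (Poly_Mapping.lookup mon) else 0)"
      have inj: "inj_on Poly_Mapping.lookup A" for A :: "('a \<Rightarrow>\<^sub>0 nat) set"
        by (rule inj_onI) (simp add: poly_mapping_eqI)
      have "finite {mon::'a \<Rightarrow>\<^sub>0 nat. Poly_Mapping.lookup mon \<in> S}"
        using finite_vimage_IntI[OF S(1), of Poly_Mapping.lookup UNIV] inj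
        by (simp add: vimage_def)
      then have lc: "Poly_Mapping.lookup c mon =
          (if Poly_Mapping.lookup mon \<in> S then a (Poly_Mapping.lookup mon) else 0)" for mon
        unfolding c_def by (subst lookup_Abs_poly_mapping) (auto elim: finite_subset[rotated])
      have keys: "Poly_Mapping.keys c =
          {mon. Poly_Mapping.lookup mon \<in> S \<and> a (Poly_Mapping.lookup mon) \<noteq> 0}"
        by (auto simp: in_keys_iff lc split: if_splits)
      have ki: "Poly_Mapping.keys mon \<subseteq> I" if "Poly_Mapping.lookup mon \<in> S" for mon
        using S(2) that by (auto simp: in_keys_iff)
      have ex: "\<exists>mon. Poly_Mapping.lookup mon = m" if "m \<in> S" for m
      proof -
        have "\<forall>i. i \<notin> I \<longrightarrow> m i = 0" using S(2) that by simp
        then have "{i. m i \<noteq> 0} \<subseteq> I" by auto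
        then have "finite {i. m i \<noteq> 0}" using I finite_subset by blast
        then show ?thesis using lookup_Abs_poly_mapping by blast
      qed
      have "mpeval x c = (\<Sum>mon\<in>Poly_Mapping.keys c. a (Poly_Mapping.lookup mon) * monval I x (Poly_Mapping.lookup mon))"
        unfolding mpeval_def by (intro sum.cong refl) (auto simp: keys lc monokey ki)
      also have "\<dots> = (\<Sum>m\<in>Poly_Mapping.lookup ` Poly_Mapping.keys c. a m * monval I x m)"
        by (simp add: sum.reindex[OF inj])
      also have "\<dots> = (\<Sum>m\<in>S. a m * monval I x m)"
        using S(1) ex by (intro sum.mono_neutral_left) (auto simp: keys image_iff)
      finally have "mpeval x c = 0" using S(3) by simp
      then have "c = 0" using ai S(2) F ki unfolding alg_indep_def by (auto simp: lc keys)
      then show "\<forall>m\<in>S. a m = 0" using ex lc by (metis lookup_zero)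
    qed
  next
    assume mi: "mindep F I x"
    show "alg_indep F I x" unfolding alg_indep_def
    proof (intro allI impI, elim conjE)
      fix c :: "('a \<Rightarrow>\<^sub>0 nat) \<Rightarrow>\<^sub>0 'b"
      assume c: "\<forall>mon. Poly_Mapping.lookup c mon \<in> F"
        "\<forall>mon\<in>Poly_Mapping.keys c. Poly_Mapping.keys mon \<subseteq> I" "mpeval x c = 0"
      have inj: "inj_on Poly_Mapping.lookup (Poly_Mapping.keys c)"
        by (rule inj_onI) (simp add: poly_mapping_eqI)
      define a where "a m = Poly_Mapping.lookup c (Poly_Mapping.Abs_poly_mapping m)" for m
      have al: "a (Poly_Mapping.lookup mon) = Poly_Mapping.lookup c mon" for mon
        by (simp add: a_def)
      have "a m = 0" if "m \<in> Poly_Mapping.lookup ` Poly_Mapping.keys c" for m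
      proof (rule mindepD[OF mi])
        show "(\<Sum>m\<in>Poly_Mapping.lookup ` Poly_Mapping.keys c. a m * monval I x m) = 0"
          using c(3) c(2) unfolding mpeval_def
          by (simp add: sum.reindex[OF inj] al monokey)
        show "\<And>m. m \<in> Poly_Mapping.lookup ` Poly_Mapping.keys c \<Longrightarrow> a m \<in> F"
          using c(1) by (auto simp: al)
        show "m i = 0" if "m \<in> Poly_Mapping.lookup ` Poly_Mapping.keys c" "i \<notin> I" for m i
          using c(2) that by (metis imageE in_keys_iff subsetD)
      qed (use that in auto)
      then have "Poly_Mapping.keys c = {}" using al by (metis equals0I imageI in_keys_iff)
      then show "c = 0" by simp
    qed
  qed
qed

lemma mindep_inj:
  assumes F: "is_subring F" and I: "finite I" and mi: "mindep F I x" and nt: "(1::'a::idom) \<noteq> 0"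
  shows "inj_on (x :: 'i \<Rightarrow> 'a) I"
proof (rule inj_onI, rule ccontr)
  fix i j assume ij: "i \<in> I" "j \<in> I" "x i = x j" "i \<noteq> j"
  define e :: "'i \<Rightarrow> 'i \<Rightarrow> nat" where "e k l = (if l = k then 1 else 0)" for k l
  have me: "monval I x (e k) = x k" if "k \<in> I" for k
  proof -
    have "monval I x (e k) = (\<Prod>l\<in>I. if l = k then x l else 1)"
      unfolding monval_def by (intro prod.cong) (auto simp: e_def)
    then show ?thesis using that I by simp
  qed
  have ne: "e i \<noteq> e j" using ij(4) by (auto simp: e_def fun_eq_iff split: if_splits)
  have s0: "(\<Sum>m\<in>{e i, e j}. (if m = e i then 1 else - 1) * monval I x m) = 0"
    using ne ij by (simp add: me)
  have "(if e i = e i then 1 else - 1 :: 'a) = 0"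
  proof (rule mindepD[OF mi _ _ _ s0])
    show "(if m = e i then 1 else - 1) \<in> F" for m using subringD(1,2,5)[OF F] by simp
    show "m l = 0" if "m \<in> {e i, e j}" "l \<notin> I" for m l using that ij by (auto simp: e_def)
  qed auto
  then show False by simp
qed

lemma mindep_image:
  fixes x :: "'i \<Rightarrow> 'a::comm_ring_1"
  assumes I: "finite I" and mi: "mindep F I x" and inj: "inj_on x I"
  shows "mindep F (x ` I) id"
  unfolding mindep_def
proof (intro allI impI, elim conjE)
  fix S :: "('a \<Rightarrow> nat) set" and a
  assume S: "finite S" "\<forall>m\<in>S. a m \<in> F \<and> (\<forall>i. i \<notin> x ` I \<longrightarrow> m i = 0)"
    "(\<Sum>m\<in>S. a m * monval (x ` I) id m) = 0"
  define g where "g m = (\<lambda>i. if i \<in> I then m (x i) else 0)" for m :: "'a \<Rightarrow> nat"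
  have gi: "inj_on g S"
  proof (rule inj_onI, rule ext)
    fix m m' y assume m: "m \<in> S" "m' \<in> S" "g m = g m'"
    show "m y = m' y"
    proof (cases "y \<in> x ` I")
      case True
      then obtain i where "i \<in> I" "y = x i" by auto
      then show ?thesis using fun_cong[OF m(3), of i] by (simp add: g_def)
    next
      case False
      then show ?thesis using S(2) m(1,2) by metis
    qed
  qed
  have gm: "monval I x (g m) = monval (x ` I) id m" for m
    unfolding monval_def by (simp add: prod.reindex[OF inj] g_def)
  define b where "b m = a (inv_into S g m)" for m
  have bg: "b (g m) = a m" if "m \<in> S" for m using gi that by (simp add: b_def)
  have s: "(\<Sum>m\<in>g ` S. b m * monval I x m) = 0"
    using S(3) by (simp add: sum.reindex[OF gi] bg gm)
  have "b (g m) = 0" if "m \<in> S" for m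
  proof (rule mindepD[OF mi _ _ _ s])
    show "\<And>m. m \<in> g ` S \<Longrightarrow> b m \<in> F" using S(2) bg by auto
    show "\<And>m i. m \<in> g ` S \<Longrightarrow> i \<notin> I \<Longrightarrow> m i = 0" by (auto simp: g_def)
  qed (use S(1) that in auto)
  then show "\<forall>m\<in>S. a m = 0" using bg by auto
qed

lemma mindep_empty: "mindep F {} x"
  unfolding mindep_def
proof (intro allI impI, elim conjE)
  fix S :: "('b \<Rightarrow> nat) set" and a :: "('b \<Rightarrow> nat) \<Rightarrow> 'a"
  assume S: "\<forall>m\<in>S. a m \<in> F \<and> (\<forall>i. i \<notin> {} \<longrightarrow> m i = 0)" "(\<Sum>m\<in>S. a m * monval {} x m) = 0"
  then have "S \<subseteq> {\<lambda>_. 0}" by (auto simp: fun_eq_iff)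
  then consider "S = {}" | "S = {\<lambda>_. 0}" by blast
  then show "\<forall>m\<in>S. a m = 0" by cases (use S(2) in \<open>auto simp: monval_def\<close>)
qed

text \<open>Grouping a relation by the exponent of \<open>x i\<close> gives a polynomial in
  \<open>x i\<close> with coefficients in \<open>M\<close>. Transcendence kills each coefficient,
  and each coefficient is a relation among the old elements. \<open>M\<close> may be larger than the
  field they generate.\<close>

lemma mindep_insert:
  assumes M: "is_subring M" and FM: "F \<subseteq> M" "x ` I \<subseteq> M"
    and I: "finite I" "i \<notin> I" and mi: "mindep F I x" and t: "transc M (x i)"
  shows "mindep F (insert i I) (x :: 'i \<Rightarrow> 'a::field)"
  unfolding mindep_def
proof (intro allI impI, elim conjE)
  fix S :: "('i \<Rightarrow> nat) set" and a
  assume S: "finite S" "\<forall>m\<in>S. a m \<in> F \<and> (\<forall>j. j \<notin> insert i I \<longrightarrow> m j = 0)"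
    "(\<Sum>m\<in>S. a m * monval (insert i I) x m) = 0"
  define p where "p = (\<Sum>m\<in>S. monom (a m * monval I x m) (m i))"
  have cp: "coeff p k = (\<Sum>m\<in>{m\<in>S. m i = k}. a m * monval I x m)" for k
    unfolding p_def using S(1) by (simp add: coeff_sum sum.If_cases Int_def)
  have "poly p (x i) = (\<Sum>m\<in>S. a m * monval (insert i I) x m)"
    unfolding p_def using I by (auto simp: poly_sum poly_monom monval_insert intro!: sum.cong)
  moreover have "coeff p k \<in> M" for k
    unfolding cp monval_def
    by (intro subring_sum[OF M] subringD(4)[OF M] subring_prod[OF M] subring_power[OF M])
      (use S(2) FM in auto)
  ultimately have "p = 0" using t S(3) unfolding transc_def by auto
  then have c0: "(\<Sum>m\<in>{m\<in>S. m i = k}. a m * monval I x m) = 0" for k using cp by simp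
  show "\<forall>m\<in>S. a m = 0"
  proof
    fix m0 assume m0: "m0 \<in> S"
    define Sk where "Sk = {m\<in>S. m i = m0 i}"
    have inj: "inj_on (\<lambda>m. m(i := 0)) Sk"
    proof (rule inj_onI, rule ext)
      fix m m' y assume m: "m \<in> Sk" "m' \<in> Sk" "m(i := 0) = m'(i := 0)"
      show "m y = m' y" using fun_cong[OF m(3), of y] m(1,2) by (cases "y = i") (auto simp: Sk_def)
    qed
    define b where "b m = a (m(i := m0 i))" for m
    have b: "b (m(i := 0)) = a m" if "m \<in> Sk" for m
      using that by (simp add: b_def Sk_def) (metis fun_upd_triv)
    have mm: "monval I x (m(i := 0)) = monval I x m" for m using I(2) by (intro monval_cong) auto
    have s0: "(\<Sum>m\<in>(\<lambda>m. m(i := 0)) ` Sk. b m * monval I x m) = 0"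
      using c0[of "m0 i"] by (simp add: sum.reindex[OF inj] b mm Sk_def[symmetric])
    have "b (m0(i := 0)) = 0"
    proof (rule mindepD[OF mi _ _ _ s0])
      show "\<And>m. m \<in> (\<lambda>m. m(i := 0)) ` Sk \<Longrightarrow> b m \<in> F" using S(2) b by (auto simp: Sk_def)
      show "\<And>m j. m \<in> (\<lambda>m. m(i := 0)) ` Sk \<Longrightarrow> j \<notin> I \<Longrightarrow> m j = 0" using S(2) by (auto simp: Sk_def)
    qed (use S(1) m0 in \<open>auto simp: Sk_def\<close>)
    then show "a m0 = 0" using b m0 by (simp add: Sk_def)
  qed
qed

lemma monval_span_subring:
  assumes R: "is_subring R"
  shows "is_subring (rspan R (range (monval I x)))"
proof -
  note RR = subringD[OF R]
  have 1: "monval I x (\<lambda>_. 0) = 1" by (simp add: monval_def)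
  have "u * v \<in> rspan R (range (monval I x))"
    if "u \<in> rspan R (range (monval I x))" "v \<in> rspan R (range (monval I x))" for u v
    using RR(4) _ that by (rule rspan_mult) (auto simp: monval_mult intro!: rspan_gen RR(2))
  moreover have "- u \<in> rspan R (range (monval I x))" if "u \<in> rspan R (range (monval I x))" for u
    using rspan_scale[OF RR(4) that, of "-1"] RR by auto
  moreover have "1 \<in> rspan R (range (monval I x))"
    by (rule rspan_gen[OF RR(2)]) (metis 1 rangeI)
  ultimately show ?thesis unfolding is_subring_def
    by (auto intro: rspan.zero rspan_add)
qed

lemma monval_span_repr:
  assumes R: "is_subring R" and z: "z \<in> rspan R (range (monval I x))"
  shows "\<exists>S a. finite S \<and> (\<forall>m\<in>S. a m \<in> R \<and> (\<forall>i. i \<notin> I \<longrightarrow> m i = 0)) \<and>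
    z = (\<Sum>m\<in>S. a m * monval I x m)"
  using z
proof (induction rule: rspan.induct)
  case zero
  show ?case by (rule exI[of _ "{}"]) auto
next
  case (add c m z)
  then obtain S a m0 where S: "finite S" "\<forall>m\<in>S. a m \<in> R \<and> (\<forall>i. i \<notin> I \<longrightarrow> m i = 0)"
    "z = (\<Sum>m\<in>S. a m * monval I x m)" "m = monval I x m0" by blast
  define m1 where "m1 i = (if i \<in> I then m0 i else 0)" for i
  have m1: "m = monval I x m1" unfolding S(4) by (intro monval_cong) (auto simp: m1_def)
  define a' where "a' m = (if m \<in> S then a m else 0) + (if m = m1 then c else 0)" for m
  have "(\<Sum>m\<in>insert m1 S. a' m * monval I x m) =
    (\<Sum>m\<in>insert m1 S. (if m \<in> S then a m else 0) * monval I x m) +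
    (\<Sum>m\<in>insert m1 S. (if m = m1 then c else 0) * monval I x m)"
    by (simp add: a'_def distrib_right sum.distrib)
  also have "(\<Sum>m\<in>insert m1 S. (if m \<in> S then a m else 0) * monval I x m) = (\<Sum>m\<in>S. a m * monval I x m)"
    using S(1) by (intro sum.mono_neutral_cong_right) auto
  also have "(\<Sum>m\<in>insert m1 S. (if m = m1 then c else 0) * monval I x m) =
      (\<Sum>m\<in>{m1}. (if m = m1 then c else 0) * monval I x m)"
    using S(1) by (intro sum.mono_neutral_right) auto
  finally have "c * m + z = (\<Sum>m\<in>insert m1 S. a' m * monval I x m)" using S(3) m1 by simp
  then show ?case using S add subringD[OF R]
    by (intro exI[of _ "insert m1 S"] exI[of _ a']) (auto simp: a'_def m1_def)
qed

lemma monval_single: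
  assumes "finite I" "i \<in> I"
  shows "monval I x (\<lambda>j. if j = i then 1 else 0) = x i"
proof -
  have "monval I x (\<lambda>j. if j = i then 1 else 0) = (\<Prod>l\<in>I. if l = i then x l else 1)"
    unfolding monval_def by (intro prod.cong) auto
  then show ?thesis using assms by simp
qed

text \<open>The converse of \<open>mindep_insert\<close>: coefficients in the generated field are
  quotients of polynomial expressions, so clearing denominators turns an algebraic equation for
  \<open>x i\<close> into a relation between monomials.\<close>

lemma mindep_transc:
  fixes x :: "'i \<Rightarrow> 'a::field"
  assumes R: "is_subring R" and I: "finite I" "i \<notin> I" and mi: "mindep R (insert i I) x"
  shows "transc (gen_field R (x ` I)) (x i)"
  unfolding transc_def
proof (intro allI impI, elim conjE)
  fix p assume p: "\<forall>k. coeff p k \<in> gen_field R (x ` I)" "poly p (x i) = 0"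
  define P where "P = rspan R (range (monval I x))"
  have Psub: "is_subring P" unfolding P_def by (rule monval_span_subring[OF R])
  note PP = subringD[OF Psub]
  have RP: "R \<subseteq> P"
  proof
    fix c assume "c \<in> R"
    then have "c * monval I x (\<lambda>_. 0) \<in> P" unfolding P_def by (intro rspan_scaled_gen) auto
    then show "c \<in> P" by (simp add: monval_def)
  qed
  have "x j \<in> P" if "j \<in> I" for j
    unfolding P_def monval_single[OF I(1) that, symmetric, of x] by (intro rspan_gen subringD(2)[OF R]) auto
  then have "gen_field R (x ` I) \<subseteq> {a / b | a b. a \<in> P \<and> b \<in> P \<and> b \<noteq> 0}"
    using RP by (intro gen_field_quotients[OF Psub]) auto
  with p(1) have "\<exists>u v. coeff p k = u / v \<and> u \<in> P \<and> v \<in> P \<and> v \<noteq> 0" for k by blast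
  then obtain u v where uv: "\<And>k. coeff p k = u k / v k" "\<And>k. u k \<in> P" "\<And>k. v k \<in> P" "\<And>k. v k \<noteq> 0"
    by metis
  define V where "V = (\<Prod>k\<le>degree p. v k)"
  have V: "V \<noteq> 0" using uv(4) by (simp add: V_def)
  define w where "w k = (if k \<le> degree p then u k * (\<Prod>l\<in>{..degree p} - {k}. v l) else 0)" for k
  have w: "V * coeff p k = w k" for k
  proof (cases "k \<le> degree p")
    case True
    then have "V = v k * (\<Prod>l\<in>{..degree p} - {k}. v l)" unfolding V_def by (simp add: prod.remove)
    then show ?thesis using True uv by (simp add: w_def)
  qed (simp add: w_def coeff_eq_0)
  have wP: "w k \<in> P" for k
    unfolding w_def using uv PP by (auto intro!: subring_prod[OF Psub] PP(4))
  have "\<exists>S a. finite S \<and> (\<forall>m\<in>S. a m \<in> R \<and> (\<forall>i. i \<notin> I \<longrightarrow> m i = 0)) \<and>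
    w k = (\<Sum>m\<in>S. a m * monval I x m)" for k
    by (rule monval_span_repr[OF R wP[unfolded P_def]])
  then have "\<forall>k. \<exists>S a. finite S \<and> (\<forall>m\<in>S. a m \<in> R \<and> (\<forall>i. i \<notin> I \<longrightarrow> m i = 0)) \<and>
    w k = (\<Sum>m\<in>S. a m * monval I x m)" by blast
  from choice[OF this] obtain S where "\<forall>k. \<exists>a. finite (S k) \<and> (\<forall>m\<in>S k. a m \<in> R \<and>
    (\<forall>i. i \<notin> I \<longrightarrow> m i = 0)) \<and> w k = (\<Sum>m\<in>S k. a m * monval I x m)" ..
  from choice[OF this] obtain a where Sa: "\<forall>k. finite (S k) \<and> (\<forall>m\<in>S k. a k m \<in> R \<and>
    (\<forall>i. i \<notin> I \<longrightarrow> m i = 0)) \<and> w k = (\<Sum>m\<in>S k. a k m * monval I x m)" ..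
  have S: "\<And>k. finite (S k)" "\<And>k m. m \<in> S k \<Longrightarrow> a k m \<in> R"
    "\<And>k m i. m \<in> S k \<Longrightarrow> i \<notin> I \<Longrightarrow> m i = 0" "\<And>k. w k = (\<Sum>m\<in>S k. a k m * monval I x m)"
    using Sa by simp_all
  \<comment> \<open>A pair of a power \<open>k\<close> of \<open>x i\<close> and a monomial
    \<open>m\<close> in the other elements is merged into one exponent vector. The coefficient sets
    contain only vectors vanishing at \<open>i\<close>, so the merging is injective.\<close>
  define e where "e = (\<lambda>(k::nat, m::'i \<Rightarrow> nat). m(i := k))"
  define Z where "Z = Sigma {..degree p} S"
  have ie: "inj_on e Z"
  proof (rule inj_onI, clarify)
    fix k m k' m' assume h: "(k, m) \<in> Z" "(k', m') \<in> Z" "e (k, m) = e (k', m')"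
    from fun_cong[OF h(3), of i] have "k = k'" by (simp add: e_def)
    moreover have "m y = m' y" for y
    proof (cases "y = i")
      case True
      have "m i = 0" "m' i = 0" using S(3)[OF _ I(2), of m k] S(3)[OF _ I(2), of m' k'] h(1,2)
        by (auto simp: Z_def)
      then show ?thesis using True by simp
    qed (use fun_cong[OF h(3), of y] in \<open>simp add: e_def\<close>)
    ultimately show "k = k' \<and> m = m'" by auto
  qed
  define b where "b m = a (m i) (m(i := 0))" for m
  have be: "b (e (k, m)) = a k m" if "(k, m) \<in> Z" for k m
  proof -
    have "m i = 0" using S(3)[OF _ I(2)] that by (auto simp: Z_def)
    then show ?thesis by (auto simp: b_def e_def intro!: arg_cong[of _ _ "a k"])
  qed
  have mm: "monval I x (m(i := k)) = monval I x m" for m k using I(2) by (intro monval_cong) auto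
  have "0 = V * poly p (x i)" using p by simp
  also have "\<dots> = (\<Sum>k\<le>degree p. w k * x i ^ k)"
    by (simp add: poly_altdef sum_distrib_left w[symmetric] mult_ac)
  also have "\<dots> = (\<Sum>k\<le>degree p. \<Sum>m\<in>S k. a k m * monval (insert i I) x (e (k, m)))"
    by (intro sum.cong refl) (simp add: S(4) sum_distrib_left sum_distrib_right e_def monval_insert[OF I] mm mult_ac)
  also have "\<dots> = (\<Sum>z\<in>Z. b (e z) * monval (insert i I) x (e z))"
    unfolding Z_def by (subst sum.Sigma) (auto simp: S(1) be[unfolded Z_def] intro!: sum.cong)
  also have "\<dots> = (\<Sum>m\<in>e ` Z. b m * monval (insert i I) x m)"
    by (simp add: sum.reindex[OF ie])
  finally have s0: "(\<Sum>m\<in>e ` Z. b m * monval (insert i I) x m) = 0" by simp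
  have "b (e z) = 0" if "z \<in> Z" for z
  proof (rule mindepD[OF mi _ _ _ s0])
    show "finite (e ` Z)" unfolding Z_def using S(1) by auto
    show "\<And>m. m \<in> e ` Z \<Longrightarrow> b m \<in> R" using be S(2) by (auto simp: Z_def)
    show "\<And>m j. m \<in> e ` Z \<Longrightarrow> j \<notin> insert i I \<Longrightarrow> m j = 0" using S(3) by (auto simp: Z_def e_def)
  qed (use that in auto)
  then have "a k m = 0" if "k \<le> degree p" "m \<in> S k" for k m
    using be[of k m] that by (auto simp: Z_def)
  then have "w k = 0" for k using S(4)[of k] by (cases "k \<le> degree p") (auto simp: w_def)
  then have "coeff p k = 0" for k using w[of k] V by simp
  then show "p = 0" by (simp add: poly_eq_iff)
qed

subsection \<open>Transcendence degree\<close>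

text \<open>A dimension count in place of the exchange lemma. The monomials in \<open>T\<close> with
  exponents below \<open>e\<close> number \<open>e ^ card T\<close>; after multiplication by one
  common denominator they lie in the span of monomials in \<open>S\<close> with exponents linear in
  \<open>e\<close>, a space of dimension of order \<open>e ^ card S\<close>. For
  \<open>card S < card T\<close> and large \<open>e\<close> they are dependent.\<close>

lemma mindep_card_le:
  fixes F :: "'a::field set"
  assumes F: "is_subfield F" and S: "finite S" and T: "finite T" "T \<subseteq> gen_field F S"
    and mi: "mindep F T id"
  shows "card T \<le> card S"
proof (rule ccontr)
  assume "\<not> card T \<le> card S"
  then have less: "card S < card T" by simp
  define MD where "MD D = monval S id ` (S \<rightarrow>\<^sub>E {..D::nat})" for D
  have MDI: "monval S id m \<in> MD D" if "\<And>s. s \<in> S \<Longrightarrow> m s \<le> D" for m D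
  proof -
    have "monval S id m = monval S id (restrict m S)" by (intro monval_cong) auto
    then show ?thesis unfolding MD_def using that by (auto intro!: image_eqI[of _ _ "restrict m S"])
  qed
  note FF = subfieldD[OF F]
  have MDmono: "z \<in> rspan F (MD D) \<Longrightarrow> D \<le> D' \<Longrightarrow> z \<in> rspan F (MD D')" for z D D'
    by (erule rspan_mono) (auto simp: MD_def PiE_def Pi_def intro!: image_mono)
  have MDmult: "y * z \<in> rspan F (MD (D + D'))" if "y \<in> rspan F (MD D)" "z \<in> rspan F (MD D')" for y z D D'
    using FF(4) _ that
  proof (rule rspan_mult)
    fix m m' assume "m \<in> MD D" "m' \<in> MD D'"
    then obtain f g where fg: "f \<in> S \<rightarrow>\<^sub>E {..D}" "g \<in> S \<rightarrow>\<^sub>E {..D'}" "m = monval S id f" "m' = monval S id g"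
      by (auto simp: MD_def)
    have "m * m' \<in> MD (D + D')" unfolding fg monval_mult
      by (rule MDI) (use fg in \<open>auto simp: PiE_def Pi_def intro!: add_mono\<close>)
    then show "m * m' \<in> rspan F (MD (D + D'))" using FF by (intro rspan_gen)
  qed
  have one: "1 \<in> rspan F (MD D)" for D
    using MDI[of "\<lambda>_. 0" D] FF by (intro rspan_gen) (auto simp: monval_def)
  have MDpow: "y ^ n \<in> rspan F (MD (n * D))" if "y \<in> rspan F (MD D)" for y n D
    by (induction n) (use one MDmult[OF that] in auto)
  define P where "P = rspan F (range (monval S id))"
  have Psub: "is_subring P" unfolding P_def by (rule monval_span_subring[OF subfield_subring[OF F]])
  have PD: "\<exists>D. z \<in> rspan F (MD D)" if "z \<in> P" for z
    using that unfolding P_def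
  proof (induction rule: rspan.induct)
    case zero then show ?case by (auto intro: rspan.zero)
  next
    case (add c m z)
    then obtain D f where D: "z \<in> rspan F (MD D)" "m = monval S id f" by auto
    define D' where "D' = Max (insert D (f ` S))"
    have "D \<le> D'" unfolding D'_def by (rule Max_ge) (use S in auto)
    moreover have "f s \<le> D'" if "s \<in> S" for s unfolding D'_def by (rule Max_ge) (use S that in auto)
    ultimately have "c * m + z \<in> rspan F (MD D')"
      using add D MDmono MDI[of f D'] by (intro rspan.add) auto
    then show ?case ..
  qed
  have FP: "F \<subseteq> P"
  proof
    fix c assume "c \<in> F"
    then have "c * monval S id (\<lambda>_. 0) \<in> P" unfolding P_def by (intro rspan_scaled_gen) auto
    then show "c \<in> P" by (simp add: monval_def)
  qed
  have SP: "S \<subseteq> P"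
  proof
    fix s assume "s \<in> S"
    then have "monval S id (\<lambda>j. if j = s then 1 else 0) \<in> P"
      unfolding P_def by (intro rspan_gen FF) auto
    then show "s \<in> P" using monval_single[OF S \<open>s \<in> S\<close>, of id] by simp
  qed
  have "\<forall>t\<in>T. \<exists>u v. t = u / v \<and> u \<in> P \<and> v \<in> P \<and> v \<noteq> 0"
    using gen_field_quotients[OF Psub FP SP] T(2) by blast
  then obtain u v where uv: "\<And>t. t \<in> T \<Longrightarrow> t = u t / v t" "\<And>t. t \<in> T \<Longrightarrow> u t \<in> P"
    "\<And>t. t \<in> T \<Longrightarrow> v t \<in> P" "\<And>t. t \<in> T \<Longrightarrow> v t \<noteq> 0" by metis
  define V where "V = (\<Prod>t\<in>T. v t)"
  define A where "A t = u t * (\<Prod>s\<in>T - {t}. v s)" for t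
  have V: "V \<noteq> 0" using uv(4) T(1) by (simp add: V_def)
  have At: "t * V = A t" if "t \<in> T" for t
  proof -
    have "V = v t * (\<Prod>s\<in>T - {t}. v s)" unfolding V_def using that T by (simp add: prod.remove)
    then show ?thesis using uv that by (simp add: A_def) (metis nonzero_divide_eq_eq mult.commute mult.left_commute)
  qed
  have AP: "A t \<in> P" if "t \<in> T" for t
    unfolding A_def using uv that by (intro subringD(4)[OF Psub] subring_prod[OF Psub]) auto
  have VP: "V \<in> P" unfolding V_def using uv by (intro subring_prod[OF Psub]) auto
  have "\<forall>w\<in>insert V (A ` T). \<exists>D. w \<in> rspan F (MD D)" using AP VP PD by auto
  then obtain Df where Df: "\<forall>w\<in>insert V (A ` T). w \<in> rspan F (MD (Df w))" by metis
  define D where "D = Max (Df ` insert V (A ` T))"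
  have "Df w \<le> D" if "w \<in> insert V (A ` T)" for w
    unfolding D_def by (rule Max_ge) (use T that in auto)
  then have D: "w \<in> rspan F (MD D)" if "w \<in> insert V (A ` T)" for w
    using Df MDmono that by blast
  define r where "r = card T"
  define n where "n = card S"
  \<comment> \<open>With this choice \<open>(D * e * r + 1) ^ n\<close> is at most
    \<open>e ^ n * (D * r + 1) ^ n\<close>, which is less than \<open>e ^ (n + 1)\<close>, and
    \<open>n + 1\<close> is at most \<open>r\<close>.\<close>
  define e where "e = (D * r + 1) ^ n + 1"
  define C where "C = T \<rightarrow>\<^sub>E {..<e}"
  have fC: "finite C" unfolding C_def using T by (intro finite_PiE) auto
  have cC: "card C = e ^ r" unfolding C_def r_def using T by (simp add: card_PiE)
  \<comment> \<open>This is the monomial with exponents \<open>m\<close> multiplied by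
    \<open>V ^ (e * r)\<close>, written with the numerators \<open>A t = t * V\<close> so that no
    denominators remain.\<close>
  define val where "val m = (\<Prod>t\<in>T. A t ^ m t * V ^ (e - m t))" for m
  have val: "val m = V ^ (e * r) * monval T id m" if "m \<in> C" for m
  proof -
    have "val m = (\<Prod>t\<in>T. V ^ e * t ^ m t)" unfolding val_def
    proof (intro prod.cong refl)
      fix t assume t: "t \<in> T"
      then have "m t \<le> e" using that by (auto simp: C_def PiE_def Pi_def less_imp_le)
      then have "V ^ e = V ^ m t * V ^ (e - m t)" by (simp add: power_add[symmetric])
      then show "A t ^ m t * V ^ (e - m t) = V ^ e * t ^ m t"
        by (simp add: At[OF t, symmetric] power_mult_distrib mult_ac)
    qed
    then show ?thesis by (simp add: prod.distrib monval_def r_def power_mult)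
  qed
  have valP: "val m \<in> rspan F (MD (D * e * r))" if "m \<in> C" for m
  proof -
    have "(\<Prod>t\<in>T'. A t ^ m t * V ^ (e - m t)) \<in> rspan F (MD (D * e * card T'))" if "T' \<subseteq> T" for T'
      using finite_subset[OF that T(1)] that
    proof (induction T' rule: finite_induct)
      case empty then show ?case using one by simp
    next
      case (insert t T')
      have "m t \<le> e" using \<open>m \<in> C\<close> insert by (auto simp: C_def PiE_def Pi_def less_imp_le)
      then have "m t * D + (e - m t) * D = D * e" by (simp add: add_mult_distrib[symmetric])
      then have "A t ^ m t * V ^ (e - m t) \<in> rspan F (MD (D * e))"
        using MDmult[OF MDpow[OF D, of "A t" "m t"] MDpow[OF D, of V "e - m t"]] insert by auto
      with MDmult[OF this, of "\<Prod>t\<in>T'. A t ^ m t * V ^ (e - m t)" "D * e * card T'"] insert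
      show ?case by (simp add: algebra_simps)
    qed
    from this[of T] show ?thesis by (simp add: val_def r_def)
  qed
  have fM: "finite (MD (D * e * r))" unfolding MD_def using S by (intro finite_imageI finite_PiE) auto
  have "card (MD (D * e * r)) \<le> card (S \<rightarrow>\<^sub>E {..D * e * r})"
    unfolding MD_def using S by (intro card_image_le finite_PiE) auto
  also have "\<dots> = (D * e * r + 1) ^ n" using S by (simp add: card_PiE n_def)
  also have "\<dots> \<le> (e * (D * r + 1)) ^ n"
    by (intro power_mono) (auto simp: e_def algebra_simps)
  also have "\<dots> = e ^ n * (D * r + 1) ^ n" by (rule power_mult_distrib)
  also have "\<dots> < e ^ n * e" by (simp add: e_def)
  also have "\<dots> = e ^ Suc n" by simp
  also have "\<dots> \<le> e ^ r" using less by (intro power_increasing) (auto simp: e_def r_def n_def)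
  finally have "card (MD (D * e * r)) < card C" by (simp add: cC)
  from lin_dep[OF F fM fC this, of val] valP
  obtain a where a: "\<forall>c\<in>C. a c \<in> F" "\<exists>c\<in>C. a c \<noteq> 0" "(\<Sum>c\<in>C. a c * val c) = 0" by auto
  have "V ^ (e * r) * (\<Sum>c\<in>C. a c * monval T id c) = 0"
    using a(3) by (simp add: sum_distrib_left val mult_ac)
  then have s0: "(\<Sum>c\<in>C. a c * monval T id c) = 0" using V by simp
  define z where "z m = (\<lambda>i. if i \<in> T then m i else 0)" for m :: "'a \<Rightarrow> nat"
  have zi: "inj_on z C"
  proof (rule inj_onI)
    fix m m' assume m: "m \<in> C" "m' \<in> C" "z m = z m'"
    show "m = m'"
      by (rule PiE_ext[OF m(1,2)[unfolded C_def]]) (use fun_cong[OF m(3)] in \<open>auto simp: z_def split: if_splits\<close>, metis)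
  qed
  have zm: "monval T id (z m) = monval T id m" for m by (intro monval_cong) (auto simp: z_def)
  define b where "b m = a (inv_into C z m)" for m
  have bz: "b (z m) = a m" if "m \<in> C" for m using zi that by (simp add: b_def)
  have s1: "(\<Sum>m\<in>z ` C. b m * monval T id m) = 0"
    using s0 by (simp add: sum.reindex[OF zi] bz zm)
  have "b (z m) = 0" if "m \<in> C" for m
  proof (rule mindepD[OF mi _ _ _ s1])
    show "\<And>m. m \<in> z ` C \<Longrightarrow> b m \<in> F" using a(1) bz by auto
    show "\<And>m i. m \<in> z ` C \<Longrightarrow> i \<notin> T \<Longrightarrow> m i = 0" by (auto simp: z_def)
  qed (use fC that in auto)
  then show False using a(2) bz by auto
qed

text \<open>\<open>Sup\<close> on natural numbers is meaningful here because
  \<open>mindep_card_le\<close> bounds the set of cardinalities, and the generators themselves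
  attain the bound.\<close>

lemma trdeg_gen_field:
  fixes F :: "'a::field set"
  assumes F: "is_subfield F" and I: "finite I" and mi: "mindep F I x"
  shows "trdeg F (gen_field F (x ` I)) = card I"
proof -
  have inj: "inj_on x I" using mindep_inj[OF subfield_subring[OF F] I mi] by simp
  define X where "X = {card T | T. finite T \<and> T \<subseteq> gen_field F (x ` I) \<and> alg_indep F T id}"
  have ai: "finite T \<Longrightarrow> alg_indep F T id \<longleftrightarrow> mindep F T id" for T
    by (rule alg_indep_iff_mindep) (use subfieldD[OF F] in auto)
  have ub: "y \<le> card I" if "y \<in> X" for y
  proof -
    from that obtain T where T: "y = card T" "finite T" "T \<subseteq> gen_field F (x ` I)" "alg_indep F T id"
      by (auto simp: X_def)
    then have "y \<le> card (x ` I)" using mindep_card_le[OF F _ T(2,3)] ai I by auto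
    then show ?thesis using card_image[OF inj] by simp
  qed
  have "card I \<in> X" unfolding X_def
    using mindep_image[OF I mi inj] ai[of "x ` I"] I card_image[OF inj] gen_field_gens[of "x ` I" F]
    by (intro CollectI exI[of _ "x ` I"]) simp
  then have "Sup X = card I" using ub by (intro cSup_eq_maximum) auto
  then show ?thesis by (simp add: trdeg_def X_def)
qed

subsection \<open>Field homomorphisms on subfields\<close>

text \<open>A total function that is constrained only on \<open>M\<close>. Restriction and
  composition of partial homomorphisms then need no change of type.\<close>

definition hom_on :: "'a::field set \<Rightarrow> ('a \<Rightarrow> 'b::field) \<Rightarrow> bool" where
  "hom_on M g \<longleftrightarrow> g 1 = 1 \<and> (\<forall>x\<in>M. \<forall>y\<in>M. g (x + y) = g x + g y \<and> g (x * y) = g x * g y)"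

lemma hom_onD:
  assumes M: "is_subfield M" and h: "hom_on M g"
  shows "g 1 = 1" "g 0 = 0" "x \<in> M \<Longrightarrow> y \<in> M \<Longrightarrow> g (x + y) = g x + g y"
    "x \<in> M \<Longrightarrow> y \<in> M \<Longrightarrow> g (x * y) = g x * g y" "x \<in> M \<Longrightarrow> g (- x) = - g x"
    "x \<in> M \<Longrightarrow> y \<in> M \<Longrightarrow> g (x - y) = g x - g y" "x \<in> M \<Longrightarrow> g (inverse x) = inverse (g x)"
    "x \<in> M \<Longrightarrow> y \<in> M \<Longrightarrow> g (x / y) = g x / g y" "x \<in> M \<Longrightarrow> g (x ^ n) = g x ^ n"
    "x \<in> M \<Longrightarrow> g x = 0 \<Longrightarrow> x = 0"
proof -
  note MM = subfieldD[OF M]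
  show 1: "g 1 = 1" and a: "x \<in> M \<Longrightarrow> y \<in> M \<Longrightarrow> g (x + y) = g x + g y"
    and m: "x \<in> M \<Longrightarrow> y \<in> M \<Longrightarrow> g (x * y) = g x * g y" for x y using h unfolding hom_on_def by auto
  have "g 0 + g 0 = g 0" using a[of 0 0] MM(1) by simp
  then show 0: "g 0 = 0" by (metis add_cancel_right_right)
  show n: "x \<in> M \<Longrightarrow> g (- x) = - g x" for x
    using a[of x "-x"] MM 0 by (simp add: eq_neg_iff_add_eq_0 add.commute)
  show "x \<in> M \<Longrightarrow> y \<in> M \<Longrightarrow> g (x - y) = g x - g y" for x y
    using a[of x "-y"] n[of y] MM by simp
  have iv: "g x * g (inverse x) = 1" if "x \<in> M" "x \<noteq> 0" for x
    using m[of x "inverse x"] that MM 1 by simp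
  show i: "x \<in> M \<Longrightarrow> g (inverse x) = inverse (g x)" for x
    using iv[of x] 0 by (cases "x = 0") (simp_all add: inverse_unique)
  show "x \<in> M \<Longrightarrow> y \<in> M \<Longrightarrow> g (x / y) = g x / g y" for x y
    using m[of x "inverse y"] i[of y] MM by (simp add: divide_inverse)
  show "x \<in> M \<Longrightarrow> g (x ^ n) = g x ^ n" for x
    by (induction n) (use 1 m MM in auto)
  show "x \<in> M \<Longrightarrow> g x = 0 \<Longrightarrow> x = 0" for x using iv[of x] by auto
qed

lemma hom_on_sum:
  assumes M: "is_subfield M" and h: "hom_on M g" and "\<And>i. i \<in> A \<Longrightarrow> f i \<in> M"
  shows "g (sum f A) = (\<Sum>i\<in>A. g (f i))"
  using assms(3)
proof (induction A rule: infinite_finite_induct)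
  case (insert x A)
  then show ?case using hom_onD(3)[OF M h] subfield_sum[OF M, of A f] by auto
qed (use hom_onD[OF M h] in auto)

lemma hom_on_eqI:
  assumes h: "hom_on (gen_field F S) g" "hom_on (gen_field F S) g'"
    and e: "\<And>x. x \<in> F \<Longrightarrow> g x = g' x" "\<And>x. x \<in> S \<Longrightarrow> g x = g' x" and x: "x \<in> gen_field F S"
  shows "g x = g' x"
proof -
  define M where "M = gen_field F S"
  have M: "is_subfield M" unfolding M_def by (rule gen_field_subfield)
  note H = hom_onD[OF M h(1)[folded M_def]] and H' = hom_onD[OF M h(2)[folded M_def]]
  have "is_subfield {x\<in>M. g x = g' x}"
    unfolding is_subfield_def using subfieldD[OF M] H H' by auto
  then have "gen_field F S \<subseteq> {x\<in>M. g x = g' x}"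
    by (rule gen_field_least)
      (use e gen_field_base[of F S] gen_field_gens[of S F] in \<open>auto simp: M_def\<close>)
  then show ?thesis using x by auto
qed

lemma hom_on_image_gen_field:
  assumes h: "hom_on (gen_field F S) g" and E: "is_subfield E"
    and "\<And>x. x \<in> F \<Longrightarrow> g x \<in> E" "\<And>x. x \<in> S \<Longrightarrow> g x \<in> E" and x: "x \<in> gen_field F S"
  shows "g x \<in> E"
proof -
  define M where "M = gen_field F S"
  have M: "is_subfield M" unfolding M_def by (rule gen_field_subfield)
  note H = hom_onD[OF M h(1)[folded M_def]]
  have "is_subfield {x\<in>M. g x \<in> E}"
    unfolding is_subfield_def using subfieldD[OF M] subfieldD[OF E] H by auto
  then have "gen_field F S \<subseteq> {x\<in>M. g x \<in> E}"
    by (rule gen_field_least)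
      (use assms gen_field_base[of F S] gen_field_gens[of S F] in \<open>auto simp: M_def\<close>)
  then show ?thesis using x by auto
qed

text \<open>Two evaluations of the same ring with the same kernel: mapping
  \<open>e1 a / e1 b\<close> to \<open>e2 a / e2 b\<close> is well defined. It is applied to
  polynomials at two transcendental points, and to power series before and after the twist.\<close>

lemma hom_on_quotients:
  fixes e1 e2 :: "'r::comm_ring_1 \<Rightarrow> 'b::field"
  assumes P: "is_subring P"
    and h1: "e1 1 = 1" "\<And>a b. a \<in> P \<Longrightarrow> b \<in> P \<Longrightarrow> e1 (a + b) = e1 a + e1 b"
      "\<And>a b. a \<in> P \<Longrightarrow> b \<in> P \<Longrightarrow> e1 (a * b) = e1 a * e1 b"
    and h2: "e2 1 = 1" "\<And>a b. a \<in> P \<Longrightarrow> b \<in> P \<Longrightarrow> e2 (a + b) = e2 a + e2 b"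
      "\<And>a b. a \<in> P \<Longrightarrow> b \<in> P \<Longrightarrow> e2 (a * b) = e2 a * e2 b"
    and z: "\<And>a. a \<in> P \<Longrightarrow> e1 a = 0 \<longleftrightarrow> e2 a = 0"
  shows "\<exists>g. hom_on {e1 a / e1 b | a b. a \<in> P \<and> b \<in> P \<and> e1 b \<noteq> 0} g \<and>
    (\<forall>a\<in>P. \<forall>b\<in>P. e1 b \<noteq> 0 \<longrightarrow> g (e1 a / e1 b) = e2 a / e2 b)"
proof -
  note PP = subringD[OF P]
  have n1: "e1 (a - b) = e1 a - e1 b" if "a \<in> P" "b \<in> P" for a b
    using h1(2)[of "a - b" b] that PP by simp
  have n2: "e2 (a - b) = e2 a - e2 b" if "a \<in> P" "b \<in> P" for a b
    using h2(2)[of "a - b" b] that PP by simp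
  have wd: "e2 a / e2 b = e2 c / e2 d"
    if "a \<in> P" "b \<in> P" "c \<in> P" "d \<in> P" "e1 b \<noteq> 0" "e1 d \<noteq> 0" "e1 a / e1 b = e1 c / e1 d" for a b c d
  proof -
    have "e1 (a * d - c * b) = 0" using that PP h1 n1 by (simp add: frac_eq_eq)
    then have "e2 (a * d - c * b) = 0" using that PP z by simp
    then have "e2 a * e2 d = e2 c * e2 b" using that PP h2 n2 by simp
    then show ?thesis using that z by (simp add: frac_eq_eq)
  qed
  define g where "g x = (SOME y. \<exists>a b. a \<in> P \<and> b \<in> P \<and> e1 b \<noteq> 0 \<and> x = e1 a / e1 b \<and> y = e2 a / e2 b)" for x
  have g: "g (e1 a / e1 b) = e2 a / e2 b" if ab: "a \<in> P" "b \<in> P" "e1 b \<noteq> 0" for a b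
    unfolding g_def
  proof (rule some_equality)
    show "\<exists>a' b'. a' \<in> P \<and> b' \<in> P \<and> e1 b' \<noteq> 0 \<and> e1 a / e1 b = e1 a' / e1 b' \<and> e2 a / e2 b = e2 a' / e2 b'"
      using ab by blast
  qed (use wd ab in metis)
  have "g 1 = 1" using g[of 1 1] PP h1 h2 by simp
  moreover have "g (x + y) = g x + g y \<and> g (x * y) = g x * g y"
    if xy: "x \<in> {e1 a / e1 b | a b. a \<in> P \<and> b \<in> P \<and> e1 b \<noteq> 0}"
      "y \<in> {e1 a / e1 b | a b. a \<in> P \<and> b \<in> P \<and> e1 b \<noteq> 0}" for x y
  proof -
    from xy obtain a b c d where d: "x = e1 a / e1 b" "y = e1 c / e1 d" "a \<in> P" "b \<in> P" "c \<in> P" "d \<in> P"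
      "e1 b \<noteq> 0" "e1 d \<noteq> 0" by blast
    have nz: "e2 b \<noteq> 0" "e2 d \<noteq> 0" using d z by auto
    have s: "x + y = e1 (a * d + c * b) / e1 (b * d)" "x * y = e1 (a * c) / e1 (b * d)"
      using d PP h1 by (auto simp: field_simps)
    have bd: "e1 (b * d) \<noteq> 0" using d h1 by simp
    have "g (x + y) = e2 (a * d + c * b) / e2 (b * d)" "g (x * y) = e2 (a * c) / e2 (b * d)"
      unfolding s by (intro g; use bd d PP in simp)+
    moreover have "g x = e2 a / e2 b" "g y = e2 c / e2 d" unfolding d using g d by auto
    moreover have "e2 (a * d + c * b) / e2 (b * d) = e2 a / e2 b + e2 c / e2 d"
      "e2 (a * c) / e2 (b * d) = e2 a / e2 b * (e2 c / e2 d)"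
      using d PP h2 nz by (simp_all add: field_simps)
    ultimately show ?thesis by simp
  qed
  ultimately have "hom_on {e1 a / e1 b | a b. a \<in> P \<and> b \<in> P \<and> e1 b \<noteq> 0} g"
    unfolding hom_on_def by blast
  with g show ?thesis by blast
qed

lemma gen_field_insert:
  assumes "is_subfield F"
  shows "gen_field F (insert x S) = gen_field (gen_field F S) {x}"
proof
  show "gen_field F (insert x S) \<subseteq> gen_field (gen_field F S) {x}"
    by (rule gen_field_least[OF gen_field_subfield])
      (use gen_field_base[of "gen_field F S" "{x}"] gen_field_base[of F S] gen_field_gens[of S F]
        gen_field_gens[of "{x}" "gen_field F S"] in auto)
  show "gen_field (gen_field F S) {x} \<subseteq> gen_field F (insert x S)"
    by (rule gen_field_least[OF gen_field_subfield])
      (use gen_field_mono[of S "insert x S" F] gen_field_gens[of "insert x S" F] in auto)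
qed

lemma gen_field_empty: "is_subfield F \<Longrightarrow> gen_field F {} = F"
  using gen_field_least[of F F "{}"] gen_field_base[of F "{}"] by auto

text \<open>Since \<open>w\<close> lies in \<open>M\<close>, the element \<open>Z + w\<close> is as
  transcendental over \<open>M\<close> as \<open>Z\<close>, so \<open>g\<close> extends with
  \<open>Z + w\<close> as the image of \<open>Z\<close>.\<close>

lemma hom_on_shift:
  fixes M :: "'b::field set"
  assumes M: "is_subfield M" and h: "hom_on M g" and gM: "\<And>x. x \<in> M \<Longrightarrow> g x \<in> M"
    and t: "transc M Z" and w: "w \<in> M"
  shows "\<exists>g'. hom_on (gen_field M {Z}) g' \<and> (\<forall>x\<in>gen_field M {Z}. g' x \<in> gen_field M {Z}) \<and>
    (\<forall>x\<in>M. g' x = g x) \<and> g' Z = Z + w"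
proof -
  note MM = subfieldD[OF M] and H = hom_onD[OF M h]
  define P where "P = {p. \<forall>k. coeff p k \<in> M}"
  have P: "is_subring P" unfolding is_subring_def P_def
    using MM by (auto simp: coeff_mult coeff_pCons split: nat.splits intro!: subfield_sum[OF M])
  note PP = subringD[OF P]
  define e1 where "e1 p = poly p Z" for p
  define e2 where "e2 p = poly (map_poly g p) (Z + w)" for p
  have cg: "coeff (map_poly g p) k = g (coeff p k)" for p k
    using H by (simp add: coeff_map_poly)
  have gp: "map_poly g (p + q) = map_poly g p + map_poly g q"
    "map_poly g (p * q) = map_poly g p * map_poly g q" if "p \<in> P" "q \<in> P" for p q
    using that H MM unfolding P_def
    by (auto simp: poly_eq_iff cg coeff_mult hom_on_sum[OF M h])
  have g1: "map_poly g 1 = 1" by (rule poly_eqI) (use H in \<open>simp add: cg coeff_1\<close>)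
  have gP: "map_poly g p \<in> P" if "p \<in> P" for p using that gM by (auto simp: P_def cg)
  have [simp]: "[:w, 1:] \<in> P" using w MM by (auto simp: P_def coeff_pCons split: nat.splits)
  have XP: "[:0, 1:] \<in> P" using MM by (auto simp: P_def coeff_pCons split: nat.splits)
  have cP: "[:c:] \<in> P" if "c \<in> M" for c
    using that MM by (auto simp: P_def coeff_pCons split: nat.splits)
  have compP: "pcompose p [:w, 1:] \<in> P" if "p \<in> P" for p
    using that
  proof (induction p)
    case (pCons c p)
    have "p \<in> P" "c \<in> M" using pCons.prems unfolding P_def
      by (simp_all, metis coeff_pCons_Suc, metis coeff_pCons_0)
    then show ?case using pCons.IH unfolding pcompose_pCons by (intro PP(3,4) cP) auto
  qed (use PP in simp)
  \<comment> \<open>Evaluation at the shifted point is evaluation at \<open>Z\<close> of a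
    substituted polynomial over \<open>M\<close>; this carries injectivity from \<open>e1\<close> to
    \<open>e2\<close>.\<close>
  have e2': "e2 p = e1 (pcompose (map_poly g p) [:w, 1:])" for p
    by (simp add: e1_def e2_def poly_pcompose add.commute)
  have tz: "p = 0" if "p \<in> P" "e1 p = 0" for p
    using t that unfolding transc_def P_def e1_def by auto
  have z: "e1 p = 0 \<longleftrightarrow> e2 p = 0" if p: "p \<in> P" for p
  proof
    assume "e1 p = 0"
    then have "p = 0" using tz p by simp
    then show "e2 p = 0" by (simp add: e2_def)
  next
    assume "e2 p = 0"
    then have "pcompose (map_poly g p) [:w, 1:] = 0" using tz[OF compP[OF gP[OF p]]] e2' by simp
    then have "map_poly g p = 0" by (rule pcompose_eq_0) simp
    then have "coeff p k = 0" for k using cg[of p k] p H(10)[of "coeff p k"] by (simp add: P_def)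
    then show "e1 p = 0" by (simp add: e1_def poly_eq_iff[symmetric] poly_altdef)
  qed
  obtain g' where g': "hom_on {e1 a / e1 b | a b. a \<in> P \<and> b \<in> P \<and> e1 b \<noteq> 0} g'"
    "\<forall>a\<in>P. \<forall>b\<in>P. e1 b \<noteq> 0 \<longrightarrow> g' (e1 a / e1 b) = e2 a / e2 b"
    using hom_on_quotients[OF P, of e1 e2] z gp g1 by (auto simp: e1_def e2_def)
  define P1 where "P1 = e1 ` P"
  have P1: "is_subring P1" unfolding is_subring_def P1_def
  proof (intro conjI ballI)
    show "0 \<in> e1 ` P" by (rule image_eqI[of _ _ 0]) (use PP in \<open>auto simp: e1_def\<close>)
    show "1 \<in> e1 ` P" by (rule image_eqI[of _ _ 1]) (use PP in \<open>auto simp: e1_def\<close>)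
    fix x y assume "x \<in> e1 ` P" "y \<in> e1 ` P"
    then obtain a b where ab: "x = e1 a" "y = e1 b" "a \<in> P" "b \<in> P" by auto
    show "x + y \<in> e1 ` P" by (rule image_eqI[of _ _ "a + b"]) (use PP ab in \<open>auto simp: e1_def\<close>)
    show "x * y \<in> e1 ` P" by (rule image_eqI[of _ _ "a * b"]) (use PP ab in \<open>auto simp: e1_def\<close>)
  next
    fix x assume "x \<in> e1 ` P"
    then obtain a where ab: "x = e1 a" "a \<in> P" by auto
    show "- x \<in> e1 ` P" by (rule image_eqI[of _ _ "- a"]) (use PP ab in \<open>auto simp: e1_def\<close>)
  qed
  have MP1: "M \<subseteq> P1" unfolding P1_def by (auto simp: e1_def intro!: image_eqI[OF _ cP])
  have ZP1: "{Z} \<subseteq> P1" unfolding P1_def by (auto simp: e1_def intro!: image_eqI[OF _ XP])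
  have sub: "gen_field M {Z} \<subseteq> {e1 a / e1 b | a b. a \<in> P \<and> b \<in> P \<and> e1 b \<noteq> 0}"
    using gen_field_quotients[OF P1 MP1 ZP1] unfolding P1_def by blast
  have hg: "hom_on (gen_field M {Z}) g'"
    using g'(1) sub unfolding hom_on_def by (meson subsetD)
  have e11: "e1 1 = 1" "e2 1 = 1" by (simp_all add: e1_def e2_def g1)
  have onM: "g' x = g x" if "x \<in> M" for x
  proof -
    have "g' (e1 [:x:] / e1 1) = e2 [:x:] / e2 1" using g'(2)[rule_format, OF cP[OF that] PP(2)] e11 by simp
    then show ?thesis using H by (simp add: e11) (simp add: e1_def e2_def map_poly_pCons)
  qed
  have onZ: "g' Z = Z + w"
  proof -
    have "g' (e1 [:0, 1:] / e1 1) = e2 [:0, 1:] / e2 1" using g'(2)[rule_format, OF XP PP(2)] e11 by simp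
    then show ?thesis using H by (simp add: e11) (simp add: e1_def e2_def map_poly_pCons)
  qed
  have "g' x \<in> gen_field M {Z}" if "x \<in> gen_field M {Z}" for x
    by (rule hom_on_image_gen_field[OF hg gen_field_subfield _ _ that])
      (use onM onZ gM w gen_field_base[of M "{Z}"] gen_field_gens[of "{Z}" M]
        in \<open>auto intro!: subfieldD(3)[OF gen_field_subfield]\<close>)
  with hg onM onZ show ?thesis by blast
qed

text \<open>The elements are adjoined in the order of \<open>key\<close>, one shift at a time. Each
  \<open>w s\<close> involves earlier elements only, so the resulting maps are the unipotent
  automorphisms of the tower.\<close>

lemma hom_on_tower_shift:
  fixes F0 :: "'b::field set" and key :: "'i \<Rightarrow> nat"
  assumes F0: "is_subfield F0" and inj: "inj_on key I"
    and t: "\<And>s. s \<in> I \<Longrightarrow> key s < N \<Longrightarrow> transc (gen_field F0 (x ` {r\<in>I. key r < key s})) (x s)"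
    and w: "\<And>s. s \<in> I \<Longrightarrow> key s < N \<Longrightarrow> w s \<in> gen_field F0 (x ` {r\<in>I. key r < key s})"
  shows "\<exists>g. hom_on (gen_field F0 (x ` {r\<in>I. key r < N})) g \<and>
    (\<forall>y\<in>gen_field F0 (x ` {r\<in>I. key r < N}). g y \<in> gen_field F0 (x ` {r\<in>I. key r < N})) \<and>
    (\<forall>c\<in>F0. g c = c) \<and> (\<forall>s\<in>I. key s < N \<longrightarrow> g (x s) = x s + w s)"
  using t w
proof (induction N)
  case 0
  show ?case using gen_field_empty[OF F0] by (intro exI[of _ "\<lambda>x. x"]) (auto simp: hom_on_def)
next
  case (Suc n)
  define M where "M = gen_field F0 (x ` {r\<in>I. key r < n})"
  have M: "is_subfield M" unfolding M_def by (rule gen_field_subfield)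
  obtain g where g: "hom_on M g" "\<forall>y\<in>M. g y \<in> M" "\<forall>c\<in>F0. g c = c"
    "\<forall>s\<in>I. key s < n \<longrightarrow> g (x s) = x s + w s"
    using Suc unfolding M_def by auto
  show ?case
  proof (cases "\<exists>s\<in>I. key s = n")
    case False
    then have "{r\<in>I. key r < Suc n} = {r\<in>I. key r < n}" by (auto simp: less_Suc_eq)
    then show ?thesis using g False unfolding M_def by (intro exI[of _ g]) (auto simp: less_Suc_eq)
  next
    case True
    then obtain s where s: "s \<in> I" "key s = n" by auto
    have e: "{r\<in>I. key r < Suc n} = insert s {r\<in>I. key r < n}"
      using s inj by (auto simp: less_Suc_eq dest: inj_onD)
    have M': "gen_field F0 (x ` {r\<in>I. key r < Suc n}) = gen_field M {x s}"
      unfolding e M_def by (simp add: gen_field_insert[OF F0])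
    obtain g' where g': "hom_on (gen_field M {x s}) g'" "\<forall>y\<in>gen_field M {x s}. g' y \<in> gen_field M {x s}"
      "\<forall>y\<in>M. g' y = g y" "g' (x s) = x s + w s"
      using hom_on_shift[OF M g(1), of "x s" "w s"] g(2) Suc.prems[OF s(1)] s(2)
      unfolding M_def by auto
    have xM: "x r \<in> M" if "r \<in> I" "key r < n" for r
      unfolding M_def by (rule subsetD[OF gen_field_gens]) (use that in auto)
    have F0M: "F0 \<subseteq> M" unfolding M_def by (rule gen_field_base)
    have "\<forall>r\<in>I. key r < Suc n \<longrightarrow> g' (x r) = x r + w r"
    proof (intro ballI impI)
      fix r assume r: "r \<in> I" "key r < Suc n"
      show "g' (x r) = x r + w r"
      proof (cases "key r = n")
        case True
        then have "r = s" using inj s r by (auto dest: inj_onD)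
        then show ?thesis using g' by simp
      next
        case False
        then have "key r < n" using r by simp
        then show ?thesis using g' g xM r by auto
      qed
    qed
    moreover have "\<forall>c\<in>F0. g' c = c" using F0M g' g by auto
    ultimately show ?thesis unfolding M' using g'(1,2) by (intro exI[of _ g'] conjI) simp_all
  qed
qed

subsection \<open>Additive difference equations\<close>

lemma hom_on_subset: "hom_on M g \<Longrightarrow> M' \<subseteq> M \<Longrightarrow> hom_on M' g"
  unfolding hom_on_def by blast

lemma hom_on_comp:
  assumes "hom_on M g" "hom_on M' h" "\<And>x. x \<in> M \<Longrightarrow> g x \<in> M'" shows "hom_on M (h \<circ> g)"
  using assms unfolding hom_on_def by simp

lemma frobenius_add:
  fixes x y :: "'a::comm_ring_1"
  assumes "prime p" "of_nat p = (0::'a)"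
  shows "(x + y) ^ (p ^ n) = x ^ (p ^ n) + y ^ (p ^ n)"
proof -
  have "CHAR('a) dvd p" using assms(2) by (simp add: of_nat_eq_0_iff_char_dvd)
  then have "CHAR('a) = 1 \<or> CHAR('a) = p" using assms(1) unfolding prime_nat_iff by blast
  then have "CHAR('a) = p" by auto
  then show ?thesis using assms(1) by (intro freshmans_dream') auto
qed

lemma frobenius_diff:
  fixes x y :: "'a::comm_ring_1"
  assumes "prime p" "of_nat p = (0::'a)"
  shows "(x - y) ^ (p ^ n) = x ^ (p ^ n) - y ^ (p ^ n)"
  using frobenius_add[OF assms, of "x - y" y] by (simp add: algebra_simps)

lemma frobenius_sum:
  fixes f :: "'b \<Rightarrow> 'a::comm_ring_1"
  assumes "prime p" "of_nat p = (0::'a)"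
  shows "sum f A ^ (p ^ n) = (\<Sum>i\<in>A. f i ^ (p ^ n))"
proof (induction A rule: infinite_finite_induct)
  case (insert x F)
  then show ?case using frobenius_add[OF assms] by simp
qed (use prime_gt_0_nat[OF assms(1)] in \<open>auto simp: power_0_left\<close>)

text \<open>Among the relations stating that a monic \<open>p\<close>-polynomial in \<open>Z\<close>
  lies in \<open>M\<close>, one of least degree is chosen. Applying \<open>t\<close> replaces
  \<open>Z ^ (p ^ e)\<close> by \<open>Z ^ (p ^ e) - f ^ (p ^ e)\<close>; subtraction removes the
  leading term, so minimality forces every coefficient to be fixed by \<open>t\<close>.\<close>

lemma algebraic_additive_relation:
  fixes t :: "'b::field \<Rightarrow> 'b"
  assumes p: "prime p" "of_nat p = (0::'b)"
    and t: "hom_on UNIV t" and M: "is_subfield M" and tM: "\<And>x. x \<in> M \<Longrightarrow> t x \<in> M"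
    and Z: "Z = t Z + f" "f \<in> M" and nt: "\<not> transc M Z"
  shows "\<exists>E c m. (\<forall>e\<le>E. c e \<in> M \<and> t (c e) = c e) \<and> c E = 1 \<and> m \<in> M \<and>
    m - t m = (\<Sum>e\<le>E. c e * f ^ (p ^ e))"
proof -
  note MM = subfieldD[OF M]
  have U: "is_subfield (UNIV :: 'b set)" by (simp add: is_subfield_def)
  note T = hom_onD[OF U t, simplified]
  define Rel where "Rel E c m \<longleftrightarrow> (\<forall>e\<le>E. c e \<in> M) \<and> c E = 1 \<and> m \<in> M \<and> (\<Sum>e\<le>E. c e * Z ^ (p ^ e)) = m"
    for E :: nat and c m
  have normalize: "\<exists>E'\<le>E. \<exists>c m. Rel E' c m"
    if "\<forall>e\<le>E. c e \<in> M" "\<exists>e\<le>E. c e \<noteq> 0" "m \<in> M" "(\<Sum>e\<le>E. c e * Z ^ (p ^ e)) = m" for E c m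
  proof -
    define E' where "E' = Max {e. e \<le> E \<and> c e \<noteq> 0}"
    have fin: "finite {e. e \<le> E \<and> c e \<noteq> 0}" by simp
    have "E' \<in> {e. e \<le> E \<and> c e \<noteq> 0}" unfolding E'_def using that(2) fin by (intro Max_in) auto
    then have E': "E' \<le> E" "c E' \<noteq> 0" by auto
    have z: "c e = 0" if "E' < e" "e \<le> E" for e
    proof (rule ccontr)
      assume "c e \<noteq> 0"
      then have "e \<le> E'" unfolding E'_def using fin that by (intro Max_ge) auto
      then show False using that by simp
    qed
    have "m = (\<Sum>e\<le>E'. c e * Z ^ (p ^ e))"
      unfolding that(4)[symmetric] using E' z by (intro sum.mono_neutral_right) auto
    then have "(\<Sum>e\<le>E'. c e / c E' * Z ^ (p ^ e)) = m / c E'"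
      by (simp add: sum_divide_distrib)
    then have "Rel E' (\<lambda>e. c e / c E') (m / c E')"
      unfolding Rel_def using that E' by (auto intro!: MM)
    then show ?thesis using E' by blast
  qed
  obtain n where n: "n > 0" "\<And>k. Z ^ k \<in> rspan M ((\<lambda>i. Z ^ i) ` {..<n})"
    using alg_over_power_span[OF M not_transc_alg[OF nt]] by blast
  \<comment> \<open>Slot 0 holds the constant 1 and slot \<open>Suc e\<close> the power
    \<open>Z ^ (p ^ e)\<close>. These \<open>n + 1\<close> elements lie in a space spanned by
    \<open>n\<close> elements.\<close>
  define v where "v i = (case i of 0 \<Rightarrow> 1 | Suc e \<Rightarrow> Z ^ (p ^ e))" for i
  have cl: "card ((\<lambda>i. Z ^ i) ` {..<n}) < card {..n}"
    using card_image_le[of "{..<n}" "\<lambda>i. Z ^ i"] by simp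
  have vs: "v i \<in> rspan M ((\<lambda>i. Z ^ i) ` {..<n})" for i
    using n(2)[of 0] n(2) by (cases i) (auto simp: v_def)
  obtain x where x: "\<forall>i\<in>{..n}. x i \<in> M" "\<exists>i\<in>{..n}. x i \<noteq> 0" "(\<Sum>i\<in>{..n}. x i * v i) = 0"
    using lin_dep[OF M _ _ cl, of v] vs by auto
  obtain n' where n': "n = Suc n'" using n(1) by (cases n) auto
  have "(\<Sum>i\<le>n. x i * v i) = x 0 + (\<Sum>e\<le>n'. x (Suc e) * Z ^ (p ^ e))"
    unfolding n' by (subst sum.atMost_Suc_shift) (simp add: v_def)
  then have s: "(\<Sum>e\<le>n'. x (Suc e) * Z ^ (p ^ e)) = - x 0"
    using x(3) by (simp add: eq_neg_iff_add_eq_0 add.commute)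
  have "\<exists>e\<le>n'. x (Suc e) \<noteq> 0"
  proof (rule ccontr)
    assume h: "\<not> ?thesis"
    then have x0: "x 0 = 0" using s by simp
    have "x i = 0" if "i \<le> n" for i using h x0 that n' by (cases i) auto
    then show False using x(2) by auto
  qed
  with normalize[of n' "\<lambda>e. x (Suc e)" "- x 0"] s x(1) n' MM
  have ex: "\<exists>E. \<exists>c m. Rel E c m" by auto
  define E where "E = (LEAST E. \<exists>c m. Rel E c m)"
  have "\<exists>c m. Rel E c m" unfolding E_def using ex by (rule LeastI_ex)
  then obtain c m where R: "Rel E c m" by blast
  have least: "E \<le> E'" if "Rel E' c' m'" for E' c' m'
    unfolding E_def by (rule Least_le) (use that in blast)
  have R': "\<And>e. e \<le> E \<Longrightarrow> c e \<in> M" "c E = 1" "m \<in> M" "(\<Sum>e\<le>E. c e * Z ^ (p ^ e)) = m"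
    using R unfolding Rel_def by auto
  have ts: "t (sum g A) = (\<Sum>i\<in>A. t (g i))" for g :: "nat \<Rightarrow> 'b" and A
    by (rule hom_on_sum[OF U t]) simp
  have tZ: "t (Z ^ (p ^ e)) = Z ^ (p ^ e) - f ^ (p ^ e)" for e
  proof -
    have "t Z = Z - f" using Z(1) by (metis add_diff_cancel_right')
    then show ?thesis by (simp add: T frobenius_diff[OF p])
  qed
  have tm: "t m = (\<Sum>e\<le>E. t (c e) * Z ^ (p ^ e)) - (\<Sum>e\<le>E. t (c e) * f ^ (p ^ e))"
    unfolding R'(4)[symmetric] by (simp add: ts T(4) tZ right_diff_distrib sum_subtractf)
  \<comment> \<open>The right-hand side lies in \<open>M\<close>, and the term for \<open>E\<close>
    vanishes because \<open>c E = 1\<close>. A coefficient not fixed by \<open>t\<close> would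
    therefore give a shorter relation.\<close>
  have d: "(\<Sum>e\<le>E. (c e - t (c e)) * Z ^ (p ^ e)) = m - t m - (\<Sum>e\<le>E. t (c e) * f ^ (p ^ e))"
    using tm R'(4) by (simp add: left_diff_distrib sum_subtractf)
  have tc: "t (c e) = c e" if "e \<le> E" for e
  proof (rule ccontr)
    assume ne: "t (c e) \<noteq> c e"
    then have "e < E" using R'(2) T that by (cases "e = E") auto
    then obtain E0 where E0: "E = Suc E0" "e \<le> E0" by (cases E) auto
    have "(\<Sum>e\<le>E0. (c e - t (c e)) * Z ^ (p ^ e)) = m - t m - (\<Sum>e\<le>E. t (c e) * f ^ (p ^ e))"
      unfolding d[symmetric] using R'(2) T by (simp add: E0(1))
    moreover have "m - t m - (\<Sum>e\<le>E. t (c e) * f ^ (p ^ e)) \<in> M"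
      using R' tM Z(2) by (intro MM subfield_sum[OF M]) auto
    moreover have "\<forall>e\<le>E0. c e - t (c e) \<in> M" using R'(1) tM E0 by (auto intro!: MM)
    moreover have "\<exists>e\<le>E0. c e - t (c e) \<noteq> 0" using ne E0(2) by (intro exI[of _ e]) simp
    ultimately obtain E' c' m' where "E' \<le> E0" "Rel E' c' m'"
      using normalize[of E0 "\<lambda>e. c e - t (c e)"] by blast
    then show False using least[of E' c' m'] E0 by simp
  qed
  have "m - t m = (\<Sum>e\<le>E. c e * f ^ (p ^ e))"
    using tm R'(4) tc by simp
  then show ?thesis using R' tc by blast
qed

text \<open>
  The order in which the entries are adjoined: first the subdiagonal, then the columns from right to
  left, each from top to bottom.
\<close>

definition pair_key :: "nat \<Rightarrow> nat \<times> nat \<Rightarrow> nat" where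
  "pair_key d = (\<lambda>(i, j). if i = Suc j then i else (d + 2) * (d + 2 - j) + i)"

lemma pair_key_diag [simp]: "pair_key d (Suc j, j) = Suc j"
  by (simp add: pair_key_def)

lemma pair_key_off_diag: "i \<noteq> Suc j \<Longrightarrow> pair_key d (i, j) = (d + 2) * (d + 2 - j) + i"
  by (simp only: pair_key_def prod.case if_False)

lemma pair_key_big:
  assumes "(r, s) \<in> Iset d" "r \<noteq> Suc s" shows "d + 1 < pair_key d (r, s)"
proof -
  have "1 \<le> d + 2 - s" using assms by (auto simp: Iset_def)
  then have "(d + 2) * 1 \<le> (d + 2) * (d + 2 - s)" by (rule mult_le_mono2)
  then have "d + 2 \<le> (d + 2) * (d + 2 - s)" by (simp only: mult_1_right)
  moreover have "pair_key d (r, s) = (d + 2) * (d + 2 - s) + r" by (rule pair_key_off_diag[OF assms(2)])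
  ultimately show ?thesis by (metis add_leD1 add_less_cancel_left le_add1 le_trans less_le_trans one_less_numeral_iff semiring_norm(76))
qed

text \<open>The factor \<open>d + 2\<close> exceeds every row index, so off the subdiagonal a
  difference in columns outweighs any difference in rows.\<close>

lemma pair_key_column:
  assumes "(r, s) \<in> Iset d" "(r', s') \<in> Iset d" "s < s'" "r \<noteq> Suc s"
  shows "pair_key d (r', s') < pair_key d (r, s)"
proof (cases "r' = Suc s'")
  case True
  then show ?thesis using pair_key_big[OF assms(1,4)] assms(2) by (auto simp: Iset_def)
next
  case False
  have "d + 2 - s' + 1 \<le> d + 2 - s" using assms by (auto simp: Iset_def)
  then have "(d + 2) * (d + 2 - s' + 1) \<le> (d + 2) * (d + 2 - s)" by (rule mult_le_mono2)
  then have "(d + 2) * (d + 2 - s') + (d + 2) \<le> (d + 2) * (d + 2 - s)" by (simp only: distrib_left mult_1_right)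
  moreover have "r' \<le> d + 1" "0 < r" using assms by (auto simp: Iset_def)
  ultimately show ?thesis unfolding pair_key_off_diag[OF False] pair_key_off_diag[OF assms(4)]
    by linarith
qed

lemma pair_key_row:
  assumes "(r, s) \<in> Iset d" "(r', s) \<in> Iset d" "r' < r"
  shows "pair_key d (r', s) < pair_key d (r, s)"
proof -
  have r: "r \<noteq> Suc s" using assms by (auto simp: Iset_def)
  show ?thesis
  proof (cases "r' = Suc s")
    case True
    then show ?thesis using pair_key_big[OF assms(1) r] assms(2) by (simp add: Iset_def)
  next
    case False
    show ?thesis unfolding pair_key_off_diag[OF False] pair_key_off_diag[OF r] using assms(3) by linarith
  qed
qed

lemma inj_pair_key: "inj_on (pair_key d) (Iset d)"
proof (rule inj_onI, clarify)
  fix r s r' s' assume h: "(r, s) \<in> Iset d" "(r', s') \<in> Iset d" "pair_key d (r, s) = pair_key d (r', s')"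
  show "r = r' \<and> s = s'"
  proof (cases "r = Suc s \<or> r' = Suc s'")
    case True
    then show ?thesis using h pair_key_big[OF h(1)] pair_key_big[OF h(2)]
      by (cases "r = Suc s"; cases "r' = Suc s'") (auto simp: Iset_def)
  next
    case False
    then have "s = s'" using h pair_key_column[OF h(1,2)] pair_key_column[OF h(2,1)]
      by (metis less_irrefl nat_neq_iff)
    then show ?thesis using h pair_key_row[of r s d r'] pair_key_row[of r' s d r]
      by (metis less_irrefl nat_neq_iff)
  qed
qed

lemma finite_Iset: "finite (Iset d)"
  by (rule finite_subset[of _ "{..d+1} \<times> {..d+1}"]) (auto simp: Iset_def)

text \<open>
  If \<open>X i j\<close> were algebraic over the field \<open>M\<close> of the earlier entries, then \<open>m - t m = \<Sum> c e * f ^ p ^ e\<close>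
  for some \<open>m \<in> M\<close> and constants \<open>c e\<close>, where \<open>f = X i j - t (X i j)\<close>. The automorphism \<open>g\<close> adds \<open>u\<close> times column \<open>j + 1\<close> to
  column \<open>j\<close>, and \<open>g'\<close> adds column \<open>i\<close> to column \<open>j + 1\<close>. They commute on \<open>M\<close>; comparing
  \<open>g (g' m)\<close> with \<open>g' (g m)\<close> gives \<open>\<Sum> c e * u ^ p ^ e = 0\<close> for every constant \<open>u\<close>.
\<close>

theorem unipotent_tower:
  fixes t :: "'b::field \<Rightarrow> 'b" and X :: "nat \<Rightarrow> nat \<Rightarrow> 'b"
  assumes p: "prime p" "of_nat p = (0::'b)" and t: "hom_on UNIV t"
    and F0: "is_subfield F0" and tF0: "\<And>x. x \<in> F0 \<Longrightarrow> t x \<in> F0"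
    and U: "is_subfield U" "F0 \<subseteq> U" and XU: "\<And>i j. (i, j) \<in> Iset d \<Longrightarrow> X i j \<in> U"
    and const: "\<And>x. x \<in> U \<Longrightarrow> t x = x \<Longrightarrow> x \<in> F0"
    and inf: "infinite {x\<in>F0. t x = x}"
    and X1: "\<And>i. X i i = 1" and a: "\<And>i. 1 \<le> i \<Longrightarrow> i \<le> d \<Longrightarrow> a i \<in> F0"
    and eq: "\<And>i j. (i, j) \<in> Iset d \<Longrightarrow> X i j = t (X i j) + a (i - 1) * t (X (i - 1) j)"
    and base: "\<And>i. 1 \<le> i \<Longrightarrow> i \<le> d \<Longrightarrow> transc (gen_field F0 ((\<lambda>k. X (Suc k) k) ` {1..<i})) (X (Suc i) i)"
    and s: "s \<in> Iset d"
  shows "transc (gen_field F0 (case_prod X ` {r\<in>Iset d. pair_key d r < pair_key d s})) (case_prod X s)"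
  using s
proof (induction "pair_key d s" arbitrary: s rule: less_induct)
  case less
  obtain i j where s: "s = (i, j)" by (cases s)
  have ij: "(i, j) \<in> Iset d" using less s by simp
  have UN: "is_subfield (UNIV :: 'b set)" by (simp add: is_subfield_def)
  note T = hom_onD[OF UN t, simplified]
  note FF = subfieldD[OF F0]
  define N where "N = pair_key d s"
  define K where "K = {r\<in>Iset d. pair_key d r < N}"
  define M where "M = gen_field F0 (case_prod X ` K)"
  have M: "is_subfield M" unfolding M_def by (rule gen_field_subfield)
  note MM = subfieldD[OF M]
  have F0M: "F0 \<subseteq> M" unfolding M_def by (rule gen_field_base)
  have XM: "X r s \<in> M" if "(r, s) \<in> K" for r s
    unfolding M_def by (rule subsetD[OF gen_field_gens]) (use that in force)
  have aF0: "a (r - 1) \<in> F0" if "(r, s) \<in> Iset d" for r s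
    using that a[of "r - 1"] by (auto simp: Iset_def)
  show ?case
  proof (cases "i = Suc j")
    case True
    \<comment> \<open>For a subdiagonal entry the earlier entries are exactly the previous
      subdiagonal ones, so the hypothesis \<open>base\<close> applies directly.\<close>
    have "case_prod X ` K = (\<lambda>k. X (Suc k) k) ` {1..<j}"
    proof -
      have "K = (\<lambda>k. (Suc k, k)) ` {1..<j}"
      proof (intro equalityI subsetI)
        fix r assume r: "r \<in> K"
        obtain u v where uv: "r = (u, v)" by (cases r)
        have h: "(u, v) \<in> Iset d" "pair_key d (u, v) < Suc j" using r True by (auto simp: uv K_def N_def s)
        moreover have "j \<le> d" using ij True by (auto simp: Iset_def)
        ultimately have "u = Suc v" using pair_key_big[of u v d] by (cases "u = Suc v") auto
        then show "r \<in> (\<lambda>k. (Suc k, k)) ` {1..<j}" using h by (auto simp: uv Iset_def)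
      qed (use ij True in \<open>auto simp: K_def N_def s Iset_def\<close>)
      then show ?thesis by (simp add: image_image)
    qed
    then show ?thesis using base[of j] ij True unfolding M_def K_def N_def s
      by (auto simp: Iset_def)
  next
    case False
    have ij': "1 \<le> j" "j + 2 \<le> i" "i \<le> d + 1" using ij False by (auto simp: Iset_def)
    have big: "d + 1 < N" unfolding N_def s by (rule pair_key_big[OF ij False])
    have KD: "(Suc k, k) \<in> K" if "1 \<le> k" "k \<le> d" for k
      using that big by (auto simp: K_def Iset_def)
    have KC: "(r, c) \<in> K" if "j < c" "c < r" "r \<le> d + 1" for r c
      using pair_key_column[OF ij, of r c] that False ij' by (auto simp: K_def N_def s Iset_def)
    have KR: "(r, j) \<in> K" if "j < r" "r < i" for r
      using pair_key_row[OF ij, of r] that ij' by (auto simp: K_def N_def s Iset_def)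
    have KRD: "r < i" if "(r, j) \<in> K" "r \<noteq> Suc j" for r
      using that pair_key_row[of r j d i] ij
      by (metis (no_types, lifting) K_def N_def less_asym less_irrefl linorder_neqE_nat mem_Collect_eq s)
    have KI: "(r, c) \<in> Iset d" if "(r, c) \<in> K" for r c using that by (simp add: K_def)
    have Kdown: "(r - 1, c) \<in> K" if "(r, c) \<in> K" "r - 1 \<noteq> c" for r c
    proof -
      have "(r - 1, c) \<in> Iset d" using KI[OF that(1)] that(2) by (auto simp: Iset_def)
      then show ?thesis using pair_key_row[OF KI[OF that(1)], of "r - 1"] that(1)
        by (auto simp: K_def Iset_def)
    qed
    \<comment> \<open>Solving the difference equation for \<open>t (X r c)\<close> reduces it to
      \<open>t (X (r - 1) c)\<close>; the recursion ends at the diagonal, where the entry is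
      1.\<close>
    have tXM: "t (X r c) \<in> M" if "(r, c) \<in> K" for r c
      using that
    proof (induction r)
      case (Suc r)
      have e: "X (Suc r) c = t (X (Suc r) c) + a r * t (X r c)" using eq[OF KI[OF Suc.prems]] by simp
      have "t (X r c) \<in> M"
      proof (cases "r = c")
        case True then show ?thesis using X1 T MM by simp
      next
        case False then show ?thesis using Suc Kdown[OF Suc.prems] by simp
      qed
      moreover have "a r \<in> M" using aF0[OF KI[OF Suc.prems]] F0M by auto
      ultimately have "X (Suc r) c - a r * t (X r c) \<in> M" using XM[OF Suc.prems] by (intro MM)
      moreover have "t (X (Suc r) c) = X (Suc r) c - a r * t (X r c)" using e by (metis add_diff_cancel_right')
      ultimately show ?case by simp
    qed (use KI in \<open>auto simp: Iset_def\<close>)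
    have tM: "t x \<in> M" if "x \<in> M" for x
    proof (rule hom_on_image_gen_field[where F = F0 and S = "case_prod X ` K" and g = t and x = x])
      show "hom_on (gen_field F0 (case_prod X ` K)) t" using t by (simp add: hom_on_def)
    qed (use M tF0 F0M tXM that in \<open>auto simp: M_def[symmetric]\<close>)
    have MU: "M \<subseteq> U" unfolding M_def
      by (rule gen_field_least[OF U]) (use XU KI in force)
    define Z where "Z = X i j"
    define f where "f = a (i - 1) * t (X (i - 1) j)"
    have i1: "(i - 1, j) \<in> K" using ij' by (intro KR) auto
    have fM: "f \<in> M" unfolding f_def using aF0[OF ij] F0M tXM[OF i1] by (intro MM) auto
    have Zeq: "Z = t Z + f" unfolding Z_def f_def by (rule eq[OF ij])
    \<comment> \<open>If \<open>w\<close> solves the same linear equations with zero diagonal, then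
      so does \<open>X + w\<close> with unit diagonal. Hence the shift by \<open>w\<close> commutes
      with \<open>t\<close> on the generators and therefore on \<open>M\<close>.\<close>
    have auto_ex: "\<exists>g. hom_on M g \<and> (\<forall>y\<in>M. g y \<in> M) \<and> (\<forall>c\<in>F0. g c = c) \<and>
        (\<forall>(r, c)\<in>K. g (X r c) = X r c + w r c) \<and> (\<forall>y\<in>M. g (t y) = t (g y))"
      if w: "\<And>r c. (r, c) \<in> K \<Longrightarrow> w r c \<in> gen_field F0 (case_prod X ` {u\<in>Iset d. pair_key d u < pair_key d (r, c)})"
        and w0: "\<And>c. w c c = 0"
        and weq: "\<And>r c. (r, c) \<in> K \<Longrightarrow> w r c = t (w r c) + a (r - 1) * t (w (r - 1) c)" for w
    proof -
      have "\<exists>g. hom_on (gen_field F0 (case_prod X ` {r\<in>Iset d. pair_key d r < N})) g \<and>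
        (\<forall>y\<in>gen_field F0 (case_prod X ` {r\<in>Iset d. pair_key d r < N}).
          g y \<in> gen_field F0 (case_prod X ` {r\<in>Iset d. pair_key d r < N})) \<and>
        (\<forall>c\<in>F0. g c = c) \<and> (\<forall>s\<in>Iset d. pair_key d s < N \<longrightarrow> g (case_prod X s) = case_prod X s + case_prod w s)"
      proof (rule hom_on_tower_shift[OF F0 inj_pair_key])
        fix u assume u: "u \<in> Iset d" "pair_key d u < N"
        show "transc (gen_field F0 (case_prod X ` {r\<in>Iset d. pair_key d r < pair_key d u})) (case_prod X u)"
          using less.hyps[of u] u by (simp add: N_def)
        show "case_prod w u \<in> gen_field F0 (case_prod X ` {r\<in>Iset d. pair_key d r < pair_key d u})"
          using w u by (cases u) (auto simp: K_def)
      qed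
      then obtain g where g: "hom_on M g" "\<forall>y\<in>M. g y \<in> M" "\<forall>c\<in>F0. g c = c"
        "\<forall>s\<in>Iset d. pair_key d s < N \<longrightarrow> g (case_prod X s) = case_prod X s + case_prod w s"
        unfolding M_def K_def by blast
      have gX: "g (X r c) = X r c + w r c" if "(r, c) \<in> K" for r c
        using g(4) that by (auto simp: K_def)
      note G = hom_onD[OF M g(1)]
      have comm: "g (t (X r c)) = t (g (X r c))" if "(r, c) \<in> K" for r c
        using that
      proof (induction r)
        case (Suc r)
        have e: "t (X (Suc r) c) = X (Suc r) c - a r * t (X r c)"
          using eq[OF KI[OF Suc.prems]] by (metis add_diff_cancel_right' diff_Suc_1)
        have we: "w (Suc r) c = t (w (Suc r) c) + a r * t (w r c)"
          using weq[OF Suc.prems] by simp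
        have IH: "g (t (X r c)) = t (X r c) + t (w r c)" "t (X r c) \<in> M"
        proof -
          have "g (t (X r c)) = t (X r c) + t (w r c) \<and> t (X r c) \<in> M"
          proof (cases "r = c")
            case True then show ?thesis using X1 T MM G w0 by simp
          next
            case False
            then have "(r, c) \<in> K" using Kdown[OF Suc.prems] by simp
            then show ?thesis using Suc.IH gX tXM T by simp
          qed
          then show "g (t (X r c)) = t (X r c) + t (w r c)" "t (X r c) \<in> M" by auto
        qed
        have ar: "a r \<in> M" "g (a r) = a r" using aF0[OF KI[OF Suc.prems]] F0M g(3) by auto
        have "g (t (X (Suc r) c)) = g (X (Suc r) c) - g (a r) * g (t (X r c))"
          unfolding e using XM[OF Suc.prems] ar IH(2) MM by (simp add: G)
        also have "\<dots> = X (Suc r) c - a r * t (X r c) + (w (Suc r) c - a r * t (w r c))"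
          using gX[OF Suc.prems] ar IH by (simp add: algebra_simps)
        also have "w (Suc r) c - a r * t (w r c) = t (w (Suc r) c)" using we by (metis add_diff_cancel_right')
        also have "X (Suc r) c - a r * t (X r c) = t (X (Suc r) c)" using e by simp
        finally show ?case using gX[OF Suc.prems] T by simp
      qed (use KI in \<open>auto simp: Iset_def\<close>)
      have "(g \<circ> t) y = (t \<circ> g) y" if "y \<in> M" for y
      proof (rule hom_on_eqI[of F0 "case_prod X ` K" "g \<circ> t" "t \<circ> g"])
        show "hom_on (gen_field F0 (case_prod X ` K)) (g \<circ> t)" unfolding M_def[symmetric]
          by (rule hom_on_comp[OF hom_on_subset[OF t subset_UNIV] g(1) tM])
        show "hom_on (gen_field F0 (case_prod X ` K)) (t \<circ> g)" unfolding M_def[symmetric]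
          by (rule hom_on_comp[OF g(1) t]) simp
      qed (use that comm g(3) tF0 in \<open>auto simp: M_def[symmetric]\<close>)
      then have "\<forall>y\<in>M. g (t y) = t (g y)" by simp
      moreover have "\<forall>(r, c)\<in>K. g (X r c) = X r c + w r c" using gX by auto
      ultimately show ?thesis using g(1-3) by blast
    qed
    have Xgen: "X r c \<in> gen_field F0 (case_prod X ` {u\<in>Iset d. pair_key d u < n})"
      if "(r, c) \<in> Iset d" "pair_key d (r, c) < n" for r c n
      by (rule subsetD[OF gen_field_gens]) (use that in force)
    note GG = subfieldD[OF gen_field_subfield]
    show ?thesis
    proof (rule ccontr)
      assume "\<not> ?thesis"
      then have nt: "\<not> transc M Z" by (simp add: M_def K_def N_def s Z_def)
      obtain E c m where c: "\<And>e. e \<le> E \<Longrightarrow> c e \<in> M" "\<And>e. e \<le> E \<Longrightarrow> t (c e) = c e" "c E = 1" "m \<in> M"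
        "m - t m = (\<Sum>e\<le>E. c e * f ^ (p ^ e))"
        using algebraic_additive_relation[OF p t M tM Zeq fM nt] by blast
      have cF0: "c e \<in> F0" if "e \<le> E" for e using c that MU const by auto
      define Y where "Y = X i (j + 1)"
      have YK: "(i, j + 1) \<in> K" using ij' by (intro KC) auto
      have YM: "Y \<in> M" unfolding Y_def by (rule XM[OF YK])
      \<comment> \<open>Column \<open>i\<close> of \<open>X\<close>, placed in column
        \<open>j + 1\<close>. In row \<open>i\<close> it equals \<open>X i i = 1\<close>, so
        \<open>Y\<close> is moved to \<open>Y + 1\<close>.\<close>
      define w' where "w' r c = (if c = j + 1 \<and> i \<le> r then X r i else 0)" for r c
      have "\<exists>g. hom_on M g \<and> (\<forall>y\<in>M. g y \<in> M) \<and> (\<forall>c\<in>F0. g c = c) \<and>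
        (\<forall>(r, c)\<in>K. g (X r c) = X r c + w' r c) \<and> (\<forall>y\<in>M. g (t y) = t (g y))"
      proof (rule auto_ex)
        fix r c assume rc: "(r, c) \<in> K"
        show "w' r c \<in> gen_field F0 (case_prod X ` {u\<in>Iset d. pair_key d u < pair_key d (r, c)})"
        proof (cases "c = j + 1 \<and> i < r")
          case True
          then have "(r, i) \<in> Iset d" "(r, j + 1) \<in> Iset d" using KI[OF rc] ij' by (auto simp: Iset_def)
          moreover have "pair_key d (r, i) < pair_key d (r, j + 1)"
            by (rule pair_key_column) (use calculation True ij' in auto)
          ultimately show ?thesis using True by (auto simp: w'_def intro!: Xgen)
        qed (use X1 GG in \<open>auto simp: w'_def\<close>)
        show "w' r c = t (w' r c) + a (r - 1) * t (w' (r - 1) c)"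
        proof (cases "c = j + 1 \<and> i < r")
          case True
          then have "(r, i) \<in> Iset d" using KI[OF rc] ij' by (auto simp: Iset_def)
          moreover have "i \<le> r - 1" using True by auto
          ultimately show ?thesis using eq[of r i] True by (simp add: w'_def)
        next
          case False
          then show ?thesis using X1 T ij' by (auto simp: w'_def)
        qed
      next
        show "w' c c = 0" for c using ij' by (auto simp: w'_def)
      qed
      then obtain g' where g'0: "hom_on M g' \<and> (\<forall>y\<in>M. g' y \<in> M) \<and> (\<forall>c\<in>F0. g' c = c) \<and>
        (\<forall>(r, c)\<in>K. g' (X r c) = X r c + w' r c) \<and> (\<forall>y\<in>M. g' (t y) = t (g' y))" ..
      then have g': "hom_on M g'" "\<And>y. y \<in> M \<Longrightarrow> g' y \<in> M" "\<And>c. c \<in> F0 \<Longrightarrow> g' c = c"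
        "\<And>r c. (r, c) \<in> K \<Longrightarrow> g' (X r c) = X r c + w' r c" "\<And>y. y \<in> M \<Longrightarrow> g' (t y) = t (g' y)"
        by auto
      note G' = hom_onD[OF M g'(1)]
      have zero: "(\<Sum>e\<le>E. c e * u ^ (p ^ e)) = 0" if u: "u \<in> F0" "t u = u" for u
      proof -
        \<comment> \<open>Column \<open>j + 1\<close> multiplied by the constant \<open>u\<close>,
          placed in column \<open>j\<close>. Constancy of \<open>u\<close> preserves the difference
          equations.\<close>
        define w where "w r c = (if c = j \<and> j + 1 \<le> r then u * X r (j + 1) else 0)" for r c
        have "\<exists>g. hom_on M g \<and> (\<forall>y\<in>M. g y \<in> M) \<and> (\<forall>c\<in>F0. g c = c) \<and>
          (\<forall>(r, c)\<in>K. g (X r c) = X r c + w r c) \<and> (\<forall>y\<in>M. g (t y) = t (g y))"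
        proof (rule auto_ex)
          fix r c assume rc: "(r, c) \<in> K"
          have uG: "u \<in> gen_field F0 S" for S using u gen_field_base[of F0 S] by auto
          show "w r c \<in> gen_field F0 (case_prod X ` {u\<in>Iset d. pair_key d u < pair_key d (r, c)})"
          proof (cases "c = j \<and> j + 1 < r")
            case True
            then have "(r, j + 1) \<in> Iset d" "(r, j) \<in> Iset d" using KI[OF rc] ij' by (auto simp: Iset_def)
            moreover have "pair_key d (r, j + 1) < pair_key d (r, j)"
              by (rule pair_key_column) (use calculation True ij' in auto)
            ultimately show ?thesis using True uG by (auto simp: w_def intro!: Xgen GG(4))
          qed (use X1 GG uG in \<open>auto simp: w_def\<close>)
          show "w r c = t (w r c) + a (r - 1) * t (w (r - 1) c)"
          proof (cases "c = j \<and> j + 1 < r")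
            case True
            then have "(r, j + 1) \<in> Iset d" using KI[OF rc] ij' by (auto simp: Iset_def)
            moreover have "j + 1 \<le> r - 1" using True by auto
            ultimately have "u * X r (j + 1) = t (u * X r (j + 1)) + a (r - 1) * t (u * X (r - 1) (j + 1))"
              using eq[of r "j + 1"] T u by (metis distrib_left mult.left_commute)
            then show ?thesis using True \<open>j + 1 \<le> r - 1\<close> by (simp add: w_def)
          next
            case False
            then show ?thesis using X1 T u by (auto simp: w_def)
          qed
        next
          show "w c c = 0" for c by (auto simp: w_def)
        qed
        then obtain g where g0: "hom_on M g \<and> (\<forall>y\<in>M. g y \<in> M) \<and> (\<forall>c\<in>F0. g c = c) \<and>
          (\<forall>(r, c)\<in>K. g (X r c) = X r c + w r c) \<and> (\<forall>y\<in>M. g (t y) = t (g y))" ..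
        then have g: "hom_on M g" "\<And>y. y \<in> M \<Longrightarrow> g y \<in> M" "\<And>c. c \<in> F0 \<Longrightarrow> g c = c"
          "\<And>r c. (r, c) \<in> K \<Longrightarrow> g (X r c) = X r c + w r c" "\<And>y. y \<in> M \<Longrightarrow> g (t y) = t (g y)"
          by auto
        note G = hom_onD[OF M g(1)]
        have gs: "g (\<Sum>e\<le>E. h e) = (\<Sum>e\<le>E. g (h e))" if "\<And>e. e \<le> E \<Longrightarrow> h e \<in> M" for h
          using that by (intro hom_on_sum[OF M g(1)]) auto
        have gs': "g' (\<Sum>e\<le>E. h e) = (\<Sum>e\<le>E. g' (h e))" if "\<And>e. e \<le> E \<Longrightarrow> h e \<in> M" for h
          using that by (intro hom_on_sum[OF M g'(1)]) auto
        have ts: "t (\<Sum>e\<le>E. h e) = (\<Sum>e\<le>E. t (h e))" for h :: "nat \<Rightarrow> 'b"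
          by (intro hom_on_sum[OF _ t]) (auto simp: is_subfield_def)
        have comm: "g (g' y) = g' (g y)" if "y \<in> M" for y
        proof -
          have "(g \<circ> g') y = (g' \<circ> g) y"
          proof (rule hom_on_eqI[of F0 "case_prod X ` K" "g \<circ> g'" "g' \<circ> g"])
            show "hom_on (gen_field F0 (case_prod X ` K)) (g \<circ> g')" unfolding M_def[symmetric]
              by (rule hom_on_comp[OF g'(1) g(1) g'(2)])
            show "hom_on (gen_field F0 (case_prod X ` K)) (g' \<circ> g)" unfolding M_def[symmetric]
              by (rule hom_on_comp[OF g(1) g'(1) g(2)])
            fix x assume "x \<in> case_prod X ` K"
            then obtain r k where x: "x = X r k" "(r, k) \<in> K" by auto
            have wM: "w r k \<in> M"
            proof (cases "k = j \<and> j + 1 < r")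
              case True
              then have "(r, j + 1) \<in> K" using KI[OF x(2)] ij' by (intro KC) (auto simp: Iset_def)
              then show ?thesis using True XM u F0M MM(4) by (auto simp: w_def)
            next
              case False
              then show ?thesis using X1 MM(1) u F0M by (auto simp: w_def le_Suc_eq)
            qed
            have w'M: "w' r k \<in> M"
            proof (cases "k = j + 1 \<and> i < r")
              case True
              then have "(r, i) \<in> K" using KI[OF x(2)] ij' by (intro KC) (auto simp: Iset_def)
              then show ?thesis using True XM by (auto simp: w'_def)
            qed (use X1 MM in \<open>auto simp: w'_def\<close>)
            \<comment> \<open>Entries of column \<open>j\<close> in \<open>K\<close> beyond the
              subdiagonal have row index less than \<open>i\<close>. In these rows \<open>g'\<close>
              does not move column \<open>j + 1\<close>.\<close>
            have 1: "g' (w r k) = w r k"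
            proof (cases "k = j \<and> j + 1 < r")
              case True
              then have r: "r < i" using KRD x by auto
              have k: "(r, j + 1) \<in> K" using True KI[OF x(2)] by (intro KC) (auto simp: Iset_def)
              have "g' (X r (j + 1)) = X r (j + 1)" using g'(4)[OF k] r by (simp add: w'_def)
              then show ?thesis using True G'(4)[of u "X r (j + 1)"] u F0M g'(3) XM[OF k]
                by (auto simp: w_def)
            next
              case False
              then show ?thesis using X1 u g'(3) FF G' by (auto simp: w_def)
            qed
            have 2: "g (w' r k) = w' r k"
            proof (cases "k = j + 1 \<and> i < r")
              case True
              then have "(r, i) \<in> K" using KI[OF x(2)] ij' by (intro KC) (auto simp: Iset_def)
              then show ?thesis using True g(4)[of r i] ij' by (auto simp: w'_def w_def)
            next
              case False
              then show ?thesis using X1 G by (auto simp: w'_def)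
            qed
            show "(g \<circ> g') x = (g' \<circ> g) x" using x wM w'M 1 2 g(4) g'(4) XM G G' by simp
          qed (use that g(3) g'(3) in \<open>auto simp: M_def[symmetric]\<close>)
          then show ?thesis by simp
        qed
        \<comment> \<open>The change of \<open>f\<close> under \<open>g\<close> is
          \<open>u * (Y - t Y)\<close>, which is \<open>u * Y - t (u * Y)\<close>. So
          \<open>D\<close>, the \<open>p\<close>-polynomial with coefficients \<open>c\<close> at
          \<open>u * Y\<close>, has the same difference \<open>D - t D\<close> as
          \<open>g m - m\<close>.\<close>
        define D where "D = (\<Sum>e\<le>E. c e * u ^ (p ^ e) * Y ^ (p ^ e))"
        have uM: "u \<in> M" using u F0M by auto
        have i1j: "(i - 1, j + 1) \<in> K \<or> i - 1 = j + 1" using ij' by (cases "i - 1 = j + 1") (auto intro!: KC)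
        have i1M: "X (i - 1) (j + 1) \<in> M" using i1j XM X1 MM by auto
        have gi1: "g (X (i - 1) j) = X (i - 1) j + u * X (i - 1) (j + 1)"
          using g(4)[OF i1] ij' by (simp add: w_def)
        have aM: "a (i - 1) \<in> M" "g (a (i - 1)) = a (i - 1)" "g' (a (i - 1)) = a (i - 1)"
          using aF0[OF ij] F0M g(3) g'(3) by auto
        have Yeq: "Y = t Y + a (i - 1) * t (X (i - 1) (j + 1))"
          unfolding Y_def by (rule eq[OF KI[OF YK]])
        have gf: "g f = f + u * (Y - t Y)"
        proof -
          have "g f = a (i - 1) * t (g (X (i - 1) j))"
            unfolding f_def using G(4) aM tXM[OF i1] g(5)[OF XM[OF i1]] by simp
          also have "\<dots> = f + u * (a (i - 1) * t (X (i - 1) (j + 1)))"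
            unfolding gi1 f_def using T u by (simp add: algebra_simps)
          also have "a (i - 1) * t (X (i - 1) (j + 1)) = Y - t Y" using Yeq by (metis add_diff_cancel_left')
          finally show ?thesis .
        qed
        have g'f: "g' f = f"
        proof -
          have "g' f = a (i - 1) * t (g' (X (i - 1) j))"
            unfolding f_def using G'(4) aM tXM[OF i1] g'(5)[OF XM[OF i1]] by simp
          then show ?thesis using g'(4)[OF i1] by (simp add: w'_def f_def)
        qed
        have cM: "e \<le> E \<Longrightarrow> c e \<in> M" "e \<le> E \<Longrightarrow> g (c e) = c e" "e \<le> E \<Longrightarrow> g' (c e) = c e" for e
          using c cF0 g(3) g'(3) by auto
        have DM: "D \<in> M" unfolding D_def using c uM YM by (intro subfield_sum[OF M] MM) auto
        have tY: "t Y \<in> M" using YM tM by simp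
        \<comment> \<open>The deviation of \<open>g m\<close> from \<open>m + D\<close> is fixed by
          \<open>t\<close>; hence it lies in \<open>F0\<close>, and both \<open>g\<close> and
          \<open>g'\<close> fix it.\<close>
        define \<kappa> where "\<kappa> = g m - m - D"
        have \<kappa>M: "\<kappa> \<in> M" unfolding \<kappa>_def using g(2) c DM by (intro MM) auto
        have "\<kappa> - t \<kappa> = (g m - t (g m)) - (m - t m) - (D - t D)"
          unfolding \<kappa>_def by (simp add: T)
        also have "g m - t (g m) = g (m - t m)" using g(5)[OF c(4)] G(6)[OF c(4) tM[OF c(4)]] by simp
        also have "g (m - t m) = (\<Sum>e\<le>E. c e * g f ^ (p ^ e))"
          unfolding c(5) using cM fM MM by (simp add: gs G)
        also have "D - t D = (\<Sum>e\<le>E. c e * (u * (Y - t Y)) ^ (p ^ e))"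
          unfolding D_def using c(2) u T
          by (simp add: ts power_mult_distrib frobenius_diff[OF p] sum_subtractf[symmetric] algebra_simps)
        also have "(\<Sum>e\<le>E. c e * g f ^ (p ^ e)) = (m - t m) + (\<Sum>e\<le>E. c e * (u * (Y - t Y)) ^ (p ^ e))"
          unfolding c(5) gf frobenius_add[OF p] by (simp add: distrib_left sum.distrib)
        finally have "t \<kappa> = \<kappa>" by simp
        then have \<kappa>F: "\<kappa> \<in> F0" using const \<kappa>M MU by auto
        define \<kappa>' where "\<kappa>' = g' m - m"
        have "\<kappa>' - t \<kappa>' = (g' m - t (g' m)) - (m - t m)" unfolding \<kappa>'_def by (simp add: T)
        also have "g' m - t (g' m) = g' (m - t m)" using g'(5)[OF c(4)] G'(6)[OF c(4) tM[OF c(4)]] by simp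
        also have "g' (m - t m) = m - t m"
          unfolding c(5) using cM fM MM g'f by (simp add: gs' G')
        finally have "t \<kappa>' = \<kappa>'" by simp
        moreover have "\<kappa>' \<in> M" unfolding \<kappa>'_def using g'(2) c by (intro MM) auto
        ultimately have \<kappa>'F: "\<kappa>' \<in> F0" using const MU by auto
        have gm: "g m = m + D + \<kappa>" by (simp add: \<kappa>_def)
        have g'm: "g' m = m + \<kappa>'" by (simp add: \<kappa>'_def)
        have g'Y: "g' Y = Y + 1" unfolding Y_def using g'(4)[OF YK] X1 by (simp add: w'_def)
        have g'D: "g' D = D + (\<Sum>e\<le>E. c e * u ^ (p ^ e))"
        proof -
          have "g' D = (\<Sum>e\<le>E. c e * u ^ (p ^ e) * (Y + 1) ^ (p ^ e))"
            unfolding D_def using cM u g'(3) YM uM MM by (simp add: gs' G' g'Y)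
          then show ?thesis unfolding D_def frobenius_add[OF p]
            by (simp add: distrib_left sum.distrib)
        qed
        have "g' (g m) = m + \<kappa>' + (D + (\<Sum>e\<le>E. c e * u ^ (p ^ e))) + \<kappa>"
          unfolding gm using G' c DM \<kappa>M MM \<kappa>F g'(3) by (simp add: g'D g'm)
        moreover have "g (g' m) = m + D + \<kappa> + \<kappa>'"
          unfolding g'm using G c \<kappa>'F F0M g(3) by (auto simp: gm)
        ultimately show ?thesis using comm[of m] c by (simp add: algebra_simps)
      qed
      \<comment> \<open>This polynomial is nonzero since \<open>c E = 1\<close>, yet it vanishes at
        all of the infinitely many constants.\<close>
      define P where "P = (\<Sum>e\<le>E. monom (c e) (p ^ e))"
      have p1: "1 < p" using p(1) by (rule prime_gt_1_nat)
      have "coeff P (p ^ E) = (\<Sum>e\<le>E. if e = E then c e else 0)"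
        unfolding P_def coeff_sum by (intro sum.cong refl) (use p1 in auto)
      then have "P \<noteq> 0" using c(3) by auto
      moreover have "{x\<in>F0. t x = x} \<subseteq> {x. poly P x = 0}"
        using zero by (auto simp: P_def poly_sum poly_monom)
      ultimately show False using inf poly_roots_finite[of P] finite_subset by blast
    qed
  qed
qed

subsection \<open>Power series on a closed disc over a complete non-archimedean field\<close>

locale carlitz =
  fixes absv :: "'a::field \<Rightarrow> real" and p k q :: nat and \<theta> :: 'a
  assumes field: "complete_alg_closed_nonarch absv"
    and p: "prime p" and charp: "of_nat p = (0::'a)"
    and k: "k \<ge> 1" and q: "q = p ^ k"
    and theta: "absv \<theta> > 1"
begin

lemma av_nonneg [simp]: "0 \<le> absv x"
  and av_zero_iff [simp]: "absv x = 0 \<longleftrightarrow> x = 0"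
  and av_mult: "absv (x * y) = absv x * absv y"
  and av_add_max: "absv (x + y) \<le> max (absv x) (absv y)"
  and av_complete: "cauchy_abs absv s \<Longrightarrow> \<exists>L. conv_abs absv s L"
  and alg_closed: "degree r \<ge> 1 \<Longrightarrow> \<exists>x. poly (r :: 'a poly) x = 0"
  using field unfolding complete_alg_closed_nonarch_def by auto

lemma av_0 [simp]: "absv 0 = 0" by simp

lemma av_1 [simp]: "absv 1 = 1"
proof -
  have "absv 1 * absv 1 = absv 1 * 1" using av_mult[of 1 1] by simp
  then show ?thesis by (simp only: mult_cancel_left) simp
qed

lemma av_power: "absv (x ^ n) = absv x ^ n"
  by (induction n) (auto simp: av_mult)

lemma av_prod: "absv (prod f A) = (\<Prod>i\<in>A. absv (f i))"
  by (induction A rule: infinite_finite_induct) (auto simp: av_mult)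

lemma av_minus [simp]: "absv (- x) = absv x"
proof -
  have "absv (-1) ^ 2 = absv ((-1) ^ 2)" by (simp only: av_power)
  then have "absv (-1) ^ 2 = 1 ^ 2" by simp
  then have "absv (-1) = 1" by (metis av_nonneg power_eq_iff_eq_base zero_less_numeral zero_le_one pos2)
  then show ?thesis using av_mult[of "-1" x] by simp
qed

lemma av_inverse: "absv (inverse x) = inverse (absv x)"
proof (cases "x = 0")
  case False
  then have "absv x * absv (inverse x) = 1" using av_mult[of x "inverse x"] by simp
  then show ?thesis by (simp add: inverse_unique)
qed simp

lemma av_divide: "absv (x / y) = absv x / absv y"
  by (simp add: divide_inverse av_mult av_inverse)

lemma av_add_le: "absv x \<le> B \<Longrightarrow> absv y \<le> B \<Longrightarrow> absv (x + y) \<le> B"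
  using av_add_max[of x y] by simp

lemma av_diff_le: "absv x \<le> B \<Longrightarrow> absv y \<le> B \<Longrightarrow> absv (x - y) \<le> B"
  using av_add_le[of x B "-y"] by simp

lemma av_add_less: "absv x < B \<Longrightarrow> absv y < B \<Longrightarrow> absv (x + y) < B"
  using av_add_max[of x y] by simp

lemma av_diff_less: "absv x < B \<Longrightarrow> absv y < B \<Longrightarrow> absv (x - y) < B"
  using av_add_less[of x B "-y"] by simp

lemma av_diff_commute: "absv (x - y) = absv (y - x)"
  using av_minus[of "x - y"] by simp

lemma av_sum_le: "0 \<le> B \<Longrightarrow> (\<And>i. i \<in> A \<Longrightarrow> absv (f i) \<le> B) \<Longrightarrow> absv (sum f A) \<le> B"
  by (induction A rule: infinite_finite_induct) (auto intro: av_add_le)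

lemma av_sum_less: "0 < B \<Longrightarrow> (\<And>i. i \<in> A \<Longrightarrow> absv (f i) < B) \<Longrightarrow> absv (sum f A) < B"
  by (induction A rule: infinite_finite_induct) (auto intro: av_add_less)

lemma av_dominant:
  assumes "absv x < absv y" shows "absv (x - y) = absv y" "absv (y - x) = absv y"
proof -
  have "absv (y - x) \<le> absv y" using assms by (intro av_diff_le) auto
  moreover have "absv y \<le> absv (y - x)"
  proof (rule ccontr)
    assume "\<not> ?thesis"
    then have "absv ((y - x) + x) < absv y" using assms by (intro av_add_less) auto
    then show False by simp
  qed
  ultimately show "absv (y - x) = absv y" by simp
  then show "absv (x - y) = absv y" by (simp add: av_diff_commute)
qed

lemma conv_unique: "conv_abs absv s L \<Longrightarrow> conv_abs absv s L' \<Longrightarrow> L = L'"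
proof (rule ccontr)
  assume h: "conv_abs absv s L" "conv_abs absv s L'" "L \<noteq> L'"
  then have e: "absv (L - L') > 0" by (metis av_nonneg av_zero_iff less_eq_real_def right_minus_eq)
  obtain N where N: "\<forall>n\<ge>N. absv (s n - L) < absv (L - L')"
    using h(1) e unfolding conv_abs_def by blast
  obtain N' where N': "\<forall>n\<ge>N'. absv (s n - L') < absv (L - L')"
    using h(2) e unfolding conv_abs_def by blast
  have "absv ((s (max N N') - L') - (s (max N N') - L)) < absv (L - L')"
    by (rule av_diff_less) (use N N' in simp_all)
  then show False by simp
qed

lemma lim_absI: "conv_abs absv s L \<Longrightarrow> lim_abs absv s = L"
  unfolding lim_abs_def using conv_unique by blast

lemma q_gt_1: "1 < q"
  using p k q by (metis One_nat_def Suc_le_lessD nat_less_le one_less_power prime_gt_1_nat zero_less_one)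

lemma frob_add: "(x + y :: 'a) ^ (q ^ n) = x ^ (q ^ n) + y ^ (q ^ n)"
  unfolding q power_mult[symmetric] by (rule frobenius_add[OF p charp])

lemma frob_diff: "(x - y :: 'a) ^ (q ^ n) = x ^ (q ^ n) - y ^ (q ^ n)"
  unfolding q power_mult[symmetric] by (rule frobenius_diff[OF p charp])

lemma frob_sum:
  fixes f :: "'i \<Rightarrow> 'a"
  shows "(sum f A :: 'a) ^ (q ^ n) = (\<Sum>i\<in>A. f i ^ (q ^ n))"
  unfolding q power_mult[symmetric] by (rule frobenius_sum[OF p charp])

lemma q_pos [simp]: "0 < q" using q_gt_1 by simp

lemma q_nz [simp]: "q \<noteq> 0" using q_gt_1 by simp

lemma small_inverse: "0 < e \<Longrightarrow> \<exists>N. \<forall>n\<ge>N. inverse (real (Suc n)) \<le> e"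
proof -
  assume "0 < e"
  then obtain N where N: "inverse (real (Suc N)) < e" using reals_Archimedean by blast
  have "inverse (real (Suc n)) \<le> e" if "N \<le> n" for n
  proof -
    have "inverse (real (Suc n)) \<le> inverse (real (Suc N))" using that by (intro le_imp_inverse_le) auto
    then show ?thesis using N by linarith
  qed
  then show ?thesis by blast
qed

definition R :: real where "R = absv \<theta>"

lemma R_gt_1: "1 < R" by (simp add: R_def theta)

lemma R_pos [simp]: "0 < R" "0 \<le> R" "R \<noteq> 0" using R_gt_1 by auto

lemma R_pow_ge_1 [simp]: "1 \<le> R ^ n" using R_gt_1 by simp

lemma theta_nz [simp]: "\<theta> \<noteq> 0" using theta by auto

text \<open>\<open>gle f B\<close> bounds the Gauss norm of \<open>f\<close> on the disc of radius \<open>R = |\<theta>|\<close> by \<open>B\<close>.\<close>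

definition gle :: "'a fps \<Rightarrow> real \<Rightarrow> bool" where
  "gle f B \<longleftrightarrow> (\<forall>n. absv (fps_nth f n) * R ^ n \<le> B)"

lemma gleD: "gle f B \<Longrightarrow> absv (fps_nth f n) * R ^ n \<le> B" by (simp add: gle_def)

lemma gle_nonneg: "gle f B \<Longrightarrow> 0 \<le> B"
  using gleD[of f B 0] order_trans[OF av_nonneg[of "fps_nth f 0"]] by simp

lemma gle_mono: "gle f B \<Longrightarrow> B \<le> C \<Longrightarrow> gle f C"
  unfolding gle_def by (meson order_trans)

lemma gle_0 [simp]: "0 \<le> B \<Longrightarrow> gle 0 B" by (simp add: gle_def)

lemma gle_add: "gle f B \<Longrightarrow> gle g B \<Longrightarrow> gle (f + g) B"
  unfolding gle_def
proof
  fix n assume h: "\<forall>n. absv (fps_nth f n) * R ^ n \<le> B" "\<forall>n. absv (fps_nth g n) * R ^ n \<le> B"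
  have "absv (fps_nth f n) \<le> B / R ^ n" "absv (fps_nth g n) \<le> B / R ^ n"
    using h by (simp_all add: pos_le_divide_eq)
  then have "absv (fps_nth (f + g) n) \<le> B / R ^ n" by (simp add: av_add_le)
  then show "absv (fps_nth (f + g) n) * R ^ n \<le> B" by (simp add: pos_le_divide_eq)
qed

lemma gle_uminus: "gle f B \<Longrightarrow> gle (- f) B"
  by (simp add: gle_def)

lemma gle_diff: "gle f B \<Longrightarrow> gle g B \<Longrightarrow> gle (f - g) B"
  using gle_add[of f B "-g"] gle_uminus by simp

lemma gle_sum: "0 \<le> B \<Longrightarrow> (\<And>i. i \<in> A \<Longrightarrow> gle (f i) B) \<Longrightarrow> gle (sum f A) B"
  by (induction A rule: infinite_finite_induct) (auto intro: gle_add)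

lemma gle_mult:
  assumes "gle f B" "gle g C" shows "gle (f * g) (B * C)"
  unfolding gle_def
proof
  fix n
  have "absv (fps_nth (f * g) n) \<le> B * C / R ^ n"
    unfolding fps_mult_nth
  proof (rule av_sum_le)
    show "0 \<le> B * C / R ^ n" using gle_nonneg[OF assms(1)] gle_nonneg[OF assms(2)] by simp
    fix i assume "i \<in> {0..n}"
    then have "R ^ n = R ^ i * R ^ (n - i)" by (simp add: power_add[symmetric])
    moreover have "(absv (fps_nth f i) * R ^ i) * (absv (fps_nth g (n - i)) * R ^ (n - i)) \<le> B * C"
      by (intro mult_mono gleD assms mult_nonneg_nonneg gle_nonneg[OF assms(1)]) auto
    ultimately show "absv (fps_nth f i * fps_nth g (n - i)) \<le> B * C / R ^ n"
      by (simp add: pos_le_divide_eq av_mult mult_ac)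
  qed
  then show "absv (fps_nth (f * g) n) * R ^ n \<le> B * C" by (simp add: pos_le_divide_eq)
qed

lemma gle_prod: "(\<And>i. i \<in> A \<Longrightarrow> gle (f i) (B i)) \<Longrightarrow> gle (prod f A) (prod B A)"
proof (induction A rule: infinite_finite_induct)
  case (infinite A) then show ?case by (auto simp: gle_def)
next
  case empty then show ?case by (auto simp: gle_def)
qed (auto intro: gle_mult)

lemma gle_power: "gle f B \<Longrightarrow> gle (f ^ n) (B ^ n)"
  using gle_prod[of "{..<n}" "\<lambda>_. f" "\<lambda>_. B"] by simp

lemma gle_const: "absv c \<le> B \<Longrightarrow> gle (fps_const c) B"
  using order_trans[OF av_nonneg[of c]] by (auto simp: gle_def)

lemma gle_X: "gle fps_X R" by (auto simp: gle_def)

lemma gle_poly_ex: "\<exists>B. gle (fps_of_poly r) B"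
proof
  show "gle (fps_of_poly r) (\<Sum>i\<le>degree r. absv (coeff r i) * R ^ i)"
    unfolding gle_def fps_of_poly_nth
  proof
    fix n
    show "absv (coeff r n) * R ^ n \<le> (\<Sum>i\<le>degree r. absv (coeff r i) * R ^ i)"
    proof (cases "n \<le> degree r")
      case True
      then show ?thesis by (intro member_le_sum) auto
    qed (auto simp: coeff_eq_0 intro!: sum_nonneg)
  qed
qed

lemma gle_poly_eval:
  assumes "gle (fps_of_poly r) B" "absv x \<le> R" shows "absv (poly r x) \<le> B"
  unfolding poly_altdef
proof (rule av_sum_le)
  show "0 \<le> B" using gle_nonneg assms by blast
  fix i
  have "absv (coeff r i * x ^ i) \<le> absv (coeff r i) * R ^ i"
    unfolding av_mult av_power by (intro mult_left_mono power_mono assms) auto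
  also have "\<dots> \<le> B" using gleD[OF assms(1), of i] by simp
  finally show "absv (coeff r i * x ^ i) \<le> B" .
qed

text \<open>The Gauss-norm closure of the polynomials, that is, the Tate algebra of the disc of
  radius \<open>R\<close>. The point \<theta> lies on the boundary of this closed disc.\<close>

definition T :: "'a fps set" where
  "T = {f. \<forall>e>0. \<exists>r. gle (f - fps_of_poly r) e}"

text \<open>
  \<open>ev f x y\<close> says that \<open>f\<close> takes the value \<open>y\<close> at \<open>x\<close>. Polynomial approximation in the Gauss norm makes
  compatibility with products and with limits immediate.
\<close>

definition ev :: "'a fps \<Rightarrow> 'a \<Rightarrow> 'a \<Rightarrow> bool" where
  "ev f x y \<longleftrightarrow> (\<forall>e>0. \<exists>r. gle (f - fps_of_poly r) e \<and> absv (poly r x - y) \<le> e)"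

lemma TD: "f \<in> T \<Longrightarrow> 0 < e \<Longrightarrow> \<exists>r. gle (f - fps_of_poly r) e"
  by (simp add: T_def)

lemma evD: "ev f x y \<Longrightarrow> 0 < e \<Longrightarrow> \<exists>r. gle (f - fps_of_poly r) e \<and> absv (poly r x - y) \<le> e"
  by (simp add: ev_def)

lemma ev_T: "ev f x y \<Longrightarrow> f \<in> T" unfolding ev_def T_def by blast

lemma T_bounded:
  assumes "f \<in> T" shows "\<exists>B\<ge>1. gle f B"
proof -
  obtain r where r: "gle (f - fps_of_poly r) 1" using TD[OF assms, of 1] by auto
  obtain B where B: "gle (fps_of_poly r) B" using gle_poly_ex by blast
  have "gle (f - fps_of_poly r + fps_of_poly r) (max 1 B)"
    using r B by (intro gle_add) (auto elim: gle_mono)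
  then show ?thesis by (intro exI[of _ "max 1 B"]) auto
qed

lemma ev_bound:
  assumes "ev f x y" "gle f B" "0 < B" "absv x \<le> R" shows "absv y \<le> B"
proof -
  obtain r where r: "gle (f - fps_of_poly r) B" "absv (poly r x - y) \<le> B"
    using evD[OF assms(1,3)] by auto
  have "gle (f - (f - fps_of_poly r)) B" using assms(2) r(1) by (rule gle_diff)
  then have "absv (poly r x) \<le> B" using gle_poly_eval assms(4) by simp
  then have "absv (poly r x - (poly r x - y)) \<le> B" using r(2) by (rule av_diff_le)
  then show ?thesis by simp
qed

lemma ev_poly: "ev (fps_of_poly r) x (poly r x)"
  unfolding ev_def by (intro allI impI exI[of _ r]) simp

lemma ev_const: "ev (fps_const c) x c"
  using ev_poly[of "[:c:]" x] by (simp add: fps_of_poly_const)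

lemma ev_add:
  assumes "ev f x y" "ev g x z" shows "ev (f + g) x (y + z)"
  unfolding ev_def
proof (intro allI impI)
  fix e :: real assume "0 < e"
  then obtain r s where h: "gle (f - fps_of_poly r) e" "absv (poly r x - y) \<le> e"
    "gle (g - fps_of_poly s) e" "absv (poly s x - z) \<le> e"
    using assms unfolding ev_def by meson
  have "gle ((f - fps_of_poly r) + (g - fps_of_poly s)) e" using h by (intro gle_add)
  moreover have "absv ((poly r x - y) + (poly s x - z)) \<le> e" using h by (intro av_add_le)
  ultimately show "\<exists>r. gle (f + g - fps_of_poly r) e \<and> absv (poly r x - (y + z)) \<le> e"
    by (intro exI[of _ "r + s"]) (simp add: fps_of_poly_add algebra_simps)
qed

lemma ev_mult:
  assumes "ev f x y" "ev g x z" and x: "absv x \<le> R" shows "ev (f * g) x (y * z)"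
  unfolding ev_def
proof (intro allI impI)
  fix e :: real assume e: "0 < e"
  obtain B1 where B1: "B1 \<ge> 1" "gle f B1" using T_bounded[OF ev_T[OF assms(1)]] by auto
  obtain B2 where B2: "B2 \<ge> 1" "gle g B2" using T_bounded[OF ev_T[OF assms(2)]] by auto
  define B where "B = max B1 B2"
  have B: "1 \<le> B" "gle f B" "gle g B" using B1 B2 gle_mono unfolding B_def by auto
  \<comment> \<open>The bound \<open>e / B\<close> makes the two error products at most
    \<open>e\<close>; the bound \<open>B\<close> keeps the approximating polynomials themselves
    within norm \<open>B\<close>.\<close>
  define d where "d = min (e / B) B"
  have d: "0 < d" "d \<le> B" "B * d \<le> e" "d * B \<le> e" using e B(1) by (auto simp: d_def min_def field_simps)
  obtain r s where h: "gle (f - fps_of_poly r) d" "absv (poly r x - y) \<le> d"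
    "gle (g - fps_of_poly s) d" "absv (poly s x - z) \<le> d"
    using assms d(1) unfolding ev_def by meson
  have gs: "gle (fps_of_poly s) B"
  proof -
    have "gle (g - (g - fps_of_poly s)) B" using B(3) gle_mono[OF h(3) d(2)] by (rule gle_diff)
    then show ?thesis by simp
  qed
  have gr: "gle (fps_of_poly r) B"
  proof -
    have "gle (f - (f - fps_of_poly r)) B" using B(2) gle_mono[OF h(1) d(2)] by (rule gle_diff)
    then show ?thesis by simp
  qed
  have 1: "gle (f * (g - fps_of_poly s) + (f - fps_of_poly r) * fps_of_poly s) e"
    by (intro gle_add gle_mono[OF gle_mult[OF B(2) h(3)] d(3)] gle_mono[OF gle_mult[OF h(1) gs] d(4)])
  have z: "absv z \<le> B" using ev_bound[OF assms(2) B(3) _ x] B(1) by simp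
  have rB: "absv (poly r x) \<le> B" using gle_poly_eval[OF gr x] .
  have "absv (poly r x * (poly s x - z)) \<le> e" unfolding av_mult
    using mult_mono[OF rB h(4)] d(3) B(1) by simp
  moreover have "absv ((poly r x - y) * z) \<le> e" unfolding av_mult
    using mult_mono[OF h(2) z] d(1,4) by simp
  ultimately have 2: "absv (poly r x * (poly s x - z) + (poly r x - y) * z) \<le> e" by (rule av_add_le)
  show "\<exists>r. gle (f * g - fps_of_poly r) e \<and> absv (poly r x - y * z) \<le> e"
    using 1 2 by (intro exI[of _ "r * s"]) (simp add: fps_of_poly_mult algebra_simps)
qed

lemma ev_sum: "(\<And>i. i \<in> A \<Longrightarrow> ev (f i) x (y i)) \<Longrightarrow> ev (sum f A) x (sum y A)"
proof (induction A rule: infinite_finite_induct)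
  case (insert a A) then show ?case by (simp add: ev_add)
qed (use ev_const[of 0 x] in auto)

lemma ev_prod: "absv x \<le> R \<Longrightarrow> (\<And>i. i \<in> A \<Longrightarrow> ev (f i) x (y i)) \<Longrightarrow> ev (prod f A) x (prod y A)"
proof (induction A rule: infinite_finite_induct)
  case (insert a A) then show ?case by (simp add: ev_mult)
qed (use ev_const[of 1 x] in auto)

lemma ev_power: "absv x \<le> R \<Longrightarrow> ev f x y \<Longrightarrow> ev (f ^ n) x (y ^ n)"
  using ev_prod[of x "{..<n}" "\<lambda>_. f" "\<lambda>_. y"] by simp

lemma ev_unique:
  assumes "ev f x y" "ev f x z" "absv x \<le> R" shows "y = z"
proof (rule ccontr)
  assume "y \<noteq> z"
  then have e: "0 < absv (y - z) / 2" by (metis av_nonneg av_zero_iff half_gt_zero less_eq_real_def right_minus_eq)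
  define e where "e = absv (y - z) / 2"
  have e: "0 < e" using e by (simp add: e_def)
  obtain r s where h: "gle (f - fps_of_poly r) e" "absv (poly r x - y) \<le> e"
    "gle (f - fps_of_poly s) e" "absv (poly s x - z) \<le> e"
    using assms e unfolding ev_def by meson
  have "gle ((f - fps_of_poly s) - (f - fps_of_poly r)) e" by (rule gle_diff[OF h(3,1)])
  then have "gle (fps_of_poly (r - s)) e" by (simp add: fps_of_poly_diff)
  then have "absv (poly (r - s) x) \<le> e" using assms(3) by (rule gle_poly_eval)
  then have "absv (((poly s x - z) - (poly r x - y)) + poly (r - s) x) \<le> e"
    using av_add_le[OF av_diff_le[OF h(4,2)]] by blast
  then have "absv (y - z) \<le> e" by simp
  then show False using e by (simp add: e_def)
qed

lemma av_cauchyI: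
  fixes s :: "nat \<Rightarrow> 'a"
  assumes "\<And>e. 0 < e \<Longrightarrow> \<exists>N. \<forall>m\<ge>N. \<forall>n\<ge>N. absv (s m - s n) \<le> e"
  shows "\<exists>L. \<forall>e>0. \<exists>N. \<forall>n\<ge>N. absv (s n - L) \<le> e"
proof -
  have "cauchy_abs absv s" unfolding cauchy_abs_def
  proof (intro allI impI)
    fix e :: real assume "0 < e"
    then obtain N where "\<forall>m\<ge>N. \<forall>n\<ge>N. absv (s m - s n) \<le> e / 2" using assms[of "e / 2"] by auto
    with \<open>0 < e\<close> show "\<exists>N. \<forall>m\<ge>N. \<forall>n\<ge>N. absv (s m - s n) < e"
      by (intro exI[of _ N]) (smt (verit) field_sum_of_halves)
  qed
  then obtain L where "conv_abs absv s L" using av_complete by blast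
  then show ?thesis unfolding conv_abs_def by (intro exI[of _ L]) (meson less_imp_le)
qed

lemma ev_exists:
  assumes f: "f \<in> T" and x: "absv x \<le> R" shows "\<exists>y. ev f x y"
proof -
  have "\<exists>r. gle (f - fps_of_poly r) (inverse (real (Suc n)))" for n using TD[OF f] by simp
  then obtain r where r: "\<And>n. gle (f - fps_of_poly (r n)) (inverse (real (Suc n)))" by metis
  note small = small_inverse
  have "\<exists>L. \<forall>e>0. \<exists>N. \<forall>n\<ge>N. absv (poly (r n) x - L) \<le> e"
  proof (rule av_cauchyI)
    fix e :: real assume "0 < e"
    then obtain N where N: "\<forall>n\<ge>N. inverse (real (Suc n)) \<le> e" using small by blast
    have "absv (poly (r m) x - poly (r n) x) \<le> e" if "m \<ge> N" "n \<ge> N" for m n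
    proof -
      have "gle ((f - fps_of_poly (r n)) - (f - fps_of_poly (r m))) e"
        by (intro gle_diff gle_mono[OF r]) (use N that in auto)
      then have "gle (fps_of_poly (r m - r n)) e" by (simp add: fps_of_poly_diff)
      from gle_poly_eval[OF this x] show ?thesis by simp
    qed
    then show "\<exists>N. \<forall>m\<ge>N. \<forall>n\<ge>N. absv (poly (r m) x - poly (r n) x) \<le> e" by blast
  qed
  then obtain L where L: "\<forall>e>0. \<exists>N. \<forall>n\<ge>N. absv (poly (r n) x - L) \<le> e" by blast
  have "ev f x L" unfolding ev_def
  proof (intro allI impI)
    fix e :: real assume "0 < e"
    then obtain N M where "\<forall>n\<ge>N. absv (poly (r n) x - L) \<le> e" "\<forall>n\<ge>M. inverse (real (Suc n)) \<le> e"
      using L small by meson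
    then show "\<exists>r. gle (f - fps_of_poly r) e \<and> absv (poly r x - L) \<le> e"
      by (intro exI[of _ "r (max N M)"]) (auto intro: gle_mono[OF r])
  qed
  then show ?thesis ..
qed

lemma T_evI: "(\<exists>y. ev f \<theta> y) \<longleftrightarrow> f \<in> T"
  using ev_exists[of f \<theta>] ev_T by (auto simp: R_def)

lemma T_add: "f \<in> T \<Longrightarrow> g \<in> T \<Longrightarrow> f + g \<in> T"
  using ev_add unfolding T_evI[symmetric] by blast

lemma T_mult: "f \<in> T \<Longrightarrow> g \<in> T \<Longrightarrow> f * g \<in> T"
  using ev_mult[of f \<theta> _ g] unfolding T_evI[symmetric] R_def by blast

lemma T_poly: "fps_of_poly r \<in> T"
  using ev_poly ev_T by blast

lemma T_const: "fps_const c \<in> T"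
  using ev_const ev_T by blast

lemma T_subring: "is_subring T"
proof -
  have "- f \<in> T" if "f \<in> T" for f using T_mult[OF T_const[of "-1"] that] by (simp add: fps_const_neg[symmetric])
  then show ?thesis unfolding is_subring_def using T_add T_mult T_const[of 0] T_const[of 1] by auto
qed

lemma T_limit:
  assumes "\<And>e. 0 < e \<Longrightarrow> \<exists>g\<in>T. gle (f - g) e" shows "f \<in> T"
  unfolding T_def
proof (intro CollectI allI impI)
  fix e :: real assume e: "0 < e"
  then obtain g where g: "g \<in> T" "gle (f - g) e" using assms by blast
  obtain r where r: "gle (g - fps_of_poly r) e" using TD[OF g(1) e] by blast
  have "gle ((f - g) + (g - fps_of_poly r)) e" using g r by (intro gle_add)
  then show "\<exists>r. gle (f - fps_of_poly r) e" by auto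
qed

lemma T_coeffs_small:
  assumes "f \<in> T" "0 < e" shows "\<exists>N. \<forall>n\<ge>N. absv (fps_nth f n) < e"
proof -
  obtain r where r: "gle (f - fps_of_poly r) (e / 2)" using TD[OF assms(1), of "e / 2"] assms(2) by auto
  show ?thesis
  proof (intro exI[of _ "Suc (degree r)"] allI impI)
    fix n assume "Suc (degree r) \<le> n"
    then have "absv (fps_nth f n) * R ^ n \<le> e / 2" using gleD[OF r, of n] by (simp add: coeff_eq_0)
    moreover have "absv (fps_nth f n) * 1 \<le> absv (fps_nth f n) * R ^ n" by (intro mult_left_mono) auto
    ultimately show "absv (fps_nth f n) < e" using assms(2) by simp
  qed
qed

text \<open>Coefficients converge separately. For each coefficient the comparison goes through a
  later index \<open>m\<close> depending on that coefficient; the ultrametric inequality adds no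
  loss, so the bound \<open>e\<close> is uniform.\<close>

lemma gauss_complete:
  fixes F :: "nat \<Rightarrow> 'a fps"
  assumes "\<And>e. 0 < e \<Longrightarrow> \<exists>N. \<forall>m\<ge>N. \<forall>n\<ge>N. gle (F m - F n) e"
  shows "\<exists>G. \<forall>e>0. \<exists>N. \<forall>n\<ge>N. gle (F n - G) e"
proof -
  have "\<exists>L. \<forall>e>0. \<exists>N. \<forall>n\<ge>N. absv (fps_nth (F n) j - L) \<le> e" for j
  proof (rule av_cauchyI)
    fix e :: real assume "0 < e"
    then obtain N where N: "\<forall>m\<ge>N. \<forall>n\<ge>N. gle (F m - F n) (e * R ^ j)" using assms[of "e * R ^ j"] by auto
    have "absv (fps_nth (F m) j - fps_nth (F n) j) \<le> e" if "m \<ge> N" "n \<ge> N" for m n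
      using N that gleD[of "F m - F n" "e * R ^ j" j] by simp
    then show "\<exists>N. \<forall>m\<ge>N. \<forall>n\<ge>N. absv (fps_nth (F m) j - fps_nth (F n) j) \<le> e" by blast
  qed
  then obtain L where L: "\<And>j e. 0 < e \<Longrightarrow> \<exists>N. \<forall>n\<ge>N. absv (fps_nth (F n) j - L j) \<le> e" by metis
  define G where "G = Abs_fps L"
  show ?thesis
  proof (intro exI[of _ G] allI impI)
    fix e :: real assume e: "0 < e"
    from assms[OF e] obtain N where N: "\<forall>m\<ge>N. \<forall>n\<ge>N. gle (F m - F n) e" ..
    have "absv (fps_nth (F n - G) j) * R ^ j \<le> e" if "n \<ge> N" for n j
    proof -
      obtain M where M: "\<forall>m\<ge>M. absv (fps_nth (F m) j - L j) \<le> e / R ^ j" using L[of "e / R ^ j" j] e by auto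
      define m where "m = max N M"
      have "absv (fps_nth (F n - F m) j) \<le> e / R ^ j"
        using gleD[of "F n - F m" e j] N that by (simp add: m_def pos_le_divide_eq)
      moreover have "absv (fps_nth (F m) j - L j) \<le> e / R ^ j" using M by (simp add: m_def)
      ultimately have "absv (fps_nth (F n - F m) j + (fps_nth (F m) j - L j)) \<le> e / R ^ j" by (rule av_add_le)
      then show ?thesis by (simp add: G_def pos_le_divide_eq)
    qed
    then show "\<exists>N. \<forall>n\<ge>N. gle (F n - G) e" unfolding gle_def by blast
  qed
qed

text \<open>The pole \<open>a\<close> lies outside the disc, so the geometric expansion of
  \<open>1 / (t - a)\<close> converges there; its partial sums are the approximating polynomials for
  the value at \<open>x\<close>.\<close>

lemma ev_inverse_linear:
  assumes a: "R < absv a" and x: "absv x \<le> R"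
  shows "ev (inverse (fps_X - fps_const a)) x (inverse (x - a))" "gle (inverse (fps_X - fps_const a)) (inverse (absv a))"
proof -
  have a0: "a \<noteq> 0" using a R_gt_1 by auto
  have xa: "absv (x - a) = absv a" using a x by (intro av_dominant) auto
  define f where "f = Abs_fps (\<lambda>n. - (inverse a ^ Suc n))"
  have "(fps_X - fps_const a) * f = 1"
  proof (rule fps_ext)
    fix n
    show "fps_nth ((fps_X - fps_const a) * f) n = fps_nth 1 n"
      using a0 by (cases n) (auto simp: f_def left_diff_distrib)
  qed
  moreover have "fps_nth (fps_X - fps_const a) 0 \<noteq> 0" using a0 by simp
  ultimately have f: "inverse (fps_X - fps_const a) = f"
    by (metis fps_inverse_unique mult.commute)
  have fb: "absv (fps_nth f n) * R ^ n = (R / absv a) ^ n * inverse (absv a)" for n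
    unfolding f_def by (simp add: av_mult av_power av_divide av_inverse power_divide field_simps)
  have a1: "0 < absv a" using a R_gt_1 by linarith
  then have r1: "0 \<le> R / absv a" "R / absv a < 1" using a by auto
  show "gle (inverse (fps_X - fps_const a)) (inverse (absv a))"
    unfolding f gle_def fb using power_le_one[OF r1(1)] r1(2)
    by (auto intro!: mult_left_le_one_le)
  show "ev (inverse (fps_X - fps_const a)) x (inverse (x - a))"
    unfolding f ev_def
  proof (intro allI impI)
    fix e :: real assume e: "0 < e"
    obtain N where N: "(R / absv a) ^ N < e * absv a"
      using real_arch_pow_inv[of "e * absv a" "R / absv a"] e a1 r1 by auto
    have N': "(R / absv a) ^ N * inverse (absv a) \<le> e"
      using N a1 by (simp add: divide_inverse[symmetric] pos_divide_le_eq)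
    define r where "r = (\<Sum>n<N. monom (- (inverse a ^ Suc n)) n)"
    have cr: "coeff r n = (if n < N then - (inverse a ^ Suc n) else 0)" for n
      unfolding r_def by (simp add: coeff_sum if_distrib cong: if_cong)
    have "gle (f - fps_of_poly r) e"
      unfolding gle_def
    proof
      fix n
      show "absv (fps_nth (f - fps_of_poly r) n) * R ^ n \<le> e"
      proof (cases "n < N")
        case False
        then have "absv (fps_nth (f - fps_of_poly r) n) * R ^ n = (R / absv a) ^ n * inverse (absv a)"
          using fb[of n] by (simp add: cr)
        also have "\<dots> \<le> (R / absv a) ^ N * inverse (absv a)"
          using False r1 by (intro mult_right_mono power_decreasing) auto
        finally show ?thesis using N' by simp
      qed (use e in \<open>simp add: cr f_def\<close>)
    qed
    moreover have "absv (poly r x - inverse (x - a)) \<le> e"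
    proof -
      have "(x - a) * poly r x = 1 - (x / a) ^ N"
        unfolding r_def
      proof (induction N)
        case (Suc N)
        have "(x - a) * poly (\<Sum>n<Suc N. monom (- (inverse a ^ Suc n)) n) x =
            1 - (x / a) ^ N - (x - a) * inverse a * (x / a) ^ N"
          unfolding sum.lessThan_Suc poly_add distrib_left Suc.IH
          by (simp add: poly_monom power_divide divide_inverse power_mult_distrib power_inverse)
        also have "(x - a) * inverse a * (x / a) ^ N = (x / a) ^ Suc N - (x / a) ^ N"
          using a0 by (simp add: left_diff_distrib divide_inverse)
        finally show ?case by simp
      qed simp
      moreover have "x - a \<noteq> 0" using xa a0 by auto
      ultimately have "poly r x = (1 - (x / a) ^ N) * inverse (x - a)"
        by (metis divide_inverse nonzero_mult_div_cancel_left)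
      then have "poly r x - inverse (x - a) = - ((x / a) ^ N) * inverse (x - a)"
        by (simp add: left_diff_distrib)
      then have "absv (poly r x - inverse (x - a)) = (absv x / absv a) ^ N * inverse (absv a)"
        by (simp add: av_mult av_power av_divide av_inverse xa)
      also have "\<dots> \<le> (R / absv a) ^ N * inverse (absv a)"
        using x by (intro mult_right_mono power_mono divide_right_mono) auto
      finally show ?thesis using N' by simp
    qed
    ultimately show "\<exists>r. gle (f - fps_of_poly r) e \<and> absv (poly r x - inverse (x - a)) \<le> e" by blast
  qed
qed

subsection \<open>Frobenius twists of power series\<close>

definition tw :: "nat \<Rightarrow> 'a fps \<Rightarrow> 'a fps" where
  "tw i f = Abs_fps (\<lambda>n. fps_nth f n ^ (q ^ i))"

lemma tw_nth [simp]: "fps_nth (tw i f) n = fps_nth f n ^ (q ^ i)"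
  by (simp add: tw_def)

lemma tw_add: "tw i (f + g) = tw i f + tw i g"
  by (rule fps_ext) (simp add: frob_add)

lemma tw_diff: "tw i (f - g) = tw i f - tw i g"
  by (rule fps_ext) (simp add: frob_diff)

lemma tw_mult: "tw i (f * g) = tw i f * tw i g"
  by (rule fps_ext) (simp add: fps_mult_nth frob_sum power_mult_distrib)

lemma tw_0 [simp]: "tw i 0 = 0"
  by (rule fps_ext) (simp add: power_0_left)

lemma tw_1 [simp]: "tw i 1 = 1"
  by (rule fps_ext) (simp add: power_0_left)

lemma tw_sum: "tw i (sum f A) = (\<Sum>j\<in>A. tw i (f j))"
  by (induction A rule: infinite_finite_induct) (auto simp: tw_add)

lemma tw_prod: "tw i (prod f A) = (\<Prod>j\<in>A. tw i (f j))"
  by (induction A rule: infinite_finite_induct) (auto simp: tw_mult)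

lemma tw_power: "tw i (f ^ n) = tw i f ^ n"
  by (induction n) (auto simp: tw_mult)

lemma tw_tw: "tw i (tw j f) = tw (j + i) f"
  by (rule fps_ext) (simp add: power_mult[symmetric] power_add)

lemma tw_zero_id [simp]: "tw 0 f = f"
  by (rule fps_ext) simp

lemma tw_eq_0_iff: "tw i f = 0 \<longleftrightarrow> f = 0"
  by (auto simp: fps_eq_iff)

lemma coeff_twist [simp]: "coeff (twist q i u) n = coeff u n ^ (q ^ i)"
  by (simp add: twist_def coeff_map_poly)

lemma tw_poly: "tw i (fps_of_poly r) = fps_of_poly (twist q i r)"
  by (rule fps_ext) simp

lemma tw_X [simp]: "tw i fps_X = fps_X"
  by (rule fps_ext) (simp add: power_0_left)

lemma tw_const: "tw i (fps_const c) = fps_const (c ^ (q ^ i))"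
  by (rule fps_ext) (simp add: power_0_left)

lemma poly_twist:
  fixes r :: "'a poly"
  shows "poly (twist q i r) (x ^ (q ^ i)) = poly r x ^ (q ^ i)"
proof -
  have "degree (twist q i r) = degree r"
    unfolding twist_def by (rule degree_map_poly) simp
  moreover have "poly r x ^ (q ^ i) = (\<Sum>j\<le>degree r. (coeff r j * x ^ j) ^ (q ^ i))"
    unfolding poly_altdef by (rule frob_sum)
  ultimately show ?thesis
    by (simp add: poly_altdef[of "twist q i r"] power_mult_distrib power_mult[symmetric] mult.commute)
qed

text \<open>Raising coefficients to a power leaves the factor \<open>R ^ n\<close> unchanged; the
  bound survives because the radius is larger than 1, so \<open>R ^ n\<close> is at most its own
  powers.\<close>

lemma gle_tw:
  assumes "gle f B" shows "gle (tw i f) (B ^ (q ^ i))"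
  unfolding gle_def
proof
  fix n
  have "R ^ n \<le> (R ^ n) ^ (q ^ i)" by (rule self_le_power) auto
  then have "absv (fps_nth (tw i f) n) * R ^ n \<le> (absv (fps_nth f n) * R ^ n) ^ (q ^ i)"
    unfolding power_mult_distrib tw_nth av_power by (intro mult_left_mono) auto
  also have "\<dots> \<le> B ^ (q ^ i)" by (intro power_mono gleD assms) auto
  finally show "absv (fps_nth (tw i f) n) * R ^ n \<le> B ^ (q ^ i)" .
qed

text \<open>The Frobenius identity for polynomials passes to limits, since an error of at most 1
  only shrinks under powers. With \<theta> as the point \<open>x ^ (q ^ i)\<close>, this links
  values of a twist at \<theta> to values of the series at a root of \<theta>.\<close>

lemma ev_tw:
  assumes "ev f x y" shows "ev (tw i f) (x ^ (q ^ i)) (y ^ (q ^ i))"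
  unfolding ev_def
proof (intro allI impI)
  fix e :: real assume e: "0 < e"
  define d where "d = min 1 e"
  have d: "0 < d" using e by (simp add: d_def)
  have "d ^ (q ^ i) \<le> d ^ 1" using d by (intro power_decreasing) (auto simp: d_def Suc_le_eq)
  then have de: "d ^ (q ^ i) \<le> e" by (simp add: d_def)
  obtain r where r: "gle (f - fps_of_poly r) d" "absv (poly r x - y) \<le> d" using evD[OF assms d] by auto
  have "gle (tw i f - fps_of_poly (twist q i r)) e"
    using gle_mono[OF gle_tw[OF r(1)] de] by (simp add: tw_diff tw_poly)
  moreover have "absv (poly (twist q i r) (x ^ (q ^ i)) - y ^ (q ^ i)) \<le> e"
  proof -
    have "absv (poly r x - y) ^ (q ^ i) \<le> d ^ (q ^ i)" using r(2) by (intro power_mono) auto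
    then show ?thesis using de unfolding poly_twist frob_diff[symmetric] av_power by simp
  qed
  ultimately show "\<exists>r. gle (tw i f - fps_of_poly r) e \<and> absv (poly r (x ^ (q ^ i)) - y ^ (q ^ i)) \<le> e"
    by blast
qed

subsection \<open>The Schwarz lemma\<close>

text \<open>By descending induction on the index: the coefficients of \<open>r\<close> are determined from the top.\<close>

lemma gle_divide_linear:
  assumes g: "gle (fps_of_poly ([:- x, 1:] * r)) B" and x: "absv x \<le> R"
  shows "gle (fps_of_poly r) (B / R)"
proof -
  have "absv (coeff r j) * R ^ Suc j \<le> B" for j
  proof (induction "Suc (degree r) - j" arbitrary: j rule: less_induct)
    case less
    show ?case
    proof (cases "j \<le> degree r")
      case False
      then show ?thesis using gle_nonneg[OF g] by (simp add: coeff_eq_0)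
    next
      case True
      have IH: "absv (coeff r (Suc j)) * R ^ Suc (Suc j) \<le> B" by (rule less) (use True in auto)
      have "coeff ([:- x, 1:] * r) (Suc j) = coeff r j - x * coeff r (Suc j)" by simp
      then have c: "coeff r j = coeff ([:- x, 1:] * r) (Suc j) + x * coeff r (Suc j)" by simp
      have "absv (x * coeff r (Suc j)) * R ^ Suc j \<le> R * absv (coeff r (Suc j)) * R ^ Suc j"
        unfolding av_mult using x by (intro mult_right_mono) auto
      also have "\<dots> \<le> B" using IH by (simp add: mult_ac)
      finally have "absv (x * coeff r (Suc j)) \<le> B / R ^ Suc j" by (simp add: pos_le_divide_eq)
      moreover have "absv (coeff ([:- x, 1:] * r) (Suc j)) \<le> B / R ^ Suc j"
        using gleD[OF g, of "Suc j"] unfolding fps_of_poly_nth by (simp add: pos_le_divide_eq)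
      ultimately have "absv (coeff r j) \<le> B / R ^ Suc j" unfolding c by (intro av_add_le)
      then show ?thesis by (simp add: pos_le_divide_eq)
    qed
  qed
  then show ?thesis unfolding gle_def by (simp add: pos_le_divide_eq mult_ac)
qed

lemma fps_of_poly_root: "fps_of_poly [:- x, 1:] = fps_X - fps_const (x :: 'a)"
  by (simp add: fps_of_poly_linear fps_eq_iff)

text \<open>Polynomial approximants of \<open>E\<close> are made divisible by \<open>t - x\<close>.
  Division gains the factor \<open>1 / R\<close> on differences as well, so the quotients form a
  Cauchy sequence whose limit is the required factor.\<close>

lemma divide_root:
  assumes E: "E \<in> T" "gle E B" "ev E x 0" and x: "absv x \<le> R"
  shows "\<exists>G\<in>T. E = (fps_X - fps_const x) * G \<and> gle G (B / R)"
proof -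
  have "\<exists>r. gle (E - fps_of_poly ([:- x, 1:] * r)) e" if e: "0 < e" for e
  proof -
    obtain s where s: "gle (E - fps_of_poly s) e" "absv (poly s x) \<le> e" using evD[OF E(3) e] by auto
    \<comment> \<open>Subtracting the value at \<open>x\<close>, which is at most \<open>e\<close>,
      costs nothing in the approximation and creates the root.\<close>
    have "poly (s - [:poly s x:]) x = 0" by simp
    then obtain r where r: "s - [:poly s x:] = [:- x, 1:] * r" by (metis dvdE poly_eq_0_iff_dvd)
    have "gle (E - fps_of_poly s + fps_of_poly [:poly s x:]) e"
      using s by (intro gle_add) (auto simp: fps_of_poly_const intro: gle_const)
    then have "gle (E - fps_of_poly (s - [:poly s x:])) e"
      unfolding fps_of_poly_diff by (simp add: algebra_simps)
    then show ?thesis unfolding r by blast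
  qed
  then have "\<forall>n. \<exists>r. gle (E - fps_of_poly ([:- x, 1:] * r)) (inverse (real (Suc n)))" by simp
  then obtain r where r: "\<And>n. gle (E - fps_of_poly ([:- x, 1:] * r n)) (inverse (real (Suc n)))"
    by metis
  note small = small_inverse
  have "\<exists>G. \<forall>e>0. \<exists>N. \<forall>n\<ge>N. gle (fps_of_poly (r n) - G) e"
  proof (rule gauss_complete)
    fix e :: real assume "0 < e"
    then obtain N where N: "\<forall>n\<ge>N. inverse (real (Suc n)) \<le> e * R" using small[of "e * R"] by auto
    have "gle (fps_of_poly (r m) - fps_of_poly (r n)) e" if "m \<ge> N" "n \<ge> N" for m n
    proof -
      have "gle ((E - fps_of_poly ([:- x, 1:] * r n)) - (E - fps_of_poly ([:- x, 1:] * r m))) (e * R)"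
        by (intro gle_diff gle_mono[OF r]) (use N that in auto)
      then have "gle (fps_of_poly ([:- x, 1:] * (r m - r n))) (e * R)"
        unfolding right_diff_distrib fps_of_poly_diff by simp
      from gle_divide_linear[OF this x] show ?thesis by (simp add: fps_of_poly_diff)
    qed
    then show "\<exists>N. \<forall>m\<ge>N. \<forall>n\<ge>N. gle (fps_of_poly (r m) - fps_of_poly (r n)) e" by blast
  qed
  then obtain G where G: "\<And>e. 0 < e \<Longrightarrow> \<exists>N. \<forall>n\<ge>N. gle (fps_of_poly (r n) - G) e" by blast
  have approx: "\<exists>n. gle (fps_of_poly (r n) - G) e \<and> gle (E - fps_of_poly ([:- x, 1:] * r n)) e"
    if e: "0 < e" for e
  proof -
    obtain N M where "\<forall>n\<ge>N. gle (fps_of_poly (r n) - G) e" "\<forall>n\<ge>M. inverse (real (Suc n)) \<le> e"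
      using G[OF e] small[OF e] by blast
    then show ?thesis by (intro exI[of _ "max N M"] conjI gle_mono[OF r]) simp_all
  qed
  note lin = fps_of_poly_root
  have gl: "gle (fps_X - fps_const x) R"
    using x gle_X gle_const[of x R] by (intro gle_diff) auto
  have GT: "G \<in> T"
  proof (rule T_limit)
    fix e :: real assume "0 < e"
    then obtain n where "gle (fps_of_poly (r n) - G) e" using approx by blast
    then have "gle (G - fps_of_poly (r n)) e" using gle_uminus by fastforce
    then show "\<exists>g\<in>T. gle (G - g) e" using T_poly by blast
  qed
  have "E - (fps_X - fps_const x) * G = 0"
  proof (rule fps_ext, rule ccontr)
    fix j assume ne: "fps_nth (E - (fps_X - fps_const x) * G) j \<noteq> fps_nth 0 j"
    define H where "H = E - (fps_X - fps_const x) * G"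
    have pos: "0 < absv (fps_nth H j)" using ne unfolding H_def[symmetric]
      by (metis av_nonneg av_zero_iff fps_zero_nth less_eq_real_def)
    define e where "e = absv (fps_nth H j) / 2 / R"
    have e: "0 < e" using pos by (simp add: e_def)
    obtain n where n: "gle (fps_of_poly (r n) - G) e" "gle (E - fps_of_poly ([:- x, 1:] * r n)) e"
      using approx[OF e] by blast
    have eR: "e \<le> R * e" using e R_gt_1 by simp
    have "gle ((E - fps_of_poly ([:- x, 1:] * r n)) + (fps_X - fps_const x) * (fps_of_poly (r n) - G)) (R * e)"
      by (intro gle_add gle_mono[OF n(2) eR] gle_mult gl n)
    then have "gle H (R * e)"
      unfolding H_def fps_of_poly_mult lin by (simp add: algebra_simps)
    from gleD[OF this, of j] have "absv (fps_nth H j) * R ^ j \<le> absv (fps_nth H j) / 2"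
      by (simp add: e_def)
    moreover have "absv (fps_nth H j) * 1 \<le> absv (fps_nth H j) * R ^ j" by (intro mult_left_mono) auto
    ultimately show False using pos by linarith
  qed
  moreover have "gle G (B / R)"
    unfolding gle_def
  proof (rule allI, rule field_le_epsilon)
    fix j and e :: real assume e: "0 < e"
    define d where "d = B + e"
    have B0: "0 \<le> B" by (rule gle_nonneg[OF E(2)])
    obtain n where n: "gle (fps_of_poly (r n) - G) e" "gle (E - fps_of_poly ([:- x, 1:] * r n)) e"
      using approx[OF e] by blast
    have "gle (E - (E - fps_of_poly ([:- x, 1:] * r n))) (max B e)"
      by (intro gle_diff gle_mono[OF E(2)] gle_mono[OF n(2)]) auto
    then have "gle (fps_of_poly ([:- x, 1:] * r n)) (max B e)" by simp
    from gle_divide_linear[OF this x] have 1: "gle (fps_of_poly (r n)) (max B e / R)" .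
    have le: "max B e / R \<le> B / R + e"
    proof -
      have "e / R \<le> e" using e R_gt_1 by (simp add: field_simps)
      moreover have "max B e / R \<le> (B + e) / R" using B0 e by (intro divide_right_mono) auto
      ultimately show ?thesis by (simp add: add_divide_distrib)
    qed
    have e2: "e \<le> B / R + e" using B0 by simp
    have "gle (fps_of_poly (r n) - (fps_of_poly (r n) - G)) (B / R + e)"
      by (intro gle_diff gle_mono[OF 1 le] gle_mono[OF n(1) e2])
    then show "absv (fps_nth G j) * R ^ j \<le> B / R + e" using gleD[of G _ j] by simp
  qed
  ultimately show ?thesis using GT by (intro bexI[of _ G]) auto
qed

lemma divide_roots:
  assumes "finite S" "E \<in> T" "gle E B" "\<And>x. x \<in> S \<Longrightarrow> absv x \<le> R \<and> ev E x 0"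
  shows "\<exists>G\<in>T. E = (\<Prod>x\<in>S. fps_X - fps_const x) * G \<and> gle G (B / R ^ card S)"
  using assms
proof (induction S arbitrary: E B rule: finite_induct)
  case empty
  then show ?case by (intro bexI[of _ E]) auto
next
  case (insert x S)
  obtain G where G: "G \<in> T" "E = (fps_X - fps_const x) * G" "gle G (B / R)"
    using divide_root[of E B x] insert.prems by auto
  \<comment> \<open>The other points differ from \<open>x\<close>, so their vanishing passes to the
    quotient.\<close>
  have "ev G y 0" if y: "y \<in> S" for y
  proof -
    obtain z where z: "ev G y z" using ev_exists[OF G(1)] insert.prems y by blast
    have "ev (fps_X - fps_const x) y (y - x)"
      using ev_poly[of "[:- x, 1:]" y] unfolding fps_of_poly_root by simp
    then have "ev E y ((y - x) * z)" unfolding G(2) using z insert.prems(3) y by (intro ev_mult) auto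
    then have "(y - x) * z = 0" using insert.prems(3) y ev_unique[of E y _ 0] by blast
    then have "z = 0" using y insert.hyps by auto
    then show ?thesis using z by simp
  qed
  then obtain G' where G': "G' \<in> T" "G = (\<Prod>x\<in>S. fps_X - fps_const x) * G'" "gle G' (B / R / R ^ card S)"
    using insert.IH[of G "B / R"] G insert.prems by auto
  then show ?case using insert.hyps G by (intro bexI[of _ G']) (auto simp: mult_ac)
qed

text \<open>Dividing out the zeros gains one factor \<open>1 / R\<close> for each. Their product has
  nonzero constant term, so the lowest coefficient of \<open>E\<close> is that constant term times
  the lowest coefficient of the quotient. Working with the lowest coefficient allows
  \<open>E\<close> to vanish at 0.\<close>

lemma schwarz:
  assumes "finite S" "E \<in> T" "gle E B" "\<And>x. x \<in> S \<Longrightarrow> absv x \<le> R \<and> ev E x 0 \<and> x \<noteq> 0"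
  shows "absv (fps_nth E (subdegree E)) \<le> (\<Prod>x\<in>S. absv x) * (B / R ^ card S)"
proof -
  obtain G where G: "G \<in> T" "E = (\<Prod>x\<in>S. fps_X - fps_const x) * G" "gle G (B / R ^ card S)"
    using divide_roots[of S E B] assms by blast
  define P where "P = (\<Prod>x\<in>S. fps_X - fps_const x)"
  have P0: "fps_nth P 0 = (\<Prod>x\<in>S. - x)"
    unfolding P_def by (induction S rule: infinite_finite_induct) auto
  then have Pn: "fps_nth P 0 \<noteq> 0" using assms by (simp add: prod_zero_iff)
  then have sP: "subdegree P = 0" by (simp add: subdegree_eq_0_iff)
  have b: "0 \<le> (\<Prod>x\<in>S. absv x) * (B / R ^ card S)"
    using gle_nonneg[OF assms(3)] by (intro mult_nonneg_nonneg prod_nonneg divide_nonneg_nonneg) auto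
  show ?thesis
  proof (cases "G = 0")
    case True
    then show ?thesis using G b by simp
  next
    case False
    moreover have "P \<noteq> 0" using Pn by auto
    ultimately have "subdegree E = subdegree G" using G(2) sP subdegree_mult[of P G]
      unfolding P_def[symmetric] by simp
    moreover have "fps_nth E (subdegree P + subdegree G) = fps_nth P (subdegree P) * fps_nth G (subdegree G)"
      unfolding G(2) P_def[symmetric] by (rule nth_subdegree_mult)
    ultimately have e: "fps_nth E (subdegree E) = (\<Prod>x\<in>S. - x) * fps_nth G (subdegree G)"
      using sP P0 by simp
    have "absv (fps_nth G (subdegree G)) * 1 \<le> absv (fps_nth G (subdegree G)) * R ^ subdegree G"
      by (intro mult_left_mono) auto
    also have "\<dots> \<le> B / R ^ card S" by (rule gleD[OF G(3)])
    finally have "absv (fps_nth G (subdegree G)) \<le> B / R ^ card S" by simp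
    then have "(\<Prod>x\<in>S. absv x) * absv (fps_nth G (subdegree G)) \<le> (\<Prod>x\<in>S. absv x) * (B / R ^ card S)"
      by (intro mult_left_mono prod_nonneg) auto
    then show ?thesis unfolding e av_mult av_prod by simp
  qed
qed

end

context carlitz
begin

subsection \<open>The base field\<close>

lemma Fq_subfield: "is_subfield (Fq q :: 'a set)"
proof -
  have "(x + y) ^ q = x ^ q + y ^ q" for x y :: 'a using frob_add[of x y 1] by simp
  moreover have "(- x) ^ q = - (x ^ q)" for x :: 'a
    using frob_diff[of 0 x 1] by (simp add: power_0_left)
  ultimately show ?thesis unfolding is_subfield_def Fq_def
    by (auto simp: power_mult_distrib power_inverse power_0_left)
qed

lemma finite_Fq: "finite (Fq q :: 'a set)"
proof -
  define r :: "'a poly" where "r = monom 1 q - monom 1 1"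
  have "coeff r q = 1" using q_gt_1 by (simp add: r_def)
  then have "r \<noteq> 0" by auto
  moreover have "Fq q = {x. poly r x = 0}" by (auto simp: Fq_def r_def poly_monom)
  ultimately show ?thesis using poly_roots_finite by simp
qed

lemma card_Fq: "1 < card (Fq q :: 'a set)"
proof -
  have "card {0, 1 :: 'a} \<le> card (Fq q :: 'a set)"
    by (intro card_mono finite_Fq) (use subfieldD[OF Fq_subfield] in auto)
  then show ?thesis by simp
qed

lemma av_Fq: "c \<in> Fq q \<Longrightarrow> c \<noteq> 0 \<Longrightarrow> absv c = 1"
proof -
  assume c: "c \<in> Fq q" "c \<noteq> 0"
  then have "c ^ q = c" by (simp add: Fq_def)
  then have "absv c ^ q = absv c" by (metis av_power)
  moreover have "absv c ^ q = absv c * absv c ^ (q - 1)" by (metis Suc_pred' power_Suc q_pos)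
  ultimately have "absv c ^ (q - 1) = 1" using c(2) by simp
  then show ?thesis using q_gt_1 power_eq_imp_eq_base[of "absv c" "q - 1" 1] by simp
qed

lemma av_Fq_le: "c \<in> Fq q \<Longrightarrow> absv c \<le> 1"
  using av_Fq[of c] by (cases "c = 0") auto

lemma av_poly_Fq:
  assumes r: "\<And>i. coeff r i \<in> Fq q" "r \<noteq> 0"
  shows "absv (poly r \<theta>) = R ^ degree r"
proof -
  define n where "n = degree r"
  have lt: "absv (coeff r n * \<theta> ^ n) = R ^ n"
    unfolding av_mult av_power using av_Fq[OF r(1)] r(2) by (simp add: n_def R_def)
  have "absv (\<Sum>i<n. coeff r i * \<theta> ^ i) < R ^ n"
  proof (rule av_sum_less)
    fix i assume "i \<in> {..<n}"
    then have "R ^ i < R ^ n" using R_gt_1 by (intro power_strict_increasing) auto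
    moreover have "absv (coeff r i * \<theta> ^ i) \<le> 1 * R ^ i"
      unfolding av_mult av_power R_def by (intro mult_right_mono av_Fq_le r) auto
    ultimately show "absv (coeff r i * \<theta> ^ i) < R ^ n" by simp
  qed simp
  then have "absv (- (\<Sum>i<n. coeff r i * \<theta> ^ i)) < absv (coeff r n * \<theta> ^ n)" using lt by simp
  from av_dominant(2)[OF this] have "absv ((\<Sum>i<n. coeff r i * \<theta> ^ i) + coeff r n * \<theta> ^ n) = R ^ n"
    using lt by (simp add: add.commute)
  then show ?thesis by (simp add: poly_altdef n_def[symmetric] lessThan_Suc_atMost[symmetric])
qed

text \<open>The ring \<open>F_q[\<theta>]\<close>, and its elements of degree at most \<open>n\<close>.\<close>

definition A :: "'a set" where
  "A = {poly r \<theta> | r. \<forall>i. coeff r i \<in> Fq q}"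

definition An :: "nat \<Rightarrow> 'a set" where
  "An n = {poly r \<theta> | r. (\<forall>i. coeff r i \<in> Fq q) \<and> degree r \<le> n}"

lemma Fq_poly_subring: "is_subring {r :: 'a poly. \<forall>i. coeff r i \<in> Fq q}"
  unfolding is_subring_def using subfieldD[OF Fq_subfield]
  by (auto simp: coeff_mult coeff_pCons split: nat.splits intro!: subfield_sum[OF Fq_subfield])

lemma A_subring: "is_subring A"
proof -
  note PP = subringD[OF Fq_poly_subring]
  have I: "poly r \<theta> \<in> A" if "r \<in> {r :: 'a poly. \<forall>i. coeff r i \<in> Fq q}" for r
    using that unfolding A_def by blast
  have E: "\<exists>r. x = poly r \<theta> \<and> r \<in> {r :: 'a poly. \<forall>i. coeff r i \<in> Fq q}" if "x \<in> A" for x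
    using that unfolding A_def by blast
  show ?thesis unfolding is_subring_def
  proof (intro conjI ballI)
    show "0 \<in> A" using I[OF PP(1)] by simp
    show "1 \<in> A" using I[OF PP(2)] by simp
    fix x assume "x \<in> A"
    then obtain r where r: "x = poly r \<theta>" "r \<in> {r :: 'a poly. \<forall>i. coeff r i \<in> Fq q}" using E by blast
    show "- x \<in> A" using I[OF PP(5)[OF r(2)]] r by simp
    fix y assume "y \<in> A"
    then obtain s where s: "y = poly s \<theta>" "s \<in> {r :: 'a poly. \<forall>i. coeff r i \<in> Fq q}" using E by blast
    show "x + y \<in> A" using I[OF PP(3)[OF r(2) s(2)]] r s by simp
    show "x * y \<in> A" using I[OF PP(4)[OF r(2) s(2)]] r s by simp
  qed
qed

text \<open>A nonzero polynomial in \<theta> over the finite field has absolute value a power of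
  \<open>R\<close> with exponent its degree. This discreteness is the source of every lower bound
  below.\<close>

lemma A_ge_1: "a \<in> A \<Longrightarrow> a \<noteq> 0 \<Longrightarrow> 1 \<le> absv a"
  unfolding A_def using av_poly_Fq by force

lemma theta_power_A: "\<theta> ^ i \<in> A"
  unfolding A_def using subfieldD[OF Fq_subfield]
  by (intro CollectI exI[of _ "monom 1 i"]) (auto simp: poly_monom)

lemma An_A: "An n \<subseteq> A" unfolding An_def A_def by auto

lemma A_An: "a \<in> A \<Longrightarrow> \<exists>n. a \<in> An n" unfolding An_def A_def by auto

lemma An_mono: "a \<in> An n \<Longrightarrow> n \<le> m \<Longrightarrow> a \<in> An m" unfolding An_def by force

lemma An_0 [simp]: "0 \<in> An n"
  unfolding An_def using subfieldD[OF Fq_subfield] by (intro CollectI exI[of _ 0]) auto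

lemma An_add: "a \<in> An n \<Longrightarrow> b \<in> An n \<Longrightarrow> a + b \<in> An n"
  unfolding An_def using subfieldD[OF Fq_subfield]
  by clarify (rule exI[of _ "_ + _"], auto intro: degree_add_le)

lemma An_uminus: "a \<in> An n \<Longrightarrow> - a \<in> An n"
  unfolding An_def using subfieldD[OF Fq_subfield] by clarify (rule exI[of _ "- _"], auto)

lemma An_mult: "a \<in> An n \<Longrightarrow> b \<in> An m \<Longrightarrow> a * b \<in> An (n + m)"
proof -
  assume "a \<in> An n" "b \<in> An m"
  then obtain r s where r: "a = poly r \<theta>" "\<And>i. coeff r i \<in> Fq q" "degree r \<le> n"
    and s: "b = poly s \<theta>" "\<And>i. coeff s i \<in> Fq q" "degree s \<le> m" unfolding An_def by blast
  have "r * s \<in> {r. \<forall>i. coeff r i \<in> Fq q}" using r s by (intro subringD(4)[OF Fq_poly_subring]) auto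
  moreover have "degree (r * s) \<le> n + m" using degree_mult_le[of r s] r s by linarith
  ultimately show ?thesis unfolding An_def using r s by (intro CollectI exI[of _ "r * s"]) auto
qed

lemma theta_power_An: "\<theta> ^ i \<in> An i"
  unfolding An_def using subfieldD[OF Fq_subfield]
  by (intro CollectI exI[of _ "monom 1 i"]) (auto simp: poly_monom degree_monom_le)

lemma An_le: "a \<in> An n \<Longrightarrow> absv a \<le> R ^ n"
proof -
  assume "a \<in> An n"
  then obtain r where r: "a = poly r \<theta>" "\<And>i. coeff r i \<in> Fq q" "degree r \<le> n" unfolding An_def by blast
  show ?thesis
  proof (cases "r = 0")
    case False
    then show ?thesis using av_poly_Fq[OF r(2)] r R_gt_1 by (simp add: power_increasing)
  qed (use r in simp)
qed

text \<open>The same absolute value formula shows that \<theta> is transcendental over the finite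
  field, so the \<open>n + 1\<close> coefficients are determined by the element.\<close>

lemma card_An: "finite (An n)" "card (An n) = card (Fq q :: 'a set) ^ (n + 1)"
proof -
  define e where "e c = (\<Sum>i\<le>n. c i * \<theta> ^ i)" for c :: "nat \<Rightarrow> 'a"
  define D where "D = {..n} \<rightarrow>\<^sub>E (Fq q :: 'a set)"
  define rr where "rr c = (\<Sum>i\<le>n. monom (c i) i)" for c :: "nat \<Rightarrow> 'a"
  have cr: "coeff (rr c) i = (if i \<le> n then c i else 0)" for c i
    unfolding rr_def by (simp add: coeff_sum if_distrib cong: if_cong)
  have er: "e c = poly (rr c) \<theta>" for c by (simp add: e_def rr_def poly_sum poly_monom)
  have cD: "coeff (rr c) i \<in> Fq q" if "c \<in> D" for c i
    using that subfieldD[OF Fq_subfield] by (auto simp: cr D_def)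
  have "inj_on e D"
  proof (rule inj_onI)
    fix c c' assume h: "c \<in> D" "c' \<in> D" "e c = e c'"
    have "poly (rr c - rr c') \<theta> = 0" using h(3) by (simp add: er)
    moreover have "coeff (rr c - rr c') i \<in> Fq q" for i
      using cD h subfieldD[OF Fq_subfield] by simp
    ultimately have "rr c - rr c' = 0" using av_poly_Fq[of "rr c - rr c'"] by fastforce
    then have "coeff (rr c) i = coeff (rr c') i" for i by simp
    then have "c i = c' i" if "i \<le> n" for i using that cr by metis
    then show "c = c'" using h unfolding D_def by (intro PiE_ext) auto
  qed
  moreover have "e ` D = An n"
  proof (intro equalityI subsetI)
    fix x assume "x \<in> e ` D"
    then obtain c where c: "c \<in> D" "x = poly (rr c) \<theta>" by (auto simp: er)
    have "degree (rr c) \<le> n" by (intro degree_le) (simp add: cr)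
    then show "x \<in> An n" unfolding An_def using c cD by blast
  next
    fix x assume "x \<in> An n"
    then obtain r where r: "x = poly r \<theta>" "\<And>i. coeff r i \<in> Fq q" "degree r \<le> n" unfolding An_def by blast
    have "r = rr (restrict (coeff r) {..n})"
      by (rule poly_eqI) (use r(3) in \<open>auto simp: cr coeff_eq_0\<close>)
    then show "x \<in> e ` D" using r unfolding D_def by (intro image_eqI[of _ _ "restrict (coeff r) {..n}"]) (auto simp: er)
  qed
  moreover have "finite D" "card D = card (Fq q :: 'a set) ^ (n + 1)"
    unfolding D_def using finite_Fq by (auto simp: card_PiE intro: finite_PiE)
  ultimately show "finite (An n)" "card (An n) = card (Fq q :: 'a set) ^ (n + 1)"
    by (metis finite_imageI, metis card_image)
qed

lemma Kfield_eq: "Kfield q \<theta> = {a / b | a b. a \<in> A \<and> b \<in> A \<and> b \<noteq> 0}"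
proof (intro equalityI subsetI)
  fix x assume "x \<in> Kfield q \<theta>"
  then obtain f g where fg: "x = poly f \<theta> / poly g \<theta>" "poly f \<theta> \<in> A" "poly g \<theta> \<in> A"
    unfolding Kfield_def A_def by blast
  show "x \<in> {a / b | a b. a \<in> A \<and> b \<in> A \<and> b \<noteq> 0}"
  proof (cases "poly g \<theta> = 0")
    case True
    \<comment> \<open>A vanishing denominator is allowed in \<open>Kfield\<close>; division by 0
      then gives 0, which is a legitimate quotient.\<close>
    then have "x = 0 / 1" using fg by simp
    then show ?thesis using subringD(1,2)[OF A_subring]
      by (intro CollectI exI[of _ 0] exI[of _ 1]) simp
  next
    case False
    then show ?thesis using fg by (intro CollectI exI[of _ "poly f \<theta>"] exI[of _ "poly g \<theta>"]) simp
  qed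
next
  fix x assume "x \<in> {a / b | a b. a \<in> A \<and> b \<in> A \<and> b \<noteq> 0}"
  then show "x \<in> Kfield q \<theta>" unfolding Kfield_def A_def by blast
qed

lemma Kfield_subfield: "is_subfield (Kfield q \<theta>)"
  unfolding Kfield_eq by (rule quotients_subfield[OF A_subring])

lemma A_Kfield: "A \<subseteq> Kfield q \<theta>"
proof
  fix x assume "x \<in> A"
  then show "x \<in> Kfield q \<theta>" unfolding Kfield_eq using subringD(2)[OF A_subring]
    by (intro CollectI exI[of _ x] exI[of _ 1]) simp
qed

lemma Kbar_eq: "Kbar q \<theta> = {x. alg_over (Kfield q \<theta>) x}"
  unfolding Kbar_def alg_over_def by blast

lemma Kbar_subfield: "is_subfield (Kbar q \<theta>)"
  unfolding Kbar_eq by (rule subfield_alg_over[OF Kfield_subfield])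

lemma Kfield_Kbar: "Kfield q \<theta> \<subseteq> Kbar q \<theta>"
proof
  fix x assume x: "x \<in> Kfield q \<theta>"
  then show "x \<in> Kbar q \<theta>" unfolding Kbar_def using subfieldD[OF Kfield_subfield]
    by (intro CollectI exI[of _ "[:-x, 1:]"]) (auto simp: coeff_pCons split: nat.splits)
qed

lemma Fq_A: "Fq q \<subseteq> A"
  unfolding A_def using subfieldD[OF Fq_subfield]
  by (auto intro!: exI[of _ "[:_:]"] simp: coeff_pCons split: nat.splits)

lemma A_Kbar: "A \<subseteq> Kbar q \<theta>" using A_Kfield Kfield_Kbar by auto

lemma theta_Kbar: "\<theta> \<in> Kbar q \<theta>" using theta_power_A[of 1] A_Kbar by auto

text \<open>Substituting \<open>X ^ (q ^ n)\<close> into an annihilating polynomial of the power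
  annihilates the root. It keeps the coefficients of the auxiliary polynomials, which are such
  roots, inside the algebraic closure.\<close>

lemma Kbar_root: "x ^ (q ^ n) \<in> Kbar q \<theta> \<Longrightarrow> x \<in> Kbar q \<theta>"
proof -
  assume "x ^ (q ^ n) \<in> Kbar q \<theta>"
  then obtain r where r: "r \<noteq> 0" "\<forall>i. coeff r i \<in> Kfield q \<theta>" "poly r (x ^ (q ^ n)) = 0"
    unfolding Kbar_def by blast
  define s where "s = pcompose r (monom 1 (q ^ n))"
  have "poly s x = 0" using r by (simp add: s_def poly_pcompose poly_monom)
  moreover have "s \<noteq> 0" unfolding s_def
    using pcompose_eq_0[of r "monom 1 (q ^ n)"] r by (auto simp: degree_monom_eq)
  moreover have "coeff s i \<in> Kfield q \<theta>" for i
  proof -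
    have "s = (\<Sum>j\<le>degree r. smult (coeff r j) (monom 1 (q ^ n) ^ j))"
      unfolding s_def by (simp add: pcompose_altdef poly_altdef coeff_map_poly map_poly_def[symmetric] degree_map_poly)
    then have "coeff s i = (\<Sum>j\<le>degree r. coeff r j * (if q ^ n * j = i then 1 else 0))"
      by (simp add: coeff_sum monom_power)
    also have "\<dots> \<in> Kfield q \<theta>"
      by (intro subfield_sum[OF Kfield_subfield]) (use r(2) subfieldD[OF Kfield_subfield] in auto)
    finally show ?thesis .
  qed
  ultimately show ?thesis unfolding Kbar_def by blast
qed

lemma common_denominator:
  assumes "finite S" "S \<subseteq> Kfield q \<theta>"
  shows "\<exists>d\<in>A. d \<noteq> 0 \<and> (\<forall>x\<in>S. d * x \<in> A)"
  using assms
proof (induction S rule: finite_induct)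
  case empty
  show ?case using subringD(2)[OF A_subring] by (intro bexI[of _ 1]) auto
next
  case (insert x S)
  then obtain d where d: "d \<in> A" "d \<noteq> 0" "\<forall>x\<in>S. d * x \<in> A" by auto
  obtain a b where ab: "x = a / b" "a \<in> A" "b \<in> A" "b \<noteq> 0" using insert.prems unfolding Kfield_eq by blast
  have "d * b * y \<in> A" if "y \<in> insert x S" for y
  proof (cases "y = x")
    case True
    then have e: "d * b * y = d * a" using ab by simp
    show ?thesis unfolding e using d ab by (intro subringD(4)[OF A_subring])
  next
    case False
    then have "b * (d * y) \<in> A" using d ab that subringD(4)[OF A_subring] by auto
    then show ?thesis by (simp add: mult_ac)
  qed
  then show ?case using d ab subringD(4)[OF A_subring] by (intro bexI[of _ "d * b"]) auto
qed

subsection \<open>Lattices in finite extensions\<close>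

text \<open>
  The module spanned over \<open>F_q[\<theta>]\<close> by \<open>B\<close>, filtered by the degree of the coordinates. Below, \<open>B\<close> is a
  basis of a finite extension of the base field with \<open>b * b' \<in> lat B \<kappa>\<close>, so that the degree filtration
  plays the role of a height; the module need not contain \<open>1\<close>.
\<close>

definition lat :: "'a set \<Rightarrow> nat \<Rightarrow> 'a set" where
  "lat B n = {(\<Sum>b\<in>B. a b * b) | a. \<forall>b\<in>B. a b \<in> An n}"

lemma latI: "(\<And>b. b \<in> B \<Longrightarrow> a b \<in> An n) \<Longrightarrow> (\<Sum>b\<in>B. a b * b) \<in> lat B n"
  unfolding lat_def by blast

lemma latD: "x \<in> lat B n \<Longrightarrow> \<exists>a. (\<forall>b\<in>B. a b \<in> An n) \<and> x = (\<Sum>b\<in>B. a b * b)"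
  unfolding lat_def by blast

lemma lat_mono: "x \<in> lat B n \<Longrightarrow> n \<le> m \<Longrightarrow> x \<in> lat B m"
  by (drule latD) (auto intro!: latI intro: An_mono)

lemma lat_0 [simp]: "0 \<in> lat B n"
  using latI[of B "\<lambda>_. 0" n] by simp

lemma lat_add: "x \<in> lat B n \<Longrightarrow> y \<in> lat B n \<Longrightarrow> x + y \<in> lat B n"
proof -
  assume x: "x \<in> lat B n" and y: "y \<in> lat B n"
  from x obtain a where "\<And>b. b \<in> B \<Longrightarrow> a b \<in> An n" "x = (\<Sum>b\<in>B. a b * b)" using latD by blast
  moreover from y obtain c where "\<And>b. b \<in> B \<Longrightarrow> c b \<in> An n" "y = (\<Sum>b\<in>B. c b * b)" using latD by blast
  ultimately show ?thesis using latI[of B "\<lambda>b. a b + c b" n] An_add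
    by (simp add: distrib_right sum.distrib)
qed

lemma lat_uminus: "x \<in> lat B n \<Longrightarrow> - x \<in> lat B n"
proof -
  assume "x \<in> lat B n"
  then obtain a where a: "\<And>b. b \<in> B \<Longrightarrow> a b \<in> An n" "x = (\<Sum>b\<in>B. a b * b)" using latD by blast
  then show ?thesis using latI[of B "\<lambda>b. - a b" n] An_uminus by (simp add: sum_negf)
qed

lemma lat_diff: "x \<in> lat B n \<Longrightarrow> y \<in> lat B n \<Longrightarrow> x - y \<in> lat B n"
  using lat_add[of x B n "- y"] lat_uminus by simp

lemma lat_sum: "(\<And>i. i \<in> S \<Longrightarrow> f i \<in> lat B n) \<Longrightarrow> sum f S \<in> lat B n"
  by (induction S rule: infinite_finite_induct) (auto intro: lat_add)

lemma lat_scale: "c \<in> An m \<Longrightarrow> x \<in> lat B n \<Longrightarrow> c * x \<in> lat B (m + n)"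
proof -
  assume c: "c \<in> An m" and x: "x \<in> lat B n"
  from x obtain a where a: "\<And>b. b \<in> B \<Longrightarrow> a b \<in> An n" "x = (\<Sum>b\<in>B. a b * b)" using latD by blast
  show ?thesis using latI[of B "\<lambda>b. c * a b" "m + n"] An_mult[OF c a(1)] a(2)
    by (simp add: sum_distrib_left mult_ac)
qed

text \<open>Only an upper bound, since without independence coordinates need not be unique.
  \<open>liouville\<close> uses it for the basis with one element removed.\<close>

lemma card_lat_le:
  assumes "finite B"
  shows "finite (lat B n)" "card (lat B n) \<le> card (Fq q :: 'a set) ^ ((n + 1) * card B)"
proof -
  define D where "D = B \<rightarrow>\<^sub>E An n"
  have "finite D" "card D = card (An n) ^ card B"
    unfolding D_def using assms card_An(1)[of n] by (auto simp: card_PiE intro: finite_PiE)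
  then have D: "finite D" "card D = card (Fq q :: 'a set) ^ ((n + 1) * card B)"
    by (simp_all only: card_An(2) power_mult)
  have "lat B n \<subseteq> (\<lambda>a. \<Sum>b\<in>B. a b * b) ` D"
  proof
    fix x assume "x \<in> lat B n"
    then obtain a where a: "\<And>b. b \<in> B \<Longrightarrow> a b \<in> An n" "x = (\<Sum>b\<in>B. a b * b)" using latD by blast
    show "x \<in> (\<lambda>a. \<Sum>b\<in>B. a b * b) ` D"
      by (rule image_eqI[of _ _ "restrict a B"]) (use a in \<open>auto simp: D_def\<close>)
  qed
  moreover have "finite ((\<lambda>a. \<Sum>b\<in>B. a b * b) ` D)" using D by simp
  ultimately show "finite (lat B n)" "card (lat B n) \<le> card (Fq q :: 'a set) ^ ((n + 1) * card B)"
    using card_mono[of "(\<lambda>a. \<Sum>b\<in>B. a b * b) ` D" "lat B n"] card_image_le[OF D(1), of "\<lambda>a. \<Sum>b\<in>B. a b * b"] D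
    by (auto intro: finite_subset)
qed

end

locale order_lattice = carlitz +
  fixes B :: "'a set" and \<kappa> :: nat
  assumes finB: "finite B" and neB: "B \<noteq> {}"
    and indB: "\<And>c. (\<forall>b\<in>B. c b \<in> Kfield q \<theta>) \<Longrightarrow> (\<Sum>b\<in>B. c b * b) = 0 \<Longrightarrow> \<forall>b\<in>B. c b = 0"
    and multB: "\<And>b b'. b \<in> B \<Longrightarrow> b' \<in> B \<Longrightarrow> b * b' \<in> lat B \<kappa>"
begin

lemma card_lat: "card (lat B n) = card (Fq q :: 'a set) ^ ((n + 1) * card B)"
proof -
  define D where "D = B \<rightarrow>\<^sub>E An n"
  have "card D = card (An n) ^ card B"
    unfolding D_def using finB by (simp add: card_PiE)
  then have D: "card D = card (Fq q :: 'a set) ^ ((n + 1) * card B)"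
    by (simp only: card_An(2) power_mult)
  have "inj_on (\<lambda>a. \<Sum>b\<in>B. a b * b) D"
  proof (rule inj_onI)
    fix a c assume h: "a \<in> D" "c \<in> D" "(\<Sum>b\<in>B. a b * b) = (\<Sum>b\<in>B. c b * b)"
    have s0: "(\<Sum>b\<in>B. (a b - c b) * b) = 0" using h(3) by (simp add: left_diff_distrib sum_subtractf)
    have sK: "\<forall>b\<in>B. a b - c b \<in> Kfield q \<theta>"
    proof
      fix b assume "b \<in> B"
      then have "a b \<in> Kfield q \<theta>" "c b \<in> Kfield q \<theta>"
        using h(1,2) An_A[of n] A_Kfield unfolding D_def by (meson PiE_mem subsetD)+
      then show "a b - c b \<in> Kfield q \<theta>" by (rule subfieldD(6)[OF Kfield_subfield])
    qed
    have "\<forall>b\<in>B. a b - c b = 0" using sK s0 by (rule indB)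
    then have "\<forall>b\<in>B. a b = c b" by simp
    then show "a = c" using h unfolding D_def by (intro PiE_ext) auto
  qed
  moreover have "(\<lambda>a. \<Sum>b\<in>B. a b * b) ` D = lat B n"
  proof (intro equalityI subsetI)
    fix x assume "x \<in> lat B n"
    then obtain a where a: "\<And>b. b \<in> B \<Longrightarrow> a b \<in> An n" "x = (\<Sum>b\<in>B. a b * b)" using latD by blast
    show "x \<in> (\<lambda>a. \<Sum>b\<in>B. a b * b) ` D"
      by (rule image_eqI[of _ _ "restrict a B"]) (use a in \<open>auto simp: D_def\<close>)
  qed (auto simp: D_def intro!: latI)
  ultimately show ?thesis using D card_image by fastforce
qed

lemma lat_mult: "x \<in> lat B n \<Longrightarrow> y \<in> lat B m \<Longrightarrow> x * y \<in> lat B (n + m + \<kappa>)"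
proof -
  assume x: "x \<in> lat B n" and y: "y \<in> lat B m"
  from x obtain a where a: "\<And>b. b \<in> B \<Longrightarrow> a b \<in> An n" "x = (\<Sum>b\<in>B. a b * b)" using latD by blast
  from y obtain c where c: "\<And>b. b \<in> B \<Longrightarrow> c b \<in> An m" "y = (\<Sum>b\<in>B. c b * b)" using latD by blast
  have "x * y = (\<Sum>b\<in>B. \<Sum>b'\<in>B. (a b * c b') * (b * b'))"
    unfolding a(2) c(2) by (simp add: sum_product mult_ac)
  also have "\<dots> \<in> lat B (n + m + \<kappa>)"
    by (intro lat_sum lat_scale An_mult a c multB)
  finally show ?thesis .
qed

lemma lat_power: "x \<in> lat B n \<Longrightarrow> 0 < j \<Longrightarrow> x ^ j \<in> lat B (j * (n + \<kappa>))"
proof (induction j)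
  case (Suc j)
  show ?case
  proof (cases "j = 0")
    case True
    then show ?thesis using Suc lat_mono[of x B n] by simp
  next
    case False
    then have "x * x ^ j \<in> lat B (n + j * (n + \<kappa>) + \<kappa>)" using Suc by (intro lat_mult) auto
    then show ?thesis by (simp add: algebra_simps)
  qed
qed simp

lemma cardB: "0 < card B" using finB neB by (simp add: card_gt_0_iff)

text \<open>Siegel's lemma by the pigeonhole principle: the coefficient matrix maps tuples of height
  \<open>n\<close> to tuples of height \<open>n + m + \<kappa>\<close>, and the hypothesis says that
  the source has more elements. The difference of two tuples with the same image is a solution, and
  no degree is lost by subtraction.\<close>

lemma siegel:
  assumes fin: "finite E" "finite V" and M: "\<And>e v. e \<in> E \<Longrightarrow> v \<in> V \<Longrightarrow> M e v \<in> lat B m"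
    and less: "card E * (n + m + \<kappa> + 1) < card V * (n + 1)"
  shows "\<exists>x. (\<forall>v\<in>V. x v \<in> lat B n) \<and> (\<exists>v\<in>V. x v \<noteq> 0) \<and> (\<forall>e\<in>E. (\<Sum>v\<in>V. M e v * x v) = 0)"
proof -
  define c where "c = card (Fq q :: 'a set)"
  define X where "X = V \<rightarrow>\<^sub>E lat B n"
  define Y where "Y = E \<rightarrow>\<^sub>E lat B (n + m + \<kappa>)"
  define f where "f x = restrict (\<lambda>e. \<Sum>v\<in>V. M e v * x v) E" for x
  have "card X = card (lat B n) ^ card V" unfolding X_def using fin by (simp add: card_PiE)
  then have cX: "card X = c ^ (card B * (card V * (n + 1)))"
    by (simp only: card_lat c_def power_mult[symmetric] mult_ac)
  have "card Y = card (lat B (n + m + \<kappa>)) ^ card E" unfolding Y_def using fin by (simp add: card_PiE)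
  then have cY: "card Y = c ^ (card B * (card E * (n + m + \<kappa> + 1)))"
    by (simp only: card_lat c_def power_mult[symmetric] mult_ac)
  have fY: "finite Y" unfolding Y_def using fin card_lat_le[OF finB] by (intro finite_PiE) auto
  have "f ` X \<subseteq> Y"
  proof clarify
    fix x assume x: "x \<in> X"
    have "(\<Sum>v\<in>V. M e v * x v) \<in> lat B (n + m + \<kappa>)" if "e \<in> E" for e
    proof (rule lat_sum)
      fix v assume "v \<in> V"
      then have "x v * M e v \<in> lat B (n + m + \<kappa>)" using x M that by (intro lat_mult) (auto simp: X_def)
      then show "M e v * x v \<in> lat B (n + m + \<kappa>)" by (simp add: mult.commute)
    qed
    then show "f x \<in> Y" unfolding f_def Y_def by auto
  qed
  then have "card (f ` X) \<le> card Y" using fY by (intro card_mono)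
  also have "card Y < card X" unfolding cX cY
    using less cardB card_Fq by (intro power_strict_increasing) (auto simp: c_def)
  finally have "\<not> inj_on f X" by (rule pigeonhole)
  then obtain x y where xy: "x \<in> X" "y \<in> X" "x \<noteq> y" "f x = f y" unfolding inj_on_def by blast
  have "\<exists>v\<in>V. x v \<noteq> y v" using xy PiE_ext[OF xy(1,2)[unfolded X_def]] by blast
  moreover have "(\<Sum>v\<in>V. M e v * (x v - y v)) = 0" if "e \<in> E" for e
    using fun_cong[OF xy(4), of e] that by (simp add: f_def right_diff_distrib sum_subtractf)
  moreover have "\<forall>v\<in>V. x v - y v \<in> lat B n" using xy by (auto simp: X_def intro!: lat_diff)
  ultimately show ?thesis by (intro exI[of _ "\<lambda>v. x v - y v"]) auto
qed

lemma lat_le: "\<exists>C\<ge>1. \<forall>n. \<forall>x\<in>lat B n. absv x \<le> C * R ^ n"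
proof (intro exI[of _ "Max (insert 1 (absv ` B))"] conjI allI ballI)
  define C where "C = Max (insert 1 (absv ` B))"
  have C: "1 \<le> C" "\<And>b. b \<in> B \<Longrightarrow> absv b \<le> C" unfolding C_def using finB by auto
  show "1 \<le> Max (insert 1 (absv ` B))" using C by (simp add: C_def)
  fix n x assume "x \<in> lat B n"
  then obtain a where a: "\<And>b. b \<in> B \<Longrightarrow> a b \<in> An n" "x = (\<Sum>b\<in>B. a b * b)" using latD by blast
  have "absv x \<le> C * R ^ n" unfolding a(2)
  proof (rule av_sum_le)
    show "0 \<le> C * R ^ n" using C by simp
    fix b assume b: "b \<in> B"
    have "absv (a b) * absv b \<le> R ^ n * C" using An_le[OF a(1)[OF b]] C(2)[OF b] by (intro mult_mono) auto
    then show "absv (a b * b) \<le> C * R ^ n" by (simp add: av_mult mult.commute)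
  qed
  then show "absv x \<le> Max (insert 1 (absv ` B)) * R ^ n" by (simp add: C_def)
qed

lemma indB_nonzero: "b \<in> B \<Longrightarrow> b \<noteq> 0"
proof
  assume b: "b \<in> B" "b = 0"
  have "(\<Sum>b'\<in>B. (if b' = b then 1 else 0) * b') = 0"
    using b finB by (simp add: if_distrib[of "\<lambda>x. x * _"] cong: if_cong)
  moreover have "\<forall>b'\<in>B. (if b' = b then 1 else 0) \<in> Kfield q \<theta>"
    using subfieldD[OF Kfield_subfield] by auto
  ultimately show False using indB[of "\<lambda>b'. if b' = b then 1 else 0"] b by auto
qed

text \<open>
  Pigeonhole produces \<open>y\<close> with \<open>x * y = a * b1\<close> for a nonzero \<open>a \<in> F_q[\<theta>]\<close>, hence \<open>|a| \<ge> 1\<close>.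
\<close>

lemma liouville:
  "\<exists>c>0. \<forall>m. \<forall>x\<in>lat B m. x \<noteq> 0 \<longrightarrow> c / R ^ (card B * (m + \<kappa>)) \<le> absv x"
proof -
  obtain C where C: "C \<ge> 1" "\<And>n x. x \<in> lat B n \<Longrightarrow> absv x \<le> C * R ^ n" using lat_le by blast
  obtain b1 where b1: "b1 \<in> B" using neB by blast
  have b1p: "0 < absv b1" using indB_nonzero[OF b1] by (metis av_nonneg av_zero_iff less_eq_real_def)
  define B' where "B' = B - {b1}"
  have B': "finite B'" "card B' = card B - 1" using b1 finB by (auto simp: B'_def)
  have "absv b1 / C / R ^ (card B * (m + \<kappa>)) \<le> absv x" if x: "x \<in> lat B m" "x \<noteq> 0" for m x
  proof -
    \<comment> \<open>Dropping one coordinate must outweigh the growth of heights from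
      \<open>n\<close> to \<open>n + m + \<kappa>\<close> in the remaining \<open>card B - 1\<close>
      coordinates; this \<open>n\<close> is at least
      \<open>(card B - 1) * (m + \<kappa>)\<close>.\<close>
    define n where "n = card B * (m + \<kappa>)"
    define N where "N = n + m + \<kappa>"
    \<comment> \<open>The remainder \<open>w\<close> collects all coordinates of
      \<open>x * y\<close> except that of \<open>b1\<close>. Two elements \<open>y\<close> with the
      same remainder differ by one whose product with \<open>x\<close> is a multiple of
      \<open>b1\<close>.\<close>
    have ex: "\<exists>w. w \<in> lat B' N \<and> (\<exists>a\<in>A. x * y = a * b1 + w)" if "y \<in> lat B n" for y
    proof -
      have "x * y \<in> lat B N" using lat_mult[OF x(1) that] by (simp add: N_def add_ac)
      then obtain a where a: "\<And>b. b \<in> B \<Longrightarrow> a b \<in> An N" "x * y = (\<Sum>b\<in>B. a b * b)" using latD by blast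
      have "x * y = a b1 * b1 + (\<Sum>b\<in>B'. a b * b)" unfolding a(2) B'_def using finB b1 by (simp add: sum.remove)
      moreover have "(\<Sum>b\<in>B'. a b * b) \<in> lat B' N" using a(1) by (intro latI) (auto simp: B'_def)
      ultimately show ?thesis using a(1)[OF b1] An_A by blast
    qed
    then obtain w where w: "\<And>y. y \<in> lat B n \<Longrightarrow> w y \<in> lat B' N"
      "\<And>y. y \<in> lat B n \<Longrightarrow> \<exists>a\<in>A. x * y = a * b1 + w y" by metis
    have "card (w ` lat B n) \<le> card (lat B' N)"
      by (intro card_mono card_lat_le[OF B'(1)]) (use w in auto)
    also have "\<dots> \<le> card (Fq q :: 'a set) ^ ((N + 1) * (card B - 1))"
      using card_lat_le(2)[OF B'(1)] B'(2) by simp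
    also have "\<dots> < card (lat B n)" unfolding card_lat
    proof (rule power_strict_increasing)
      obtain s where s: "card B = Suc s" using cardB by (cases "card B") auto
      show "(N + 1) * (card B - 1) < (n + 1) * card B"
        unfolding N_def n_def s by (simp add: algebra_simps)
    qed (use card_Fq in simp)
    finally have "\<not> inj_on w (lat B n)" by (rule pigeonhole)
    then obtain y z where yz: "y \<in> lat B n" "z \<in> lat B n" "y \<noteq> z" "w y = w z" unfolding inj_on_def by blast
    obtain a a' where a: "a \<in> A" "a' \<in> A" "x * y = a * b1 + w y" "x * z = a' * b1 + w z" using w(2) yz by metis
    have e: "x * (y - z) = (a - a') * b1" using a yz by (simp add: right_diff_distrib left_diff_distrib)
    have "a - a' \<noteq> 0" using e x yz by auto
    then have "1 \<le> absv (a - a')" using a A_ge_1 subringD(6)[OF A_subring] by blast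
    then have "absv b1 \<le> absv x * absv (y - z)" unfolding av_mult[symmetric] e
      unfolding av_mult using mult_right_mono[of 1 "absv (a - a')" "absv b1"] by simp
    also have "\<dots> \<le> absv x * (C * R ^ n)" using C(2)[OF lat_diff[OF yz(1,2)]] by (intro mult_left_mono) auto
    finally show ?thesis using C(1) by (simp add: n_def pos_divide_le_eq mult_ac divide_divide_eq_left)
  qed
  then show ?thesis using b1p C(1) by (intro exI[of _ "absv b1 / C"]) auto
qed

end

context carlitz
begin

text \<open>A finite algebra containing \<open>Z\<close> is given an independent basis, and the
  basis is then scaled by a denominator \<open>d1\<close> of its structure constants. Products of
  scaled basis elements again have integral coordinates. The factor \<open>d2\<close> clears the
  coordinates of the elements of \<open>Z\<close>.\<close>

lemma lattice_exists:
  assumes Z: "finite Z" "Z \<subseteq> Kbar q \<theta>"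
  shows "\<exists>B \<kappa> d n. order_lattice absv p k q \<theta> B \<kappa> \<and> B \<subseteq> Kbar q \<theta> \<and> d \<in> A \<and> d \<noteq> 0 \<and> (\<forall>z\<in>Z. d * z \<in> lat B n)"
proof -
  define F where "F = Kfield q \<theta>"
  have F: "is_subfield F" unfolding F_def by (rule Kfield_subfield)
  obtain B1 where B1: "finite B1" "1 \<in> rspan F B1" "Z \<subseteq> rspan F B1"
    "\<forall>b\<in>B1. \<forall>b'\<in>B1. b * b' \<in> rspan F B1"
    using finite_ext[OF F Z(1)] Z(2) unfolding Kbar_eq F_def by blast
  obtain B0 where B0: "finite B0" "rspan F B0 = rspan F B1" "B0 \<subseteq> B1"
    "\<forall>c. (\<forall>b\<in>B0. c b \<in> F) \<and> (\<Sum>b\<in>B0. c b * b) = 0 \<longrightarrow> (\<forall>b\<in>B0. c b = 0)"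
    using rspan_independent[OF F B1(1)] by blast
  have rep: "\<exists>c. (\<forall>b\<in>B0. c b \<in> F) \<and> x = (\<Sum>b\<in>B0. c b * b)" if "x \<in> rspan F B1" for x
    using rspan_repr[OF subfield_subring[OF F] B0(1), of x "\<lambda>x. x"] that B0(2) by simp
  have ne: "B0 \<noteq> {}"
  proof
    assume "B0 = {}"
    then show False using rep[OF B1(2)] by simp
  qed
  have "\<forall>b\<in>B0. \<forall>b'\<in>B0. \<exists>c. (\<forall>b''\<in>B0. c b'' \<in> F) \<and> b * b' = (\<Sum>b''\<in>B0. c b'' * b'')"
    using rep B1(4) B0(3) by blast
  then obtain s where s: "\<And>b b' b''. b \<in> B0 \<Longrightarrow> b' \<in> B0 \<Longrightarrow> b'' \<in> B0 \<Longrightarrow> s b b' b'' \<in> F"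
    "\<And>b b'. b \<in> B0 \<Longrightarrow> b' \<in> B0 \<Longrightarrow> b * b' = (\<Sum>b''\<in>B0. s b b' b'' * b'')" by metis
  have "\<forall>z\<in>Z. \<exists>c. (\<forall>b\<in>B0. c b \<in> F) \<and> z = (\<Sum>b\<in>B0. c b * b)" using rep B1(3) by blast
  then obtain u where u: "\<And>z b. z \<in> Z \<Longrightarrow> b \<in> B0 \<Longrightarrow> u z b \<in> F" "\<And>z. z \<in> Z \<Longrightarrow> z = (\<Sum>b\<in>B0. u z b * b)"
    by metis
  obtain d1 where d1: "d1 \<in> A" "d1 \<noteq> 0" "\<And>b b' b''. b \<in> B0 \<Longrightarrow> b' \<in> B0 \<Longrightarrow> b'' \<in> B0 \<Longrightarrow> d1 * s b b' b'' \<in> A"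
    using common_denominator[of "(\<lambda>(b, b', b''). s b b' b'') ` (B0 \<times> B0 \<times> B0)"] B0(1) s(1)
    unfolding F_def by fastforce
  obtain d2 where d2: "d2 \<in> A" "d2 \<noteq> 0" "\<And>z b. z \<in> Z \<Longrightarrow> b \<in> B0 \<Longrightarrow> d2 * u z b \<in> A"
    using common_denominator[of "(\<lambda>(z, b). u z b) ` (Z \<times> B0)"] B0(1) Z(1) u(1)
    unfolding F_def by fastforce
  \<comment> \<open>With \<open>x * y = \<Sum> s b * b\<close> in the unscaled basis, the product of
    \<open>d1 * x\<close> and \<open>d1 * y\<close> has coordinates \<open>d1 * s b\<close> in the
    scaled one.\<close>
  define B where "B = (\<lambda>b. d1 * b) ` B0"
  have "b \<in> Kbar q \<theta>" if "b \<in> B1" for b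
    unfolding Kbar_eq F_def[symmetric]
    using alg_over_stable[OF F B1(1,2), of b] B1(4) that by blast
  then have BK: "B \<subseteq> Kbar q \<theta>"
    unfolding B_def using B0(3) d1(1) A_Kbar subfieldD(4)[OF Kbar_subfield] by blast
  have inj: "inj_on (\<lambda>b. d1 * b) B0" using d1(2) by (auto intro: inj_onI)
  have sumB: "(\<Sum>b\<in>B. c b * b) = (\<Sum>b\<in>B0. c (d1 * b) * (d1 * b))" for c
    unfolding B_def by (simp add: sum.reindex[OF inj])
  have bound: "\<exists>n. \<forall>x\<in>S. x \<in> An n" if "finite S" "S \<subseteq> A" for S
    using that
  proof (induction S rule: finite_induct)
    case (insert x S)
    then obtain n where n: "\<forall>x\<in>S. x \<in> An n" by auto
    obtain m where "x \<in> An m" using A_An insert.prems by blast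
    with n show ?case by (intro exI[of _ "max n m"]) (auto intro: An_mono)
  qed auto
  obtain \<kappa> where \<kappa>: "\<And>b b' b''. b \<in> B0 \<Longrightarrow> b' \<in> B0 \<Longrightarrow> b'' \<in> B0 \<Longrightarrow> d1 * s b b' b'' \<in> An \<kappa>"
    using bound[of "(\<lambda>(b, b', b''). d1 * s b b' b'') ` (B0 \<times> B0 \<times> B0)"] B0(1) d1(3) by fastforce
  obtain n where n: "\<And>z b. z \<in> Z \<Longrightarrow> b \<in> B0 \<Longrightarrow> d2 * u z b \<in> An n"
    using bound[of "(\<lambda>(z, b). d2 * u z b) ` (Z \<times> B0)"] B0(1) Z(1) d2(3) by fastforce
  have mem: "(\<Sum>b\<in>B0. c b * (d1 * b)) \<in> lat B m" if "\<And>b. b \<in> B0 \<Longrightarrow> c b \<in> An m" for c m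
  proof -
    have "(\<Sum>b\<in>B. c (b / d1) * b) \<in> lat B m" using that d1(2) by (intro latI) (auto simp: B_def)
    then show ?thesis unfolding sumB using d1(2) by simp
  qed
  have "order_lattice absv p k q \<theta> B \<kappa>"
  proof
    show "finite B" "B \<noteq> {}" using B0 ne by (auto simp: B_def)
    fix c assume c: "\<forall>b\<in>B. c b \<in> Kfield q \<theta>" "(\<Sum>b\<in>B. c b * b) = 0"
    have "(\<Sum>b\<in>B0. (c (d1 * b) * d1) * b) = 0" using c(2) unfolding sumB by (simp add: mult_ac)
    moreover have "\<forall>b\<in>B0. c (d1 * b) * d1 \<in> F"
      using c(1) d1(1) A_Kfield subfieldD(4)[OF F] by (auto simp: B_def F_def)
    ultimately have "\<forall>b\<in>B0. c (d1 * b) * d1 = 0" using B0(4) by auto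
    then show "\<forall>b\<in>B. c b = 0" using d1(2) by (auto simp: B_def)
  next
    fix b b' assume "b \<in> B" "b' \<in> B"
    then obtain x y where xy: "b = d1 * x" "b' = d1 * y" "x \<in> B0" "y \<in> B0" by (auto simp: B_def)
    have "b * b' = d1 * d1 * (x * y)" by (simp add: xy mult_ac)
    also have "\<dots> = (\<Sum>b\<in>B0. (d1 * s x y b) * (d1 * b))"
      unfolding s(2)[OF xy(3,4)] by (simp add: sum_distrib_left mult_ac)
    also have "\<dots> \<in> lat B \<kappa>" using \<kappa> xy by (intro mem)
    finally show "b * b' \<in> lat B \<kappa>" .
  qed
  moreover have "d1 * d2 * z \<in> lat B n" if z: "z \<in> Z" for z
  proof -
    have "d1 * d2 * z = d1 * d2 * (\<Sum>b\<in>B0. u z b * b)" using u(2)[OF z] by simp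
    also have "\<dots> = (\<Sum>b\<in>B0. (d2 * u z b) * (d1 * b))"
      by (simp add: sum_distrib_left mult_ac)
    also have "\<dots> \<in> lat B n" using n z by (intro mem)
    finally show ?thesis .
  qed
  moreover have "d1 * d2 \<in> A" "d1 * d2 \<noteq> 0" using d1 d2 subringD(4)[OF A_subring] by auto
  ultimately show ?thesis using BK by blast
qed

end

section \<open>Twists of polynomials and roots under powers of the Frobenius\<close>

context carlitz
begin

lemma twist_mult: "twist q i (r * s) = twist q i r * twist q i (s :: 'a poly)"
  unfolding fps_of_poly_eq_iff[symmetric] fps_of_poly_mult tw_poly[symmetric] by (rule tw_mult)

lemma twist_sum: "twist q i (sum f S) = (\<Sum>j\<in>S. twist q i (f j :: 'a poly))"
  unfolding fps_of_poly_eq_iff[symmetric] fps_of_poly_sum tw_poly[symmetric] by (rule tw_sum)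

lemma twist_twist: "twist q i (twist q j r) = twist q (j + i) (r :: 'a poly)"
  unfolding fps_of_poly_eq_iff[symmetric] tw_poly[symmetric] by (rule tw_tw)

lemma twist_0 [simp]: "twist q 0 r = (r :: 'a poly)"
  by (rule poly_eqI) simp

lemma twist_prod: "twist q i (prod f S) = (\<Prod>j\<in>S. twist q i (f j :: 'a poly))"
  unfolding fps_of_poly_eq_iff[symmetric] fps_of_poly_prod tw_poly[symmetric] by (rule tw_prod)

lemma twist_power: "twist q i (r ^ n) = twist q i (r :: 'a poly) ^ n"
  unfolding fps_of_poly_eq_iff[symmetric] fps_of_poly_power tw_poly[symmetric] by (rule tw_power)

lemma twist_linear: "twist q i [:- x, 1:] = [:- (x ^ (q ^ i)), 1 :: 'a:]"
  using frob_diff[of 0 x i] by (intro poly_eqI) (simp add: coeff_pCons power_0_left split: nat.splits)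

lemma twist_smult: "twist q i (smult c r) = smult (c ^ (q ^ i)) (twist q i (r :: 'a poly))"
  by (rule poly_eqI) (simp add: power_mult_distrib)

lemma degree_twist: "degree (twist q i r) = degree (r :: 'a poly)"
  unfolding twist_def by (rule degree_map_poly) simp

lemma twist_eq_0_iff: "twist q i r = 0 \<longleftrightarrow> r = (0 :: 'a poly)"
  by (auto simp: poly_eq_iff)

lemma frob_root: "\<exists>y :: 'a. y ^ (q ^ n) = x"
proof -
  define r where "r = monom 1 (q ^ n) - [:x:]"
  obtain s where "q ^ n = Suc s" using q_gt_1 by (metis Suc_pred' q_pos zero_less_power)
  then have "coeff r (q ^ n) = 1" by (simp add: r_def)
  then have "q ^ n \<le> degree r" by (intro le_degree) simp
  moreover have "1 \<le> q ^ n" using q_gt_1 by (intro one_le_power) simp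
  ultimately have "1 \<le> degree r" by linarith
  then obtain y where "poly r y = 0" using alg_closed by blast
  then show ?thesis by (intro exI[of _ y]) (simp add: r_def poly_monom)
qed

text \<open>A choice of \<open>q ^ n\<close>-th root. It exists because the field is algebraically
  closed, and it is unique because the Frobenius map is injective.\<close>

definition frt :: "nat \<Rightarrow> 'a \<Rightarrow> 'a" where
  "frt n x = (SOME y. y ^ (q ^ n) = x)"

lemma frt_power [simp]: "frt n x ^ (q ^ n) = x"
  unfolding frt_def by (rule someI_ex[OF frob_root])

lemma frt_0_iff: "frt n x = 0 \<longleftrightarrow> x = 0"
  using frt_power[of n x] by (metis power_eq_0_iff q_pos zero_less_power)

lemma frob_inject: "x ^ (q ^ n) = 0 \<Longrightarrow> (x :: 'a) = 0"
  by simp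

lemma theta_power_neq: "1 \<le> j \<Longrightarrow> \<theta> \<noteq> \<theta> ^ (q ^ j)"
proof
  assume j: "1 \<le> j" "\<theta> = \<theta> ^ (q ^ j)"
  then have "R ^ 1 = R ^ (q ^ j)" unfolding R_def by (metis av_power power_one_right)
  moreover have "1 < q ^ j" using j q_gt_1 by (intro one_less_power) auto
  ultimately show False using R_gt_1 power_strict_increasing[of 1 "q ^ j" R] by simp
qed

text \<open>The numbers \<open>a\<close> and \<open>b\<close> are only lower bounds for the orders
  of vanishing; the coefficients at these places may be 0. This is needed when several series are
  compared at one common order.\<close>

lemma fps_mult_low:
  fixes f g :: "'a fps"
  assumes "\<And>i. i < a \<Longrightarrow> fps_nth f i = 0" "\<And>i. i < b \<Longrightarrow> fps_nth g i = 0"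
  shows "fps_nth (f * g) (a + b) = fps_nth f a * fps_nth g b"
proof -
  have "fps_nth (f * g) (a + b) = (\<Sum>i=0..a + b. fps_nth f i * fps_nth g (a + b - i))"
    by (rule fps_mult_nth)
  also have "\<dots> = (\<Sum>i\<in>{a}. fps_nth f i * fps_nth g (a + b - i))"
  proof (rule sum.mono_neutral_right, goal_cases)
    case 3
    show ?case
    proof
      fix i assume i: "i \<in> {0..a + b} - {a}"
      show "fps_nth f i * fps_nth g (a + b - i) = 0"
      proof (cases "i < a")
        case False
        then have "a + b - i < b" using i by auto
        then show ?thesis using assms(2) by simp
      qed (use assms(1) in simp)
    qed
  qed auto
  finally show ?thesis by simp
qed

end

section \<open>Siegel's lemma for a fixed ratio and polynomials with lattice coefficients\<close>

context order_lattice
begin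

text \<open>If the unknowns outnumber the equations by a factor of at least
  \<open>(t + 1) / t\<close>, the solution has height \<open>t * (m + \<kappa>)\<close>, which no
  longer depends on the number of unknowns. Uniform height bounds rest on this.\<close>

lemma siegel_ratio:
  assumes fin: "finite E" "finite V" "V \<noteq> {}"
    and M: "\<And>e v. e \<in> E \<Longrightarrow> v \<in> V \<Longrightarrow> M e v \<in> lat B m"
    and ratio: "card E * (t + 1) \<le> card V * t"
  shows "\<exists>x. (\<forall>v\<in>V. x v \<in> lat B (t * (m + \<kappa>))) \<and> (\<exists>v\<in>V. x v \<noteq> 0) \<and> (\<forall>e\<in>E. (\<Sum>v\<in>V. M e v * x v) = 0)"
proof (rule siegel[OF fin(1,2) M])
  define n where "n = t * (m + \<kappa>)"
  have V: "0 < card V" using fin by (simp add: card_gt_0_iff)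
  have "card E * (n + m + \<kappa> + 1) * (t + 1) = card E * (t + 1) * (n + m + \<kappa> + 1)"
    by (simp only: mult_ac)
  also have "\<dots> \<le> card V * t * (n + m + \<kappa> + 1)" by (rule mult_right_mono[OF ratio]) simp
  also have "t * (n + m + \<kappa> + 1) = t * n + n + t" by (simp add: n_def algebra_simps)
  then have "card V * t * (n + m + \<kappa> + 1) = card V * (t * n + n + t)" by (simp only: mult.assoc)
  also have "\<dots> < card V * ((n + 1) * (t + 1))" using V by (simp add: algebra_simps)
  finally have "card E * (n + m + \<kappa> + 1) * (t + 1) < card V * (n + 1) * (t + 1)" by (simp only: mult.assoc)
  then show "card E * (t * (m + \<kappa>) + m + \<kappa> + 1) < card V * (t * (m + \<kappa>) + 1)"
    unfolding n_def[symmetric] by (simp only: mult_less_cancel2)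
qed

definition PL :: "nat \<Rightarrow> nat \<Rightarrow> 'a poly set" where
  "PL n D = {r. (\<forall>i. coeff r i \<in> lat B n) \<and> degree r \<le> D}"

lemma PL_mono: "r \<in> PL n D \<Longrightarrow> n \<le> n' \<Longrightarrow> D \<le> D' \<Longrightarrow> r \<in> PL n' D'"
  unfolding PL_def by (auto intro: lat_mono)

lemma PL_sum: "(\<And>i. i \<in> S \<Longrightarrow> f i \<in> PL n D) \<Longrightarrow> sum f S \<in> PL n D"
  unfolding PL_def
  by (induction S rule: infinite_finite_induct) (auto intro: lat_add degree_add_le)

lemma PL_mult: "r \<in> PL n D \<Longrightarrow> s \<in> PL n' D' \<Longrightarrow> r * s \<in> PL (n + n' + \<kappa>) (D + D')"
  unfolding PL_def
proof (intro CollectI conjI allI)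
  assume h: "r \<in> {r. (\<forall>i. coeff r i \<in> lat B n) \<and> degree r \<le> D}"
    "s \<in> {r. (\<forall>i. coeff r i \<in> lat B n') \<and> degree r \<le> D'}"
  fix i show "coeff (r * s) i \<in> lat B (n + n' + \<kappa>)"
    unfolding coeff_mult using h by (intro lat_sum lat_mult) auto
  show "degree (r * s) \<le> D + D'" using degree_mult_le[of r s] h by auto
qed

lemma PL_twist: "r \<in> PL n D \<Longrightarrow> twist q i r \<in> PL (q ^ i * (n + \<kappa>)) D"
  unfolding PL_def by (auto simp: degree_twist intro!: lat_power)

lemma PL_eval: "r \<in> PL n D \<Longrightarrow> poly r \<theta> \<in> lat B (n + D)"
  unfolding poly_altdef
proof (rule lat_sum)
  fix i assume r: "r \<in> PL n D" and i: "i \<in> {..degree r}"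
  have "\<theta> ^ i * coeff r i \<in> lat B (i + n)"
    using r by (intro lat_scale theta_power_An) (auto simp: PL_def)
  then show "coeff r i * \<theta> ^ i \<in> lat B (n + D)"
    using i r by (auto simp: PL_def mult.commute intro: lat_mono)
qed

end

section \<open>The auxiliary function and the two estimates of its lowest coefficient\<close>

text \<open>
  The hypotheses of the criterion, scaled by a common denominator \<open>d\<close>, together with a nontrivial
  relation \<open>\<rho>\<close> between the values; the locale is shown to be contradictory. The matrices \<open>Th v\<close> and the
  denominators \<open>del v\<close> describe the \<open>v\<close>-th twist: \<open>del v * tw v \<psi> = Th v * \<psi>\<close>.
\<close>

locale frobenius_system = order_lattice absv p k q \<theta> B \<kappa>
  for absv :: "'a::field \<Rightarrow> real" and p k q \<theta> B \<kappa> +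
  fixes J :: "'j set" and \<psi> :: "'j \<Rightarrow> 'a fps" and Th1 :: "'j \<Rightarrow> 'j \<Rightarrow> 'a poly"
    and d :: 'a and W n0 DT :: nat and y \<rho> :: "'j \<Rightarrow> 'a" and j0 :: 'j
  assumes BK: "B \<subseteq> Kbar q \<theta>" and finJ: "finite J" and j0: "j0 \<in> J" "\<rho> j0 \<noteq> 0"
    and psiT: "\<And>j. j \<in> J \<Longrightarrow> \<psi> j \<in> T"
    and ind: "\<And>h. (\<forall>j\<in>J. \<forall>i. coeff (h j) i \<in> Kbar q \<theta>) \<Longrightarrow> (\<Sum>j\<in>J. fps_of_poly (h j) * \<psi> j) = 0 \<Longrightarrow> \<forall>j\<in>J. h j = 0"
    and rel: "\<And>j. j \<in> J \<Longrightarrow> fps_of_poly (smult d ([:- (\<theta> ^ q), 1:] ^ W)) * tw 1 (\<psi> j) =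
      (\<Sum>i\<in>J. fps_of_poly (Th1 j i) * \<psi> i)"
    and Th1: "\<And>j i. j \<in> J \<Longrightarrow> i \<in> J \<Longrightarrow> Th1 j i \<in> PL n0 DT"
    and d: "d \<noteq> 0" "d \<in> lat B n0"
    and val: "\<And>j. j \<in> J \<Longrightarrow> ev (\<psi> j) \<theta> (y j)"
    and rho: "\<And>j. j \<in> J \<Longrightarrow> \<rho> j \<in> lat B n0" and rho0: "(\<Sum>j\<in>J. \<rho> j * y j) = 0"
begin

primrec Th :: "nat \<Rightarrow> 'j \<Rightarrow> 'j \<Rightarrow> 'a poly" where
  "Th 0 = (\<lambda>j i. if i = j then [:d:] else 0)"
| "Th (Suc v) = (\<lambda>j i. \<Sum>m\<in>J. twist q 1 (Th v j m) * Th1 m i)"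

primrec del :: "nat \<Rightarrow> 'a poly" where
  "del 0 = [:d:]"
| "del (Suc v) = twist q 1 (del v) * smult d ([:- (\<theta> ^ q), 1:] ^ W)"

text \<open>The zeros of the denominators are the points \<open>\<theta> ^ (q ^ j)\<close> with
  \<open>j \<ge> 1\<close>. So \<open>del v\<close> vanishes neither at \<theta>, where twists are
  evaluated, nor at 0, where lowest coefficients are read off.\<close>

lemma del_eq: "\<exists>c. c \<noteq> 0 \<and> del v = smult c (\<Prod>j\<in>{1..v}. [:- (\<theta> ^ (q ^ j)), 1:] ^ W)"
proof (induction v)
  case 0
  show ?case using d by (intro exI[of _ d]) simp
next
  case (Suc v)
  then obtain c where c: "c \<noteq> 0" "del v = smult c (\<Prod>j\<in>{1..v}. [:- (\<theta> ^ (q ^ j)), 1:] ^ W)" by blast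
  have "twist q 1 (\<Prod>j\<in>{1..v}. [:- (\<theta> ^ (q ^ j)), 1:] ^ W) = (\<Prod>j\<in>{1..v}. [:- (\<theta> ^ (q ^ Suc j)), 1:] ^ W)"
    unfolding twist_prod twist_power twist_linear by (simp add: power_mult[symmetric] mult.commute)
  moreover have "(\<Prod>j\<in>{1..Suc v}. [:- (\<theta> ^ (q ^ j)), 1:] ^ W) =
      (\<Prod>j\<in>{1..v}. [:- (\<theta> ^ (q ^ Suc j)), 1:] ^ W) * [:- (\<theta> ^ q), 1:] ^ W"
    by (induction v) (auto simp: mult_ac)
  ultimately have "del (Suc v) = smult (c ^ q * d) (\<Prod>j\<in>{1..Suc v}. [:- (\<theta> ^ (q ^ j)), 1:] ^ W)"
    using c(2) by (simp add: twist_smult mult.commute)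
  then show ?case using c(1) d(1) by (intro exI[of _ "c ^ q * d"]) auto
qed

lemma del_theta: "poly (del v) \<theta> \<noteq> 0"
  using del_eq[of v] theta_power_neq by (auto simp: poly_prod prod_zero_iff)

lemma del_0: "coeff (del v) 0 \<noteq> 0"
  using del_eq[of v] by (auto simp: poly_0_coeff_0[symmetric] poly_prod prod_zero_iff)

lemma Th_rel: "j \<in> J \<Longrightarrow> fps_of_poly (del v) * tw v (\<psi> j) = (\<Sum>i\<in>J. fps_of_poly (Th v j i) * \<psi> i)"
proof (induction v)
  case 0
  have "(\<Sum>i\<in>J. fps_of_poly (Th 0 j i) * \<psi> i) = (\<Sum>i\<in>J. if i = j then fps_of_poly [:d:] * \<psi> j else 0)"
    by (intro sum.cong) auto
  then show ?case using 0 finJ by simp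
next
  case (Suc v)
  define \<delta> where "\<delta> = fps_of_poly (smult d ([:- (\<theta> ^ q), 1:] ^ W))"
  have "fps_of_poly (del (Suc v)) * tw (Suc v) (\<psi> j) = \<delta> * tw 1 (fps_of_poly (del v) * tw v (\<psi> j))"
    by (simp add: tw_mult tw_tw tw_poly fps_of_poly_mult \<delta>_def mult_ac)
  also have "\<dots> = (\<Sum>m\<in>J. fps_of_poly (twist q 1 (Th v j m)) * (\<delta> * tw 1 (\<psi> m)))"
    unfolding Suc.IH[OF Suc.prems] by (simp add: tw_sum tw_mult tw_poly sum_distrib_left mult_ac)
  also have "\<dots> = (\<Sum>m\<in>J. \<Sum>i\<in>J. fps_of_poly (twist q 1 (Th v j m) * Th1 m i) * \<psi> i)"
    unfolding \<delta>_def by (intro sum.cong refl) (simp only: rel sum_distrib_left fps_of_poly_mult mult.assoc)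
  also have "\<dots> = (\<Sum>i\<in>J. fps_of_poly (Th (Suc v) j i) * \<psi> i)"
    by (subst sum.swap) (simp add: fps_of_poly_sum sum_distrib_right)
  finally show ?case .
qed

text \<open>One step of the recursion for \<open>Th\<close> takes height \<open>h\<close> to
  \<open>q * h + c0\<close>. The bound \<open>q ^ v * c1 - c0\<close> starts at \<open>n0\<close>
  and absorbs the additive loss in every step, because \<open>q \<ge> 2\<close>.\<close>

definition c0 where "c0 = q * \<kappa> + n0 + \<kappa>"
definition c1 where "c1 = n0 + c0"

lemma Th_PL: "j \<in> J \<Longrightarrow> i \<in> J \<Longrightarrow> Th v j i \<in> PL (q ^ v * c1 - c0) (v * DT)"
proof (induction v arbitrary: i)
  case 0
  then show ?case using d by (auto simp: c1_def PL_def coeff_pCons split: nat.splits)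
next
  case (Suc v)
  have "twist q 1 (Th v j m) * Th1 m i \<in> PL (q ^ 1 * (q ^ v * c1 - c0 + \<kappa>) + n0 + \<kappa>) (v * DT + DT)"
    if "m \<in> J" for m
    using Suc that by (intro PL_mult PL_twist Th1) auto
  then have "Th (Suc v) j i \<in> PL (q ^ 1 * (q ^ v * c1 - c0 + \<kappa>) + n0 + \<kappa>) (v * DT + DT)"
    unfolding Th.simps by (intro PL_sum)
  moreover have "q ^ 1 * (q ^ v * c1 - c0 + \<kappa>) + n0 + \<kappa> \<le> q ^ Suc v * c1 - c0"
  proof -
    have "1 * c1 \<le> q ^ v * c1" by (intro mult_right_mono) (simp_all add: Suc_le_eq)
    moreover have "c0 \<le> c1" by (simp add: c1_def)
    ultimately have "c0 \<le> q ^ v * c1" by linarith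
    then obtain s where s: "q ^ v * c1 = c0 + s" using le_Suc_ex by blast
    have e: "q ^ Suc v * c1 = q * c0 + q * s" using s by (metis distrib_left mult.assoc power_Suc)
    have "2 * c0 \<le> q * c0" using q_gt_1 by (intro mult_right_mono) auto
    then show ?thesis unfolding e s by (simp add: c0_def algebra_simps)
  qed
  ultimately show ?case by (rule PL_mono) simp
qed

text \<open>Evaluating \<open>Th v\<close> at \<theta> adds its degree \<open>v * DT\<close> to the
  height, and multiplying by a value of \<rho> adds \<open>n0 + \<kappa>\<close>. All this fits into
  \<open>q ^ v * c2\<close> since \<open>v \<le> q ^ v\<close>.\<close>

definition c2 where "c2 = c1 + DT + n0 + \<kappa>"

text \<open>
  \<open>E = \<Sum> h a * \<psi> a\<close> vanishes at a \<open>q^v\<close>-th root of \<open>\<theta>\<close> if the row \<open>\<Sum> a. (tw v (h a))(\<theta>) * Th v a\<close> is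
  proportional to \<open>\<rho>\<close>; \<open>cond v a i\<close> are the coefficients of these linear conditions.
\<close>

definition cond :: "nat \<Rightarrow> 'j \<Rightarrow> 'j \<Rightarrow> 'a" where
  "cond v a i = poly (Th v a i) \<theta> * \<rho> j0 - poly (Th v a j0) \<theta> * \<rho> i"

lemma v_le_qpow: "v \<le> q ^ v"
  using q_gt_1 less_exp[of v] power_mono[of 2 q v] by linarith

lemma cond_lat:
  assumes "a \<in> J" "i \<in> J" shows "cond v a i \<in> lat B (q ^ v * c2)"
proof -
  have "n0 + \<kappa> \<le> q ^ v * (n0 + \<kappa>)" "v * DT \<le> q ^ v * DT"
    using v_le_qpow[of v] one_le_power[of q v] q_gt_1 by (auto intro: mult_right_mono)
  moreover have "q ^ v * c2 = q ^ v * c1 + q ^ v * DT + q ^ v * (n0 + \<kappa>)"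
    by (simp add: c2_def algebra_simps)
  ultimately have le: "(q ^ v * c1 - c0 + v * DT) + n0 + \<kappa> \<le> q ^ v * c2" by linarith
  show ?thesis unfolding cond_def
    by (intro lat_mono[OF lat_diff[OF lat_mult lat_mult] le] PL_eval Th_PL rho assms j0)
qed

text \<open>The summand 1 pays for \<open>\<theta> ^ e\<close>, as
  \<open>e < D \<le> N \<le> v \<le> q ^ v\<close>, and the last \<kappa> pays for raising the
  condition to a power.\<close>

definition c3 where "c3 = 1 + c2 + \<kappa>"

definition nJ where "nJ = card J"

lemma ell_pos: "0 < nJ" unfolding nJ_def using finJ j0 by (auto simp: card_gt_0_iff)

definition c4 where "c4 = (2 * nJ) * (c3 + \<kappa>)"

text \<open>
  All equations are raised to the power \<open>q^(2N)\<close>, which makes their coefficients integral; \<open>g a e\<close> stands for the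
  \<open>q^(2N)\<close>-th power of the coefficient of \<open>t^e\<close> in \<open>h a\<close>. The zeros used have index \<open>N \<le> v < 2N\<close>, so
  that the heights of the conditions do not depend on \<open>N\<close>.
\<close>

lemma auxiliary_polynomials:
  assumes m: "1 \<le> m"
  defines "N \<equiv> 2 * nJ * m" and "D \<equiv> (2 * nJ - 1) * m"
  shows "\<exists>g. (\<forall>a\<in>J. \<forall>e<D. g a e \<in> lat B (q ^ (2 * N) * c4)) \<and> (\<exists>a\<in>J. \<exists>e<D. g a e \<noteq> 0) \<and>
    (\<forall>i\<in>J. \<forall>v. N \<le> v \<and> v < 2 * N \<longrightarrow>
      (\<Sum>a\<in>J. \<Sum>e<D. \<theta> ^ e * cond v a i * frt (2 * N) (g a e) ^ (q ^ v)) = 0)"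
proof -
  define M where "M = 2 * N"
  \<comment> \<open>The index \<open>j0\<close> is left out because its condition holds
    identically.\<close>
  define E where "E = (J - {j0}) \<times> {N..<2 * N}"
  define V where "V = J \<times> {..<D}"
  \<comment> \<open>Raised to the power \<open>q ^ (M - v)\<close>, the condition for
    \<open>v\<close> becomes linear in the \<open>q ^ M\<close>-th powers of the unknown
    coefficients, since \<open>q ^ v * q ^ (M - v) = q ^ M\<close>.\<close>
  define mat where "mat = (\<lambda>(i, v) (a, e). (\<theta> ^ e * cond v a i) ^ (q ^ (M - v)))"
  have D0: "0 < D" using m ell_pos by (simp add: D_def)
  have DN: "D \<le> N" unfolding D_def N_def by (intro mult_right_mono) auto
  \<comment> \<open>There are \<open>(nJ - 1) * 2 * nJ * m\<close> equations and
    \<open>nJ * (2 * nJ - 1) * m\<close> unknowns, exactly the ratio for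
    \<open>t = 2 * nJ - 2\<close>. The choice also leaves \<open>N - D = m\<close>, the surplus of
    zeros over the degree. For \<open>nJ = 1\<close> there are no equations and
    \<open>t = 0\<close>.\<close>
  have sol: "\<exists>x. (\<forall>u\<in>V. x u \<in> lat B ((2 * nJ - 2) * (q ^ M * c3 + \<kappa>))) \<and> (\<exists>u\<in>V. x u \<noteq> 0) \<and>
      (\<forall>w\<in>E. (\<Sum>u\<in>V. mat w u * x u) = 0)"
  proof (rule siegel_ratio)
    show "finite E" "finite V" "V \<noteq> {}" unfolding E_def V_def using finJ j0 D0 by auto
    fix w u assume "w \<in> E" "u \<in> V"
    then obtain i v a e where "w = (i, v)" "i \<in> J - {j0}" "v \<in> {N..<2 * N}" "u = (a, e)" "a \<in> J" "e \<in> {..<D}"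
      unfolding E_def V_def by blast
    then have w: "w = (i, v)" "i \<in> J" "N \<le> v" "v < 2 * N" "u = (a, e)" "a \<in> J" "e < D" by auto
    have Mv: "q ^ M = q ^ (M - v) * q ^ v" using w by (simp add: M_def power_add[symmetric])
    have "e \<le> q ^ v" using w DN v_le_qpow[of v] by simp
    then have "e + q ^ v * c2 + \<kappa> \<le> q ^ v * c3"
    proof -
      have "1 * \<kappa> \<le> q ^ v * \<kappa>" by (intro mult_right_mono) (simp_all add: Suc_le_eq)
      moreover have "q ^ v * c3 = q ^ v + q ^ v * c2 + q ^ v * \<kappa>" by (simp add: c3_def algebra_simps)
      ultimately show ?thesis using \<open>e \<le> q ^ v\<close> by linarith
    qed
    then have "q ^ (M - v) * (e + q ^ v * c2 + \<kappa>) \<le> q ^ M * c3"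
      unfolding Mv mult.assoc by (intro mult_left_mono) auto
    moreover have "(\<theta> ^ e * cond v a i) ^ (q ^ (M - v)) \<in> lat B (q ^ (M - v) * (e + q ^ v * c2 + \<kappa>))"
      using w by (intro lat_power lat_scale theta_power_An cond_lat) auto
    ultimately show "mat w u \<in> lat B (q ^ M * c3)"
      unfolding w mat_def by (auto intro: lat_mono)
  next
    obtain s where s: "nJ = Suc s" using ell_pos by (cases nJ) auto
    have "card E = s * N" unfolding E_def using finJ j0 s by (simp add: card_cartesian_product nJ_def[symmetric])
    moreover have "card V = nJ * D" unfolding V_def by (simp add: card_cartesian_product nJ_def)
    ultimately show "card E * (2 * nJ - 2 + 1) \<le> card V * (2 * nJ - 2)"
      unfolding N_def D_def s by (simp add: algebra_simps)
  qed
  then obtain x where x: "\<forall>u\<in>V. x u \<in> lat B ((2 * nJ - 2) * (q ^ M * c3 + \<kappa>))" "\<exists>u\<in>V. x u \<noteq> 0"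
      "\<forall>w\<in>E. (\<Sum>u\<in>V. mat w u * x u) = 0" by blast
  define g where "g a e = x (a, e)" for a e
  have le: "(2 * nJ - 2) * (q ^ M * c3 + \<kappa>) \<le> q ^ M * c4"
  proof -
    have "1 * \<kappa> \<le> q ^ M * \<kappa>" by (intro mult_right_mono) (simp_all add: Suc_le_eq)
    then have "q ^ M * c3 + \<kappa> \<le> q ^ M * (c3 + \<kappa>)" by (simp add: distrib_left)
    then have "(2 * nJ - 2) * (q ^ M * c3 + \<kappa>) \<le> (2 * nJ) * (q ^ M * (c3 + \<kappa>))" by (intro mult_mono) auto
    then show ?thesis by (simp add: c4_def mult_ac)
  qed
  have eqn: "(\<Sum>a\<in>J. \<Sum>e<D. \<theta> ^ e * cond v a i * frt M (g a e) ^ (q ^ v)) = 0"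
    if i: "i \<in> J" and v: "N \<le> v" "v < 2 * N" for i v
  proof (cases "i = j0")
    case True
    then show ?thesis by (simp add: cond_def)
  next
    case False
    have Mv: "q ^ M = q ^ v * q ^ (M - v)" using v by (simp add: M_def power_add[symmetric])
    have fr: "(frt M z ^ (q ^ v)) ^ (q ^ (M - v)) = z" for z
      using frt_power[of M z] unfolding Mv power_mult by simp
    have "(\<Sum>a\<in>J. \<Sum>e<D. \<theta> ^ e * cond v a i * frt M (g a e) ^ (q ^ v)) ^ (q ^ (M - v)) =
        (\<Sum>a\<in>J. \<Sum>e<D. (\<theta> ^ e * cond v a i) ^ (q ^ (M - v)) * g a e)"
      by (simp only: frob_sum power_mult_distrib[of _ "frt M _ ^ (q ^ v)"] fr)
    also have "\<dots> = (\<Sum>u\<in>V. mat (i, v) u * x u)"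
      unfolding V_def by (simp add: sum.cartesian_product mat_def g_def split_def)
    also have "\<dots> = 0" using x(3) i v False by (auto simp: E_def)
    finally show ?thesis by (rule frob_inject)
  qed
  show ?thesis
  proof (intro exI[of _ g] conjI ballI allI impI)
    show "g a e \<in> lat B (q ^ (2 * N) * c4)" if "a \<in> J" "e < D" for a e
      using x(1) that lat_mono[OF _ le] by (auto simp: g_def V_def M_def)
    show "\<exists>a\<in>J. \<exists>e<D. g a e \<noteq> 0" using x(2) by (auto simp: g_def V_def)
    show "(\<Sum>a\<in>J. \<Sum>e<D. \<theta> ^ e * cond v a i * frt (2 * N) (g a e) ^ (q ^ v)) = 0"
      if "i \<in> J" "N \<le> v \<and> v < 2 * N" for i v using eqn that by (auto simp: M_def)
  qed
qed

text \<open>The coordinates with respect to \<psi> of the \<open>v\<close>-th twist of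
  \<open>E\<close>, multiplied by \<open>del v\<close>.\<close>

definition Y :: "('j \<Rightarrow> 'a poly) \<Rightarrow> nat \<Rightarrow> 'j \<Rightarrow> 'a poly" where
  "Y h v i = (\<Sum>a\<in>J. twist q v (h a) * Th v a i)"

lemma Y_rel:
  "fps_of_poly (del v) * tw v (\<Sum>a\<in>J. fps_of_poly (h a) * \<psi> a) = (\<Sum>i\<in>J. fps_of_poly (Y h v i) * \<psi> i)"
proof -
  have "fps_of_poly (del v) * tw v (\<Sum>a\<in>J. fps_of_poly (h a) * \<psi> a) =
      (\<Sum>a\<in>J. fps_of_poly (twist q v (h a)) * (fps_of_poly (del v) * tw v (\<psi> a)))"
    by (simp add: tw_sum tw_mult tw_poly sum_distrib_left mult_ac)
  also have "\<dots> = (\<Sum>a\<in>J. \<Sum>i\<in>J. fps_of_poly (twist q v (h a) * Th v a i) * \<psi> i)"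
    by (intro sum.cong refl) (simp only: Th_rel sum_distrib_left fps_of_poly_mult mult.assoc)
  also have "\<dots> = (\<Sum>i\<in>J. fps_of_poly (Y h v i) * \<psi> i)"
    by (subst sum.swap) (simp add: Y_def fps_of_poly_sum sum_distrib_right)
  finally show ?thesis .
qed

text \<open>The conditions make the row of values of \<open>Y h v\<close> at \<theta> proportional
  to \<rho>, so its pairing with the values \<open>y\<close> is a multiple of the given relation and
  vanishes. That pairing is \<open>del v\<close> times the \<open>q ^ v\<close>-th power of the
  value of \<open>E\<close> at \<open>x\<close>.\<close>

lemma zero_at_root:
  assumes x: "x ^ (q ^ v) = \<theta>" "absv x \<le> R"
    and h: "\<And>i. i \<in> J \<Longrightarrow> (\<Sum>a\<in>J. poly (twist q v (h a)) \<theta> * cond v a i) = 0"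
  shows "ev (\<Sum>a\<in>J. fps_of_poly (h a) * \<psi> a) x 0"
proof -
  define E where "E = (\<Sum>a\<in>J. fps_of_poly (h a) * \<psi> a)"
  have ET: "E \<in> T" unfolding E_def
    by (intro subring_sum[OF T_subring] subringD(4)[OF T_subring] T_poly psiT)
  obtain z where z: "ev E x z" using ev_exists[OF ET x(2)] by blast
  have Yc: "poly (Y h v i) \<theta> * \<rho> j0 = poly (Y h v j0) \<theta> * \<rho> i" if "i \<in> J" for i
  proof -
    have "0 = (\<Sum>a\<in>J. poly (twist q v (h a)) \<theta> * cond v a i)" using h[OF that] by simp
    also have "\<dots> = poly (Y h v i) \<theta> * \<rho> j0 - poly (Y h v j0) \<theta> * \<rho> i"
      by (simp add: Y_def cond_def poly_sum sum_distrib_left right_diff_distrib sum_subtractf mult_ac)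
    finally show ?thesis by simp
  qed
  have tR: "absv \<theta> \<le> R" by (simp add: R_def)
  have "ev (fps_of_poly (del v) * tw v E) \<theta> (poly (del v) \<theta> * z ^ (q ^ v))"
    using ev_tw[OF z, of v] x(1) by (intro ev_mult ev_poly tR) simp
  moreover have "ev (fps_of_poly (del v) * tw v E) \<theta> (\<Sum>i\<in>J. poly (Y h v i) \<theta> * y i)"
    unfolding E_def Y_rel by (intro ev_sum ev_mult ev_poly val tR)
  ultimately have e: "poly (del v) \<theta> * z ^ (q ^ v) = (\<Sum>i\<in>J. poly (Y h v i) \<theta> * y i)"
    using ev_unique tR by blast
  have "\<rho> j0 * (\<Sum>i\<in>J. poly (Y h v i) \<theta> * y i) = (\<Sum>i\<in>J. (poly (Y h v i) \<theta> * \<rho> j0) * y i)"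
    by (simp add: sum_distrib_left mult_ac)
  also have "\<dots> = (\<Sum>i\<in>J. (poly (Y h v j0) \<theta> * \<rho> i) * y i)" using Yc by (intro sum.cong refl) simp
  also have "\<dots> = poly (Y h v j0) \<theta> * (\<Sum>i\<in>J. \<rho> i * y i)"
    unfolding sum_distrib_left by (simp only: mult.assoc)
  finally have "(\<Sum>i\<in>J. poly (Y h v i) \<theta> * y i) = 0" using j0 rho0 by simp
  then have "z = 0" using e del_theta[of v] by simp
  then show ?thesis using z by (simp add: E_def)
qed

text \<open>A height for the \<open>M\<close>-th twist of all rows \<open>Y h v\<close> with
  \<open>v \<le> nJ\<close>: the first summand comes from twisting \<open>h\<close>, the second from
  \<open>Th\<close>, and \<open>2 * \<kappa>\<close> from powers and products. \<open>c9\<close> is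
  the height of the solution of \<open>siegel_ratio\<close> with
  \<open>t = 2 * nJ + 1\<close>.\<close>

definition c8 where "c8 = q ^ nJ * (c4 + \<kappa>) + q ^ nJ * c1 + 2 * \<kappa>"
definition c9 where "c9 = (2 * nJ + 1) * (c8 + \<kappa>)"

text \<open>The rows for \<open>v = 0, ..., nJ\<close> are \<open>nJ + 1\<close> vectors of length
  \<open>nJ\<close> and hence dependent over the rational functions. Siegel's lemma makes the
  coefficients of a dependence small in height; their degree may be arbitrary, since only
  coefficients are estimated later.\<close>

lemma Y_relation:
  assumes h: "\<And>a. a \<in> J \<Longrightarrow> twist q M (h a) \<in> PL (q ^ M * c4) D"
  shows "\<exists>b D2. (\<forall>v\<le>nJ. \<forall>e<D2. b v e \<in> lat B (q ^ M * c9)) \<and> (\<exists>v\<le>nJ. \<exists>e<D2. b v e \<noteq> 0) \<and>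
    (\<forall>i\<in>J. (\<Sum>v\<le>nJ. (\<Sum>e<D2. monom (frt M (b v e)) e) * Y h v i) = 0)"
proof -
  \<comment> \<open>\<open>D'\<close> exceeds the degree of every row. The coefficients of degree
    below \<open>D2 + D'\<close> give \<open>nJ * (2 * nJ + 1) * D'\<close> equations in
    \<open>(nJ + 1) * 2 * nJ * D'\<close> unknowns, exactly the ratio for
    \<open>t = 2 * nJ + 1\<close>.\<close>
  define D' where "D' = D + nJ * DT + 1"
  define D2 where "D2 = 2 * nJ * D'"
  have YP: "twist q M (Y h v i) \<in> PL (q ^ M * c8) (D + nJ * DT)" if "i \<in> J" "v \<le> nJ" for i v
  proof -
    have qv: "q ^ v \<le> q ^ nJ" using that q_gt_1 by (intro power_increasing) auto
    have "twist q v (twist q M (h a)) * twist q M (Th v a i) \<in>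
        PL (q ^ v * (q ^ M * c4 + \<kappa>) + q ^ M * (q ^ v * c1 - c0 + \<kappa>) + \<kappa>) (D + v * DT)"
      if "a \<in> J" for a using h \<open>i \<in> J\<close> that by (intro PL_mult PL_twist Th_PL) auto
    moreover have "twist q v (twist q M (h a)) = twist q M (twist q v (h a))" for a
      by (simp add: twist_twist add.commute)
    ultimately have "twist q M (Y h v i) \<in>
        PL (q ^ v * (q ^ M * c4 + \<kappa>) + q ^ M * (q ^ v * c1 - c0 + \<kappa>) + \<kappa>) (D + v * DT)"
      unfolding Y_def twist_sum twist_mult by (intro PL_sum) auto
    moreover have "q ^ v * (q ^ M * c4 + \<kappa>) + q ^ M * (q ^ v * c1 - c0 + \<kappa>) + \<kappa> \<le> q ^ M * c8"
    proof -
      have k: "1 * \<kappa> \<le> q ^ M * \<kappa>" by (intro mult_right_mono) (simp_all add: Suc_le_eq)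
      then have "q ^ M * c4 + \<kappa> \<le> q ^ M * (c4 + \<kappa>)" by (simp add: distrib_left)
      then have 1: "q ^ v * (q ^ M * c4 + \<kappa>) \<le> q ^ nJ * (q ^ M * (c4 + \<kappa>))"
        using qv by (intro mult_mono) auto
      have "q ^ v * c1 - c0 + \<kappa> \<le> q ^ nJ * c1 + \<kappa>"
        using mult_right_mono[OF qv, of c1] by linarith
      then have 2: "q ^ M * (q ^ v * c1 - c0 + \<kappa>) \<le> q ^ M * (q ^ nJ * c1 + \<kappa>)" by (intro mult_left_mono) auto
      have "q ^ M * c8 = q ^ nJ * (q ^ M * (c4 + \<kappa>)) + q ^ M * (q ^ nJ * c1 + \<kappa>) + q ^ M * \<kappa>"
        by (simp add: c8_def algebra_simps)
      then show ?thesis using 1 2 k by linarith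
    qed
    moreover have "D + v * DT \<le> D + nJ * DT" using that by simp
    ultimately show ?thesis by (rule PL_mono)
  qed
  define E where "E = J \<times> {..<D2 + D'}"
  define V where "V = {..nJ} \<times> {..<D2}"
  define mat where "mat = (\<lambda>(i, s) (v, e). if e \<le> s then coeff (twist q M (Y h v i)) (s - e) else 0)"
  have "\<exists>x. (\<forall>u\<in>V. x u \<in> lat B ((2 * nJ + 1) * (q ^ M * c8 + \<kappa>))) \<and> (\<exists>u\<in>V. x u \<noteq> 0) \<and>
      (\<forall>w\<in>E. (\<Sum>u\<in>V. mat w u * x u) = 0)"
  proof (rule siegel_ratio)
    have "0 < D2" unfolding D2_def D'_def using ell_pos by simp
    then have "(0, 0) \<in> V" by (simp add: V_def)
    then show "finite E" "finite V" "V \<noteq> {}" unfolding E_def V_def using finJ by auto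
    show "mat w u \<in> lat B (q ^ M * c8)" if "w \<in> E" "u \<in> V" for w u
      using that YP unfolding E_def V_def mat_def PL_def by auto
    have "card E = nJ * ((2 * nJ + 1) * D')"
      unfolding E_def D2_def by (simp add: card_cartesian_product nJ_def[symmetric])
    moreover have "card V = (nJ + 1) * (2 * nJ * D')"
      unfolding V_def D2_def by (simp add: card_cartesian_product)
    ultimately show "card E * (2 * nJ + 1 + 1) \<le> card V * (2 * nJ + 1)" by (simp add: algebra_simps)
  qed
  then obtain x where x: "\<forall>u\<in>V. x u \<in> lat B ((2 * nJ + 1) * (q ^ M * c8 + \<kappa>))" "\<exists>u\<in>V. x u \<noteq> 0"
      "\<forall>w\<in>E. (\<Sum>u\<in>V. mat w u * x u) = 0" by blast
  define b where "b v e = x (v, e)" for v e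
  have le: "(2 * nJ + 1) * (q ^ M * c8 + \<kappa>) \<le> q ^ M * c9"
  proof -
    have "1 * \<kappa> \<le> q ^ M * \<kappa>" by (intro mult_right_mono) (simp_all add: Suc_le_eq)
    then have "q ^ M * c8 + \<kappa> \<le> q ^ M * (c8 + \<kappa>)" by (simp add: distrib_left)
    then have "(2 * nJ + 1) * (q ^ M * c8 + \<kappa>) \<le> (2 * nJ + 1) * (q ^ M * (c8 + \<kappa>))" by (intro mult_left_mono) auto
    then show ?thesis by (simp add: c9_def mult_ac)
  qed
  have zero: "(\<Sum>v\<le>nJ. (\<Sum>e<D2. monom (frt M (b v e)) e) * Y h v i) = 0" if i: "i \<in> J" for i
  proof -
    define P where "P = (\<Sum>v\<le>nJ. (\<Sum>e<D2. monom (b v e) e) * twist q M (Y h v i))"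
    have tP: "twist q M (\<Sum>v\<le>nJ. (\<Sum>e<D2. monom (frt M (b v e)) e) * Y h v i) = P"
    proof -
      have "twist q M (monom (frt M z) e) = monom z e" for z e
        by (rule poly_eqI) (simp add: power_0_left)
      then show ?thesis unfolding P_def by (simp add: twist_sum twist_mult)
    qed
    have "P = 0"
    proof (rule poly_eqI)
      fix s
      have cm: "coeff ((\<Sum>e<D2. monom (b v e) e) * r) s = (\<Sum>e<D2. b v e * (if e \<le> s then coeff r (s - e) else 0))" for v r
        unfolding sum_distrib_right coeff_sum coeff_monom_mult by (intro sum.cong) auto
      have cP: "coeff P s = (\<Sum>v\<le>nJ. \<Sum>e<D2. b v e * (if e \<le> s then coeff (twist q M (Y h v i)) (s - e) else 0))"
        unfolding P_def coeff_sum cm ..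
      show "coeff P s = coeff 0 s"
      proof (cases "s < D2 + D'")
        case True
        then have "0 = (\<Sum>u\<in>V. mat (i, s) u * x u)" using x(3) i by (auto simp: E_def)
        also have "\<dots> = coeff P s"
          unfolding V_def cP sum.cartesian_product by (intro sum.cong) (auto simp: mat_def b_def)
        finally show ?thesis by simp
      next
        case False
        have "coeff (twist q M (Y h v i)) (s - e) = 0" if "v \<le> nJ" "e < D2" for v e
        proof (rule coeff_eq_0)
          show "degree (twist q M (Y h v i)) < s - e"
            using YP[OF i that(1)] that False unfolding PL_def D'_def by auto
        qed
        then show ?thesis unfolding cP by (simp add: sum.neutral)
      qed
    qed
    with tP have "twist q M (\<Sum>v\<le>nJ. (\<Sum>e<D2. monom (frt M (b v e)) e) * Y h v i) = 0" by (rule trans)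
    then show ?thesis by (rule twist_eq_0_iff[THEN iffD1])
  qed
  show ?thesis
  proof (rule exI[of _ b], rule exI[of _ D2], intro conjI ballI allI impI)
    show "b v e \<in> lat B (q ^ M * c9)" if "v \<le> nJ" "e < D2" for v e
      using x(1) that lat_mono[OF _ le] by (auto simp: b_def V_def)
    show "\<exists>v\<le>nJ. \<exists>e<D2. b v e \<noteq> 0" using x(2) by (auto simp: b_def V_def)
  qed (use zero in auto)
qed

lemma lat_Kbar: "lat B n \<subseteq> Kbar q \<theta>"
proof
  fix x assume "x \<in> lat B n"
  then obtain a where "\<And>b. b \<in> B \<Longrightarrow> a b \<in> An n" "x = (\<Sum>b\<in>B. a b * b)" using latD by blast
  then show "x \<in> Kbar q \<theta>"
    using BK An_A[of n] A_Kbar by (auto intro!: subfield_sum[OF Kbar_subfield] subfieldD(4)[OF Kbar_subfield])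
qed

text \<open>The \<open>q ^ M\<close>-th root turns height \<open>q ^ M * c\<close> into
  \<open>c\<close>, and the constant survives because it is at least 1. This is how bounds become
  independent of \<open>M\<close>.\<close>

lemma frt_le:
  assumes "absv x \<le> C * R ^ (q ^ M * c)" "1 \<le> C" shows "absv (frt M x) \<le> C * R ^ c"
proof (rule power_le_imp_le_base[of _ "q ^ M - 1"])
  have "absv (frt M x) ^ (q ^ M) = absv x" unfolding av_power[symmetric] frt_power ..
  also have "\<dots> \<le> C * R ^ (q ^ M * c)" by (rule assms)
  also have "\<dots> \<le> C ^ (q ^ M) * R ^ (q ^ M * c)"
    using assms(2) by (intro mult_right_mono self_le_power) auto
  also have "\<dots> = (C * R ^ c) ^ (q ^ M)" by (simp add: power_mult_distrib power_mult[symmetric] mult.commute)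
  finally show "absv (frt M x) ^ Suc (q ^ M - 1) \<le> (C * R ^ c) ^ Suc (q ^ M - 1)" by simp
qed (use assms in simp)

lemma frt_ge:
  assumes "c' / R ^ (q ^ M * c) \<le> absv x" "0 < c'" "c' \<le> 1" shows "c' / R ^ c \<le> absv (frt M x)"
proof (rule power_le_imp_le_base[of _ "q ^ M - 1"])
  have "c' ^ (q ^ M) \<le> c' ^ 1" using assms by (intro power_decreasing) (auto simp: Suc_le_eq)
  have "(c' / R ^ c) ^ (q ^ M) = c' ^ (q ^ M) / R ^ (q ^ M * c)"
    by (simp add: power_divide power_mult[symmetric] mult.commute)
  also have "\<dots> \<le> c' / R ^ (q ^ M * c)" using \<open>c' ^ (q ^ M) \<le> c' ^ 1\<close> by (intro divide_right_mono) auto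
  also have "\<dots> \<le> absv x" by (rule assms)
  also have "\<dots> = absv (frt M x) ^ (q ^ M)" unfolding av_power[symmetric] frt_power ..
  finally show "(c' / R ^ c) ^ Suc (q ^ M - 1) \<le> absv (frt M x) ^ Suc (q ^ M - 1)" by simp
qed simp

text \<open>The term of least index with nonzero coefficient must be balanced by the later ones,
  each of which contains at least one more factor \<open>e\<close>. If \<open>e\<close> were too
  small, the first term would dominate.\<close>

lemma additive_lower_bound:
  assumes A: "\<And>v. v \<le> n \<Longrightarrow> absv (a v) \<le> U" "\<And>v. v \<le> n \<Longrightarrow> a v \<noteq> 0 \<Longrightarrow> l \<le> absv (a v)"
    and ne: "\<exists>v\<le>n. a v \<noteq> 0" and s: "(\<Sum>v\<le>n. a v * e ^ (q ^ v)) = 0" and e: "e \<noteq> 0" and l: "0 < l"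
  shows "min 1 (l / U) \<le> absv e"
proof (rule ccontr)
  assume "\<not> ?thesis"
  then have e1: "absv e < 1" "absv e < l / U" by auto
  define v0 where "v0 = (LEAST v. v \<le> n \<and> a v \<noteq> 0)"
  have v0: "v0 \<le> n" "a v0 \<noteq> 0" using LeastI_ex[OF ne] by (auto simp: v0_def)
  have low: "a v = 0" if "v < v0" for v
    using not_less_Least[OF that[unfolded v0_def]] that v0(1) by auto
  have lU: "l \<le> U" using A[OF v0(1)] v0(2) by linarith
  then have U: "0 < U" using l by simp
  have ep: "0 < absv e" using e by (metis av_nonneg av_zero_iff less_eq_real_def)
  have "0 = a v0 * e ^ (q ^ v0) + (\<Sum>v\<in>{..n} - {v0}. a v * e ^ (q ^ v))"
    using s v0 sum.remove[of "{..n}" v0 "\<lambda>v. a v * e ^ (q ^ v)"] by simp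
  then have eq: "a v0 * e ^ (q ^ v0) = - (\<Sum>v\<in>{..n} - {v0}. a v * e ^ (q ^ v))"
    by (metis eq_neg_iff_add_eq_0)
  have "absv (a v0 * e ^ (q ^ v0)) \<le> U * absv e * absv e ^ (q ^ v0)"
    unfolding eq av_minus
  proof (rule av_sum_le)
    fix v assume v: "v \<in> {..n} - {v0}"
    show "absv (a v * e ^ (q ^ v)) \<le> U * absv e * absv e ^ (q ^ v0)"
    proof (cases "v < v0")
      case False
      then have "v0 < v" using v by auto
      then have "Suc (q ^ v0) \<le> q ^ v" using q_gt_1 by (intro Suc_leI power_strict_increasing) auto
      then have "absv e ^ (q ^ v) \<le> absv e ^ Suc (q ^ v0)" using e1 by (intro power_decreasing) auto
      then have "absv (a v) * absv e ^ (q ^ v) \<le> U * absv e ^ Suc (q ^ v0)"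
        using A(1)[of v] v U by (intro mult_mono) auto
      then show ?thesis by (simp add: av_mult av_power mult_ac)
    qed (use low U in simp)
  qed (use U in simp)
  then have "absv (a v0) \<le> U * absv e" using ep by (simp add: av_mult av_power)
  moreover have "U * absv e < l" using e1(2) U by (simp add: field_simps)
  ultimately show False using A(2)[OF v0] by simp
qed

text \<open>A dependence between the rows is a linear relation between the twists of
  \<open>E\<close>. All twists vanish to the same order as \<open>E\<close> and have powers of its
  lowest coefficient as lowest coefficients, so the lowest term of the relation is an additive
  polynomial equation for that coefficient.\<close>

lemma lower_bound:
  "\<exists>c>0. \<forall>M D h. (\<forall>a\<in>J. twist q M (h a) \<in> PL (q ^ M * c4) D) \<longrightarrow>
     (\<Sum>a\<in>J. fps_of_poly (h a) * \<psi> a) \<noteq> 0 \<longrightarrow>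
     c \<le> absv (fps_nth (\<Sum>a\<in>J. fps_of_poly (h a) * \<psi> a) (subdegree (\<Sum>a\<in>J. fps_of_poly (h a) * \<psi> a)))"
proof -
  obtain C where C: "1 \<le> C" "\<And>n x. x \<in> lat B n \<Longrightarrow> absv x \<le> C * R ^ n" using lat_le by blast
  obtain c' where c': "0 < c'" "\<And>m x. x \<in> lat B m \<Longrightarrow> x \<noteq> 0 \<Longrightarrow> c' / R ^ (card B * (m + \<kappa>)) \<le> absv x"
    using liouville by blast
  \<comment> \<open>The minimum with 1 is needed because a root of the constant is at least the
    constant only if the constant is at most 1.\<close>
  define l1 where "l1 = min 1 c' / R ^ (card B * (c9 + \<kappa>))"
  define \<Delta> where "\<Delta> v = absv (coeff (del v) 0)" for v
  have \<Delta>: "0 < \<Delta> v" for v unfolding \<Delta>_def using del_0[of v] by (metis av_nonneg av_zero_iff less_eq_real_def)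
  define \<Delta>min where "\<Delta>min = Min (\<Delta> ` {..nJ})"
  define \<Delta>max where "\<Delta>max = Max (\<Delta> ` {..nJ})"
  have \<Delta>m: "0 < \<Delta>min" "\<And>v. v \<le> nJ \<Longrightarrow> \<Delta>min \<le> \<Delta> v" "\<And>v. v \<le> nJ \<Longrightarrow> \<Delta> v \<le> \<Delta>max"
    unfolding \<Delta>min_def \<Delta>max_def using \<Delta> by auto
  define l where "l = l1 * \<Delta>min"
  define U where "U = C * R ^ c9 * \<Delta>max"
  have l: "0 < l" unfolding l_def l1_def using c' \<Delta>m by simp
  have U: "0 < U" unfolding U_def using C \<Delta>m(3)[of 0] \<Delta>[of 0] by simp
  show ?thesis
  proof (intro exI[of _ "min 1 (l / U)"] conjI allI impI)
    show "0 < min 1 (l / U)" using l U by simp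
    fix M D h
    assume h: "\<forall>a\<in>J. twist q M (h a) \<in> PL (q ^ M * c4) D"
      and nz: "(\<Sum>a\<in>J. fps_of_poly (h a) * \<psi> a) \<noteq> 0"
    define E where "E = (\<Sum>a\<in>J. fps_of_poly (h a) * \<psi> a)"
    have "\<exists>b D2. (\<forall>v\<le>nJ. \<forall>e<D2. b v e \<in> lat B (q ^ M * c9)) \<and> (\<exists>v\<le>nJ. \<exists>e<D2. b v e \<noteq> 0) \<and>
      (\<forall>i\<in>J. (\<Sum>v\<le>nJ. (\<Sum>e<D2. monom (frt M (b v e)) e) * Y h v i) = 0)"
      by (rule Y_relation) (use h in auto)
    then obtain b D2 where b0: "(\<forall>v\<le>nJ. \<forall>e<D2. b v e \<in> lat B (q ^ M * c9)) \<and> (\<exists>v\<le>nJ. \<exists>e<D2. b v e \<noteq> 0) \<and>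
      (\<forall>i\<in>J. (\<Sum>v\<le>nJ. (\<Sum>e<D2. monom (frt M (b v e)) e) * Y h v i) = 0)"
      by (elim exE)
    note b = b0[THEN conjunct1] b0[THEN conjunct2, THEN conjunct1] b0[THEN conjunct2, THEN conjunct2]
    define a where "a v = (\<Sum>e<D2. monom (frt M (b v e)) e)" for v
    have ca: "coeff (a v) e = (if e < D2 then frt M (b v e) else 0)" for v e
      unfolding a_def by (simp add: coeff_sum if_distrib cong: if_cong)
    have "(\<Sum>v\<le>nJ. fps_of_poly (a v) * (fps_of_poly (del v) * tw v E)) =
        (\<Sum>v\<le>nJ. \<Sum>i\<in>J. fps_of_poly (a v * Y h v i) * \<psi> i)"
      unfolding E_def Y_rel by (simp add: sum_distrib_left fps_of_poly_mult mult.assoc)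
    also have "\<dots> = (\<Sum>i\<in>J. fps_of_poly (\<Sum>v\<le>nJ. a v * Y h v i) * \<psi> i)"
      by (subst sum.swap) (simp add: fps_of_poly_sum sum_distrib_right)
    also have "\<dots> = 0" using b(3) by (simp add: a_def)
    finally have rel0: "(\<Sum>v\<le>nJ. fps_of_poly (a v) * (fps_of_poly (del v) * tw v E)) = 0" .
    \<comment> \<open>The least degree in which any coefficient polynomial of the relation is
      nonzero. The relation is read at degree \<open>k0 + m0\<close>, where each summand contributes
      a single product.\<close>
    define k0 where "k0 = (LEAST e. \<exists>v\<le>nJ. coeff (a v) e \<noteq> 0)"
    have "\<exists>e. \<exists>v\<le>nJ. coeff (a v) e \<noteq> 0" using b(2) by (auto simp: ca frt_0_iff)
    then have k0: "\<exists>v\<le>nJ. coeff (a v) k0 \<noteq> 0" unfolding k0_def by (rule LeastI_ex)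
    have k0l: "coeff (a v) e = 0" if "e < k0" "v \<le> nJ" for e v
      using not_less_Least[OF that(1)[unfolded k0_def]] that(2) by auto
    define m0 where "m0 = subdegree E"
    define e where "e = fps_nth E m0"
    have e0: "e \<noteq> 0" unfolding e_def m0_def using nz by (simp add: E_def)
    have "(\<Sum>v\<le>nJ. (coeff (a v) k0 * coeff (del v) 0) * e ^ (q ^ v)) =
        fps_nth (\<Sum>v\<le>nJ. fps_of_poly (a v) * (fps_of_poly (del v) * tw v E)) (k0 + (0 + m0))"
      unfolding fps_sum_nth
    proof (intro sum.cong refl)
      fix v assume v: "v \<in> {..nJ}"
      have tE: "fps_nth (tw v E) i = 0" if "i < m0" for i
        using nth_less_subdegree_zero[of i E] that by (simp add: m0_def power_0_left)
      have dE: "fps_nth (fps_of_poly (del v) * tw v E) (0 + m0) = coeff (del v) 0 * e ^ (q ^ v)"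
        by (subst fps_mult_low) (use tE in \<open>auto simp: e_def\<close>)
      have dl: "fps_nth (fps_of_poly (del v) * tw v E) i = 0" if "i < 0 + m0" for i
        unfolding fps_mult_nth by (intro sum.neutral ballI) (use tE that in auto)
      have "fps_nth (fps_of_poly (a v) * (fps_of_poly (del v) * tw v E)) (k0 + (0 + m0)) =
          fps_nth (fps_of_poly (a v)) k0 * fps_nth (fps_of_poly (del v) * tw v E) (0 + m0)"
        by (rule fps_mult_low) (use k0l v dl in auto)
      then show "coeff (a v) k0 * coeff (del v) 0 * e ^ (q ^ v) =
          fps_nth (fps_of_poly (a v) * (fps_of_poly (del v) * tw v E)) (k0 + (0 + m0))"
        unfolding dE by (simp add: mult_ac)
    qed
    then have s: "(\<Sum>v\<le>nJ. (coeff (a v) k0 * coeff (del v) 0) * e ^ (q ^ v)) = 0" unfolding rel0 by simp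
    have up: "absv (coeff (a v) k0 * coeff (del v) 0) \<le> U" if v: "v \<le> nJ" for v
    proof -
      have "absv (coeff (a v) k0) \<le> C * R ^ c9"
      proof (cases "k0 < D2")
        case True
        then show ?thesis using b(1) v C unfolding ca by (auto intro!: frt_le)
      qed (use C in \<open>simp add: ca\<close>)
      then show ?thesis unfolding av_mult U_def \<Delta>_def[symmetric]
        using \<Delta>m(3)[OF v] C \<Delta>[of v] by (intro mult_mono) (auto intro: less_imp_le)
    qed
    have lo: "l \<le> absv (coeff (a v) k0 * coeff (del v) 0)"
      if v: "v \<le> nJ" and n: "coeff (a v) k0 * coeff (del v) 0 \<noteq> 0" for v
    proof -
      have k: "k0 < D2" "b v k0 \<noteq> 0" using n by (auto simp: ca frt_0_iff split: if_splits)
      then have "c' / R ^ (card B * (q ^ M * c9 + \<kappa>)) \<le> absv (b v k0)" using c'(2) b(1) v by blast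
      moreover have "min 1 c' / R ^ (q ^ M * (card B * (c9 + \<kappa>))) \<le> c' / R ^ (card B * (q ^ M * c9 + \<kappa>))"
      proof (rule frac_le)
        have "1 * \<kappa> \<le> q ^ M * \<kappa>" by (intro mult_right_mono) (simp_all add: Suc_le_eq)
        then have "q ^ M * c9 + \<kappa> \<le> q ^ M * (c9 + \<kappa>)" by (simp add: distrib_left)
        then have "card B * (q ^ M * c9 + \<kappa>) \<le> card B * (q ^ M * (c9 + \<kappa>))" by (rule mult_le_mono2)
        also have "\<dots> = q ^ M * (card B * (c9 + \<kappa>))" by (simp add: mult_ac)
        finally show "R ^ (card B * (q ^ M * c9 + \<kappa>)) \<le> R ^ (q ^ M * (card B * (c9 + \<kappa>)))"
          using R_gt_1 by (intro power_increasing) auto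
      qed (use c' in auto)
      ultimately have "min 1 c' / R ^ (q ^ M * (card B * (c9 + \<kappa>))) \<le> absv (b v k0)" by simp
      then have "l1 \<le> absv (coeff (a v) k0)"
        unfolding l1_def ca using k(1) c'(1) by (simp add: frt_ge)
      moreover have "0 \<le> l1" using c'(1) by (simp add: l1_def)
      ultimately show ?thesis unfolding av_mult l_def \<Delta>_def[symmetric]
        using \<Delta>m(1) \<Delta>m(2)[OF v] by (intro mult_mono) auto
    qed
    have ex: "\<exists>v\<le>nJ. coeff (a v) k0 * coeff (del v) 0 \<noteq> 0" using k0 del_0 by auto
    have "min 1 (l / U) \<le> absv e"
      by (rule additive_lower_bound[where a = "\<lambda>v. coeff (a v) k0 * coeff (del v) 0", OF up lo ex s e0 l])
    then show "min 1 (l / U) \<le> absv (fps_nth (\<Sum>a\<in>J. fps_of_poly (h a) * \<psi> a) (subdegree (\<Sum>a\<in>J. fps_of_poly (h a) * \<psi> a)))"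
      by (simp add: e_def m0_def E_def)
  qed
qed

text \<open>The degree \<open>D\<close> costs \<open>R ^ D\<close> in the Gauss norm, while the
  \<open>N\<close> zeros save \<open>R ^ N\<close>, so the surplus \<open>N - D = m\<close> remains.
  The heights of the coefficients stay bounded after taking roots.\<close>

lemma upper_bound:
  "\<exists>C. \<forall>m\<ge>1. \<exists>M D h. (\<forall>a\<in>J. twist q M (h a) \<in> PL (q ^ M * c4) D) \<and>
     (\<Sum>a\<in>J. fps_of_poly (h a) * \<psi> a) \<noteq> 0 \<and>
     absv (fps_nth (\<Sum>a\<in>J. fps_of_poly (h a) * \<psi> a) (subdegree (\<Sum>a\<in>J. fps_of_poly (h a) * \<psi> a))) \<le> C / R ^ m"
proof -
  obtain C where C: "1 \<le> C" "\<And>n x. x \<in> lat B n \<Longrightarrow> absv x \<le> C * R ^ n" using lat_le by blast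
  have "\<forall>j\<in>J. \<exists>b\<ge>1. gle (\<psi> j) b" using psiT T_bounded by blast
  then obtain bd where bd: "\<And>j. j \<in> J \<Longrightarrow> 1 \<le> bd j" "\<And>j. j \<in> J \<Longrightarrow> gle (\<psi> j) (bd j)" by metis
  define C7 where "C7 = Max (bd ` J)"
  have C7: "gle (\<psi> j) C7" if "j \<in> J" for j
    using bd(2)[OF that] by (rule gle_mono) (use finJ that in \<open>auto simp: C7_def\<close>)
  have C70: "0 \<le> C7" using gle_nonneg[OF C7[OF j0(1)]] .
  show ?thesis
  proof (intro exI[of _ "R * (C * R ^ c4) * C7"] allI impI)
    fix m :: nat assume m: "1 \<le> m"
    define N where "N = 2 * nJ * m"
    define D where "D = (2 * nJ - 1) * m"
    have N1: "1 \<le> N" unfolding N_def using ell_pos m by (simp add: Suc_le_eq)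
    have ND: "N = D + m"
    proof -
      obtain s where "nJ = Suc s" using ell_pos by (cases nJ) auto
      then show ?thesis by (simp add: N_def D_def algebra_simps)
    qed
    define M where "M = 2 * N"
    obtain g where g: "\<And>a e. a \<in> J \<Longrightarrow> e < D \<Longrightarrow> g a e \<in> lat B (q ^ M * c4)" "\<exists>a\<in>J. \<exists>e<D. g a e \<noteq> 0"
      "\<And>i v. i \<in> J \<Longrightarrow> N \<le> v \<Longrightarrow> v < 2 * N \<Longrightarrow>
        (\<Sum>a\<in>J. \<Sum>e<D. \<theta> ^ e * cond v a i * frt M (g a e) ^ (q ^ v)) = 0"
      using auxiliary_polynomials[OF m] unfolding N_def D_def M_def by blast
    define h where "h a = (\<Sum>e<D. monom (frt M (g a e)) e)" for a
    have ch: "coeff (h a) e = (if e < D then frt M (g a e) else 0)" for a e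
      unfolding h_def by (simp add: coeff_sum if_distrib cong: if_cong)
    define E where "E = (\<Sum>a\<in>J. fps_of_poly (h a) * \<psi> a)"
    have hPL: "twist q M (h a) \<in> PL (q ^ M * c4) D" if "a \<in> J" for a
      unfolding PL_def using g(1)[OF that]
      by (auto simp: ch degree_twist power_0_left intro!: degree_le)
    have hK: "coeff (h a) i \<in> Kbar q \<theta>" if "a \<in> J" for a i
    proof (cases "i < D")
      case True
      then have "frt M (g a i) ^ (q ^ M) \<in> Kbar q \<theta>" using g(1)[OF that] lat_Kbar by auto
      then have "frt M (g a i) \<in> Kbar q \<theta>" by (rule Kbar_root)
      then show ?thesis using True by (simp add: ch)
    qed (use subfieldD(1)[OF Kbar_subfield] in \<open>simp add: ch\<close>)
    \<comment> \<open>Functional independence excludes \<open>E = 0\<close>. It applies because the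
      roots that form the coefficients of \<open>h\<close> still lie in \<open>Kbar\<close>.\<close>
    have E0: "E \<noteq> 0"
    proof
      assume "E = 0"
      then have s0: "(\<Sum>a\<in>J. fps_of_poly (h a) * \<psi> a) = 0" by (simp only: E_def)
      have "\<forall>a\<in>J. \<forall>i. coeff (h a) i \<in> Kbar q \<theta>" using hK by blast
      then have "\<forall>a\<in>J. h a = 0" using s0 by (rule ind)
      moreover obtain a e where "a \<in> J" "e < D" "g a e \<noteq> 0" using g(2) by blast
      ultimately have "coeff (h a) e = 0" by simp
      then show False using \<open>e < D\<close> \<open>g a e \<noteq> 0\<close> by (simp add: ch frt_0_iff)
    qed
    have ET: "E \<in> T" unfolding E_def
      by (intro subring_sum[OF T_subring] subringD(4)[OF T_subring] T_poly psiT)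
    have gh: "gle (fps_of_poly (h a)) (C * R ^ c4 * R ^ D)" if "a \<in> J" for a
      unfolding gle_def
    proof
      fix e
      show "absv (fps_nth (fps_of_poly (h a)) e) * R ^ e \<le> C * R ^ c4 * R ^ D"
      proof (cases "e < D")
        case True
        have "absv (frt M (g a e)) \<le> C * R ^ c4"
          using C g(1)[OF that True] by (intro frt_le) auto
        moreover have "R ^ e \<le> R ^ D" using True R_gt_1 by (intro power_increasing) auto
        ultimately show ?thesis using True C by (auto simp: ch intro!: mult_mono)
      qed (use C in \<open>simp add: ch\<close>)
    qed
    have gE: "gle E (C * R ^ c4 * R ^ D * C7)"
      unfolding E_def by (intro gle_sum gle_mult gh C7) (use C C70 in auto)
    define S where "S = (\<lambda>v. frt v \<theta>) ` {N..<2 * N}"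
    have pw: "absv (frt v \<theta>) ^ (q ^ v) = R" for v
      unfolding av_power[symmetric] frt_power by (simp add: R_def)
    have ge1: "1 < absv (frt v \<theta>)" for v
    proof (rule ccontr)
      assume "\<not> ?thesis"
      then have "absv (frt v \<theta>) ^ (q ^ v) \<le> 1" by (intro power_le_one) auto
      then show False using pw R_gt_1 by simp
    qed
    have leR: "absv (frt v \<theta>) \<le> R" for v
      using self_le_power[of "absv (frt v \<theta>)" "q ^ v"] ge1[of v] pw[of v] by simp
    have inj: "inj_on (\<lambda>v. frt v \<theta>) {N..<2 * N}"
    proof (rule inj_onI, rule ccontr)
      fix v w assume h: "frt v \<theta> = frt w \<theta>" "v \<noteq> w"
      have "absv (frt v \<theta>) ^ (q ^ v) = absv (frt v \<theta>) ^ (q ^ w)" using pw[of v] pw[of w] h(1) by simp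
      then have "q ^ v = q ^ w" using ge1[of v] by (simp add: power_inject_exp)
      then show False using h(2) q_gt_1 by (simp add: power_inject_exp)
    qed
    have cS: "card S = N" unfolding S_def by (simp add: card_image[OF inj])
    have zeros: "absv x \<le> R \<and> ev E x 0 \<and> x \<noteq> 0" if x: "x \<in> S" for x
    proof -
      obtain v where v: "x = frt v \<theta>" "N \<le> v" "v < 2 * N" using x unfolding S_def by auto
      have "ev E x 0" unfolding E_def
      proof (rule zero_at_root)
        show "x ^ (q ^ v) = \<theta>" "absv x \<le> R" using v leR by simp_all
        fix i assume i: "i \<in> J"
        have "poly (twist q v (h a)) \<theta> = (\<Sum>e<D. frt M (g a e) ^ (q ^ v) * \<theta> ^ e)" for a
        proof -
          have "twist q v (monom c e) = monom (c ^ (q ^ v)) e" for c :: 'a and e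
            by (rule poly_eqI) (simp add: power_0_left)
          then show ?thesis unfolding h_def by (simp add: twist_sum poly_sum poly_monom)
        qed
        then show "(\<Sum>a\<in>J. poly (twist q v (h a)) \<theta> * cond v a i) = 0"
          using g(3)[OF i v(2,3)] by (simp add: sum_distrib_left sum_distrib_right mult_ac)
      qed
      then show ?thesis using v leR by (simp add: frt_0_iff)
    qed
    have fS: "finite S" by (simp add: S_def)
    have "absv (fps_nth E (subdegree E)) \<le> (\<Prod>x\<in>S. absv x) * ((C * R ^ c4 * R ^ D * C7) / R ^ card S)"
      by (rule schwarz[OF fS ET gE zeros])
    also have "\<dots> \<le> R * ((C * R ^ c4 * R ^ D * C7) / R ^ card S)"
    proof (rule mult_right_mono)
      \<comment> \<open>Each zero belongs to some \<open>v\<close> with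
        \<open>N \<le> v \<le> q ^ v\<close>, so its \<open>N\<close>-th power is at most
        \<open>R\<close> in absolute value. Hence the product of all \<open>N\<close> zeros is at
        most \<open>R\<close>.\<close>
      have "(\<Prod>x\<in>S. absv x) ^ N = (\<Prod>x\<in>S. absv x ^ N)" by (simp add: prod_power_distrib)
      also have "\<dots> \<le> (\<Prod>x\<in>S. R)"
      proof (rule prod_mono, intro conjI)
        fix x assume "x \<in> S"
        then obtain v where v: "x = frt v \<theta>" "N \<le> v" unfolding S_def by auto
        have "absv x ^ N \<le> absv x ^ (q ^ v)" unfolding v(1) using ge1[of v] v(2) v_le_qpow[of v]
          by (intro power_increasing) auto
        then show "absv x ^ N \<le> R" using pw v by simp
      qed simp
      also have "\<dots> = R ^ N" by (simp add: cS)
      finally have "(\<Prod>x\<in>S. absv x) ^ Suc (N - 1) \<le> R ^ Suc (N - 1)" using N1 by simp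
      then show "(\<Prod>x\<in>S. absv x) \<le> R" by (rule power_le_imp_le_base) simp
    qed (use C C70 in simp)
    also have "\<dots> = R * (C * R ^ c4) * C7 / R ^ m" unfolding cS ND by (simp add: power_add field_simps)
    finally have "absv (fps_nth E (subdegree E)) \<le> R * (C * R ^ c4) * C7 / R ^ m" .
    then show "\<exists>M D h. (\<forall>a\<in>J. twist q M (h a) \<in> PL (q ^ M * c4) D) \<and>
     (\<Sum>a\<in>J. fps_of_poly (h a) * \<psi> a) \<noteq> 0 \<and>
     absv (fps_nth (\<Sum>a\<in>J. fps_of_poly (h a) * \<psi> a) (subdegree (\<Sum>a\<in>J. fps_of_poly (h a) * \<psi> a)))
       \<le> R * (C * R ^ c4) * C7 / R ^ m"
      using hPL E0 unfolding E_def by blast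
  qed
qed

lemma contradiction: False
proof -
  obtain c where c: "0 < c" "\<And>M D h. (\<forall>a\<in>J. twist q M (h a) \<in> PL (q ^ M * c4) D) \<Longrightarrow>
     (\<Sum>a\<in>J. fps_of_poly (h a) * \<psi> a) \<noteq> 0 \<Longrightarrow>
     c \<le> absv (fps_nth (\<Sum>a\<in>J. fps_of_poly (h a) * \<psi> a) (subdegree (\<Sum>a\<in>J. fps_of_poly (h a) * \<psi> a)))"
    using lower_bound by blast
  obtain C where C: "\<And>m. m \<ge> 1 \<Longrightarrow> \<exists>M D h. (\<forall>a\<in>J. twist q M (h a) \<in> PL (q ^ M * c4) D) \<and>
     (\<Sum>a\<in>J. fps_of_poly (h a) * \<psi> a) \<noteq> 0 \<and>
     absv (fps_nth (\<Sum>a\<in>J. fps_of_poly (h a) * \<psi> a) (subdegree (\<Sum>a\<in>J. fps_of_poly (h a) * \<psi> a))) \<le> C / R ^ m"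
    using upper_bound by blast
  have "c \<le> C / R ^ m" if "m \<ge> 1" for m using C[OF that] c(2) by force
  then have le: "c * R ^ m \<le> C" if "m \<ge> 1" for m using that by (simp add: pos_le_divide_eq)
  obtain m where "C / c < R ^ m" using real_arch_pow[OF R_gt_1] by blast
  then have "C < c * R ^ m" using c(1) by (simp add: field_simps)
  also have "\<dots> \<le> c * R ^ Suc m" using c(1) R_gt_1 by simp
  finally show False using le[of "Suc m"] by simp
qed

end

section \<open>The linear independence criterion for values at \<theta>\<close>

context carlitz
begin

theorem abp_criterion:
  fixes \<psi> :: "'j \<Rightarrow> 'a fps"
  assumes finJ: "finite J" and psiT: "\<And>j. j \<in> J \<Longrightarrow> \<psi> j \<in> T"
    and ind: "\<And>h. (\<forall>j\<in>J. \<forall>i. coeff (h j) i \<in> Kbar q \<theta>) \<Longrightarrow> (\<Sum>j\<in>J. fps_of_poly (h j) * \<psi> j) = 0 \<Longrightarrow> \<forall>j\<in>J. h j = 0"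
    and rel: "\<And>j. j \<in> J \<Longrightarrow> fps_of_poly ([:- (\<theta> ^ q), 1:] ^ W) * tw 1 (\<psi> j) =
      (\<Sum>i\<in>J. fps_of_poly (\<Theta> j i) * \<psi> i)"
    and TK: "\<And>j i n. j \<in> J \<Longrightarrow> i \<in> J \<Longrightarrow> coeff (\<Theta> j i) n \<in> Kbar q \<theta>"
    and val: "\<And>j. j \<in> J \<Longrightarrow> ev (\<psi> j) \<theta> (y j)"
    and rho: "\<And>j. j \<in> J \<Longrightarrow> \<rho> j \<in> Kbar q \<theta>" and rho0: "(\<Sum>j\<in>J. \<rho> j * y j) = 0"
    and j: "j \<in> J"
  shows "\<rho> j = 0"
proof (rule ccontr)
  assume nz: "\<rho> j \<noteq> 0"
  \<comment> \<open>The element 1 is included so that the scaling factor \<open>d\<close> itself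
    lies in the lattice, which need not contain 1.\<close>
  define Z where "Z = insert 1 (\<rho> ` J \<union> (\<Union>(a, b)\<in>J \<times> J. set (coeffs (\<Theta> a b))))"
  have Z: "finite Z" "Z \<subseteq> Kbar q \<theta>"
  proof -
    show "finite Z" unfolding Z_def using finJ by auto
    have "set (coeffs (\<Theta> a b)) \<subseteq> Kbar q \<theta>" if "a \<in> J" "b \<in> J" for a b
    proof
      fix x assume "x \<in> set (coeffs (\<Theta> a b))"
      then have "x \<in> range (coeff (\<Theta> a b))" by (metis range_coeff insertCI)
      then show "x \<in> Kbar q \<theta>" using TK[OF that] by auto
    qed
    then show "Z \<subseteq> Kbar q \<theta>" unfolding Z_def using rho subfieldD(2)[OF Kbar_subfield] by auto
  qed
  obtain B \<kappa> d n where L: "order_lattice absv p k q \<theta> B \<kappa>" "B \<subseteq> Kbar q \<theta>" "d \<in> A" "d \<noteq> 0" "\<And>z. z \<in> Z \<Longrightarrow> d * z \<in> lat B n"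
    using lattice_exists[OF Z] by blast
  interpret L: order_lattice absv p k q \<theta> B \<kappa> by (rule L(1))
  define DT where "DT = Max ((\<lambda>(a, b). degree (\<Theta> a b)) ` (J \<times> J))"
  have DT: "degree (\<Theta> a b) \<le> DT" if "a \<in> J" "b \<in> J" for a b
    unfolding DT_def by (rule Max_ge) (use finJ that in auto)
  have "frobenius_system absv p k q \<theta> B \<kappa> J \<psi> (\<lambda>a b. smult d (\<Theta> a b)) d W n DT y (\<lambda>j. d * \<rho> j) j"
  proof
    show "B \<subseteq> Kbar q \<theta>" "finite J" "j \<in> J" "d * \<rho> j \<noteq> 0" using L finJ j nz by auto
    show "\<And>j. j \<in> J \<Longrightarrow> \<psi> j \<in> T" by (rule psiT)
    show "\<And>h. \<forall>j\<in>J. \<forall>i. coeff (h j) i \<in> Kbar q \<theta> \<Longrightarrow> (\<Sum>j\<in>J. fps_of_poly (h j) * \<psi> j) = 0 \<Longrightarrow> \<forall>j\<in>J. h j = 0"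
      by (rule ind)
    show "fps_of_poly (smult d ([:- (\<theta> ^ q), 1:] ^ W)) * tw 1 (\<psi> j) = (\<Sum>i\<in>J. fps_of_poly (smult d (\<Theta> j i)) * \<psi> i)"
      if "j \<in> J" for j
      using rel[OF that] by (simp only: fps_of_poly_smult mult.assoc sum_distrib_left)
    show "smult d (\<Theta> a b) \<in> L.PL n DT" if ab: "a \<in> J" "b \<in> J" for a b
      unfolding L.PL_def
    proof (intro CollectI conjI allI)
      fix i
      show "coeff (smult d (\<Theta> a b)) i \<in> lat B n"
      proof (cases "coeff (\<Theta> a b) i = 0")
        case False
        then have "coeff (\<Theta> a b) i \<in> set (coeffs (\<Theta> a b))" using range_coeff[of "\<Theta> a b"] by blast
        then have "coeff (\<Theta> a b) i \<in> Z" unfolding Z_def using ab by auto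
        then show ?thesis using L(5) by simp
      qed simp
      show "degree (smult d (\<Theta> a b)) \<le> DT" using DT[OF ab] L(4) by simp
    qed
    show "d \<noteq> 0" by (rule L(4))
    show "d \<in> lat B n" using L(5)[of 1] by (simp add: Z_def)
    show "\<And>j. j \<in> J \<Longrightarrow> ev (\<psi> j) \<theta> (y j)" by (rule val)
    show "d * \<rho> j \<in> lat B n" if "j \<in> J" for j using L(5)[of "\<rho> j"] that by (simp add: Z_def)
    show "(\<Sum>j\<in>J. d * \<rho> j * y j) = 0" using rho0 by (simp add: sum_distrib_left[symmetric] mult.assoc)
  qed
  then show False by (rule frobenius_system.contradiction)
qed

end

context carlitz
begin

subsection \<open>Limits in the Gauss norm\<close>

definition gconv :: "(nat \<Rightarrow> 'a fps) \<Rightarrow> 'a fps \<Rightarrow> bool" where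
  "gconv F G \<longleftrightarrow> (\<forall>e>0. \<exists>N. \<forall>n\<ge>N. gle (F n - G) e)"

lemma gconvD: "gconv F G \<Longrightarrow> 0 < e \<Longrightarrow> \<exists>N. \<forall>n\<ge>N. gle (F n - G) e"
  by (simp add: gconv_def)

lemma gconv_exists:
  assumes "\<And>e. 0 < e \<Longrightarrow> \<exists>N. \<forall>n\<ge>N. gle (F (Suc n) - F n) e"
  shows "\<exists>G. gconv F G"
  unfolding gconv_def
proof (rule gauss_complete)
  fix e :: real assume e: "0 < e"
  then obtain N where N: "\<forall>n\<ge>N. gle (F (Suc n) - F n) e" using assms by blast
  have d: "gle (F n - F N) e" if "n \<ge> N" for n
    using that
  proof (induction n rule: dec_induct)
    case base then show ?case using e by simp
  next
    case (step n)
    then have "gle ((F (Suc n) - F n) + (F n - F N)) e" using N by (intro gle_add) auto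
    then show ?case by simp
  qed
  have "gle (F m - F n) e" if "m \<ge> N" "n \<ge> N" for m n
    using gle_diff[OF d[OF that(1)] d[OF that(2)]] by simp
  then show "\<exists>N. \<forall>m\<ge>N. \<forall>n\<ge>N. gle (F m - F n) e" by blast
qed

lemma gle_zero_eq: "(\<And>e. 0 < e \<Longrightarrow> gle f e) \<Longrightarrow> f = 0"
proof (rule fps_ext, rule ccontr)
  fix n assume h: "\<And>e. 0 < e \<Longrightarrow> gle f e" "fps_nth f n \<noteq> fps_nth 0 n"
  then have pos: "0 < absv (fps_nth f n) * R ^ n"
    by (metis av_nonneg av_zero_iff fps_zero_nth less_eq_real_def mult_pos_pos R_pos(1) zero_less_power)
  then have "absv (fps_nth f n) * R ^ n \<le> absv (fps_nth f n) * R ^ n / 2"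
    by (intro gleD h) simp
  then show False using pos by simp
qed

lemma gconv_unique: "gconv F G \<Longrightarrow> gconv F H \<Longrightarrow> G = H"
proof -
  assume h: "gconv F G" "gconv F H"
  have "gle (H - G) e" if e: "0 < e" for e
  proof -
    obtain N M where "\<forall>n\<ge>N. gle (F n - G) e" "\<forall>n\<ge>M. gle (F n - H) e"
      using gconvD[OF h(1) e] gconvD[OF h(2) e] by auto
    then have "gle (F (max N M) - G) e" "gle (F (max N M) - H) e" by simp_all
    then have "gle ((F (max N M) - G) - (F (max N M) - H)) e" by (rule gle_diff)
    then show ?thesis by simp
  qed
  then have "H - G = 0" by (rule gle_zero_eq)
  then show ?thesis by simp
qed

lemma gconv_add: "gconv F G \<Longrightarrow> gconv F' G' \<Longrightarrow> gconv (\<lambda>n. F n + F' n) (G + G')"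
  unfolding gconv_def
proof (intro allI impI)
  fix e :: real assume h: "\<forall>e>0. \<exists>N. \<forall>n\<ge>N. gle (F n - G) e" "\<forall>e>0. \<exists>N. \<forall>n\<ge>N. gle (F' n - G') e" "0 < e"
  obtain N where "\<forall>n\<ge>N. gle (F n - G) e" using h(1,3) by blast
  moreover obtain M where "\<forall>n\<ge>M. gle (F' n - G') e" using h(2,3) by blast
  ultimately have NM: "\<forall>n\<ge>N. gle (F n - G) e" "\<forall>n\<ge>M. gle (F' n - G') e" by auto
  have "gle (F n + F' n - (G + G')) e" if "n \<ge> max N M" for n
    using NM gle_add[of "F n - G" e "F' n - G'"] that by (simp add: algebra_simps)
  then show "\<exists>N. \<forall>n\<ge>N. gle (F n + F' n - (G + G')) e" by blast
qed

lemma gconv_scale: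
  assumes "gconv F G" "gle h B" shows "gconv (\<lambda>n. h * F n) (h * G)"
  unfolding gconv_def
proof (intro allI impI)
  fix e :: real assume e: "0 < e"
  define C where "C = max B 1"
  have C: "gle h C" "0 < C" using assms(2) gle_mono by (auto simp: C_def)
  obtain N where N: "\<forall>n\<ge>N. gle (F n - G) (e / C)" using gconvD[OF assms(1), of "e / C"] e C by auto
  have "gle (h * F n - h * G) e" if "n \<ge> N" for n
    using gle_mult[OF C(1), of "F n - G" "e / C"] N that C(2) by (simp add: right_diff_distrib)
  then show "\<exists>N. \<forall>n\<ge>N. gle (h * F n - h * G) e" by blast
qed

lemma gconv_tw: "gconv F G \<Longrightarrow> gconv (\<lambda>n. tw i (F n)) (tw i G)"
  unfolding gconv_def
proof (intro allI impI)
  fix e :: real assume h: "\<forall>e>0. \<exists>N. \<forall>n\<ge>N. gle (F n - G) e" and e: "0 < e"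
  define d where "d = min 1 e"
  have d: "0 < d" using e by (simp add: d_def)
  have "d ^ (q ^ i) \<le> d ^ 1" using d by (intro power_decreasing) (auto simp: d_def Suc_le_eq)
  then have de: "d ^ (q ^ i) \<le> e" by (simp add: d_def)
  obtain N where N: "\<forall>n\<ge>N. gle (F n - G) d" using h d by blast
  have "\<forall>n\<ge>N. gle (tw i (F n) - tw i G) e"
    unfolding tw_diff[symmetric] using N gle_mono[OF gle_tw de] by simp
  then show "\<exists>N. \<forall>n\<ge>N. gle (tw i (F n) - tw i G) e" ..
qed

lemma gconv_Suc: "gconv F G \<Longrightarrow> gconv (\<lambda>n. F (Suc n)) G"
  unfolding gconv_def by (meson le_SucI)

lemma gconv_T: "gconv F G \<Longrightarrow> (\<And>n. F n \<in> T) \<Longrightarrow> G \<in> T"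
proof (rule T_limit)
  fix e :: real assume h: "gconv F G" "\<And>n. F n \<in> T" "0 < e"
  obtain N where "\<forall>n\<ge>N. gle (F n - G) e" using gconvD[OF h(1,3)] by auto
  then have "gle (F N - G) e" by simp
  then have "gle (G - F N) e" using gle_uminus by fastforce
  then show "\<exists>g\<in>T. gle (G - g) e" using h(2) by blast
qed

text \<open>Evaluation is continuous for the Gauss norm. This identifies values of limit series with
  the limits of partial sums and products in the definitions of \<open>Lval\<close> and
  \<open>pitilde\<close>.\<close>

lemma gconv_ev:
  assumes G: "gconv F G" and F: "\<And>n. ev (F n) x (y n)" and x: "absv x \<le> R"
  shows "\<exists>L. ev G x L \<and> conv_abs absv y L"
proof -
  have "G \<in> T" by (rule gconv_T[OF G ev_T[OF F]])
  then obtain L where L: "ev G x L" using ev_exists x by blast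
  have "conv_abs absv y L" unfolding conv_abs_def
  proof (intro allI impI)
    fix e :: real assume e: "0 < e"
    obtain N where N: "\<forall>n\<ge>N. gle (F n - G) (e / 2)" using gconvD[OF G, of "e / 2"] e by auto
    have "absv (y n - L) < e" if "n \<ge> N" for n
    proof -
      have "ev (F n + fps_const (- 1) * G) x (y n + (- 1) * L)"
        by (intro ev_add F ev_mult ev_const L x)
      moreover have "F n + fps_const (- 1) * G = F n - G" by (simp add: fps_eq_iff)
      ultimately have "ev (F n - G) x (y n - L)" by simp
      from ev_bound[OF this _ _ x, of "e / 2"] N that e have "absv (y n - L) \<le> e / 2" by simp
      then show ?thesis using e by simp
    qed
    then show "\<exists>N. \<forall>n\<ge>N. absv (y n - L) < e" by blast
  qed
  with L show ?thesis by blast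
qed

lemma gconv_nth_const:
  assumes "gconv F G" "\<And>n. fps_nth (F n) 0 = c" shows "fps_nth G 0 = c"
proof (rule ccontr)
  assume ne: "fps_nth G 0 \<noteq> c"
  then have pos: "0 < absv (c - fps_nth G 0)" by (metis av_nonneg av_zero_iff less_eq_real_def right_minus_eq)
  then obtain N where "\<forall>n\<ge>N. gle (F n - G) (absv (c - fps_nth G 0) / 2)"
    using gconvD[OF assms(1), of "absv (c - fps_nth G 0) / 2"] by auto
  then have "gle (F N - G) (absv (c - fps_nth G 0) / 2)" by simp
  from gleD[OF this, of 0] pos assms(2) show False by simp
qed

lemma real_null: 
  assumes "0 \<le> x" "x < (1::real)" "0 < e" "0 \<le> C" shows "\<exists>N. \<forall>n\<ge>N. C * x ^ n \<le> e"
proof -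
  obtain N where N: "x ^ N < e / (C + 1)" using real_arch_pow_inv[of "e / (C + 1)" x] assms by auto
  have "C * x ^ n \<le> e" if "n \<ge> N" for n
  proof -
    have "x ^ n \<le> x ^ N" using assms that by (intro power_decreasing) auto
    then have "C * x ^ n \<le> (C + 1) * (e / (C + 1))" using N assms by (intro mult_mono) auto
    then show ?thesis using assms by simp
  qed
  then show ?thesis by blast
qed

lemma n_le_qpow: "n \<le> q ^ n"
  using q_gt_1 less_exp[of n] power_mono[of 2 q n] by linarith

subsection \<open>The deformation series of multiple polylogarithms\<close>

text \<open>\<open>Dl = t - \<theta>^q\<close>, \<open>IP i = 1/P_i(t)\<close>, and \<open>LF\<close>, \<open>LL\<close> are the partial sums and sums of the series \<open>L\<close>.\<close>

definition Dl :: "'a fps" where "Dl = fps_X - fps_const (\<theta> ^ q)"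

lemma Dl_poly: "Dl ^ n = fps_of_poly ([:- (\<theta> ^ q), 1:] ^ n)"
  unfolding Dl_def fps_of_poly_power fps_of_poly_root ..

lemma Dl_gle: "\<exists>B. gle (f * Dl ^ n) B" if "gle f C" for f C
proof -
  obtain B where "gle (fps_of_poly ([:- (\<theta> ^ q), 1:] ^ n)) B" using gle_poly_ex by blast
  then show ?thesis unfolding Dl_poly using gle_mult[OF that] by blast
qed

definition IP :: "nat \<Rightarrow> 'a fps" where
  "IP i = (\<Prod>j\<in>{1..i}. inverse (fps_X - fps_const (\<theta> ^ (q ^ j))))"

lemma R_less_theta: "1 \<le> j \<Longrightarrow> R < absv (\<theta> ^ (q ^ j))"
proof -
  assume "1 \<le> j"
  then have "1 < q ^ j" using q_gt_1 by (intro one_less_power) auto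
  then have "R ^ 1 < R ^ (q ^ j)" using R_gt_1 by (intro power_strict_increasing) auto
  then show ?thesis by (simp add: av_power R_def)
qed

lemma ev_IP:
  assumes "absv x \<le> R" shows "ev (IP i) x (inverse (Pq q \<theta> i x))"
proof -
  have "ev (IP i) x (\<Prod>j\<in>{1..i}. inverse (x - \<theta> ^ (q ^ j)))"
    unfolding IP_def using assms R_less_theta by (intro ev_prod ev_inverse_linear) auto
  moreover have "(\<Prod>j\<in>{1..i}. inverse (x - \<theta> ^ (q ^ j))) = inverse (Pq q \<theta> i x)"
    unfolding Pq_def using prod_inversef[of "\<lambda>j. x - \<theta> ^ (q ^ j)" "{1..i}"] by (simp add: comp_def)
  ultimately show ?thesis by simp
qed

lemma gle_IP: "gle (IP i) (inverse (R ^ (\<Sum>j\<in>{1..i}. q ^ j)))"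
proof -
  have "gle (IP i) (\<Prod>j\<in>{1..i}. inverse (absv (\<theta> ^ (q ^ j))))"
    unfolding IP_def using R_less_theta by (intro gle_prod ev_inverse_linear(2)[of _ 0]) auto
  also have "(\<Prod>j\<in>{1..i}. inverse (absv (\<theta> ^ (q ^ j)))) = inverse (\<Prod>j\<in>{1..i}. R ^ (q ^ j))"
    using prod_inversef[of "\<lambda>j. absv (\<theta> ^ (q ^ j))" "{1..i}"] by (simp add: comp_def av_power R_def)
  also have "(\<Prod>j\<in>{1..i}. R ^ (q ^ j)) = R ^ (\<Sum>j\<in>{1..i}. q ^ j)" by (simp add: power_sum)
  finally show ?thesis .
qed

text \<open>The twist moves the pole at \<open>\<theta> ^ (q ^ j)\<close> to
  \<open>\<theta> ^ (q ^ (j + 1))\<close>, so only the first pole is missing from the twisted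
  product.\<close>

lemma Dl_IP: "Dl * IP (Suc i) = tw 1 (IP i)"
proof -
  have inv: "(fps_X - fps_const (\<theta> ^ (q ^ j))) * inverse (fps_X - fps_const (\<theta> ^ (q ^ j))) = 1" for j
    using inverse_mult_eq_1'[of "fps_X - fps_const (\<theta> ^ (q ^ j))"] by simp
  have tinv: "tw 1 (inverse (fps_X - fps_const (\<theta> ^ (q ^ j)))) = inverse (fps_X - fps_const (\<theta> ^ (q ^ Suc j)))" for j
  proof -
    have "tw 1 (fps_X - fps_const (\<theta> ^ (q ^ j))) * tw 1 (inverse (fps_X - fps_const (\<theta> ^ (q ^ j)))) = 1"
      unfolding tw_mult[symmetric] inv by simp
    then have "(fps_X - fps_const (\<theta> ^ (q ^ Suc j))) * tw 1 (inverse (fps_X - fps_const (\<theta> ^ (q ^ j)))) = 1"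
      by (simp add: tw_diff tw_const power_mult[symmetric] mult.commute)
    moreover have "fps_nth (fps_X - fps_const (\<theta> ^ (q ^ Suc j))) 0 \<noteq> 0" by simp
    ultimately show ?thesis by (metis fps_inverse_unique)
  qed
  have "IP (Suc i) = inverse Dl * (\<Prod>j\<in>{1..i}. inverse (fps_X - fps_const (\<theta> ^ (q ^ Suc j))))"
    unfolding IP_def Dl_def by (induction i) (auto simp: mult_ac)
  moreover have "Dl * inverse Dl = 1" using inv[of 1] by (simp add: Dl_def)
  ultimately show ?thesis unfolding IP_def tw_prod tinv by (simp add: mult.assoc[symmetric])
qed

fun LF :: "('a poly \<times> nat) list \<Rightarrow> nat \<Rightarrow> 'a fps" where
  "LF [] N = 1"
| "LF ((v, m) # rest) N = (\<Sum>i<N. fps_of_poly (twist q i v) * IP i ^ m * LF rest i)"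

lemma ev_LF:
  assumes x: "absv x \<le> R" shows "ev (LF l N) x (Lpsum q \<theta> l x N)"
proof (induction l arbitrary: N)
  case Nil
  then show ?case using ev_const[of 1 x] by simp
next
  case (Cons vm l)
  obtain v m where vm: "vm = (v, m)" by (cases vm)
  have "ev (fps_of_poly (twist q i v) * IP i ^ m * LF l i) x
     (poly (twist q i v) x * inverse (Pq q \<theta> i x) ^ m * Lpsum q \<theta> l x i)" for i
    by (intro ev_mult ev_poly ev_power ev_IP Cons x)
  then show ?case unfolding vm LF.simps Lpsum.simps
    by (intro ev_sum) (simp add: divide_inverse power_inverse)
qed

definition good :: "('a poly \<times> nat) list \<Rightarrow> bool" where
  "good l \<longleftrightarrow> (\<forall>(v, m)\<in>set l. norm_poly absv v < R powr (real m * real q / real (q - 1)))"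

lemma coeff_le_norm_poly: "absv (coeff v j) \<le> norm_poly absv v"
proof (cases "coeff v j = 0")
  case False
  then have "coeff v j \<in> set (coeffs v)" using range_coeff[of v] by blast
  then show ?thesis unfolding norm_poly_def by (intro Max_ge) auto
next
  case True
  have "0 \<le> norm_poly absv v" unfolding norm_poly_def by (intro Max_ge) auto
  then show ?thesis using True by simp
qed

text \<open>The geometric sum in the exponent gives \<open>P_i ^ m\<close> the Gauss norm
  \<open>r ^ (q ^ i - 1)\<close> with \<open>r = R powr (m * q / (q - 1))\<close>. So the hypothesis
  on \<open>v\<close> is exactly what makes the terms decay, like the \<open>q ^ i\<close>-th power
  of \<open>norm_poly absv v / r\<close>.\<close>

lemma LF_term_bound:
  assumes s: "norm_poly absv v < R powr (real m * real q / real (q - 1))"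
  shows "\<exists>C x. 0 \<le> C \<and> 0 \<le> x \<and> x < 1 \<and> (\<forall>i. gle (fps_of_poly (twist q i v) * IP i ^ m) (C * x ^ i))"
proof -
  define r where "r = R powr (real m * real q / real (q - 1))"
  define s where "s = norm_poly absv v"
  have r0: "0 < r" by (simp add: r_def)
  have s0: "0 \<le> s" unfolding s_def norm_poly_def by (intro Max_ge) auto
  have q1: "real (q - 1) \<noteq> 0" using q_gt_1 by simp
  have rq: "r ^ (q - 1) = R ^ (m * q)"
  proof -
    have "r ^ (q - 1) = r powr real (q - 1)" using r0 by (simp add: powr_realpow)
    also have "\<dots> = R powr (real m * real q)" unfolding r_def powr_powr using q1 by simp
    also have "\<dots> = R ^ (m * q)" using powr_realpow[of R "m * q"] by simp
    finally show ?thesis .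
  qed
  have key: "R ^ (m * (\<Sum>j\<in>{1..i}. q ^ j)) = r ^ (q ^ i - 1)" for i
  proof (induction i)
    case (Suc i)
    have "q ^ Suc i - 1 = (q ^ i - 1) + (q - 1) * q ^ i"
    proof -
      obtain u where "q = Suc u" using q_gt_1 by (cases q) auto
      moreover have "1 \<le> q ^ i" using q_gt_1 by (intro one_le_power) simp
      ultimately show ?thesis by (simp add: algebra_simps)
    qed
    then have "r ^ (q ^ Suc i - 1) = r ^ (q ^ i - 1) * (r ^ (q - 1)) ^ (q ^ i)"
      by (simp add: power_add power_mult)
    also have "(r ^ (q - 1)) ^ (q ^ i) = R ^ (m * q ^ Suc i)" unfolding rq by (simp add: power_mult[symmetric] mult.assoc)
    finally show ?case using Suc by (simp add: distrib_left power_add)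
  qed simp
  have x: "0 \<le> s / r" "s / r < 1" using s0 r0 assms by (auto simp: r_def s_def)
  show ?thesis
  proof (rule exI[of _ "R ^ degree v * r"], rule exI[of _ "s / r"], intro conjI allI)
    show "0 \<le> R ^ degree v * r" using r0 by simp
    fix i
    have g1: "gle (fps_of_poly (twist q i v)) (s ^ (q ^ i) * R ^ degree v)"
      unfolding gle_def
    proof
      fix n
      show "absv (fps_nth (fps_of_poly (twist q i v)) n) * R ^ n \<le> s ^ (q ^ i) * R ^ degree v"
      proof (cases "n \<le> degree v")
        case True
        then have "R ^ n \<le> R ^ degree v" using R_gt_1 by (intro power_increasing) auto
        moreover have "absv (coeff v n) ^ (q ^ i) \<le> s ^ (q ^ i)"
          unfolding s_def by (intro power_mono coeff_le_norm_poly) auto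
        ultimately show ?thesis using s0 by (auto simp: av_power intro!: mult_mono)
      next
        case False
        then show ?thesis using s0 by (simp add: coeff_eq_0 power_0_left)
      qed
    qed
    have g2: "gle (IP i ^ m) (inverse (R ^ (\<Sum>j\<in>{1..i}. q ^ j)) ^ m)" by (intro gle_power gle_IP)
    have "inverse (R ^ (\<Sum>j\<in>{1..i}. q ^ j)) ^ m = inverse (r ^ (q ^ i - 1))"
      unfolding key[symmetric] by (simp add: power_inverse power_mult[symmetric] mult.commute)
    also have "\<dots> = r / r ^ (q ^ i)"
    proof -
      obtain u where "q ^ i = Suc u" using q_gt_1 by (metis Suc_pred' q_pos zero_less_power)
      then show ?thesis using r0 by (simp add: field_simps)
    qed
    finally have "gle (fps_of_poly (twist q i v) * IP i ^ m) (s ^ (q ^ i) * R ^ degree v * (r / r ^ (q ^ i)))"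
      using gle_mult[OF g1 g2] by simp
    moreover have "s ^ (q ^ i) * R ^ degree v * (r / r ^ (q ^ i)) = R ^ degree v * r * (s / r) ^ (q ^ i)"
      by (simp add: power_divide)
    moreover have "(s / r) ^ (q ^ i) \<le> (s / r) ^ i"
      using x n_le_qpow[of i] by (intro power_decreasing) auto
    ultimately show "gle (fps_of_poly (twist q i v) * IP i ^ m) (R ^ degree v * r * (s / r) ^ i)"
      using r0 by (auto elim!: gle_mono intro!: mult_left_mono)
  qed (use x in auto)
qed

lemma LF_bounded_conv:
  assumes "good l" shows "(\<exists>B. \<forall>N. gle (LF l N) B) \<and> (\<exists>G. gconv (LF l) G)"
  using assms
proof (induction l)
  case Nil
  have "gle (LF [] N) 1" for N using gle_const[of 1 1] by simp
  moreover have "gconv (LF []) 1" unfolding gconv_def by auto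
  ultimately show ?case by blast
next
  case (Cons vm l)
  obtain v m where vm: "vm = (v, m)" by (cases vm)
  have g: "good l" "norm_poly absv v < R powr (real m * real q / real (q - 1))"
    using Cons.prems by (auto simp: good_def vm)
  obtain B where B: "\<And>N. gle (LF l N) B" using Cons.IH[OF g(1)] by blast
  have B0: "0 \<le> B" using gle_nonneg[OF B] .
  obtain C x where C: "0 \<le> C" "0 \<le> x" "x < 1"
    "\<And>i. gle (fps_of_poly (twist q i v) * IP i ^ m) (C * x ^ i)" using LF_term_bound[OF g(2)] by blast
  have t: "gle (fps_of_poly (twist q i v) * IP i ^ m * LF l i) (C * B * x ^ i)" for i
    using gle_mult[OF C(4) B, of i i] by (simp add: mult_ac)
  have "gle (LF (vm # l) N) (C * B)" for N
    unfolding vm LF.simps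
  proof (rule gle_sum)
    fix i
    have "C * B * x ^ i \<le> C * B" using C B0 power_le_one[of x i] by (intro mult_left_le) auto
    then show "gle (fps_of_poly (twist q i v) * IP i ^ m * LF l i) (C * B)" using t gle_mono by blast
  qed (use C B0 in simp)
  moreover have "\<exists>G. gconv (LF (vm # l)) G"
  proof (rule gconv_exists)
    fix e :: real assume "0 < e"
    then obtain N where N: "\<forall>n\<ge>N. C * B * x ^ n \<le> e" using real_null[of x e "C * B"] C B0 by auto
    have "gle (LF (vm # l) (Suc n) - LF (vm # l) n) e" if "n \<ge> N" for n
      unfolding vm using gle_mono[OF t] N that by simp
    then show "\<exists>N. \<forall>n\<ge>N. gle (LF (vm # l) (Suc n) - LF (vm # l) n) e" by blast
  qed
  ultimately show ?case by blast
qed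

definition LL :: "('a poly \<times> nat) list \<Rightarrow> 'a fps" where
  "LL l = (SOME G. gconv (LF l) G)"

lemma LL_gconv: "good l \<Longrightarrow> gconv (LF l) (LL l)"
  unfolding LL_def using LF_bounded_conv someI_ex[of "\<lambda>G. gconv (LF l) G"] by blast

lemma LL_Nil: "LL [] = 1"
proof -
  have "good []" by (simp add: good_def)
  moreover have "gconv (LF []) 1" unfolding gconv_def by auto
  ultimately show ?thesis using gconv_unique LL_gconv by blast
qed

lemma LL_T: "good l \<Longrightarrow> LL l \<in> T"
proof (rule gconv_T[OF LL_gconv])
  have "absv 0 \<le> R" by simp
  then show "LF l n \<in> T" for n using ev_LF ev_T by blast
qed

lemma ev_LL:
  assumes "good (zip vs ms)" shows "ev (LL (zip vs ms)) \<theta> (Lval absv q \<theta> vs ms \<theta>)"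
proof -
  have tR: "absv \<theta> \<le> R" by (simp add: R_def)
  obtain L where L: "ev (LL (zip vs ms)) \<theta> L" "conv_abs absv (Lpsum q \<theta> (zip vs ms) \<theta>) L"
    using gconv_ev[OF LL_gconv[OF assms] ev_LF[OF tR] tR] by blast
  then show ?thesis unfolding Lval_def using lim_absI by simp
qed

lemma LF_0: "l \<noteq> [] \<Longrightarrow> LF l 0 = 0"
  by (cases l) auto

text \<open>The summand with smallest index \<open>0\<close> is split off, so the recurrence drops the last entry.\<close>

lemma LF_recurrence:
  "Dl ^ (sum_list (map snd l) + m) * LF (l @ [(v, m)]) (Suc N) =
    tw 1 (LF (l @ [(v, m)]) N) + fps_of_poly v * Dl ^ m * tw 1 (LF l N)"
proof (induction l arbitrary: N)
  case Nil
  have IP0: "IP 0 = 1" by (simp add: IP_def)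
  have "Dl ^ m * LF [(v, m)] (Suc N) =
    fps_of_poly v * Dl ^ m + (\<Sum>i<N. fps_of_poly (twist q (Suc i) v) * (Dl * IP (Suc i)) ^ m)"
    by (simp add: sum.lessThan_Suc_shift IP0 distrib_left sum_distrib_left power_mult_distrib mult_ac del: sum.lessThan_Suc)
  also have "(\<Sum>i<N. fps_of_poly (twist q (Suc i) v) * (Dl * IP (Suc i)) ^ m) = tw 1 (LF [(v, m)] N)"
    unfolding Dl_IP by (simp add: tw_sum tw_mult tw_power tw_poly twist_twist)
  finally show ?case by simp
next
  case (Cons wm l)
  obtain w m1 where wm: "wm = (w, m1)" by (cases wm)
  define s where "s = sum_list (map snd l) + m"
  \<comment> \<open>The term with outer index 0 vanishes, because the inner sum runs over a nonempty
    list below 0. The outer index can therefore be shifted without a boundary term.\<close>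
  have "Dl ^ (m1 + s) * LF ((w, m1) # (l @ [(v, m)])) (Suc N) =
    (\<Sum>i<N. fps_of_poly (twist q (Suc i) w) * (Dl * IP (Suc i)) ^ m1 * (Dl ^ s * LF (l @ [(v, m)]) (Suc i)))"
    by (simp add: sum.lessThan_Suc_shift LF_0 sum_distrib_left power_mult_distrib power_add mult_ac del: sum.lessThan_Suc)
  also have "\<dots> = (\<Sum>i<N. tw 1 (fps_of_poly (twist q i w) * IP i ^ m1) *
      (tw 1 (LF (l @ [(v, m)]) i) + fps_of_poly v * Dl ^ m * tw 1 (LF l i)))"
    unfolding Dl_IP s_def Cons.IH by (simp add: tw_mult tw_power tw_poly twist_twist)
  also have "\<dots> = tw 1 (LF ((w, m1) # (l @ [(v, m)])) N) + fps_of_poly v * Dl ^ m * tw 1 (LF ((w, m1) # l) N)"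
    by (simp add: tw_sum tw_mult distrib_left sum.distrib sum_distrib_left mult_ac)
  finally show ?case by (simp add: wm s_def add.assoc)
qed

lemma LL_recurrence:
  assumes g: "good (l @ [(v, m)])"
  shows "Dl ^ (sum_list (map snd l) + m) * LL (l @ [(v, m)]) =
    tw 1 (LL (l @ [(v, m)])) + fps_of_poly v * Dl ^ m * tw 1 (LL l)"
proof -
  have gl: "good l" using g by (auto simp: good_def)
  obtain B1 where B1: "gle (1 * Dl ^ (sum_list (map snd l) + m)) B1"
    using Dl_gle[of 1 1] gle_const[of 1 1] by auto
  obtain C where "gle (fps_of_poly v) C" using gle_poly_ex by blast
  then obtain B2 where B2: "gle (fps_of_poly v * Dl ^ m) B2" using Dl_gle by blast
  have "gconv (\<lambda>n. Dl ^ (sum_list (map snd l) + m) * LF (l @ [(v, m)]) (Suc n))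
      (Dl ^ (sum_list (map snd l) + m) * LL (l @ [(v, m)]))"
    using B1 by (intro gconv_scale gconv_Suc LL_gconv g) simp
  moreover have "gconv (\<lambda>n. tw 1 (LF (l @ [(v, m)]) n) + fps_of_poly v * Dl ^ m * tw 1 (LF l n))
      (tw 1 (LL (l @ [(v, m)])) + fps_of_poly v * Dl ^ m * tw 1 (LL l))"
    by (intro gconv_add gconv_scale[OF _ B2] gconv_tw LL_gconv g gl)
  ultimately show ?thesis unfolding LF_recurrence by (rule gconv_unique)
qed

subsection \<open>Constants\<close>

text \<open>
  Modulo the maximal ideal, \<open>f * b = a\<close> is a linear recurrence with invertible top coefficient
  \<open>b D\<close>; as \<open>f\<close> has only finitely many states of a given length, it is eventually periodic.
\<close>

lemma recurrent_periodic:
  assumes fq: "\<And>n. fps_nth f n \<in> Fq q" and fb: "f * b = a" and b0: "b \<noteq> 0"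
    and a: "\<And>e. 0 < e \<Longrightarrow> \<exists>N. \<forall>n\<ge>N. absv (fps_nth a n) < e"
    and b: "\<And>e. 0 < e \<Longrightarrow> \<exists>N. \<forall>n\<ge>N. absv (fps_nth b n) < e"
  shows "\<exists>P>0. \<exists>N. \<forall>n\<ge>N. fps_nth f (n + P) = fps_nth f n"
proof -
  obtain j0 where j0: "fps_nth b j0 \<noteq> 0" using b0 by (auto simp: fps_eq_iff)
  have pos0: "0 < absv (fps_nth b j0)" using j0 by (metis av_nonneg av_zero_iff less_eq_real_def)
  obtain N1 where N1: "\<forall>n\<ge>N1. absv (fps_nth b n) < absv (fps_nth b j0)" using b pos0 by blast
  define mx where "mx = Max ((\<lambda>n. absv (fps_nth b n)) ` {..max N1 j0})"
  have mxge: "absv (fps_nth b n) \<le> mx" if "n \<le> max N1 j0" for n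
    unfolding mx_def using that by (intro Max_ge) auto
  have mx0: "0 < mx" using mxge[of j0] pos0 by simp
  have big: "absv (fps_nth b n) < mx" if "n > max N1 j0" for n
    using N1 that mxge[of j0] by (metis less_imp_le less_le_trans max.boundedE max.cobounded2)
  have le: "absv (fps_nth b n) \<le> mx" for n
  proof (cases "n \<le> max N1 j0")
    case False
    then have "max N1 j0 < n" by (rule not_le_imp_less)
    from big[OF this] show ?thesis by simp
  qed (rule mxge)
  have "mx \<in> (\<lambda>n. absv (fps_nth b n)) ` {..max N1 j0}" unfolding mx_def by (intro Max_in) auto
  then have ex: "\<exists>n. absv (fps_nth b n) = mx" by auto
  \<comment> \<open>The first index at which the coefficients of \<open>b\<close> attain their
    maximal absolute value. Other maximal coefficients occur only up to \<open>D1\<close>.\<close>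
  define D where "D = (LEAST n. absv (fps_nth b n) = mx)"
  have D: "absv (fps_nth b D) = mx" unfolding D_def using ex by (rule LeastI_ex)
  have Dl: "absv (fps_nth b n) < mx" if "n < D" for n
    using not_less_Least[OF that[unfolded D_def]] le[of n] by simp
  define D1 where "D1 = max N1 j0"
  have DD1: "D \<le> D1" using D big[of D] unfolding D1_def by (metis less_irrefl not_le)
  obtain Na where Na: "\<forall>n\<ge>Na. absv (fps_nth a n) < mx" using a mx0 by blast
  \<comment> \<open>The number of preceding coefficients of \<open>f\<close> that determine the next
    one; a block of this length is a state of the recurrence.\<close>
  define w where "w = D1 - D"
  define st where "st n = (\<lambda>j\<in>{..<w}. fps_nth f (n + j))" for n
  have "st ` {Na..} \<subseteq> {..<w} \<rightarrow>\<^sub>E (Fq q)" unfolding st_def using fq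
    by (auto simp: PiE_def Pi_def extensional_def)
  moreover have "finite ({..<w} \<rightarrow>\<^sub>E (Fq q :: 'a set))" using finite_Fq by (intro finite_PiE) auto
  ultimately have "finite (st ` {Na..})" by (rule finite_subset)
  then have "\<not> inj_on st {Na..}" using finite_imageD infinite_Ici by blast
  then obtain n1 n2 where n: "Na \<le> n1" "Na \<le> n2" "n1 \<noteq> n2" "st n1 = st n2" unfolding inj_on_def by auto
  have gen: "\<exists>P>0. \<exists>N. \<forall>n\<ge>N. fps_nth f (n + P) = fps_nth f n"
    if nn: "Na \<le> n1" "n1 < n2" "st n1 = st n2" for n1 n2
  proof -
    have base: "fps_nth f (n1 + j) = fps_nth f (n2 + j)" if "j < w" for j
      using fun_cong[OF nn(3), of j] that by (simp add: st_def)
    have all: "fps_nth f (n1 + j) = fps_nth f (n2 + j)" for j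
    proof (induction j rule: less_induct)
      case (less j)
      show ?case
      proof (cases "j < w")
        case False
        \<comment> \<open>In the coefficient of \<open>a = f * b\<close> at degree
          \<open>n + j + D\<close>, the terms with index below \<open>D\<close> or above
          \<open>D1\<close> are smaller than \<open>mx\<close>. What remains expresses
          \<open>f\<close> at \<open>n + j\<close> through the \<open>w\<close> coefficients just
          before it.\<close>
        have tail: "\<exists>r. absv r < mx \<and> fps_nth b D * fps_nth f (n + j) =
          r - (\<Sum>i\<in>{Suc D..D1}. fps_nth b i * fps_nth f (n + j + D - i))" if nNa: "Na \<le> n" for n
        proof -
          define K where "K = n + j + D"
          have KD1: "D1 \<le> K" using False DD1 by (simp add: K_def w_def)
          define S1 where "S1 = {0..<D} \<union> {Suc D1..K}"
          have sp: "{0..K} = insert D ({Suc D..D1} \<union> S1)" unfolding S1_def using KD1 DD1 by auto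
          have dj: "D \<notin> {Suc D..D1} \<union> S1" "{Suc D..D1} \<inter> S1 = {}" unfolding S1_def using DD1 by auto
          have "fps_nth a K = (\<Sum>i=0..K. fps_nth b i * fps_nth f (K - i))"
            unfolding fb[symmetric] mult.commute[of f] by (rule fps_mult_nth)
          also have "\<dots> = fps_nth b D * fps_nth f (K - D) + ((\<Sum>i\<in>{Suc D..D1}. fps_nth b i * fps_nth f (K - i))
              + (\<Sum>i\<in>S1. fps_nth b i * fps_nth f (K - i)))"
            unfolding sp using dj by (simp add: S1_def sum.union_disjoint)
          finally have e: "fps_nth b D * fps_nth f (n + j) =
            (fps_nth a K - (\<Sum>i\<in>S1. fps_nth b i * fps_nth f (K - i)))
             - (\<Sum>i\<in>{Suc D..D1}. fps_nth b i * fps_nth f (K - i))" by (simp add: K_def algebra_simps)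
          have "absv (\<Sum>i\<in>S1. fps_nth b i * fps_nth f (K - i)) < mx"
          proof (rule av_sum_less[OF mx0])
            fix i assume "i \<in> S1"
            then have "absv (fps_nth b i) < mx"
              using Dl[of i] big[of i, folded D1_def] unfolding S1_def by (auto simp: Suc_le_eq)
            moreover have "absv (fps_nth b i) * absv (fps_nth f (K - i)) \<le> absv (fps_nth b i) * 1"
              by (intro mult_left_mono av_Fq_le fq) simp
            ultimately show "absv (fps_nth b i * fps_nth f (K - i)) < mx" by (simp add: av_mult)
          qed
          moreover have "absv (fps_nth a K) < mx" using Na nNa by (simp add: K_def)
          ultimately have "absv (fps_nth a K - (\<Sum>i\<in>S1. fps_nth b i * fps_nth f (K - i))) < mx"
            by (intro av_diff_less)
          then show ?thesis using e unfolding K_def by blast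
        qed
        obtain r1 where r1: "absv r1 < mx" "fps_nth b D * fps_nth f (n1 + j) =
          r1 - (\<Sum>i\<in>{Suc D..D1}. fps_nth b i * fps_nth f (n1 + j + D - i))" using tail nn by blast
        obtain r2 where r2: "absv r2 < mx" "fps_nth b D * fps_nth f (n2 + j) =
          r2 - (\<Sum>i\<in>{Suc D..D1}. fps_nth b i * fps_nth f (n2 + j + D - i))" using tail[of n2] nn by auto
        have "(\<Sum>i\<in>{Suc D..D1}. fps_nth b i * fps_nth f (n1 + j + D - i)) =
            (\<Sum>i\<in>{Suc D..D1}. fps_nth b i * fps_nth f (n2 + j + D - i))"
        proof (intro sum.cong refl)
          fix i assume i: "i \<in> {Suc D..D1}"
          then have ij: "i \<le> j + D" using False by (auto simp: w_def)
          have "j + D - i < j" using i ij by auto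
          then have "fps_nth f (n1 + (j + D - i)) = fps_nth f (n2 + (j + D - i))" by (rule less)
          then show "fps_nth b i * fps_nth f (n1 + j + D - i) = fps_nth b i * fps_nth f (n2 + j + D - i)"
            using ij by (simp add: add.assoc)
        qed
        then have "fps_nth b D * (fps_nth f (n1 + j) - fps_nth f (n2 + j)) = r1 - r2"
          using r1(2) r2(2) by (simp add: right_diff_distrib)
        \<comment> \<open>Elements of the finite field have absolute value 0 or 1, so a difference
          of absolute value less than 1 vanishes.\<close>
        then have "mx * absv (fps_nth f (n1 + j) - fps_nth f (n2 + j)) < mx"
          using av_diff_less[OF r1(1) r2(1)] by (metis D av_mult)
        then have "absv (fps_nth f (n1 + j) - fps_nth f (n2 + j)) < 1" using mx0 by simp
        moreover have "fps_nth f (n1 + j) - fps_nth f (n2 + j) \<in> Fq q"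
          using fq subfieldD(6)[OF Fq_subfield] by blast
        ultimately show ?thesis using av_Fq[of "fps_nth f (n1 + j) - fps_nth f (n2 + j)"] by fastforce
      qed (rule base)
    qed
    have "fps_nth f (n + (n2 - n1)) = fps_nth f n" if "n \<ge> n1" for n
      using all[of "n - n1"] that nn by (simp add: add.commute)
    then show ?thesis using nn by (intro exI[of _ "n2 - n1"]) auto
  qed
  show ?thesis using gen[of n1 n2] gen[of n2 n1] n by (metis linorder_neqE_nat)
qed

text \<open>The quotient of \<open>a\<close> by \<open>b\<close> is fixed by the twist, so its
  coefficients lie in the finite field. They are eventually periodic, hence the quotient is a
  rational function over that field: the constants of the fraction field of \<open>T\<close> are
  rational.\<close>

lemma twist_constants:
  assumes a: "a \<in> T" and b: "b \<in> T" "b \<noteq> 0" and c: "tw 1 a * b = a * tw 1 b"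
  shows "\<exists>r s. (\<forall>i. coeff r i \<in> Fq q) \<and> (\<forall>i. coeff s i \<in> Fq q) \<and> s \<noteq> 0 \<and>
    fps_of_poly s * a = fps_of_poly r * b"
proof -
  define m where "m = subdegree b"
  \<comment> \<open>Removing the power of \<open>t\<close> from \<open>b\<close> leaves an
    invertible power series.\<close>
  define b' where "b' = fps_shift m b"
  have bb: "b = fps_X ^ m * b'" unfolding b'_def m_def
    by (metis fps_shift_times_fps_X_power subdegree_decompose mult.commute)
  have b'0: "fps_nth b' 0 \<noteq> 0" using b(2) by (simp add: b'_def m_def)
  then have b'nz: "b' \<noteq> 0" by auto
  define f where "f = a * inverse b'"
  have fb: "f * b' = a" unfolding f_def mult.assoc inverse_mult_eq_1[OF b'0] by simp
  have twX: "tw 1 (fps_X ^ m) = fps_X ^ m" by (simp only: tw_power tw_X)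
  have "fps_X ^ m * b' * tw 1 b' * tw 1 f = fps_X ^ m * b' * tw 1 b' * f"
    using c unfolding bb fb[symmetric] tw_mult twX by (simp only: mult_ac)
  moreover have "fps_X ^ m * b' * tw 1 b' \<noteq> 0" using b'nz tw_eq_0_iff by simp
  ultimately have tf: "tw 1 f = f" using mult_left_cancel by blast
  have fq: "fps_nth f n \<in> Fq q" for n
    using arg_cong[OF tf, of "\<lambda>g. fps_nth g n"] by (simp add: Fq_def)
  have bs: "\<exists>N. \<forall>n\<ge>N. absv (fps_nth b' n) < e" if e: "0 < e" for e
  proof -
    obtain N where "\<forall>n\<ge>N. absv (fps_nth b n) < e" using T_coeffs_small[OF b(1) e] by blast
    then show ?thesis unfolding b'_def by (intro exI[of _ N]) simp
  qed
  obtain P N where P: "0 < P" "\<And>n. n \<ge> N \<Longrightarrow> fps_nth f (n + P) = fps_nth f n"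
    using recurrent_periodic[OF fq fb b'nz T_coeffs_small[OF a] bs] by blast
  \<comment> \<open>Multiplication by \<open>1 - t ^ P\<close> cancels the periodic tail and leaves
    a polynomial.\<close>
  define g where "g = (1 - fps_X ^ P) * f"
  have gn: "fps_nth g n = fps_nth f n - (if n < P then 0 else fps_nth f (n - P))" for n
    unfolding g_def by (simp add: left_diff_distrib fps_X_power_mult_nth)
  have gz: "fps_nth g n = 0" if "n \<ge> N + P" for n
    using P(2)[of "n - P"] that by (simp add: gn)
  define r where "r = (\<Sum>i<N + P. monom (fps_nth g i) i)"
  have cr: "coeff r n = (if n < N + P then fps_nth g n else 0)" for n
    unfolding r_def by (simp add: coeff_sum if_distrib cong: if_cong)
  have rg: "fps_of_poly r = g" by (rule fps_ext) (use gz in \<open>auto simp: cr\<close>)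
  note FF = subfieldD[OF Fq_subfield]
  have rF: "coeff r n \<in> Fq q" for n unfolding cr gn using fq FF by auto
  define s :: "'a poly" where "s = monom 1 m - monom 1 (m + P)"
  have sF: "coeff s n \<in> Fq q" for n unfolding s_def using FF by (auto)
  have "coeff s m = 1" using P(1) by (simp add: s_def)
  then have s0: "s \<noteq> 0" by auto
  have "fps_of_poly s = fps_X ^ m * (1 - fps_X ^ P)"
    unfolding s_def fps_of_poly_diff fps_of_poly_monom' by (simp add: right_diff_distrib power_add)
  then have "fps_of_poly s * a = fps_of_poly r * b"
    unfolding rg g_def bb fb[symmetric] by (simp add: mult_ac)
  then show ?thesis using rF sF s0 by blast
qed

end

subsection \<open>The series of the Carlitz period\<close>

locale carlitz_period = carlitz absv p k q \<theta> for absv :: "'a::field \<Rightarrow> real" and p k q \<theta> +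
  fixes lam :: 'a
  assumes lam: "lam ^ (q - 1) = - \<theta>"
begin

lemma lam_nz: "lam \<noteq> 0"
proof
  assume "lam = 0"
  then have "- \<theta> = 0" using lam q_gt_1 by (metis power_0_left zero_less_diff less_numeral_extra(3))
  then show False by simp
qed

lemma one_minus_fps: "fps_of_poly [:1, - c:] = 1 - fps_const (c :: 'a) * fps_X"
  unfolding fps_of_poly_linear' by (simp add: fps_eq_iff)

definition OmP :: "nat \<Rightarrow> 'a fps" where
  "OmP N = (\<Prod>i\<in>{1..N}. 1 - fps_const (inverse (\<theta> ^ (q ^ i))) * fps_X)"

lemma theta_factor_gle:
  assumes "1 \<le> i" shows "gle (fps_const (inverse (\<theta> ^ (q ^ i))) * fps_X) (inverse R ^ (i - 1))"
proof -
  have "gle (fps_const (inverse (\<theta> ^ (q ^ i))) * fps_X) (inverse (R ^ (q ^ i)) * R)"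
    by (intro gle_mult gle_const gle_X) (simp add: av_inverse av_power R_def)
  moreover have "inverse (R ^ (q ^ i)) * R \<le> inverse R ^ (i - 1)"
  proof -
    have "R ^ i \<le> R ^ (q ^ i)" using n_le_qpow R_gt_1 by (intro power_increasing) auto
    then have "inverse (R ^ (q ^ i)) \<le> inverse (R ^ i)" by (intro le_imp_inverse_le) auto
    then have "inverse (R ^ (q ^ i)) * R \<le> inverse (R ^ i) * R" by (intro mult_right_mono) auto
    also have "\<dots> = inverse R ^ (i - 1)" using assms by (cases i) (auto simp: power_inverse)
    finally show ?thesis .
  qed
  ultimately show ?thesis by (rule gle_mono)
qed

lemma OmP_gle: "gle (OmP N) 1"
proof -
  have "gle (1 - fps_const (inverse (\<theta> ^ (q ^ i))) * fps_X) 1" if "i \<in> {1..N}" for i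
  proof -
    have "inverse R ^ (i - 1) \<le> 1" using R_gt_1 by (intro power_le_one) (auto simp: field_simps)
    then have "gle (fps_const (inverse (\<theta> ^ (q ^ i))) * fps_X) 1" using theta_factor_gle[of i] that gle_mono by auto
    then show ?thesis using gle_const[of 1 1] by (intro gle_diff) auto
  qed
  then have "gle (OmP N) (\<Prod>i\<in>{1..N}. 1)" unfolding OmP_def by (intro gle_prod)
  then show ?thesis by simp
qed

lemma OmP_conv: "\<exists>G. gconv OmP G"
proof (rule gconv_exists)
  fix e :: real assume e: "0 < e"
  have x: "0 \<le> inverse R" "inverse R < 1" using R_gt_1 by (auto simp: field_simps)
  obtain N where N: "\<forall>n\<ge>N. 1 * inverse R ^ n \<le> e" using real_null[OF x e, of 1] by auto
  have "gle (OmP (Suc n) - OmP n) e" if "n \<ge> N" for n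
  proof -
    have "OmP (Suc n) - OmP n = - (OmP n * (fps_const (inverse (\<theta> ^ (q ^ Suc n))) * fps_X))"
      unfolding OmP_def by (simp add: right_diff_distrib)
    moreover have "gle (- (OmP n * (fps_const (inverse (\<theta> ^ (q ^ Suc n))) * fps_X))) (1 * inverse R ^ n)"
      using gle_mult[OF OmP_gle theta_factor_gle[of "Suc n"]] by (intro gle_uminus) simp
    ultimately show ?thesis using N that gle_mono by auto
  qed
  then show "\<exists>N. \<forall>n\<ge>N. gle (OmP (Suc n) - OmP n) e" by blast
qed

definition Om0 :: "'a fps" where "Om0 = (SOME G. gconv OmP G)"

lemma Om0: "gconv OmP Om0"
  unfolding Om0_def by (rule someI_ex[OF OmP_conv])

lemma OmP_Suc: "OmP (Suc N) = (1 - fps_const (inverse (\<theta> ^ q)) * fps_X) * tw 1 (OmP N)"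
proof -
  have "tw 1 (OmP N) = (\<Prod>i\<in>{1..N}. 1 - fps_const (inverse (\<theta> ^ (q ^ Suc i))) * fps_X)"
    unfolding OmP_def tw_prod
    by (intro prod.cong refl) (simp add: tw_diff tw_mult tw_const power_inverse power_mult[symmetric] mult.commute)
  moreover have "OmP (Suc N) = (1 - fps_const (inverse (\<theta> ^ q)) * fps_X) *
      (\<Prod>i\<in>{1..N}. 1 - fps_const (inverse (\<theta> ^ (q ^ Suc i))) * fps_X)"
    unfolding OmP_def by (induction N) (auto simp: mult_ac)
  ultimately show ?thesis by simp
qed

lemma Om0_eq: "Om0 = (1 - fps_const (inverse (\<theta> ^ q)) * fps_X) * tw 1 Om0"
proof -
  obtain B where B: "gle (1 - fps_const (inverse (\<theta> ^ q)) * fps_X) B"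
    using gle_poly_ex[of "[:1, - inverse (\<theta> ^ q):]"] unfolding one_minus_fps ..
  have "gconv (\<lambda>n. OmP (Suc n)) ((1 - fps_const (inverse (\<theta> ^ q)) * fps_X) * tw 1 Om0)"
    unfolding OmP_Suc by (intro gconv_scale[OF _ B] gconv_tw Om0)
  then show ?thesis using gconv_Suc[OF Om0] gconv_unique by blast
qed

definition Om :: "'a fps" where "Om = fps_const (inverse (lam ^ q)) * Om0"

text \<open>The normalization by \<open>lam ^ q\<close> turns the factor
  \<open>1 - t / \<theta> ^ q\<close> of the product into exactly \<open>t - \<theta> ^ q\<close>,
  since \<open>lam ^ (q * q) = (- \<theta>) ^ q * lam ^ q\<close>.\<close>

lemma Om_eq: "Om = Dl * tw 1 Om"
proof -
  have "lam ^ (q * q) = lam ^ ((q - 1) * q + q)" using q_gt_1 by (simp add: diff_mult_distrib)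
  also have "\<dots> = (- \<theta>) ^ q * lam ^ q" by (simp only: power_add power_mult lam)
  also have "(- \<theta>) ^ q = - (\<theta> ^ q)" using frob_diff[of 0 \<theta> 1] by (simp add: power_0_left)
  finally have l: "inverse (lam ^ q) = - (\<theta> ^ q) * inverse (lam ^ q) ^ q"
    using lam_nz by (simp add: power_inverse power_mult[symmetric] field_simps)
  have D: "Dl = fps_const (- (\<theta> ^ q)) * (1 - fps_const (inverse (\<theta> ^ q)) * fps_X)"
    unfolding Dl_def by (simp add: right_diff_distrib mult.assoc[symmetric] fps_const_mult fps_eq_iff)
  have "Dl * tw 1 Om = (fps_const (- (\<theta> ^ q)) * fps_const (inverse (lam ^ q) ^ q)) *
      ((1 - fps_const (inverse (\<theta> ^ q)) * fps_X) * tw 1 Om0)"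
    unfolding D Om_def tw_mult tw_const by (simp add: mult_ac)
  also have "\<dots> = fps_const (inverse (lam ^ q)) * Om0"
    unfolding Om0_eq[symmetric] fps_const_mult l[symmetric] ..
  finally show ?thesis by (simp add: Om_def)
qed

lemma Om_nz: "Om \<noteq> 0"
proof -
  have "fps_nth Om0 0 = 1"
  proof (rule gconv_nth_const[OF Om0])
    show "fps_nth (OmP n) 0 = 1" for n
      unfolding OmP_def by (induction n) auto
  qed
  then have "Om0 \<noteq> 0" by auto
  then show ?thesis using lam_nz by (simp add: Om_def)
qed

lemma Om_T: "Om \<in> T"
proof -
  have "OmP n \<in> T" for n unfolding OmP_def
  proof (intro subring_prod[OF T_subring])
    fix i
    show "1 - fps_const (inverse (\<theta> ^ (q ^ i))) * fps_X \<in> T"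
      using T_poly[of "[:1, - inverse (\<theta> ^ (q ^ i)):]"] unfolding one_minus_fps .
  qed
  then have "Om0 \<in> T" using gconv_T[OF Om0] by blast
  then show ?thesis unfolding Om_def by (intro T_mult T_const)
qed

text \<open>All partial products at \<theta> have absolute value 1, so the limit does too. Hence it
  is nonzero, and the inverted products in \<open>pitilde\<close> converge to its inverse.\<close>

lemma ev_Om: "ev Om \<theta> (inverse (pitilde absv q \<theta> lam))" and pitilde_nz: "pitilde absv q \<theta> lam \<noteq> 0"
proof -
  have tR: "absv \<theta> \<le> R" by (simp add: R_def)
  define P where "P N = (\<Prod>i\<in>{1..N}. 1 - inverse (\<theta> ^ (q ^ i - 1)))" for N
  have "ev (OmP N) \<theta> (P N)" for N
    unfolding OmP_def P_def
  proof (rule ev_prod[OF tR])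
    fix i assume "i \<in> {1..N}"
    have "q ^ i = Suc (q ^ i - 1)" using q_gt_1 by simp
    then have "\<theta> ^ (q ^ i) = \<theta> * \<theta> ^ (q ^ i - 1)" by (metis power_Suc)
    then have "inverse (\<theta> ^ (q ^ i)) * \<theta> = inverse (\<theta> ^ (q ^ i - 1))"
      by (simp add: field_simps)
    then show "ev (1 - fps_const (inverse (\<theta> ^ (q ^ i))) * fps_X) \<theta> (1 - inverse (\<theta> ^ (q ^ i - 1)))"
      using ev_poly[of "[:1, - inverse (\<theta> ^ (q ^ i)):]" \<theta>] unfolding one_minus_fps by (simp add: mult.commute)
  qed
  then obtain L where L: "ev Om0 \<theta> L" "conv_abs absv P L" using gconv_ev[OF Om0 _ tR] by blast
  have P1: "absv (P N) = 1" for N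
    unfolding P_def av_prod
  proof (rule prod.neutral, rule ballI)
    fix i assume i: "i \<in> {1..N}"
    then have "1 < q ^ i" using q_gt_1 by (intro one_less_power) auto
    then have "1 < R ^ (q ^ i - 1)" using R_gt_1 by (intro one_less_power) auto
    then have "inverse (R ^ (q ^ i - 1)) < 1" by (simp add: inverse_less_1_iff)
    then show "absv (1 - inverse (\<theta> ^ (q ^ i - 1))) = 1"
      using av_dominant(2)[of "inverse (\<theta> ^ (q ^ i - 1))" 1] by (simp add: av_inverse av_power R_def)
  qed
  have L1: "absv L = 1"
  proof -
    obtain N where "absv (P N - L) < 1" using L(2) unfolding conv_abs_def by (metis order_refl zero_less_one)
    then have "absv (P N - L) < absv (P N)" using P1 by simp
    from av_dominant(2)[OF this] show ?thesis using P1 by simp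
  qed
  then have Lnz: "L \<noteq> 0" by auto
  have "conv_abs absv (\<lambda>N. \<Prod>i\<in>{1..N}. inverse (1 - inverse (\<theta> ^ (q ^ i - 1)))) (inverse L)"
    unfolding conv_abs_def
  proof (intro allI impI)
    fix e :: real assume "0 < e"
    then obtain N where N: "\<forall>n\<ge>N. absv (P n - L) < e" using L(2) unfolding conv_abs_def by blast
    have "absv ((\<Prod>i\<in>{1..n}. inverse (1 - inverse (\<theta> ^ (q ^ i - 1)))) - inverse L) < e" if "n \<ge> N" for n
    proof -
      have Pn: "P n \<noteq> 0" using P1[of n] by auto
      have "(\<Prod>i\<in>{1..n}. inverse (1 - inverse (\<theta> ^ (q ^ i - 1)))) = inverse (P n)"
        unfolding P_def using prod_inversef[of "\<lambda>i. 1 - inverse (\<theta> ^ (q ^ i - 1))" "{1..n}"] by (simp add: comp_def)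
      moreover have "inverse (P n) - inverse L = (L - P n) / (P n * L)" using Pn Lnz by (simp add: field_simps)
      ultimately show ?thesis using N that P1 L1 by (simp add: av_divide av_mult av_diff_commute)
    qed
    then show "\<exists>N. \<forall>n\<ge>N. absv ((\<Prod>i\<in>{1..n}. inverse (1 - inverse (\<theta> ^ (q ^ i - 1)))) - inverse L) < e" by blast
  qed
  then have pt: "pitilde absv q \<theta> lam = lam ^ q * inverse L" unfolding pitilde_def by (simp add: lim_absI)
  have "ev Om \<theta> (inverse (lam ^ q) * L)" unfolding Om_def by (intro ev_mult ev_const L tR)
  then show "ev Om \<theta> (inverse (pitilde absv q \<theta> lam))" unfolding pt by simp
  show "pitilde absv q \<theta> lam \<noteq> 0" unfolding pt using lam_nz Lnz by simp
qed

end

subsection \<open>Transfer of independence\<close>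

lemma mindep_subset:
  fixes x :: "'i \<Rightarrow> 'a::comm_ring_1"
  assumes mi: "mindep F I x" and I: "finite I" "I' \<subseteq> I" shows "mindep F I' x"
  unfolding mindep_def
proof (intro allI impI, elim conjE)
  fix S :: "('i \<Rightarrow> nat) set" and a
  assume S: "finite S" "\<forall>m\<in>S. a m \<in> F \<and> (\<forall>i. i \<notin> I' \<longrightarrow> m i = 0)" "(\<Sum>m\<in>S. a m * monval I' x m) = 0"
  have "monval I x m = monval I' x m" if "m \<in> S" for m
    unfolding monval_def using I S(2) that by (intro prod.mono_neutral_right) auto
  then have s0: "(\<Sum>m\<in>S. a m * monval I x m) = 0" using S(3) by simp
  show "\<forall>m\<in>S. a m = 0"
  proof
    fix m assume "m \<in> S"
    then show "a m = 0" using S(1,2) I(2) by (intro mindepD[OF mi _ _ _ s0]) blast+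
  qed
qed

text \<open>Multiplying a relation by a large power of \<open>x i0\<close> turns the exponents of
  the inverse into complementary exponents of \<open>x i0\<close>. It mediates between the period
  and the value of \<open>Om\<close>, which is its inverse.\<close>

lemma mindep_inverse:
  fixes x :: "'i \<Rightarrow> 'a::field"
  assumes mi: "mindep F I x" and I: "finite I" "i0 \<in> I" and nz: "x i0 \<noteq> 0"
  shows "mindep F I (x(i0 := inverse (x i0)))"
  unfolding mindep_def
proof (intro allI impI, elim conjE)
  fix S :: "('i \<Rightarrow> nat) set" and a
  define x' where "x' = x(i0 := inverse (x i0))"
  assume S: "finite S" "\<forall>m\<in>S. a m \<in> F \<and> (\<forall>i. i \<notin> I \<longrightarrow> m i = 0)"
    "(\<Sum>m\<in>S. a m * monval I (x(i0 := inverse (x i0))) m) = 0"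
  define W where "W = Max ((\<lambda>m. m i0) ` S)"
  have W: "m i0 \<le> W" if "m \<in> S" for m unfolding W_def using S(1) that by (intro Max_ge) auto
  define g where "g m = m(i0 := W - m i0)" for m :: "'i \<Rightarrow> nat"
  have gi: "inj_on g S"
  proof (rule inj_onI, rule ext)
    fix m m' y assume m: "m \<in> S" "m' \<in> S" "g m = g m'"
    show "m y = m' y" using fun_cong[OF m(3), of y] W[OF m(1)] W[OF m(2)] by (cases "y = i0") (auto simp: g_def)
  qed
  have gm: "monval I x (g m) = x i0 ^ W * monval I x' m" if m: "m \<in> S" for m
  proof -
    have r: "monval I z m = z i0 ^ m i0 * (\<Prod>i\<in>I - {i0}. z i ^ m i)" for z :: "'i \<Rightarrow> 'a" and m
      unfolding monval_def using I by (simp add: prod.remove)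
    have "x i0 ^ W = x i0 ^ (W - m i0) * x i0 ^ m i0" using W[OF m] by (simp add: power_add[symmetric])
    then have "x i0 ^ (W - m i0) = x i0 ^ W * inverse (x i0) ^ m i0" using nz by (simp add: power_inverse)
    then show ?thesis unfolding r by (simp add: g_def x'_def)
  qed
  define b where "b m = a (inv_into S g m)" for m
  have bg: "b (g m) = a m" if "m \<in> S" for m using gi that by (simp add: b_def)
  have "(\<Sum>m\<in>g ` S. b m * monval I x m) = x i0 ^ W * (\<Sum>m\<in>S. a m * monval I x' m)"
    by (simp add: sum.reindex[OF gi] bg gm sum_distrib_left mult_ac)
  then have s0: "(\<Sum>m\<in>g ` S. b m * monval I x m) = 0" using S(3) by (simp add: x'_def)
  have "b (g m) = 0" if "m \<in> S" for m
  proof (rule mindepD[OF mi _ _ _ s0])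
    show "\<And>m. m \<in> g ` S \<Longrightarrow> b m \<in> F" using S(2) bg by auto
    show "\<And>m i. m \<in> g ` S \<Longrightarrow> i \<notin> I \<Longrightarrow> m i = 0" using S(2) I(2) by (auto simp: g_def)
  qed (use S(1) that in auto)
  then show "\<forall>m\<in>S. a m = 0" using bg by auto
qed

text \<open>Power series form only a domain, while the difference algebra takes place over fields;
  \<open>emb\<close> is the passage to the fraction field.\<close>

definition emb :: "'a::idom \<Rightarrow> 'a fract" where "emb a = Fract a 1"

lemma emb_0 [simp]: "emb 0 = 0" by (simp add: emb_def fract_collapse)
lemma emb_1 [simp]: "emb 1 = 1" by (simp add: emb_def fract_collapse)
lemma emb_add: "emb (a + b) = emb a + emb b" by (simp add: emb_def)
lemma emb_mult: "emb (a * b) = emb a * emb b" by (simp add: emb_def)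
lemma emb_uminus: "emb (- a) = - emb a" by (simp add: emb_def)
lemma emb_eq_iff [simp]: "emb a = emb b \<longleftrightarrow> a = b" by (simp add: emb_def eq_fract)
lemma emb_eq_0_iff [simp]: "emb a = 0 \<longleftrightarrow> a = 0" using emb_eq_iff[of a 0] by simp
lemma emb_sum: "emb (sum f A) = (\<Sum>i\<in>A. emb (f i))"
  by (induction A rule: infinite_finite_induct) (auto simp: emb_add)
lemma emb_prod: "emb (prod f A) = (\<Prod>i\<in>A. emb (f i))"
  by (induction A rule: infinite_finite_induct) (auto simp: emb_mult)
lemma emb_power: "emb (a ^ n) = emb a ^ n"
  by (induction n) (auto simp: emb_mult)
lemma emb_monval: "emb (monval I f m) = monval I (\<lambda>i. emb (f i)) m"
  by (simp add: monval_def emb_prod emb_power)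

lemma emb_quotient: "\<exists>a b. b \<noteq> 0 \<and> x = emb a / emb b"
proof (cases x)
  case (Fract a b)
  then have "x * emb b = emb a" by (simp add: emb_def eq_fract)
  then have "x = emb a / emb b" using Fract by (simp add: eq_divide_eq)
  then show ?thesis using Fract by blast
qed

lemma emb_subring: "is_subring P \<Longrightarrow> is_subring (emb ` P)"
  unfolding is_subring_def
proof (intro conjI ballI; elim conjE)
  assume P: "0 \<in> P" "1 \<in> P" "\<forall>x\<in>P. \<forall>y\<in>P. x + y \<in> P \<and> x * y \<in> P" "\<forall>x\<in>P. - x \<in> P"
  show "0 \<in> emb ` P" using P(1) emb_0 by (metis imageI)
  show "1 \<in> emb ` P" using P(2) emb_1 by (metis imageI)
  fix x assume x: "x \<in> emb ` P"
  then show "- x \<in> emb ` P" using P(4) by (auto simp: emb_uminus[symmetric])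
  fix y assume y: "y \<in> emb ` P"
  show "x + y \<in> emb ` P" using x y P(3) by (auto simp: emb_add[symmetric])
  show "x * y \<in> emb ` P" using x y P(3) by (auto simp: emb_mult[symmetric])
qed

lemma mindep_emb: "mindep (emb ` P) I (\<lambda>i. emb (f i)) \<longleftrightarrow> mindep P I f"
proof
  assume mi: "mindep (emb ` P) I (\<lambda>i. emb (f i))"
  show "mindep P I f" unfolding mindep_def
  proof (intro allI impI, elim conjE)
    fix S :: "('b \<Rightarrow> nat) set" and a
    assume S: "finite S" "\<forall>m\<in>S. a m \<in> P \<and> (\<forall>i. i \<notin> I \<longrightarrow> m i = 0)" "(\<Sum>m\<in>S. a m * monval I f m) = 0"
    have "emb (\<Sum>m\<in>S. a m * monval I f m) = 0" using S(3) by simp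
    then have s0: "(\<Sum>m\<in>S. emb (a m) * monval I (\<lambda>i. emb (f i)) m) = 0"
      by (simp add: emb_sum emb_mult emb_monval)
    show "\<forall>m\<in>S. a m = 0"
    proof
      fix m assume "m \<in> S"
      then have "emb (a m) = 0" using S(1,2) by (intro mindepD[OF mi _ _ _ s0]) auto
      then show "a m = 0" by simp
    qed
  qed
next
  assume mi: "mindep P I f"
  show "mindep (emb ` P) I (\<lambda>i. emb (f i))" unfolding mindep_def
  proof (intro allI impI, elim conjE)
    fix S :: "('b \<Rightarrow> nat) set" and a
    assume S: "finite S" "\<forall>m\<in>S. a m \<in> emb ` P \<and> (\<forall>i. i \<notin> I \<longrightarrow> m i = 0)"
      "(\<Sum>m\<in>S. a m * monval I (\<lambda>i. emb (f i)) m) = 0"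
    then have "\<forall>m\<in>S. \<exists>c\<in>P. a m = emb c" by auto
    then obtain c where c: "\<And>m. m \<in> S \<Longrightarrow> c m \<in> P" "\<And>m. m \<in> S \<Longrightarrow> a m = emb (c m)" by metis
    have "emb (\<Sum>m\<in>S. c m * monval I f m) = 0" using S(3) by (simp add: emb_sum emb_mult emb_monval c(2))
    then have s0: "(\<Sum>m\<in>S. c m * monval I f m) = 0" by simp
    show "\<forall>m\<in>S. a m = 0"
    proof
      fix m assume m: "m \<in> S"
      then have "c m = 0" using S(1,2) c by (intro mindepD[OF mi _ _ _ s0]) auto
      then show "a m = 0" using c(2)[OF m] by simp
    qed
  qed
qed

lemma transc_antimono: "transc M z \<Longrightarrow> M' \<subseteq> M \<Longrightarrow> transc M' z"
  unfolding transc_def by blast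

context carlitz
begin

definition RP :: "'a fps set" where
  "RP = {fps_of_poly r | r. \<forall>i. coeff r i \<in> Kbar q \<theta>}"

lemma Kbar_poly_subring: "is_subring {r. \<forall>i. coeff r i \<in> Kbar q \<theta>}"
  unfolding is_subring_def using subfieldD[OF Kbar_subfield]
  by (auto simp: coeff_mult coeff_pCons split: nat.splits intro!: subfield_sum[OF Kbar_subfield])

lemma RP_subring: "is_subring RP"
proof -
  have e: "RP = fps_of_poly ` {r. \<forall>i. coeff r i \<in> Kbar q \<theta>}" by (auto simp: RP_def)
  note PP = subringD[OF Kbar_poly_subring]
  show ?thesis unfolding is_subring_def e
  proof (intro conjI ballI)
    show "0 \<in> fps_of_poly ` {r. \<forall>i. coeff r i \<in> Kbar q \<theta>}" by (rule image_eqI[of _ _ 0]) (use PP in auto)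
    show "1 \<in> fps_of_poly ` {r. \<forall>i. coeff r i \<in> Kbar q \<theta>}" by (rule image_eqI[OF _ PP(2)]) simp
    fix x assume "x \<in> fps_of_poly ` {r. \<forall>i. coeff r i \<in> Kbar q \<theta>}"
    then obtain r where r: "x = fps_of_poly r" "r \<in> {r. \<forall>i. coeff r i \<in> Kbar q \<theta>}" by auto
    show "- x \<in> fps_of_poly ` {r. \<forall>i. coeff r i \<in> Kbar q \<theta>}"
      by (rule image_eqI[OF _ PP(5)[OF r(2)]]) (simp add: r fps_of_poly_uminus)
    fix y assume "y \<in> fps_of_poly ` {r. \<forall>i. coeff r i \<in> Kbar q \<theta>}"
    then obtain s where s: "y = fps_of_poly s" "s \<in> {r. \<forall>i. coeff r i \<in> Kbar q \<theta>}" by auto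
    show "x + y \<in> fps_of_poly ` {r. \<forall>i. coeff r i \<in> Kbar q \<theta>}"
      by (rule image_eqI[OF _ PP(3)[OF r(2) s(2)]]) (simp add: r s fps_of_poly_add)
    show "x * y \<in> fps_of_poly ` {r. \<forall>i. coeff r i \<in> Kbar q \<theta>}"
      by (rule image_eqI[OF _ PP(4)[OF r(2) s(2)]]) (simp add: r s fps_of_poly_mult)
  qed
qed

lemma RP_T: "RP \<subseteq> T" unfolding RP_def using T_poly by auto

lemma RP_tw: "f \<in> RP \<Longrightarrow> tw 1 f \<in> RP"
proof -
  assume "f \<in> RP"
  then obtain r where r: "f = fps_of_poly r" "\<And>i. coeff r i \<in> Kbar q \<theta>" unfolding RP_def by blast
  then show ?thesis unfolding RP_def using subfieldD(9)[OF Kbar_subfield]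
    by (intro CollectI exI[of _ "twist q 1 r"]) (simp add: tw_poly[symmetric])
qed

lemma Kbar_const_RP: "c \<in> Kbar q \<theta> \<Longrightarrow> fps_const c \<in> RP"
  unfolding RP_def using subfieldD(1)[OF Kbar_subfield]
  by (intro CollectI exI[of _ "[:c:]"]) (auto simp: fps_of_poly_const coeff_pCons split: nat.splits)

lemma X_RP: "fps_X \<in> RP"
  unfolding RP_def using subfieldD(1,2)[OF Kbar_subfield]
  by (intro CollectI exI[of _ "[:0, 1:]"]) (auto simp: coeff_pCons split: nat.splits)

lemma Dl_RP: "Dl \<in> RP"
  unfolding Dl_def using X_RP Kbar_const_RP theta_Kbar subfieldD(9)[OF Kbar_subfield]
  by (intro subringD(6)[OF RP_subring]) auto

lemma Kbar_divide_linear: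
  assumes "\<And>i. coeff ([:- \<theta>, 1:] * s) i \<in> Kbar q \<theta>" shows "coeff s i \<in> Kbar q \<theta>"
proof (induction "Suc (degree s) - i" arbitrary: i rule: less_induct)
  case less
  note KK = subfieldD[OF Kbar_subfield]
  show ?case
  proof (cases "i \<le> degree s")
    case True
    have "coeff s (Suc i) \<in> Kbar q \<theta>" by (rule less) (use True in auto)
    moreover have "coeff s i = coeff ([:- \<theta>, 1:] * s) (Suc i) + \<theta> * coeff s (Suc i)" by simp
    ultimately show ?thesis using assms[of "Suc i"] theta_Kbar KK(3,4) by presburger
  qed (use KK in \<open>simp add: coeff_eq_0\<close>)
qed

text \<open>Induction on the total degree of the coefficient polynomials: independence of the values
  makes all of them vanish at \<theta>, so the whole relation can be divided by
  \<open>t - \<theta>\<close>.\<close>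

lemma mindep_specialize:
  assumes I: "finite I" and evf: "\<And>i. i \<in> I \<Longrightarrow> ev (f i) \<theta> (w i)" and mi: "mindep (Kbar q \<theta>) I w"
  shows "mindep RP I f"
proof -
  have tR: "absv \<theta> \<le> R" by (simp add: R_def)
  have evm: "ev (monval I f m) \<theta> (monval I w m)" for m
    unfolding monval_def by (intro ev_prod ev_power tR evf)
  have main: "\<forall>m\<in>S. r m = 0"
    if "finite S" "\<forall>m\<in>S. (\<forall>j. coeff (r m) j \<in> Kbar q \<theta>) \<and> (\<forall>i. i \<notin> I \<longrightarrow> m i = 0)"
      "(\<Sum>m\<in>S. fps_of_poly (r m) * monval I f m) = 0" for S r
    using that
  proof (induction "\<Sum>m\<in>S. degree (r m)" arbitrary: r rule: less_induct)
    case less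
    have "ev (\<Sum>m\<in>S. fps_of_poly (r m) * monval I f m) \<theta> (\<Sum>m\<in>S. poly (r m) \<theta> * monval I w m)"
      by (intro ev_sum ev_mult ev_poly evm tR)
    then have "ev 0 \<theta> (\<Sum>m\<in>S. poly (r m) \<theta> * monval I w m)" using less.prems(3) by simp
    moreover have "ev 0 \<theta> 0" using ev_const[of 0 \<theta>] by simp
    ultimately have s0: "(\<Sum>m\<in>S. poly (r m) \<theta> * monval I w m) = 0" using ev_unique tR by blast
    have rK: "poly (r m) \<theta> \<in> Kbar q \<theta>" if "m \<in> S" for m
      unfolding poly_altdef using less.prems(2) that theta_Kbar subfieldD(4,9)[OF Kbar_subfield]
      by (intro subfield_sum[OF Kbar_subfield]) auto
    have "poly (r m) \<theta> = 0" if "m \<in> S" for m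
      using mindepD[OF mi less.prems(1) _ _ s0] rK less.prems(2) that by auto
    then have "\<forall>m\<in>S. \<exists>s. r m = [:- \<theta>, 1:] * s" by (meson dvdE poly_eq_0_iff_dvd)
    then obtain s where s: "\<And>m. m \<in> S \<Longrightarrow> r m = [:- \<theta>, 1:] * s m" by metis
    show ?case
    proof (cases "\<forall>m\<in>S. r m = 0")
      case False
      then obtain m0 where m0: "m0 \<in> S" "r m0 \<noteq> 0" by auto
      have dg: "degree (r m) = (if s m = 0 then 0 else Suc (degree (s m)))" if "m \<in> S" for m
        using s[OF that] degree_mult_eq[of "[:- \<theta>, 1:]" "s m"] by auto
      have "degree (s m) \<le> degree (r m)" if "m \<in> S" for m using dg[OF that] by auto
      moreover have "degree (s m0) < degree (r m0)" using dg[OF m0(1)] s[OF m0(1)] m0(2) by auto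
      ultimately have lt: "(\<Sum>m\<in>S. degree (s m)) < (\<Sum>m\<in>S. degree (r m))"
        using m0(1) less.prems(1) by (intro sum_strict_mono_ex1) auto
      have sK: "\<forall>m\<in>S. (\<forall>j. coeff (s m) j \<in> Kbar q \<theta>) \<and> (\<forall>i. i \<notin> I \<longrightarrow> m i = 0)"
        using less.prems(2) s Kbar_divide_linear by metis
      have "fps_of_poly [:- \<theta>, 1:] * (\<Sum>m\<in>S. fps_of_poly (s m) * monval I f m) =
          (\<Sum>m\<in>S. fps_of_poly (r m) * monval I f m)"
        unfolding sum_distrib_left mult.assoc[symmetric] fps_of_poly_mult[symmetric]
        by (intro sum.cong refl) (simp only: s)
      then have "fps_of_poly [:- \<theta>, 1:] * (\<Sum>m\<in>S. fps_of_poly (s m) * monval I f m) = 0"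
        using less.prems(3) by simp
      moreover have "fps_of_poly [:- \<theta>, 1:] \<noteq> 0" by (metis fps_of_poly_0 fps_of_poly_eq_iff pCons_eq_0_iff zero_neq_one)
      ultimately have "(\<Sum>m\<in>S. fps_of_poly (s m) * monval I f m) = 0" by simp
      then have "\<forall>m\<in>S. s m = 0" using less.hyps[OF lt less.prems(1) sK] by blast
      then show ?thesis using s by simp
    qed
  qed
  show ?thesis unfolding mindep_def
  proof (intro allI impI, elim conjE)
    fix S :: "('b \<Rightarrow> nat) set" and a
    assume S: "finite S" "\<forall>m\<in>S. a m \<in> RP \<and> (\<forall>i. i \<notin> I \<longrightarrow> m i = 0)" "(\<Sum>m\<in>S. a m * monval I f m) = 0"
    have "\<forall>m\<in>S. \<exists>r. a m = fps_of_poly r \<and> (\<forall>j. coeff r j \<in> Kbar q \<theta>)" using S(2) unfolding RP_def by blast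
    then obtain r where r: "\<And>m. m \<in> S \<Longrightarrow> a m = fps_of_poly (r m)" "\<And>m. m \<in> S \<Longrightarrow> \<forall>j. coeff (r m) j \<in> Kbar q \<theta>"
      by metis
    have "\<forall>m\<in>S. r m = 0"
    proof (rule main[OF S(1)])
      show "\<forall>m\<in>S. (\<forall>j. coeff (r m) j \<in> Kbar q \<theta>) \<and> (\<forall>i. i \<notin> I \<longrightarrow> m i = 0)" using r S(2) by blast
      show "(\<Sum>m\<in>S. fps_of_poly (r m) * monval I f m) = 0" using S(3) by (simp add: r(1))
    qed
    then show "\<forall>m\<in>S. a m = 0" using r(1) by simp
  qed
qed

end

lemma card_Iset: "card (Iset d) = d * (d + 1) div 2"
proof (induction d)
  case 0
  have "Iset 0 = {}" by (auto simp: Iset_def)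
  then show ?case by simp
next
  case (Suc d)
  have e: "Iset (Suc d) = Iset d \<union> (\<lambda>j. (d + 2, j)) ` {1..d + 1}" by (auto simp: Iset_def)
  have "card (Iset (Suc d)) = card (Iset d) + card ((\<lambda>j. (d + 2, j)) ` {1..d + 1})"
    unfolding e using finite_Iset by (intro card_Un_disjoint) (auto simp: Iset_def)
  also have "card ((\<lambda>j. (d + 2, j)) ` {1..d + 1}) = d + 1" by (subst card_image) (auto intro: inj_onI)
  finally show ?case using Suc by simp
qed

subsection \<open>The tuple of logarithms\<close>

locale log_tuple = carlitz_period absv p k q \<theta> lam for absv :: "'a::field \<Rightarrow> real" and p k q \<theta> lam +
  fixes d :: nat and ns :: "nat list" and us :: "'a poly list"
  assumes len: "length ns = d" "length us = d"
    and uK: "\<And>i l. i < d \<Longrightarrow> coeff (us ! i) l \<in> Kbar q \<theta>"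
    and unorm: "\<And>i. i < d \<Longrightarrow> norm_poly absv (us ! i) < absv \<theta> powr (real (ns ! i) * real q / real (q - 1))"
    and indep: "alg_indep (Kbar q \<theta>) {..d}
                  (\<lambda>k. if k = 0 then pitilde absv q \<theta> lam
                       else Lval absv q \<theta> [us ! (k - 1)] [ns ! (k - 1)] \<theta>)"
begin

definition seg where "seg i j = zip (subtuple us i j) (subtuple ns i j)"

lemma seg_eq: "seg i j = take (i - j) (drop (j - 1) (zip us ns))"
  by (simp add: seg_def subtuple_def take_zip drop_zip)

lemma good_seg: "good (seg i j)"
proof -
  have "set (seg i j) \<subseteq> set (zip us ns)"
    unfolding seg_eq using set_take_subset set_drop_subset by fastforce
  moreover have "\<forall>(v, m)\<in>set (zip us ns). norm_poly absv v < R powr (real m * real q / real (q - 1))"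
    using unorm len by (auto simp: set_zip R_def)
  ultimately show ?thesis unfolding good_def by blast
qed

lemma seg_self: "seg i i = []" by (simp add: seg_eq)

lemma seg_step:
  assumes "(i, j) \<in> Iset d"
  shows "seg i j = seg (i - 1) j @ [(us ! (i - 2), ns ! (i - 2))]"
proof -
  have ij: "1 \<le> j" "j < i" "i \<le> d + 1" using assms by (auto simp: Iset_def)
  have e: "i - j = Suc (i - 1 - j)" using ij by simp
  have "i - 1 - j < length (drop (j - 1) (zip us ns))" using ij len by simp
  then have "seg i j = seg (i - 1) j @ [drop (j - 1) (zip us ns) ! (i - 1 - j)]"
    unfolding seg_eq e by (rule take_Suc_conv_app_nth)
  moreover have "drop (j - 1) (zip us ns) ! (i - 1 - j) = (us ! (i - 2), ns ! (i - 2))"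
  proof -
    have "j - 1 + (i - 1 - j) = i - 2" using ij by simp
    moreover have "i - 2 < d" using ij by simp
    ultimately show ?thesis using len ij by (simp add: nth_drop)
  qed
  ultimately show ?thesis by simp
qed

definition Lf where "Lf i j = LL (seg i j)"
definition sw where "sw i j = sum_list (map snd (seg i j))"
definition Xf where "Xf i j = Om ^ sw i j * Lf i j"
definition af where "af i = fps_of_poly (us ! (i - 1)) * Om ^ (ns ! (i - 1))"

lemma Lf_self [simp]: "Lf i i = 1" by (simp add: Lf_def seg_self LL_Nil)
lemma Xf_self [simp]: "Xf i i = 1" by (simp add: Xf_def sw_def seg_self)

lemma Lf_T: "Lf i j \<in> T" unfolding Lf_def by (rule LL_T[OF good_seg])

lemma Xf_T: "Xf i j \<in> T"
  unfolding Xf_def using Lf_T Om_T by (intro T_mult subring_power[OF T_subring])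

lemma us_RP: "1 \<le> i \<Longrightarrow> i \<le> d \<Longrightarrow> fps_of_poly (us ! (i - 1)) \<in> RP"
  unfolding RP_def using uK[of "i - 1"] by auto

lemma Lf_rec:
  assumes ij: "(i, j) \<in> Iset d"
  shows "Dl ^ sw i j * Lf i j = tw 1 (Lf i j) + fps_of_poly (us ! (i - 2)) * Dl ^ (ns ! (i - 2)) * tw 1 (Lf (i - 1) j)"
  using LL_recurrence[of "seg (i - 1) j" "us ! (i - 2)" "ns ! (i - 2)"] good_seg[of i j]
  unfolding Lf_def sw_def seg_step[OF ij] by simp

lemma sw_step: "(i, j) \<in> Iset d \<Longrightarrow> sw i j = sw (i - 1) j + ns ! (i - 2)"
  by (simp add: sw_def seg_step)

text \<open>Replacing \<open>Om\<close> by \<open>Dl * tw 1 Om\<close> supplies exactly the powers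
  of \<open>Dl\<close> that appear in the recurrence of the series \<open>L\<close>, which removes
  all denominators from the system.\<close>

lemma Xf_rec:
  assumes ij: "(i, j) \<in> Iset d"
  shows "Xf i j = tw 1 (Xf i j) + af (i - 1) * tw 1 (Xf (i - 1) j)"
proof -
  have i2: "i - 1 - 1 = i - 2" by simp
  have "Xf i j = (Dl * tw 1 Om) ^ sw i j * Lf i j" unfolding Xf_def using Om_eq by simp
  also have "\<dots> = tw 1 Om ^ sw i j * (Dl ^ sw i j * Lf i j)" by (simp add: power_mult_distrib mult_ac)
  also have "\<dots> = tw 1 (Xf i j) +
      fps_of_poly (us ! (i - 2)) * (Dl * tw 1 Om) ^ (ns ! (i - 2)) * tw 1 (Xf (i - 1) j)"
    unfolding Lf_rec[OF ij]
    by (simp add: Xf_def tw_mult tw_power distrib_left sw_step[OF ij] power_add power_mult_distrib mult_ac)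
  also have "Dl * tw 1 Om = Om" using Om_eq by simp
  finally show ?thesis unfolding af_def i2 .
qed

text \<open>The index \<open>(1, 0)\<close> stands for the period; it is the case \<open>k = 0\<close> of the depth-one indices \<open>(k + 1, k)\<close>.\<close>

definition wv :: "nat \<times> nat \<Rightarrow> 'a" where
  "wv = (\<lambda>(i, j). if j = 0 then inverse (pitilde absv q \<theta> lam)
     else Lval absv q \<theta> (subtuple us i j) (subtuple ns i j) \<theta>)"

definition fv :: "nat \<times> nat \<Rightarrow> 'a fps" where
  "fv = (\<lambda>(i, j). if j = 0 then Om else Lf i j)"

lemma ev_fv: "ev (fv s) \<theta> (wv s)"
  using ev_Om ev_LL good_seg unfolding fv_def wv_def Lf_def seg_def by (auto split: prod.splits)

lemma depth_one_indep: "mindep RP {..d} (\<lambda>k. fv (Suc k, k))"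
proof (rule mindep_specialize[OF _ ev_fv])
  define v where "v = (\<lambda>k. if k = 0 then pitilde absv q \<theta> lam
                       else Lval absv q \<theta> [us ! (k - 1)] [ns ! (k - 1)] \<theta>)"
  have "mindep (Kbar q \<theta>) {..d} v"
    using indep alg_indep_iff_mindep[of "{..d}" "Kbar q \<theta>" v] subfieldD(1)[OF Kbar_subfield]
    unfolding v_def by simp
  \<comment> \<open>The function at index 0 is \<open>Om\<close>, whose value is the inverse of the
    period.\<close>
  then have mi: "mindep (Kbar q \<theta>) {..d} (v(0 := inverse (v 0)))"
    by (rule mindep_inverse) (auto simp: v_def pitilde_nz)
  have "(v(0 := inverse (v 0))) k = wv (Suc k, k)" if "k \<in> {..d}" for k
  proof (cases k)
    case (Suc l)
    then have "l < d" using that by simp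
    then have "subtuple us (Suc k) k = [us ! l]" "subtuple ns (Suc k) k = [ns ! l]"
      using len Suc by (auto simp: subtuple_def take_Suc_conv_app_nth)
    then show ?thesis using Suc by (simp add: v_def wv_def)
  qed (simp add: v_def wv_def)
  then have "monval {..d} (v(0 := inverse (v 0))) m = monval {..d} (\<lambda>k. wv (Suc k, k)) m" for m
    unfolding monval_def by (intro prod.cong refl) simp
  then show "mindep (Kbar q \<theta>) {..d} (\<lambda>k. wv (Suc k, k))" using mi unfolding mindep_def by simp
qed simp

definition RF :: "'a fps fract set" where "RF = emb ` RP"
definition F0 :: "'a fps fract set" where "F0 = gen_field RF {emb Om}"
text \<open>The fraction field of the Tate algebra. It contains all entries of the system, and an
  element of it fixed by the twist is rational, hence already in \<open>F0\<close>.\<close>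

definition UT :: "'a fps fract set" where
  "UT = {a / b | a b. a \<in> emb ` T \<and> b \<in> emb ` T \<and> b \<noteq> 0}"

lemma RF_subring: "is_subring RF" unfolding RF_def by (rule emb_subring[OF RP_subring])
lemma F0_subfield: "is_subfield F0" unfolding F0_def by (rule gen_field_subfield)
lemma RF_F0: "RF \<subseteq> F0" unfolding F0_def by (rule gen_field_base)
lemma Om_F0: "emb Om \<in> F0" unfolding F0_def using gen_field_gens by blast

lemma UT_subfield: "is_subfield UT"
  unfolding UT_def by (rule quotients_subfield[OF emb_subring[OF T_subring]])

lemma T_UT: "f \<in> T \<Longrightarrow> emb f \<in> UT"
proof -
  assume "f \<in> T"
  then have h: "emb f = emb f / 1 \<and> emb f \<in> emb ` T \<and> 1 \<in> emb ` T \<and> (1 :: 'a fps fract) \<noteq> 0"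
    using subringD(2)[OF emb_subring[OF T_subring]] by auto
  show ?thesis unfolding UT_def mem_Collect_eq by (rule exI, rule exI, rule h)
qed

lemma F0_UT: "F0 \<subseteq> UT"
  unfolding F0_def by (rule gen_field_least[OF UT_subfield]) (use RP_T T_UT Om_T in \<open>auto simp: RF_def\<close>)

lemma twist_extension: "\<exists>t. hom_on UNIV t \<and> (\<forall>f. t (emb f) = emb (tw 1 f))"
proof -
  have P: "is_subring (UNIV :: 'a fps set)" by (simp add: is_subring_def)
  obtain g where g: "hom_on {emb a / emb b | a b. a \<in> UNIV \<and> b \<in> UNIV \<and> emb b \<noteq> 0} g"
    "\<forall>a\<in>UNIV. \<forall>b\<in>UNIV. emb b \<noteq> 0 \<longrightarrow> g (emb a / emb b) = emb (tw 1 a) / emb (tw 1 b)"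
    using hom_on_quotients[OF P, of emb "\<lambda>f. emb (tw 1 f)"]
    by (auto simp: emb_add emb_mult tw_add tw_mult tw_eq_0_iff)
  have "{emb a / emb b | a b. a \<in> UNIV \<and> b \<in> UNIV \<and> emb b \<noteq> (0 :: 'a fps fract)} = UNIV"
    using emb_quotient by fastforce
  moreover have "g (emb f) = emb (tw 1 f)" for f using g(2)[rule_format, of f 1] by simp
  ultimately show ?thesis using g(1) by auto
qed

lemma tower:
  assumes s: "s \<in> Iset d"
  shows "transc (gen_field F0 (case_prod (\<lambda>i j. emb (Xf i j)) ` {r\<in>Iset d. pair_key d r < pair_key d s}))
    (case_prod (\<lambda>i j. emb (Xf i j)) s)"
proof -
  obtain t where t: "hom_on UNIV t" "\<And>f. t (emb f) = emb (tw 1 f)" using twist_extension by blast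
  have UN: "is_subfield (UNIV :: 'a fps fract set)" by (simp add: is_subfield_def)
  have pf: "of_nat p = (0 :: 'a fps fract)"
  proof -
    have "of_nat p = fps_const (of_nat p :: 'a)" by (simp add: fps_of_nat)
    then have "of_nat p = (0 :: 'a fps)" using charp by simp
    then show ?thesis by (simp add: of_nat_fract fract_collapse)
  qed
  \<comment> \<open>The twist divides \<open>Om\<close> by \<open>Dl\<close>, so \<open>F0\<close>
    is stable under it.\<close>
  have tDl: "emb Om / emb Dl = t (emb Om)"
  proof -
    have "Dl \<noteq> 0" using Om_eq Om_nz by auto
    moreover have "emb Om = emb Dl * t (emb Om)" unfolding t(2) emb_mult[symmetric] using Om_eq by simp
    ultimately show ?thesis by (simp add: field_simps)
  qed
  have tF0: "t x \<in> F0" if "x \<in> F0" for x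
  proof (rule hom_on_image_gen_field[where F = RF and S = "{emb Om}" and g = t and x = x])
    show "hom_on (gen_field RF {emb Om}) t" using t(1) by (simp add: hom_on_def)
    show "\<And>x. x \<in> RF \<Longrightarrow> t x \<in> F0" using RP_tw RF_F0 by (auto simp: RF_def t(2))
    show "\<And>x. x \<in> {emb Om} \<Longrightarrow> t x \<in> F0"
      using Om_F0 Dl_RP RF_F0 subfieldD(8)[OF F0_subfield] by (auto simp: RF_def tDl[symmetric])
  qed (use that F0_subfield in \<open>auto simp: F0_def\<close>)
  have const: "x \<in> F0" if x: "x \<in> UT" "t x = x" for x
  proof -
    obtain a b where ab: "x = emb a / emb b" "a \<in> T" "b \<in> T" "b \<noteq> 0" using x(1) unfolding UT_def by auto
    have "emb (tw 1 a) / emb (tw 1 b) = emb a / emb b"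
      using x(2) unfolding ab(1) hom_onD(8)[OF UN t(1), simplified] t(2) .
    then have "emb (tw 1 a * b) = emb (a * tw 1 b)"
      using ab(4) by (simp add: frac_eq_eq tw_eq_0_iff emb_mult)
    then have "tw 1 a * b = a * tw 1 b" by simp
    then obtain r s where rs: "\<forall>i. coeff r i \<in> Fq q" "\<forall>i. coeff s i \<in> Fq q" "s \<noteq> 0"
      "fps_of_poly s * a = fps_of_poly r * b" using twist_constants[OF ab(2,3,4)] by blast
    have RPI: "emb (fps_of_poly u) \<in> F0" if "\<forall>i. coeff u i \<in> Fq q" for u
    proof -
      have "coeff u i \<in> Kbar q \<theta>" for i using that Fq_A A_Kbar by (meson subsetD)
      then have "fps_of_poly u \<in> RP" unfolding RP_def by (intro CollectI exI[of _ u]) simp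
      then show ?thesis using RF_F0 unfolding RF_def by auto
    qed
    have "emb (fps_of_poly s) * emb a = emb (fps_of_poly r) * emb b"
      unfolding emb_mult[symmetric] rs(4) ..
    moreover have "fps_of_poly s \<noteq> 0" using rs(3) by (metis fps_of_poly_0 fps_of_poly_eq_iff)
    ultimately have "x = emb (fps_of_poly r) / emb (fps_of_poly s)"
      unfolding ab(1) using ab(4) by (simp add: frac_eq_eq mult.commute)
    then show ?thesis using RPI rs(1,2) subfieldD(8)[OF F0_subfield] by auto
  qed
  \<comment> \<open>The powers of \<open>t\<close> have coefficients 0 and 1 and are therefore
    constants.\<close>
  have inf: "infinite {x\<in>F0. t x = x}"
  proof
    assume fin: "finite {x\<in>F0. t x = x}"
    have "emb (fps_X ^ n) \<in> {x\<in>F0. t x = x}" for n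
      using subring_power[OF RP_subring X_RP] RF_F0 by (auto simp: RF_def t(2) tw_power simp del: fps_X_power_iff)
    then have "range (\<lambda>n. emb (fps_X ^ n :: 'a fps)) \<subseteq> {x\<in>F0. t x = x}" by auto
    then have "finite (range (\<lambda>n. emb (fps_X ^ n :: 'a fps)))" using fin finite_subset by blast
    moreover have "inj (\<lambda>n. emb (fps_X ^ n :: 'a fps))"
    proof (rule injI)
      fix m n assume "emb (fps_X ^ m :: 'a fps) = emb (fps_X ^ n)"
      then have "fps_nth (fps_X ^ m :: 'a fps) m = fps_nth (fps_X ^ n) m" by (simp only: emb_eq_iff)
      then show "m = n" by (simp split: if_splits)
    qed
    ultimately show False using finite_imageD by blast
  qed
  show ?thesis
  proof (rule unipotent_tower[OF p pf t(1) F0_subfield tF0 UT_subfield F0_UT _ const inf _ _ _ _ s])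
    show "emb (Xf i j) \<in> UT" for i j by (rule T_UT[OF Xf_T])
    show "emb (Xf i i) = 1" for i by simp
    show "emb (af i) \<in> F0" if "1 \<le> i" "i \<le> d" for i
      unfolding af_def emb_mult emb_power using us_RP[OF that] RF_F0 Om_F0
      by (intro subfieldD(4,9)[OF F0_subfield]) (auto simp: RF_def)
    show "emb (Xf i j) = t (emb (Xf i j)) + emb (af (i - 1)) * t (emb (Xf (i - 1) j))"
      if "(i, j) \<in> Iset d" for i j
      unfolding t(2) emb_mult[symmetric] emb_add[symmetric] using Xf_rec[OF that] by simp
    fix i assume i: "1 \<le> i" "i \<le> d"
    define y where "y k = emb (fv (Suc k, k))" for k
    define G where "G = gen_field RF (y ` {..<i})"
    have G: "is_subfield G" unfolding G_def by (rule gen_field_subfield)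
    have "mindep RF {..d} y" unfolding RF_def y_def by (rule mindep_emb[THEN iffD2, OF depth_one_indep])
    then have "mindep RF (insert i {..<i}) y" by (rule mindep_subset) (use i in auto)
    then have tr: "transc G (y i)" unfolding G_def by (intro mindep_transc[OF RF_subring]) auto
    have yG: "y k \<in> G" if "k < i" for k unfolding G_def using gen_field_gens[of "y ` {..<i}" RF] that by auto
    have OG: "emb Om \<in> G" using yG[of 0] i by (simp add: y_def fv_def)
    have F0G: "F0 \<subseteq> G" unfolding F0_def
      by (rule gen_field_least[OF G]) (use OG gen_field_base[of RF "y ` {..<i}"] in \<open>auto simp: G_def\<close>)
    have XG: "emb (Xf (Suc k) k) \<in> G" if "k \<in> {1..<i}" for k
    proof -
      have "emb (Lf (Suc k) k) \<in> G" using yG[of k] that by (simp add: y_def fv_def)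
      then show ?thesis unfolding Xf_def emb_mult emb_power using OG by (intro subfieldD(4,9)[OF G])
    qed
    have "transc G (emb (Xf (Suc i) i))"
    proof (rule transc_scale[OF G])
      have Onz: "emb Om ^ sw (Suc i) i \<noteq> 0" using Om_nz by simp
      have "inverse (emb Om ^ sw (Suc i) i) * emb (Xf (Suc i) i) = y i"
        using Onz i by (simp add: Xf_def emb_mult emb_power y_def fv_def)
      then show "transc G (inverse (emb Om ^ sw (Suc i) i) * emb (Xf (Suc i) i))" using tr by simp
      show "inverse (emb Om ^ sw (Suc i) i) \<in> G" using OG by (intro subfieldD(7,9)[OF G])
      show "inverse (emb Om ^ sw (Suc i) i) \<noteq> 0" using Onz by simp
    qed
    then show "transc (gen_field F0 ((\<lambda>k. emb (Xf (Suc k) k)) ` {1..<i})) (emb (Xf (Suc i) i))"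
      by (rule transc_antimono) (rule gen_field_least[OF G F0G], use XG in auto)
  qed
qed

definition II where "II = insert (1, 0) (Iset d)"

lemma finite_II: "finite II" unfolding II_def using finite_Iset by simp

text \<open>The entries are inserted in the order of \<open>pair_key\<close>. Each series
  \<open>L\<close> differs from its entry of \<open>X\<close> by a power of \<open>Om\<close>, which
  lies in the field generated so far, so transcendence carries over.\<close>

lemma functions_indep: "mindep RP II fv"
proof -
  define e where "e s = emb (fv s)" for s
  have step: "mindep RF (insert (1, 0) {s\<in>Iset d. pair_key d s < n}) e" for n
  proof (induction n)
    case 0
    have "mindep RF {..d} (\<lambda>k. e (Suc k, k))"
      unfolding RF_def e_def by (rule mindep_emb[THEN iffD2, OF depth_one_indep])
    then have "mindep RF (insert 0 {}) (\<lambda>k. e (Suc k, k))" by (rule mindep_subset) auto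
    then have tr: "transc (gen_field RF {}) (e (1, 0))"
      using mindep_transc[OF RF_subring, of "{}" 0 "\<lambda>k. e (Suc k, k)"] by simp
    have "mindep RF (insert (1, 0) {}) e"
      by (rule mindep_insert[where M = "gen_field RF {}"])
        (auto intro: subsetD[OF gen_field_base] subfield_subring gen_field_subfield mindep_empty tr simp del: One_nat_def)
    then show ?case by simp
  next
    case (Suc n)
    show ?case
    proof (cases "\<exists>s\<in>Iset d. pair_key d s = n")
      case False
      then have "{s\<in>Iset d. pair_key d s < Suc n} = {s\<in>Iset d. pair_key d s < n}" by (auto simp: less_Suc_eq)
      then show ?thesis using Suc by simp
    next
      case True
      then obtain s where s: "s \<in> Iset d" "pair_key d s = n" by auto
      define S where "S = insert (1, 0) {s\<in>Iset d. pair_key d s < n}"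
      have ins: "insert (1, 0) {s\<in>Iset d. pair_key d s < Suc n} = insert s S"
        using s inj_pair_key[of d] unfolding S_def by (auto simp: less_Suc_eq dest: inj_onD)
      define G where "G = gen_field F0 (case_prod (\<lambda>i j. emb (Xf i j)) ` {r\<in>Iset d. pair_key d r < pair_key d s})"
      have G: "is_subfield G" unfolding G_def by (rule gen_field_subfield)
      have F0G: "F0 \<subseteq> G" unfolding G_def by (rule gen_field_base)
      have Onz: "emb Om ^ n \<noteq> 0" for n using Om_nz by simp
      have OG: "emb Om ^ n \<in> G" for n using Om_F0 F0G by (intro subfieldD(9)[OF G]) auto
      have XG: "emb (Xf i j) \<in> G" if "(i, j) \<in> Iset d" "pair_key d (i, j) < n" for i j
        unfolding G_def by (rule subsetD[OF gen_field_gens]) (use that s in force)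
      have eG: "e r \<in> G" if "r \<in> S" for r
      proof (cases "r = (1, 0)")
        case True
        then show ?thesis using OG[of 1] by (simp add: e_def fv_def)
      next
        case False
        then obtain i j where ij: "r = (i, j)" "(i, j) \<in> Iset d" "pair_key d (i, j) < n"
          using \<open>r \<in> S\<close> unfolding S_def by (cases r) auto
        have "e r = emb (Xf i j) / emb Om ^ sw i j"
          using ij Onz by (simp add: e_def fv_def Xf_def emb_mult emb_power Iset_def)
        then show ?thesis using XG[OF ij(2,3)] OG by (auto intro: subfieldD(8)[OF G])
      qed
      obtain i j where ij: "s = (i, j)" by (cases s)
      have "j \<noteq> 0" using s(1) by (simp add: ij Iset_def)
      then have "case_prod (\<lambda>i j. emb (Xf i j)) s = emb Om ^ sw i j * e s"
        by (simp add: ij e_def fv_def Xf_def emb_mult emb_power)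
      with tower[OF s(1)] have "transc G (emb Om ^ sw i j * e s)" by (simp only: G_def)
      then have tr: "transc G (e s)" by (rule transc_scale[OF G]) (use OG Onz in auto)
      have sS: "s \<notin> S" using s unfolding S_def by (auto simp: Iset_def)
      show ?thesis unfolding ins
      proof (rule mindep_insert[where M = G])
        show "is_subring G" by (rule subfield_subring[OF G])
        show "s \<notin> S" "transc G (e s)" using sS tr by auto
        show "RF \<subseteq> G" using RF_F0 F0G by auto
        show "e ` S \<subseteq> G" using eG by auto
        show "finite S" using finite_Iset by (simp add: S_def)
        show "mindep RF S e" using Suc by (simp add: S_def)
      qed
    qed
  qed
  obtain n where n: "\<forall>s\<in>Iset d. pair_key d s < n"
    using finite_nat_set_iff_bounded[of "pair_key d ` Iset d"] finite_Iset by auto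
  have "insert (1, 0) {s\<in>Iset d. pair_key d s < n} = II" unfolding II_def using n by auto
  then have "mindep RF II e" using step[of n] by simp
  then show ?thesis unfolding RF_def e_def by (rule mindep_emb[THEN iffD1])
qed

subsection \<open>Descent to values\<close>

text \<open>Monomials of degree at most \<open>n\<close> in the series \<open>L\<close>: twisting does not raise this degree.\<close>

definition LM :: "nat \<Rightarrow> 'a fps set" where
  "LM n = monval (Iset d) fv ` {b. sum b (Iset d) \<le> n}"

lemma LM_mult: "f \<in> rspan RP (LM m) \<Longrightarrow> g \<in> rspan RP (LM n) \<Longrightarrow> f * g \<in> rspan RP (LM (m + n))"
proof (rule rspan_mult[of RP])
  fix x y assume "x \<in> LM m" "y \<in> LM n"
  then obtain b c where "x = monval (Iset d) fv b" "y = monval (Iset d) fv c" "sum b (Iset d) \<le> m" "sum c (Iset d) \<le> n"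
    unfolding LM_def by auto
  then have "x * y = monval (Iset d) fv (\<lambda>i. b i + c i)" "sum (\<lambda>i. b i + c i) (Iset d) \<le> m + n"
    by (simp_all add: monval_mult sum.distrib)
  then have "x * y \<in> LM (m + n)" unfolding LM_def by blast
  then show "x * y \<in> rspan RP (LM (m + n))" using subringD(2)[OF RP_subring] by (intro rspan_gen)
qed (auto intro: subringD(4)[OF RP_subring])

lemma LM_1: "1 \<in> rspan RP (LM n)"
proof -
  have "monval (Iset d) fv (\<lambda>_. 0) \<in> LM n" unfolding LM_def by (intro imageI) simp
  then have "1 \<in> LM n" by (simp add: monval_def)
  then show ?thesis using subringD(2)[OF RP_subring] by (intro rspan_gen)
qed

lemma LM_power: "f \<in> rspan RP (LM 1) \<Longrightarrow> f ^ n \<in> rspan RP (LM n)"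
proof (induction n)
  case (Suc n)
  then show ?case using LM_mult[of f 1 "f ^ n" n] by simp
qed (use LM_1 in simp)

lemma LM_prod:
  fixes f :: "'s \<Rightarrow> 'a fps"
  assumes "\<And>s. s \<in> S \<Longrightarrow> f s \<in> rspan RP (LM (b s))"
  shows "prod f S \<in> rspan RP (LM (sum b S))"
  using assms by (induction S rule: infinite_finite_induct) (auto intro: LM_1 LM_mult)

text \<open>Solving the recurrence for the twist expresses it by \<open>L\<close> itself and the
  twist of the next shorter series. Only first powers occur, so the degree stays 1.\<close>

lemma tw_Lf: "(i, j) \<in> Iset d \<Longrightarrow> tw 1 (Lf i j) \<in> rspan RP (LM 1)"
proof (induction i)
  case (Suc i)
  define c where "c = - (fps_of_poly (us ! (Suc i - 2)) * Dl ^ (ns ! (Suc i - 2)))"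
  have ij: "1 \<le> j" "j \<le> i" "i \<le> d" using Suc.prems by (auto simp: Iset_def)
  have "fps_of_poly (us ! (Suc i - 2)) \<in> RP" using us_RP[of i] ij by simp
  then have cR: "c \<in> RP" unfolding c_def using Dl_RP
    by (intro subringD(4,5)[OF RP_subring] subring_power[OF RP_subring])
  have sc: "\<And>x y. x \<in> RP \<Longrightarrow> y \<in> RP \<Longrightarrow> x * y \<in> RP" by (rule subringD(4)[OF RP_subring])
  have "Lf (Suc i) j \<in> LM 1"
  proof -
    have "monval (Iset d) fv (\<lambda>s. if s = (Suc i, j) then 1 else 0) = fv (Suc i, j)"
      using finite_Iset Suc.prems by (rule monval_single)
    moreover have "fv (Suc i, j) = Lf (Suc i) j" using ij by (simp add: fv_def)
    moreover have "(\<Sum>s\<in>Iset d. if s = (Suc i, j) then 1 else 0 :: nat) \<le> 1"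
      using finite_Iset by simp
    ultimately show ?thesis unfolding LM_def
      by (intro image_eqI[of _ _ "\<lambda>s. if s = (Suc i, j) then 1 else 0"]) simp_all
  qed
  then have 1: "Dl ^ sw (Suc i) j * Lf (Suc i) j \<in> rspan RP (LM 1)"
    using subring_power[OF RP_subring Dl_RP] by (intro rspan_scaled_gen)
  have "tw 1 (Lf i j) \<in> rspan RP (LM 1)"
  proof (cases "i = j")
    case True
    then show ?thesis using LM_1 by simp
  next
    case False
    then show ?thesis using Suc.IH Suc.prems by (auto simp: Iset_def)
  qed
  then have 2: "c * tw 1 (Lf i j) \<in> rspan RP (LM 1)" using cR by (intro rspan_scale[OF sc])
  have "tw 1 (Lf (Suc i) j) = Dl ^ sw (Suc i) j * Lf (Suc i) j + c * tw 1 (Lf i j)"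
    unfolding c_def Lf_rec[OF Suc.prems] by simp
  then show ?case using rspan_add[OF 1 2] by simp
qed (simp add: Iset_def)

lemma values_indep: "mindep (Kbar q \<theta>) II wv"
  unfolding mindep_def
proof (intro allI impI, elim conjE)
  fix S :: "(nat \<times> nat \<Rightarrow> nat) set" and a
  assume S: "finite S" "\<forall>m\<in>S. a m \<in> Kbar q \<theta> \<and> (\<forall>i. i \<notin> II \<longrightarrow> m i = 0)" "(\<Sum>m\<in>S. a m * monval II wv m) = 0"
  have n10: "(1, 0) \<notin> Iset d" by (simp add: Iset_def)
  define W where "W = Max (insert 0 ((\<lambda>m. m (1, 0)) ` S))"
  define G where "G = Max (insert 0 ((\<lambda>m. sum m (Iset d)) ` S))"
  have W: "m (1, 0) \<le> W" and G: "sum m (Iset d) \<le> G" if "m \<in> S" for m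
    unfolding W_def G_def using S(1) that by (auto intro!: Max_ge)
  \<comment> \<open>Exponents bounded separately in \<open>Om\<close> and in total degree in the
    series \<open>L\<close>. The twist preserves the span of these monomials up to the denominator
    \<open>Dl ^ W\<close>, and the set contains all monomials of the given relation.\<close>
  define J where "J = {m. (\<forall>i. i \<notin> II \<longrightarrow> m i = 0) \<and> m (1, 0) \<le> W \<and> sum m (Iset d) \<le> G}"
  have SJ: "S \<subseteq> J" unfolding J_def using S(2) W G by auto
  have finJ: "finite J"
  proof (rule finite_subset)
    show "finite {m :: nat \<times> nat \<Rightarrow> nat. \<forall>x. (x \<in> II \<longrightarrow> m x \<in> {..max W G}) \<and> (x \<notin> II \<longrightarrow> m x = 0)}"
      by (rule finite_set_of_finite_funs[OF finite_II]) simp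
    have "m s \<le> G" if "sum m (Iset d) \<le> G" "s \<in> Iset d" for m :: "nat \<times> nat \<Rightarrow> nat" and s
      using member_le_sum[OF that(2), of m] finite_Iset that(1) by simp
    then show "J \<subseteq> {m. \<forall>x. (x \<in> II \<longrightarrow> m x \<in> {..max W G}) \<and> (x \<notin> II \<longrightarrow> m x = 0)}"
      unfolding J_def II_def by (auto simp: le_max_iff_disj)
  qed
  have mII: "monval II f m = f (1, 0) ^ m (1, 0) * monval (Iset d) f m" for f :: "nat \<times> nat \<Rightarrow> 'b::comm_ring_1" and m
    unfolding II_def using finite_Iset n10 by (rule monval_insert)
  have sc: "\<And>x y. x \<in> RP \<Longrightarrow> y \<in> RP \<Longrightarrow> x * y \<in> RP" by (rule subringD(4)[OF RP_subring])
  have relJ: "Dl ^ W * tw 1 (monval II fv m) \<in> rspan RP (monval II fv ` J)" if m: "m \<in> J" for m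
  proof -
    define w where "w = m (1, 0)"
    have wW: "w \<le> W" "sum m (Iset d) \<le> G" using m by (auto simp: J_def w_def)
    have fvO: "fv (1, 0) = Om" by (simp add: fv_def)
    have "tw 1 (monval II fv m) = tw 1 Om ^ w * (\<Prod>s\<in>Iset d. tw 1 (fv s) ^ m s)"
      unfolding mII fvO by (simp add: tw_mult tw_power tw_prod monval_def w_def)
    moreover have "Dl ^ W = Dl ^ (W - w) * Dl ^ w" using wW by (simp add: power_add[symmetric])
    ultimately have "Dl ^ W * tw 1 (monval II fv m) = Dl ^ (W - w) * (Dl * tw 1 Om) ^ w * (\<Prod>s\<in>Iset d. tw 1 (fv s) ^ m s)"
      by (simp add: power_mult_distrib mult_ac)
    then have e: "Dl ^ W * tw 1 (monval II fv m) = Dl ^ (W - w) * Om ^ w * (\<Prod>s\<in>Iset d. tw 1 (fv s) ^ m s)"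
      using Om_eq by simp
    have "(\<Prod>s\<in>Iset d. tw 1 (fv s) ^ m s) \<in> rspan RP (LM (sum m (Iset d)))"
    proof (rule LM_prod)
      fix s assume "s \<in> Iset d"
      then have "tw 1 (fv s) \<in> rspan RP (LM 1)" using tw_Lf by (cases s) (auto simp: fv_def Iset_def)
      then show "tw 1 (fv s) ^ m s \<in> rspan RP (LM (m s))" by (rule LM_power)
    qed
    then have "Dl ^ (W - w) * Om ^ w * (\<Prod>s\<in>Iset d. tw 1 (fv s) ^ m s) \<in> rspan RP (monval II fv ` J)"
    proof (rule rspan_closed[where E = "{z. Dl ^ (W - w) * Om ^ w * z \<in> rspan RP (monval II fv ` J)}", simplified])
      fix c z assume c: "c \<in> RP" and "z \<in> LM (sum m (Iset d))"
      then obtain b where b: "z = monval (Iset d) fv b" "sum b (Iset d) \<le> sum m (Iset d)" unfolding LM_def by auto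
      define b' where "b' s = (if s = (1, 0) then w else if s \<in> Iset d then b s else 0)" for s
      have "monval (Iset d) fv b' = z" unfolding b(1) using n10 by (intro monval_cong) (auto simp: b'_def)
      then have "Om ^ w * z = monval II fv b'" unfolding mII fvO by (simp add: b'_def)
      moreover have "sum b' (Iset d) = sum b (Iset d)" using n10 by (intro sum.cong) (auto simp: b'_def)
      then have "b' \<in> J" unfolding J_def II_def using b(2) wW by (auto simp: b'_def)
      ultimately have "Om ^ w * z \<in> monval II fv ` J" by auto
      moreover have "Dl ^ (W - w) * c \<in> RP" using c subring_power[OF RP_subring Dl_RP] by (intro sc)
      ultimately have "(Dl ^ (W - w) * c) * (Om ^ w * z) \<in> rspan RP (monval II fv ` J)" by (intro rspan_scaled_gen)
      then show "Dl ^ (W - w) * Om ^ w * (c * z) \<in> rspan RP (monval II fv ` J)" by (simp only: mult_ac)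
    qed (auto simp: distrib_left intro: rspan.zero rspan_add)
    then show ?thesis unfolding e .
  qed
  have "\<forall>m\<in>J. \<exists>c. (\<forall>i\<in>J. c i \<in> RP) \<and> Dl ^ W * tw 1 (monval II fv m) = (\<Sum>i\<in>J. c i * monval II fv i)"
    using rspan_repr[OF RP_subring finJ relJ] by blast
  from bchoice[OF this] obtain c where c0: "\<forall>m\<in>J. (\<forall>i\<in>J. c m i \<in> RP) \<and>
    Dl ^ W * tw 1 (monval II fv m) = (\<Sum>i\<in>J. c m i * monval II fv i)" ..
  have c: "\<And>m i. m \<in> J \<Longrightarrow> i \<in> J \<Longrightarrow> c m i \<in> RP"
    "\<And>m. m \<in> J \<Longrightarrow> Dl ^ W * tw 1 (monval II fv m) = (\<Sum>i\<in>J. c m i * monval II fv i)"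
    using c0 by simp_all
  have "\<forall>m\<in>J. \<forall>i\<in>J. \<exists>r. c m i = fps_of_poly r \<and> (\<forall>n. coeff r n \<in> Kbar q \<theta>)"
    using c(1) unfolding RP_def by blast
  then obtain \<Theta> where \<Theta>: "\<And>m i. m \<in> J \<Longrightarrow> i \<in> J \<Longrightarrow> c m i = fps_of_poly (\<Theta> m i)"
    "\<And>m i. m \<in> J \<Longrightarrow> i \<in> J \<Longrightarrow> \<forall>n. coeff (\<Theta> m i) n \<in> Kbar q \<theta>" by metis
  have tR: "absv \<theta> \<le> R" by (simp add: R_def)
  define \<rho> where "\<rho> m = (if m \<in> S then a m else 0)" for m
  have rho0: "\<rho> m = 0" if "m \<in> J" for m
  proof (rule abp_criterion[OF finJ, where \<psi> = "monval II fv" and W = W and \<Theta> = \<Theta> and y = "monval II wv" and \<rho> = \<rho> and j = m])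
    show "\<And>m. m \<in> J \<Longrightarrow> monval II fv m \<in> T"
      unfolding monval_def using ev_fv ev_T by (intro subring_prod[OF T_subring] subring_power[OF T_subring]) blast
    show "\<forall>j\<in>J. h j = 0" if h: "\<forall>j\<in>J. \<forall>i. coeff (h j) i \<in> Kbar q \<theta>" "(\<Sum>j\<in>J. fps_of_poly (h j) * monval II fv j) = 0" for h
    proof
      fix j assume j: "j \<in> J"
      have "fps_of_poly (h j) = 0"
      proof (rule mindepD[OF functions_indep finJ _ _ h(2) j])
        show "\<And>m. m \<in> J \<Longrightarrow> fps_of_poly (h m) \<in> RP" using h(1) unfolding RP_def by blast
        show "\<And>m i. m \<in> J \<Longrightarrow> i \<notin> II \<Longrightarrow> m i = 0" unfolding J_def by blast
      qed
      then show "h j = 0" by (metis fps_of_poly_0 fps_of_poly_eq_iff)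
    qed
    show "fps_of_poly ([:- (\<theta> ^ q), 1:] ^ W) * tw 1 (monval II fv j) = (\<Sum>i\<in>J. fps_of_poly (\<Theta> j i) * monval II fv i)"
      if "j \<in> J" for j
      unfolding Dl_poly[symmetric] c(2)[OF that] using \<Theta>(1)[OF that] by (intro sum.cong refl) simp
    show "\<And>j i n. j \<in> J \<Longrightarrow> i \<in> J \<Longrightarrow> coeff (\<Theta> j i) n \<in> Kbar q \<theta>" using \<Theta>(2) by blast
    show "\<And>j. j \<in> J \<Longrightarrow> ev (monval II fv j) \<theta> (monval II wv j)"
      unfolding monval_def by (intro ev_prod ev_power tR ev_fv)
    show "\<And>j. j \<in> J \<Longrightarrow> \<rho> j \<in> Kbar q \<theta>" using S(2) subfieldD(1)[OF Kbar_subfield] by (auto simp: \<rho>_def)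
    show "(\<Sum>j\<in>J. \<rho> j * monval II wv j) = 0"
    proof -
      have "(\<Sum>j\<in>J. \<rho> j * monval II wv j) = (\<Sum>j\<in>S. a j * monval II wv j)"
        using SJ finJ by (intro sum.mono_neutral_cong_right) (auto simp: \<rho>_def)
      then show ?thesis using S(3) by simp
    qed
  qed (rule that)
  show "\<forall>m\<in>S. a m = 0"
  proof
    fix m assume m: "m \<in> S"
    then show "a m = 0" using rho0[of m] SJ by (auto simp: \<rho>_def)
  qed
qed

lemma transcendence_degree:
  "trdeg (Kbar q \<theta>)
     (gen_field (Kbar q \<theta>)
        (insert (pitilde absv q \<theta> lam)
           ((\<lambda>(i, j). Lval absv q \<theta> (subtuple us i j) (subtuple ns i j) \<theta>) ` Iset d)))
   = 1 + card (Iset d)"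
proof -
  \<comment> \<open>The value at index \<open>(1, 0)\<close> is inverted back to the period
    itself.\<close>
  define x where "x = wv((1, 0) := inverse (wv (1, 0)))"
  have "mindep (Kbar q \<theta>) II x" unfolding x_def
    by (rule mindep_inverse[OF values_indep finite_II]) (auto simp: II_def wv_def pitilde_nz)
  then have "trdeg (Kbar q \<theta>) (gen_field (Kbar q \<theta>) (x ` II)) = card II"
    by (rule trdeg_gen_field[OF Kbar_subfield finite_II])
  moreover have "x ` II = insert (pitilde absv q \<theta> lam)
           ((\<lambda>(i, j). Lval absv q \<theta> (subtuple us i j) (subtuple ns i j) \<theta>) ` Iset d)"
  proof -
    have "x (1, 0) = pitilde absv q \<theta> lam" by (simp add: x_def wv_def)
    moreover have "x ` Iset d = (\<lambda>(i, j). Lval absv q \<theta> (subtuple us i j) (subtuple ns i j) \<theta>) ` Iset d"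
      by (intro image_cong refl) (auto simp: x_def wv_def Iset_def)
    ultimately show ?thesis unfolding II_def by simp
  qed
  moreover have "card II = 1 + card (Iset d)" unfolding II_def using finite_Iset by (simp add: Iset_def)
  ultimately show ?thesis by simp
qed

end

theorem theorem4p3:
  fixes absv :: "'a::field \<Rightarrow> real"
    and p k q d :: nat and \<theta> lam :: 'a
    and ns :: "nat list" and us :: "'a poly list"
  assumes field: "complete_alg_closed_nonarch absv"
    and p: "prime p" and charp: "(of_nat p :: 'a) = 0"
    and k: "k \<ge> 1" and q: "q = p ^ k"
    and theta: "absv \<theta> > 1"
    and lam: "lam ^ (q - 1) = - \<theta>"
    and len: "length ns = d" "length us = d"
    and npos: "\<forall>i<d. ns ! i > 0"
    and uK: "\<forall>i<d. \<forall>l. coeff (us ! i) l \<in> Kbar q \<theta>"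
    and unorm: "\<forall>i<d. norm_poly absv (us ! i) < absv \<theta> powr (real (ns ! i) * real q / real (q - 1))"
    and indep: "alg_indep (Kbar q \<theta>) {..d}
                  (\<lambda>k. if k = 0 then pitilde absv q \<theta> lam
                       else Lval absv q \<theta> [us ! (k - 1)] [ns ! (k - 1)] \<theta>)"
  shows "trdeg (Kbar q \<theta>)
           (gen_field (Kbar q \<theta>)
              (insert (pitilde absv q \<theta> lam)
                 ((\<lambda>(i, j). Lval absv q \<theta> (subtuple us i j) (subtuple ns i j) \<theta>) ` Iset d)))
         = 1 + card (Iset d)
       \<and> 1 + card (Iset d) = 1 + d * (d + 1) div 2"
proof -
  interpret log_tuple absv p k q \<theta> lam d ns us
    by unfold_locales (use assms in auto)
  show ?thesis using transcendence_degree card_Iset by simp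
qed

end
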